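(* Assume the following. (A1) $\{\mathcal T_{g,n}:1\le g\le G_n\}$ is a partition of $\{1,\dots,n\}$ such that the collections $\{(u_{i,n},x_{i,n}'):i\in\mathcal T_{g,n}\}$ are independent over $g$ conditional on $\mathcal W_n$, and $\max_{1\le g\le G_n}\#\mathcal T_{g,n}=O(1)$. (A2) $\mathbb P[\lambda_{\min}(\sum_{i=1}^n w_{i,n}w_{i,n}')>0]\to1$, $\limsup_{n\to\infty}K_n/n<1$, $\mathcal C_n=O_p(1)$ and $\Sigma_n^{-1}=O_p(1)$. (A3) $\mathbb E[u_{i,n}|\mathcal X_n,\mathcal W_n]=0$ for all $i,n$, $\chi_n=O(1)$, and $\max_{1\le i\le n}\|\hat v_{i,n}\|/\sqrt n=o_p(1)$. Then $$\Omega_n^{-1/2}\sqrt n(\hat\beta_n-\beta)\overset{d}{\to}\mathcal N(0,I_d),\qquad \Omega_n=\hat\Gamma_n^{-1}\Sigma_n\hat\Gamma_n^{-1},$$ where $\Sigma_n=\frac1n\sum_{g=1}^{G_n}\sum_{i,j\in\mathcal T_{g,n}}\hat v_{i,n}\hat v_{j,n}'\,\mathbb E[u_{i,n}u_{j,n}|\mathcal X_n,\mathcal W_n]$.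
   Context: All limits are as $n\to\infty$, in a triangular-array setting. For each $n$, the random data $\{(y_{i,n},x_{i,n}',w_{i,n}'):1\le i\le n\}$ are generated by $y_{i,n}=\beta'x_{i,n}+\gamma_n'w_{i,n}+u_{i,n}$, where $y_{i,n}$ is scalar, $x_{i,n}$ is $d\times1$ with $d$ fixed, $w_{i,n}$ is $K_n\times1$ ($K_n$ may grow with $n$), and $u_{i,n}$ is an unobserved scalar error. Put $\mathcal X_n=(x_{1,n},\dots,x_{n,n})$, $\mathcal W_n=(w_{1,n},\dots,w_{n,n})$. $\|\cdot\|$ is the Euclidean norm, $\lambda_{\min}(\cdot)$ the minimum eigenvalue, $\mathbb V$ the variance, $\#$ cardinality. $M_n=(M_{ij,n})$ is the $n\times n$ matrix $M_{ij,n}=\mathbf 1\{i=j\}-w_{i,n}'(\sum_{k=1}^n w_{k,n}w_{k,n}')^{-1}w_{j,n}$; $\hat v_{i,n}=\sum_{j=1}^nM_{ij,n}x_{j,n}$; the OLS estimator is $\hat\beta_n=(\sum_{i=1}^n\hat v_{i,n}\hat v_{i,n}')^{-1}\sum_{i=1}^n\hat v_{i,n}y_{i,n}$. $\hat\Gamma_n=\frac1n\sum_{i=1}^n\hat v_{i,n}\hat v_{i,n}'$ and $\Sigma_n=\mathbb V[\frac1{\sqrt n}\sum_{i=1}^n\hat v_{i,n}u_{i,n}|\mathcal X_n,\mathcal W_n]$. $v_{i,n}=x_{i,n}-(\sum_{j=1}^n\mathbb E[x_{j,n}w_{j,n}'])(\sum_{j=1}^n\mathbb E[w_{j,n}w_{j,n}'])^{-1}w_{i,n}$,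 $Q_{i,n}=\mathbb E[v_{i,n}|\mathcal W_n]$, $\chi_n=\frac1n\sum_{i=1}^n\mathbb E[\|Q_{i,n}\|^2]$. $V_{i,n}=x_{i,n}-\mathbb E[x_{i,n}|\mathcal W_n]$, $\tilde V_{i,n}=\sum_{j=1}^nM_{ij,n}V_{j,n}$, $\tilde\Gamma_n=\frac1n\sum_{i=1}^n\tilde V_{i,n}\tilde V_{i,n}'$, and $$\mathcal C_n=\max_{1\le i\le n}\{\mathbb E[u_{i,n}^4|\mathcal X_n,\mathcal W_n]+\mathbb E[\|V_{i,n}\|^4|\mathcal W_n]+1/\mathbb E[u_{i,n}^2|\mathcal X_n,\mathcal W_n]\}+1/\lambda_{\min}(\mathbb E[\tilde\Gamma_n|\mathcal W_n]).$$ *)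

theory Defs
  imports
    "HOL-Probability.Probability"
    "Jordan_Normal_Form.Spectral_Radius"
begin

text \<open>
  Vectors and matrices of the fixed dimension \<open>d\<close> live in \<open>real ^ 'd\<close> and \<open>real ^ 'd ^ 'd\<close>; those of the
  varying dimension \<open>K\<close> are \<open>real vec\<close> and \<open>real mat\<close> (coordinates \<open>0, \<dots>, K - 1\<close>).
  The symbols shared by the two libraries are kept for \<open>real ^ 'd\<close>.
\<close>

no_notation Matrix.vec_index (infixl \<open>$\<close> 100)
no_notation Matrix.scalar_prod (infix \<open>\<bullet>\<close> 70)
notation Matrix.vec_index (infixl \<open>$v\<close> 100)

text \<open>Both minimum eigenvalues are only used for symmetric matrices.\<close>

definition lambda_min :: "real ^ 'd ^ 'd \<Rightarrow> real" where
  "lambda_min A = Min {c. \<exists>v. v \<noteq> 0 \<and> A *v v = c *\<^sub>R v}"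

definition mat_lambda_min :: "real mat \<Rightarrow> real" where
  "mat_lambda_min A = Min (spectrum A)"

text \<open>The value at singular matrices is an arbitrary constant.\<close>

definition mat_inv :: "real mat \<Rightarrow> real mat" where
  "mat_inv A = (case mat_inverse A of Some B \<Rightarrow> B | None \<Rightarrow> 0\<^sub>m (dim_row A) (dim_col A))"

definition outer :: "real ^ 'd \<Rightarrow> real ^ 'd \<Rightarrow> real ^ 'd ^ 'd" where
  "outer a b = (\<chi> p q. a $ p * b $ q)"

definition pos_semidef :: "real ^ 'd ^ 'd \<Rightarrow> bool" where
  "pos_semidef A \<longleftrightarrow> Finite_Cartesian_Product.transpose A = A \<and> (\<forall>v. 0 \<le> v \<bullet> (A *v v))"

text \<open>The unique positive semidefinite root, if \<open>A\<close> is positive semidefinite. The statistic is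
  normalized by its inverse, so \<open>\<Omega>\<^sub>n\<^sup>-\<^sup>1\<^sup>/\<^sup>2\<close> is the symmetric root and not a Cholesky-type factor.\<close>

definition matrix_sqrt :: "real ^ 'd ^ 'd \<Rightarrow> real ^ 'd ^ 'd" where
  "matrix_sqrt A = (THE B. pos_semidef B \<and> B ** B = A)"

text \<open>The norm of the inverse counts as infinite at singular matrices, so that \<open>A\<^sub>n\<^sup>-\<^sup>1 = O\<^sub>p(1)\<close>
  includes that \<open>A\<^sub>n\<close> is invertible up to small probability.\<close>

definition inv_norm :: "real ^ 'd ^ 'd \<Rightarrow> ennreal" where
  "inv_norm A = (if invertible A then ennreal (norm (matrix_inv A)) else \<infinity>)"

definition bounded_in_prob :: "(nat \<Rightarrow> 'a measure) \<Rightarrow> (nat \<Rightarrow> 'a \<Rightarrow> ennreal) \<Rightarrow> bool" where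
  "bounded_in_prob M X \<longleftrightarrow>
     (\<forall>\<epsilon>>0. \<exists>B::real. \<forall>\<^sub>F n in sequentially.
        measure (M n) {\<omega> \<in> space (M n). X n \<omega> > ennreal B} \<le> \<epsilon>)"

definition tendsto_zero_in_prob :: "(nat \<Rightarrow> 'a measure) \<Rightarrow> (nat \<Rightarrow> 'a \<Rightarrow> real) \<Rightarrow> bool" where
  "tendsto_zero_in_prob M X \<longleftrightarrow>
     (\<forall>\<epsilon>>0. (\<lambda>n. measure (M n) {\<omega> \<in> space (M n). \<bar>X n \<omega>\<bar> > \<epsilon>}) \<longlonglongrightarrow> 0)"

definition conv_in_dist ::
  "(nat \<Rightarrow> 'a measure) \<Rightarrow> (nat \<Rightarrow> 'a \<Rightarrow> real ^ 'd) \<Rightarrow> (real ^ 'd) measure \<Rightarrow> bool" where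
  "conv_in_dist M Z \<mu> \<longleftrightarrow>
     (\<forall>f :: real ^ 'd \<Rightarrow> real. continuous_on UNIV f \<and> bounded (range f) \<longrightarrow>
        (\<lambda>n. \<integral>\<omega>. f (Z n \<omega>) \<partial>M n) \<longlonglongrightarrow> (\<integral>z. f z \<partial>\<mu>))"

definition std_normal :: "(real ^ 'd) measure" where
  "std_normal = density lborel (\<lambda>z. ennreal (\<Prod>a\<in>UNIV. std_normal_density (z $ a)))"

definition preimages :: "'a measure \<Rightarrow> 'i set \<Rightarrow> ('i \<Rightarrow> 'a \<Rightarrow> 'b::topological_space) \<Rightarrow> 'a set set" where
  "preimages M I f = (\<Union>i\<in>I. {f i -` B \<inter> space M | B. B \<in> sets borel})"

definition W_preimages :: "'a measure \<Rightarrow> nat \<Rightarrow> nat \<Rightarrow> (nat \<Rightarrow> 'a \<Rightarrow> real vec) \<Rightarrow> 'a set set" where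
  "W_preimages M n K w = preimages M ({1..n} \<times> {..<K}) (\<lambda>(i, l) \<omega>. w i \<omega> $v l)"

definition sigma_W :: "'a measure \<Rightarrow> nat \<Rightarrow> nat \<Rightarrow> (nat \<Rightarrow> 'a \<Rightarrow> real vec) \<Rightarrow> 'a measure" where
  "sigma_W M n K w = sigma (space M) (W_preimages M n K w)"

definition sigma_XW ::
  "'a measure \<Rightarrow> nat \<Rightarrow> nat \<Rightarrow> (nat \<Rightarrow> 'a \<Rightarrow> real ^ 'd) \<Rightarrow> (nat \<Rightarrow> 'a \<Rightarrow> real vec) \<Rightarrow> 'a measure" where
  "sigma_XW M n K x w = sigma (space M) (preimages M {1..n} x \<union> W_preimages M n K w)"

definition sigma_cluster ::
  "'a measure \<Rightarrow> nat set \<Rightarrow> (nat \<Rightarrow> 'a \<Rightarrow> real) \<Rightarrow> (nat \<Rightarrow> 'a \<Rightarrow> real ^ 'd) \<Rightarrow> 'a measure" where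
  "sigma_cluster M T u x = sigma (space M) (preimages M T (\<lambda>i \<omega>. (u i \<omega>, x i \<omega>)))"

definition cond_indep :: "'a measure \<Rightarrow> 'a measure \<Rightarrow> ('i \<Rightarrow> 'a measure) \<Rightarrow> 'i set \<Rightarrow> bool" where
  "cond_indep M F A I \<longleftrightarrow>
     (\<forall>J E. J \<subseteq> I \<and> finite J \<and> J \<noteq> {} \<and> (\<forall>j\<in>J. E j \<in> sets (A j)) \<longrightarrow>
        (AE \<omega> in M. real_cond_exp M F (indicator (\<Inter>j\<in>J. E j)) \<omega>
                    = (\<Prod>j\<in>J. real_cond_exp M F (indicator (E j)) \<omega>)))"

text \<open>
  \<open>real_cond_exp\<close> is the difference of the conditional expectations of the positive and the
  negative part. Hence it is the conditional expectation also for functions that are not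
  integrable, at all points where these two are finite.
\<close>

definition vec_cond_exp ::
  "'a measure \<Rightarrow> 'a measure \<Rightarrow> ('a \<Rightarrow> real ^ 'd) \<Rightarrow> 'a \<Rightarrow> real ^ 'd" where
  "vec_cond_exp M F f \<omega> = (\<chi> a. real_cond_exp M F (\<lambda>\<omega>'. f \<omega>' $ a) \<omega>)"

definition mat_cond_exp ::
  "'a measure \<Rightarrow> 'a measure \<Rightarrow> ('a \<Rightarrow> real ^ 'd ^ 'd) \<Rightarrow> 'a \<Rightarrow> real ^ 'd ^ 'd" where
  "mat_cond_exp M F f \<omega> = (\<chi> a b. real_cond_exp M F (\<lambda>\<omega>'. f \<omega>' $ a $ b) \<omega>)"

definition cond_variance ::
  "'a measure \<Rightarrow> 'a measure \<Rightarrow> ('a \<Rightarrow> real ^ 'd) \<Rightarrow> 'a \<Rightarrow> real ^ 'd ^ 'd" where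
  "cond_variance M F Z =
     mat_cond_exp M F (\<lambda>\<omega>. outer (Z \<omega> - vec_cond_exp M F Z \<omega>) (Z \<omega> - vec_cond_exp M F Z \<omega>))"

definition gram :: "nat \<Rightarrow> nat \<Rightarrow> (nat \<Rightarrow> real vec) \<Rightarrow> real mat" where
  "gram n K w = Matrix.mat K K (\<lambda>(k, l). \<Sum>i=1..n. w i $v k * w i $v l)"

definition annihilator :: "nat \<Rightarrow> nat \<Rightarrow> (nat \<Rightarrow> real vec) \<Rightarrow> nat \<Rightarrow> nat \<Rightarrow> real" where
  "annihilator n K w i j =
     (if i = j then 1 else 0) - scalar_prod (w i) (mat_inv (gram n K w) *\<^sub>v w j)"

definition residual ::
  "nat \<Rightarrow> nat \<Rightarrow> (nat \<Rightarrow> real vec) \<Rightarrow> (nat \<Rightarrow> real ^ 'd) \<Rightarrow> nat \<Rightarrow> real ^ 'd" where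
  "residual n K w z i = (\<Sum>j=1..n. annihilator n K w i j *\<^sub>R z j)"

definition vhat ::
  "nat \<Rightarrow> nat \<Rightarrow> (nat \<Rightarrow> 'a \<Rightarrow> real ^ 'd) \<Rightarrow> (nat \<Rightarrow> 'a \<Rightarrow> real vec) \<Rightarrow> nat \<Rightarrow> 'a \<Rightarrow> real ^ 'd" where
  "vhat n K x w i \<omega> = residual n K (\<lambda>j. w j \<omega>) (\<lambda>j. x j \<omega>) i"

definition beta_hat ::
  "nat \<Rightarrow> nat \<Rightarrow> (nat \<Rightarrow> 'a \<Rightarrow> real) \<Rightarrow> (nat \<Rightarrow> 'a \<Rightarrow> real ^ 'd) \<Rightarrow> (nat \<Rightarrow> 'a \<Rightarrow> real vec)
     \<Rightarrow> 'a \<Rightarrow> real ^ 'd" where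
  "beta_hat n K y x w \<omega> =
     matrix_inv (\<Sum>i=1..n. outer (vhat n K x w i \<omega>) (vhat n K x w i \<omega>))
       *v (\<Sum>i=1..n. y i \<omega> *\<^sub>R vhat n K x w i \<omega>)"

definition Gamma_hat ::
  "nat \<Rightarrow> nat \<Rightarrow> (nat \<Rightarrow> 'a \<Rightarrow> real ^ 'd) \<Rightarrow> (nat \<Rightarrow> 'a \<Rightarrow> real vec) \<Rightarrow> 'a \<Rightarrow> real ^ 'd ^ 'd" where
  "Gamma_hat n K x w \<omega> =
     (1 / real n) *\<^sub>R (\<Sum>i=1..n. outer (vhat n K x w i \<omega>) (vhat n K x w i \<omega>))"

definition Sigma_n ::
  "'a measure \<Rightarrow> nat \<Rightarrow> nat \<Rightarrow> (nat \<Rightarrow> 'a \<Rightarrow> real) \<Rightarrow> (nat \<Rightarrow> 'a \<Rightarrow> real ^ 'd)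
     \<Rightarrow> (nat \<Rightarrow> 'a \<Rightarrow> real vec) \<Rightarrow> 'a \<Rightarrow> real ^ 'd ^ 'd" where
  "Sigma_n M n K u x w =
     cond_variance M (sigma_XW M n K x w)
       (\<lambda>\<omega>. (1 / sqrt (real n)) *\<^sub>R (\<Sum>i=1..n. u i \<omega> *\<^sub>R vhat n K x w i \<omega>))"

definition Omega_n ::
  "'a measure \<Rightarrow> nat \<Rightarrow> nat \<Rightarrow> (nat \<Rightarrow> 'a \<Rightarrow> real) \<Rightarrow> (nat \<Rightarrow> 'a \<Rightarrow> real ^ 'd)
     \<Rightarrow> (nat \<Rightarrow> 'a \<Rightarrow> real vec) \<Rightarrow> 'a \<Rightarrow> real ^ 'd ^ 'd" where
  "Omega_n M n K u x w \<omega> =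
     matrix_inv (Gamma_hat n K x w \<omega>) ** Sigma_n M n K u x w \<omega> ** matrix_inv (Gamma_hat n K x w \<omega>)"

text \<open>\<open>v\<^sub>i\<close> is the deviation of \<open>x\<^sub>i\<close> from its population linear projection on \<open>w\<^sub>i\<close>;
  component \<open>a\<close> uses row \<open>a\<close> of the matrix \<open>\<Sum>\<^sub>j E[x\<^sub>j w\<^sub>j']\<close>.\<close>

definition v_pop ::
  "'a measure \<Rightarrow> nat \<Rightarrow> nat \<Rightarrow> (nat \<Rightarrow> 'a \<Rightarrow> real ^ 'd) \<Rightarrow> (nat \<Rightarrow> 'a \<Rightarrow> real vec)
     \<Rightarrow> nat \<Rightarrow> 'a \<Rightarrow> real ^ 'd" where
  "v_pop M n K x w i \<omega> =
     (let ExW = (\<lambda>a. Matrix.vec K (\<lambda>l. \<Sum>j=1..n. \<integral>\<omega>'. x j \<omega>' $ a * w j \<omega>' $v l \<partial>M));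
          EWW = Matrix.mat K K (\<lambda>(k, l). \<Sum>j=1..n. \<integral>\<omega>'. w j \<omega>' $v k * w j \<omega>' $v l \<partial>M)
      in (\<chi> a. x i \<omega> $ a - scalar_prod (ExW a) (mat_inv EWW *\<^sub>v w i \<omega>)))"

definition Q_n ::
  "'a measure \<Rightarrow> nat \<Rightarrow> nat \<Rightarrow> (nat \<Rightarrow> 'a \<Rightarrow> real ^ 'd) \<Rightarrow> (nat \<Rightarrow> 'a \<Rightarrow> real vec)
     \<Rightarrow> nat \<Rightarrow> 'a \<Rightarrow> real ^ 'd" where
  "Q_n M n K x w i = vec_cond_exp M (sigma_W M n K w) (v_pop M n K x w i)"

definition chi_n ::
  "'a measure \<Rightarrow> nat \<Rightarrow> nat \<Rightarrow> (nat \<Rightarrow> 'a \<Rightarrow> real ^ 'd) \<Rightarrow> (nat \<Rightarrow> 'a \<Rightarrow> real vec) \<Rightarrow> ennreal" where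
  "chi_n M n K x w = (\<Sum>i=1..n. \<integral>\<^sup>+\<omega>. ennreal ((norm (Q_n M n K x w i \<omega>))\<^sup>2) \<partial>M) / of_nat n"

definition V_n ::
  "'a measure \<Rightarrow> nat \<Rightarrow> nat \<Rightarrow> (nat \<Rightarrow> 'a \<Rightarrow> real ^ 'd) \<Rightarrow> (nat \<Rightarrow> 'a \<Rightarrow> real vec)
     \<Rightarrow> nat \<Rightarrow> 'a \<Rightarrow> real ^ 'd" where
  "V_n M n K x w i \<omega> = x i \<omega> - vec_cond_exp M (sigma_W M n K w) (x i) \<omega>"

definition V_tilde ::
  "'a measure \<Rightarrow> nat \<Rightarrow> nat \<Rightarrow> (nat \<Rightarrow> 'a \<Rightarrow> real ^ 'd) \<Rightarrow> (nat \<Rightarrow> 'a \<Rightarrow> real vec)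
     \<Rightarrow> nat \<Rightarrow> 'a \<Rightarrow> real ^ 'd" where
  "V_tilde M n K x w i \<omega> = residual n K (\<lambda>j. w j \<omega>) (\<lambda>j. V_n M n K x w j \<omega>) i"

definition Gamma_tilde ::
  "'a measure \<Rightarrow> nat \<Rightarrow> nat \<Rightarrow> (nat \<Rightarrow> 'a \<Rightarrow> real ^ 'd) \<Rightarrow> (nat \<Rightarrow> 'a \<Rightarrow> real vec)
     \<Rightarrow> 'a \<Rightarrow> real ^ 'd ^ 'd" where
  "Gamma_tilde M n K x w \<omega> =
     (1 / real n) *\<^sub>R (\<Sum>i=1..n. outer (V_tilde M n K x w i \<omega>) (V_tilde M n K x w i \<omega>))"

text \<open>In \<open>ennreal\<close> the inverse of \<open>0\<close> is \<open>\<infinity>\<close>, and infinite conditional moments are not truncated.\<close>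

definition C_n ::
  "'a measure \<Rightarrow> nat \<Rightarrow> nat \<Rightarrow> (nat \<Rightarrow> 'a \<Rightarrow> real) \<Rightarrow> (nat \<Rightarrow> 'a \<Rightarrow> real ^ 'd)
     \<Rightarrow> (nat \<Rightarrow> 'a \<Rightarrow> real vec) \<Rightarrow> 'a \<Rightarrow> ennreal" where
  "C_n M n K u x w \<omega> =
     (MAX i\<in>{1..n}.
         nn_cond_exp M (sigma_XW M n K x w) (\<lambda>\<omega>'. ennreal ((u i \<omega>') ^ 4)) \<omega>
       + nn_cond_exp M (sigma_W M n K w) (\<lambda>\<omega>'. ennreal ((norm (V_n M n K x w i \<omega>')) ^ 4)) \<omega>
       + inverse (nn_cond_exp M (sigma_XW M n K x w) (\<lambda>\<omega>'. ennreal ((u i \<omega>')\<^sup>2)) \<omega>))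
     + inverse (ennreal (lambda_min
         (mat_cond_exp M (sigma_W M n K w) (Gamma_tilde M n K x w) \<omega>)))"

end

(*
For a fixed vector t put c = Gamma_hat^-1 Omega^(-1/2) t. Then t . Omega^(-1/2) sqrt n (beta_hat - beta)
is sum_i a_i u_i with a_i = (c . vhat_i) / sqrt n, and a_i is measurable with respect to the sigma-algebra F
generated by X and W. Its conditional variance given F is c . Sigma c = |t|^2. Since the clusters of (u, x) are
independent given W, the errors of one cluster have the same conditional law given F and the errors
of all other clusters as given F alone (weak union). Hence one may exchange the cluster sums one by one for
Gaussian factors, as in Lindeberg's argument, and the characteristic function of the sum differs from
exp (-|t|^2 / 2) by at most the sum of third-moment terms over the clusters.

These terms are small on an F-measurable event where the conditional fourth moments, Sigma^-1 and the
mean of |vhat_i|^2 are bounded and max |vhat_i| / sqrt n is small. The mean of |vhat_i|^2 is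
bounded in probability by chi_n and the conditional moments of V_i, because vhat = M v and M is a projection.
Gamma_hat needs no separate condition: c . Gamma_hat c = 0 forces c . vhat_i = 0 for all i and hence
c . Sigma c = 0, so Gamma_hat is invertible whenever Sigma is.
Convergence of characteristic functions gives convergence in distribution in R^d by smoothing with a small Gaussian.
*)
theory Submission
  imports Defs
begin

section \<open>Symmetric and positive semidefinite matrices\<close>

text \<open>\<open>measure\<close> gives every nonmeasurable set the value 0, so a tail condition
  says something only about measurable quantities. Hence \<open>lambda_min\<close>,
  \<open>matrix_inv\<close> and \<open>matrix_sqrt\<close> have to be shown Borel: the eigenvalue
  through closed superlevel sets, the inverse through Cramer's rule, the root as a limit of
  polynomials in the matrix.

  The exchange of clusters needs multipliers that know F and the errors of all clusters but one;
  \<open>H g\<close> collects them. The bridge between F and \<open>H g\<close> is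
  \<open>WX g\<close>, generated by W and the regressors of cluster g: both arise from it by adding
  events of other clusters, so both give functions of cluster g the conditional expectation that
  \<open>WX g\<close> gives.

  Third moments are not estimated directly. With \<alpha> a bound of the weights, |z|^3 <= (\<alpha>
  z^2 + z^4 / \<alpha>) / 2. The second moments of the cluster sums add up to at most |t|^2 and
  their fourth moments are of order \<alpha>^2, so the total is of order \<alpha>, which is small
  when max |vhat_i| / sqrt n is.\<close>

abbreviation is_symmetric :: "real^'n^'n \<Rightarrow> bool" where
  "is_symmetric A \<equiv> Finite_Cartesian_Product.transpose A = A"

abbreviation id_mat :: "real^'n^'n" where
  "id_mat \<equiv> Finite_Cartesian_Product.mat 1"

text \<open>\<open>norm A\<close> is the Frobenius norm here, so Cauchy-Schwarz in each row
  suffices.\<close>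

lemma norm_matrix_vector_le:
  fixes A :: "real^'n^'m"
  shows "norm (A *v v) \<le> norm A * norm v"
proof -
  have *: "norm ((A *v v) $ i) \<le> norm (A $ i) * norm v" for i
    using Cauchy_Schwarz_ineq2[of "A $ i" v] by (simp add: matrix_vector_mul_component)
  have "norm (A *v v) \<le> L2_set (\<lambda>i. norm (A $ i) * norm v) UNIV"
    unfolding norm_vec_def[of "A *v v"] by (intro L2_set_mono *) auto
  also have "\<dots> = norm A * norm v"
    unfolding norm_vec_def[of A] by (simp add: L2_set_left_distrib)
  finally show ?thesis .
qed

lemma symmetric_dot:
  fixes A :: "real^'n^'n"
  assumes "is_symmetric A"
  shows "(A *v x) \<bullet> y = x \<bullet> (A *v y)"
  using dot_lmul_matrix[of x A y] assms
  by (metis transpose_matrix_vector)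

lemma symmetric_dotI:
  fixes A :: "real^'n^'n"
  assumes "\<And>x y. (A *v x) \<bullet> y = x \<bullet> (A *v y)"
  shows "is_symmetric A"
proof -
  have "A $ i $ j = A $ j $ i" for i j
  proof -
    have "A $ i $ j = axis i 1 \<bullet> (A *v axis j 1)"
      by (simp add: matrix_vector_mul_component inner_axis inner_axis' inner_commute)
    also have "\<dots> = (A *v axis i 1) \<bullet> axis j 1" using assms by simp
    also have "\<dots> = A $ j $ i"
      by (simp add: matrix_vector_mul_component inner_axis inner_axis' inner_commute)
    finally show ?thesis .
  qed
  then show ?thesis by (simp add: Finite_Cartesian_Product.transpose_def Finite_Cartesian_Product.vec_eq_iff)
qed

section \<open>Quadratic forms and the smallest eigenvalue\<close>

lemma pos_semidef_cauchy_schwarz: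
  assumes A: "pos_semidef A"
  shows "(x \<bullet> (A *v y))\<^sup>2 \<le> (x \<bullet> (A *v x)) * (y \<bullet> (A *v y))"
proof -
  define a b c where "a = x \<bullet> (A *v x)" and "b = x \<bullet> (A *v y)" and "c = y \<bullet> (A *v y)"
  have sym: "y \<bullet> (A *v x) = b"
    using A unfolding b_def pos_semidef_def by (metis symmetric_dot inner_commute)
  have q: "0 \<le> a + 2 * t * b + t\<^sup>2 * c" for t
  proof -
    have "0 \<le> (x + t *\<^sub>R y) \<bullet> (A *v (x + t *\<^sub>R y))" using A by (simp add: pos_semidef_def)
    also have "\<dots> = a + 2 * t * b + t\<^sup>2 * c"
      using sym
      by (simp add: a_def b_def c_def matrix_vector_right_distrib matrix_vector_mult_scaleR
          inner_add_left inner_add_right power2_eq_square algebra_simps)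
    finally show ?thesis .
  qed
  have c: "0 \<le> c" using A by (simp add: c_def pos_semidef_def)
  show ?thesis
  proof (cases "c = 0")
    case True
    have "b = 0"
    proof (rule ccontr)
      assume "b \<noteq> 0"
      \<comment> \<open>At this argument the affine function a + 2 t b takes the value -1.\<close>
      then show False using q[of "- (a + 1) / (2 * b)"] True by (simp add: field_simps)
    qed
    then show ?thesis using True by (simp add: a_def b_def c_def)
  next
    case False
    then have c': "0 < c" using c by simp
    \<comment> \<open>The argument - b / c minimizes the quadratic polynomial.\<close>
    have "0 \<le> (a + 2 * (- b / c) * b + (- b / c)\<^sup>2 * c) * c" using q[of "- b / c"] c' by (intro mult_nonneg_nonneg) (simp_all only: less_imp_le)
    also have "\<dots> = a * c - b\<^sup>2" using c' by (simp add: field_simps power2_eq_square)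
    finally show ?thesis by (simp add: a_def b_def c_def)
  qed
qed

text \<open>Cauchy-Schwarz for the form of A, taken between A x and x. It stands in for
  diagonalization wherever a zero of the form has to become a null vector.\<close>

lemma pos_semidef_kernel:
  assumes "pos_semidef A" "x \<bullet> (A *v x) = 0"
  shows "A *v x = 0"
proof -
  have "((A *v x) \<bullet> (A *v x))\<^sup>2 \<le> 0"
    using pos_semidef_cauchy_schwarz[OF assms(1), of "A *v x" x] assms(2) by simp
  then show ?thesis by simp
qed

lemma inner_matrix_diff_id:
  fixes A :: "real^'n^'n"
  shows "v \<bullet> ((A - c *\<^sub>R id_mat) *v v) = v \<bullet> (A *v v) - c * (v \<bullet> v)"
  by (simp add: matrix_vector_mult_diff_rdistrib inner_diff_right scaleR_matrix_vector_assoc[symmetric])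

text \<open>Eigenvectors for different eigenvalues are orthogonal, hence independent, so there are
  finitely many. This gives the \<open>Min\<close> in \<open>lambda_min\<close> its meaning.\<close>

lemma finite_eigenvalues:
  fixes A :: "real^'n^'n"
  assumes A: "is_symmetric A"
  shows "finite {c. \<exists>v. v \<noteq> 0 \<and> A *v v = c *\<^sub>R v}"
proof -
  let ?S = "{c. \<exists>v. v \<noteq> 0 \<and> A *v v = c *\<^sub>R v}"
  have "\<forall>c\<in>?S. \<exists>v. v \<noteq> 0 \<and> A *v v = c *\<^sub>R v" by simp
  from bchoice[OF this] obtain f where f: "\<And>c. c \<in> ?S \<Longrightarrow> f c \<noteq> 0 \<and> A *v f c = c *\<^sub>R f c"
    by blast
  have orth: "f c \<bullet> f e = 0" if "c \<in> ?S" "e \<in> ?S" "c \<noteq> e" for c e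
  proof -
    have "c * (f c \<bullet> f e) = (A *v f c) \<bullet> f e" using f[OF that(1)] by simp
    also have "\<dots> = e * (f c \<bullet> f e)" using f[OF that(2)] by (simp add: symmetric_dot[OF A])
    finally show ?thesis using that(3) by simp
  qed
  have inj: "inj_on f ?S"
  proof (rule inj_onI, rule ccontr)
    fix c e assume "c \<in> ?S" "e \<in> ?S" "f c = f e" "c \<noteq> e"
    then show False using orth[of c e] f[of c] by simp
  qed
  have "pairwise real_inner_class.orthogonal (f ` ?S)"
    unfolding pairwise_def using orth f by (auto simp: real_inner_class.orthogonal_def)
  moreover have "0 \<notin> f ` ?S" using f by fastforce
  ultimately have "independent (f ` ?S)" by (rule pairwise_orthogonal_independent)
  then have "finite (f ` ?S)" using independent_imp_finite by blast
  then show ?thesis using inj finite_imageD by blast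
qed

text \<open>Rayleigh's principle. Let m be the minimum of the form on the unit sphere, attained at
  v0. Then A - m is positive semidefinite and its form vanishes at v0, so v0 is an eigenvector for
  m, and no eigenvalue is smaller. The right side is a family of linear inequalities in A, which
  makes the superlevel sets of \<open>lambda_min\<close> closed.\<close>

lemma le_lambda_min_iff:
  fixes A :: "real^'n^'n"
  assumes A: "is_symmetric A"
  shows "c \<le> lambda_min A \<longleftrightarrow> (\<forall>v. c * (v \<bullet> v) \<le> v \<bullet> (A *v v))"
proof -
  let ?S = "{c. \<exists>v. v \<noteq> 0 \<and> A *v v = c *\<^sub>R v}"
  let ?q = "\<lambda>v. v \<bullet> (A *v v)"
  have "\<exists>v\<in>sphere 0 1. \<forall>w\<in>sphere 0 1. ?q v \<le> ?q w"
  proof (rule continuous_attains_inf)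
    show "compact (sphere (0::real^'n) 1)" by simp
    have "axis (undefined :: 'n) 1 \<in> sphere (0::real^'n) 1" by simp
    then show "sphere (0::real^'n) 1 \<noteq> {}" by blast
    show "continuous_on (sphere 0 1) ?q"
      by (intro continuous_on_inner continuous_on_id linear_continuous_on) simp
  qed
  then obtain v0 where v0: "norm v0 = 1" and min: "\<And>w. norm w = 1 \<Longrightarrow> ?q v0 \<le> ?q w"
    by auto
  let ?m = "?q v0"
  have ge: "?m * (v \<bullet> v) \<le> ?q v" for v
  proof (cases "v = 0")
    case False
    have "?m \<le> ?q ((1 / norm v) *\<^sub>R v)" using False by (intro min) simp
    also have "\<dots> = ?q v / (v \<bullet> v)"
      by (simp add: matrix_vector_mult_scaleR dot_square_norm power2_eq_square)
    finally have "?m \<le> ?q v / (v \<bullet> v)" .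
    moreover have "0 < v \<bullet> v" using False by simp
    ultimately show ?thesis using pos_le_divide_eq by blast
  qed simp
  have psd: "pos_semidef (A - ?m *\<^sub>R id_mat)"
    unfolding pos_semidef_def
  proof
    show "is_symmetric (A - ?m *\<^sub>R id_mat)"
      using A by (simp add: Finite_Cartesian_Product.transpose_def Finite_Cartesian_Product.mat_def
          Finite_Cartesian_Product.vec_eq_iff)
  qed (use ge inner_matrix_diff_id[of _ A] in auto)
  have "v0 \<bullet> v0 = 1" using v0 by (simp add: dot_square_norm)
  then have "v0 \<bullet> ((A - ?m *\<^sub>R id_mat) *v v0) = 0" by (subst inner_matrix_diff_id) simp
  from pos_semidef_kernel[OF psd this] have "A *v v0 = ?m *\<^sub>R v0"
    by (simp add: matrix_vector_mult_diff_rdistrib scaleR_matrix_vector_assoc[symmetric])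
  moreover have "v0 \<noteq> 0" using v0 by auto
  ultimately have in_S: "?m \<in> ?S" by blast
  have low: "?m \<le> e" if e: "e \<in> ?S" for e
  proof -
    obtain v where v: "v \<noteq> 0" "A *v v = e *\<^sub>R v" using e by auto
    then have "?m * (v \<bullet> v) \<le> e * (v \<bullet> v)" using ge[of v] by simp
    then show ?thesis using v(1) by simp
  qed
  have "lambda_min A = ?m"
    unfolding lambda_min_def using finite_eigenvalues[OF A] in_S low by (intro Min_eqI) auto
  show ?thesis
  proof
    assume c: "c \<le> lambda_min A"
    show "\<forall>v. c * (v \<bullet> v) \<le> ?q v"
    proof
      fix v :: "real^'n"
      have "c * (v \<bullet> v) \<le> ?m * (v \<bullet> v)"
        using c \<open>lambda_min A = ?m\<close> by (intro mult_right_mono) auto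
      then show "c * (v \<bullet> v) \<le> ?q v" using ge[of v] by linarith
    qed
  next
    assume "\<forall>v. c * (v \<bullet> v) \<le> ?q v"
    from spec[OF this, of v0] show "c \<le> lambda_min A"
      using \<open>lambda_min A = ?m\<close> \<open>v0 \<bullet> v0 = 1\<close> by simp
  qed
qed

section \<open>Closed sets of matrices\<close>

lemma continuous_on_matrix_vector:
  fixes f :: "'t::topological_space \<Rightarrow> real^'n^'m"
  assumes "continuous_on S f" "continuous_on S g"
  shows "continuous_on S (\<lambda>x. f x *v g x)"
  unfolding matrix_vector_mult_def
  by (intro continuous_on_vec_lambda continuous_intros assms continuous_on_component)

lemma continuous_on_matrix_matrix [continuous_intros]:
  fixes f :: "'t::topological_space \<Rightarrow> real^'n^'m" and g :: "'t \<Rightarrow> real^'k^'n"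
  assumes "continuous_on S f" "continuous_on S g"
  shows "continuous_on S (\<lambda>x. f x ** g x)"
  unfolding matrix_matrix_mult_def
  by (intro continuous_on_vec_lambda continuous_intros assms continuous_on_component)

lemma tendsto_matrix_matrix:
  fixes f :: "nat \<Rightarrow> real^'n^'m" and g :: "nat \<Rightarrow> real^'k^'n"
  assumes "f \<longlonglongrightarrow> a" "g \<longlonglongrightarrow> b"
  shows "(\<lambda>k. f k ** g k) \<longlonglongrightarrow> a ** b"
  unfolding matrix_matrix_mult_def
  by (intro tendsto_vec_lambda tendsto_intros assms)

lemma tendsto_matrix_vector:
  fixes f :: "nat \<Rightarrow> real^'n^'m"
  assumes "f \<longlonglongrightarrow> a" 
  shows "(\<lambda>k. f k *v v) \<longlonglongrightarrow> a *v v"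
  unfolding matrix_vector_mult_def
  by (intro tendsto_vec_lambda tendsto_intros assms)

lemma closed_symmetric: "closed {A :: real^'n^'n. is_symmetric A}"
proof -
  have "{A :: real^'n^'n. is_symmetric A} = (\<Inter>i. \<Inter>j. {A. A $ i $ j = A $ j $ i})"
    by (auto simp: Finite_Cartesian_Product.transpose_def Finite_Cartesian_Product.vec_eq_iff)
  also have "closed \<dots>"
    by (intro closed_INT ballI closed_Collect_eq continuous_intros continuous_on_component)
  finally show ?thesis .
qed

lemma closed_quadratic_ge: "closed {A :: real^'n^'n. \<forall>v. c * (v \<bullet> v) \<le> v \<bullet> (A *v v)}"
proof -
  have cont: "continuous_on UNIV (\<lambda>A :: real^'n^'n. v \<bullet> (A *v v))" for v
    by (rule continuous_on_inner[OF continuous_on_const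
        continuous_on_matrix_vector[OF continuous_on_id continuous_on_const]])
  have "closed {A :: real^'n^'n. c * (v \<bullet> v) \<le> v \<bullet> (A *v v)}" for v
    by (rule closed_Collect_le[OF continuous_on_const cont])
  then have "closed (\<Inter>v. {A :: real^'n^'n. c * (v \<bullet> v) \<le> v \<bullet> (A *v v)})" by (intro closed_INT) auto
  moreover have "(\<Inter>v. {A :: real^'n^'n. c * (v \<bullet> v) \<le> v \<bullet> (A *v v)})
      = {A. \<forall>v. c * (v \<bullet> v) \<le> v \<bullet> (A *v v)}" by auto
  ultimately show ?thesis by simp
qed

lemma closed_pos_semidef: "closed {A :: real^'n^'n. pos_semidef A}"
proof -
  have "{A :: real^'n^'n. pos_semidef A} = {A. is_symmetric A} \<inter> {A. \<forall>v. 0 * (v \<bullet> v) \<le> v \<bullet> (A *v v)}"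
    by (auto simp: pos_semidef_def)
  then show ?thesis by (simp only: closed_Int closed_symmetric closed_quadratic_ge)
qed

lemma borel_measurable_lambda_min:
  assumes f: "f \<in> borel_measurable N" and sym: "\<And>\<omega>. \<omega> \<in> space N \<Longrightarrow> is_symmetric (f \<omega>)"
  shows "(\<lambda>\<omega>. lambda_min (f \<omega>)) \<in> borel_measurable N"
proof (rule borel_measurableI_ge)
  fix c
  have "{\<omega> \<in> space N. c \<le> lambda_min (f \<omega>)} = f -` {A. \<forall>v. c * (v \<bullet> v) \<le> v \<bullet> (A *v v)} \<inter> space N"
    using sym le_lambda_min_iff by auto
  also have "\<dots> \<in> sets N"
    by (intro measurable_sets[OF f] borel_closed closed_quadratic_ge)
  finally show "{\<omega> \<in> space N. c \<le> lambda_min (f \<omega>)} \<in> sets N" .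
qed

section \<open>The positive semidefinite square root\<close>

text \<open>Polynomials in E with nonnegative coefficients, in Horner form: besides 0 the only
  constructor multiplies by E and adds a multiple of the identity, so each property needs a single
  inductive step.\<close>

inductive nonneg_poly :: "real^'n^'n \<Rightarrow> real^'n^'n \<Rightarrow> bool" for E where
  zero: "nonneg_poly E 0"
| horner: "nonneg_poly E X \<Longrightarrow> 0 \<le> c \<Longrightarrow> nonneg_poly E (E ** X + c *\<^sub>R id_mat)"

lemma matrix_mul_scaleR [simp]:
  fixes A B :: "real^'n^'n"
  shows "(c *\<^sub>R A) ** B = c *\<^sub>R (A ** B)" "A ** (c *\<^sub>R B) = c *\<^sub>R (A ** B)"
  by (simp_all add: matrix_matrix_mult_def Finite_Cartesian_Product.vec_eq_iff sum_distrib_left mult_ac)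

lemma matrix_mult_distribs:
  fixes A B C :: "real^'n^'n"
  shows matrix_add_rdistrib: "(A + B) ** C = A ** C + B ** C"
    and matrix_sub_rdistrib: "(A - B) ** C = A ** C - B ** C"
    and matrix_sub_ldistrib: "A ** (B - C) = A ** B - A ** C"
  by (simp_all add: matrix_matrix_mult_def Finite_Cartesian_Product.vec_eq_iff
      sum.distrib sum_subtractf algebra_simps)

lemma matrix_inv:
  fixes A :: "real^'n^'n"
  assumes "invertible A"
  shows matrix_inv_right: "A ** matrix_inv A = id_mat"
    and matrix_inv_left: "matrix_inv A ** A = id_mat"
  using someI_ex[OF assms[unfolded invertible_def]] by (simp_all add: matrix_inv_def)

lemma nonneg_poly_scale: "nonneg_poly E X \<Longrightarrow> 0 \<le> c \<Longrightarrow> nonneg_poly E (c *\<^sub>R X)"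
proof (induction rule: nonneg_poly.induct)
  case (horner X a)
  then have "nonneg_poly E (E ** (c *\<^sub>R X) + (c * a) *\<^sub>R id_mat)"
    by (intro nonneg_poly.horner) auto
  then show ?case by (simp add: scaleR_add_right)
qed (simp add: nonneg_poly.zero)

lemma nonneg_poly_add: "nonneg_poly E X \<Longrightarrow> nonneg_poly E Y \<Longrightarrow> nonneg_poly E (X + Y)"
proof (induction arbitrary: Y rule: nonneg_poly.induct)
  case (horner X a)
  from horner.prems show ?case
  proof cases
    case zero
    then show ?thesis using horner.hyps by (simp add: nonneg_poly.horner)
  next
    case (horner Z b)
    then have "nonneg_poly E (E ** (X + Z) + (a + b) *\<^sub>R id_mat)"
      using \<open>0 \<le> a\<close> by (intro nonneg_poly.horner horner.IH) auto
    then show ?thesis using horner by (simp add: matrix_add_ldistrib scaleR_add_left algebra_simps)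
  qed
qed simp

lemma nonneg_poly_mult_left: "nonneg_poly E X \<Longrightarrow> nonneg_poly E (E ** X)"
  using nonneg_poly.horner[of E X 0] by simp

lemma nonneg_poly_mult: "nonneg_poly E X \<Longrightarrow> nonneg_poly E Y \<Longrightarrow> nonneg_poly E (X ** Y)"
proof (induction rule: nonneg_poly.induct)
  case zero
  then show ?case using nonneg_poly.zero[of E] by simp
next
  case (horner X a)
  then have "nonneg_poly E (E ** (X ** Y) + a *\<^sub>R Y)"
    by (intro nonneg_poly_add nonneg_poly_mult_left nonneg_poly_scale) auto
  then show ?case by (simp add: matrix_add_rdistrib matrix_mul_assoc)
qed

lemma nonneg_poly_self: "nonneg_poly E E"
  using nonneg_poly.horner[OF nonneg_poly.horner[OF nonneg_poly.zero, of 1 E], of 0] by simp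

lemma nonneg_poly_commute_base: "nonneg_poly E X \<Longrightarrow> X ** E = E ** X"
proof (induction rule: nonneg_poly.induct)
  case (horner X a)
  then show ?case
    by (simp add: matrix_add_rdistrib matrix_add_ldistrib matrix_mul_assoc[symmetric])
qed simp

lemma nonneg_poly_commute: "nonneg_poly E X \<Longrightarrow> nonneg_poly E Y \<Longrightarrow> X ** Y = Y ** X"
proof (induction rule: nonneg_poly.induct)
  case (horner X a)
  have "(E ** X) ** Y = E ** (Y ** X)" using horner by (simp add: matrix_mul_assoc[symmetric])
  also have "\<dots> = Y ** (E ** X)"
    using nonneg_poly_commute_base[OF horner.prems] by (simp add: matrix_mul_assoc)
  finally show ?case by (simp add: matrix_add_rdistrib matrix_add_ldistrib)
qed simp

text \<open>Positivity has to be carried for X and \<open>E ** X\<close> together. The step to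
  \<open>E ** X + c *\<^sub>R id_mat\<close> uses the second, and the form of
  \<open>E ** (E ** X)\<close> at v is that of X at \<open>E *v v\<close>, because X commutes with
  E.\<close>

lemma nonneg_poly_pos_semidef:
  fixes E :: "real^'n^'n"
  assumes E: "pos_semidef E"
  shows "nonneg_poly E X \<Longrightarrow>
    (\<forall>x y. (X *v x) \<bullet> y = x \<bullet> (X *v y)) \<and> (\<forall>v. 0 \<le> v \<bullet> (X *v v)) \<and> (\<forall>v. 0 \<le> v \<bullet> ((E ** X) *v v))"
proof (induction rule: nonneg_poly.induct)
  case (horner X a)
  have s: "(E *v x) \<bullet> y = x \<bullet> (E *v y)" for x y
    using E symmetric_dot by (auto simp: pos_semidef_def)
  have c: "X *v (E *v y) = E *v (X *v y)" for y
    using nonneg_poly_commute_base[OF horner.hyps(1)] by (simp add: matrix_vector_mul_assoc)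
  have id: "a * (v \<bullet> v) \<ge> 0" "v \<bullet> (E *v v) * a \<ge> 0" for v
    using horner.hyps(2) E by (auto simp: pos_semidef_def)
  have "v \<bullet> (E *v (E *v (X *v v))) \<ge> 0" for v
    using horner.IH c[of v] s[of v "E *v (X *v v)"] by (metis c)
  then show ?case
    using horner.IH id s c
    by (auto simp: matrix_add_ldistrib matrix_vector_mult_add_rdistrib matrix_vector_mul_assoc[symmetric]
        scaleR_matrix_vector_assoc[symmetric] inner_add_left inner_add_right algebra_simps
        intro!: add_nonneg_nonneg)
qed simp_all

text \<open>By polarization each entry is a combination of the values of the form at e_i + e_j, e_i
  and e_j, and along the sequence each such value increases and is bounded.\<close>

lemma monotone_matrices_convergent:
  fixes Y :: "nat \<Rightarrow> real^'n^'n"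
  assumes sym: "\<And>k x y. (Y k *v x) \<bullet> y = x \<bullet> (Y k *v y)"
    and mono: "\<And>k v. v \<bullet> (Y k *v v) \<le> v \<bullet> (Y (Suc k) *v v)"
    and bound: "\<And>k v. v \<bullet> (Y k *v v) \<le> v \<bullet> v"
  shows "convergent Y"
proof -
  have conv: "convergent (\<lambda>k. v \<bullet> (Y k *v v))" for v
  proof -
    have inc: "incseq (\<lambda>k. v \<bullet> (Y k *v v))" using mono by (rule incseq_SucI)
    obtain L where "(\<lambda>k. v \<bullet> (Y k *v v)) \<longlonglongrightarrow> L"
      by (rule incseq_convergent[OF inc]) (use bound in auto)
    then show ?thesis by (auto simp: convergent_def)
  qed
  have polar: "Y k $ i $ j = ((axis i 1 + axis j 1) \<bullet> (Y k *v (axis i 1 + axis j 1))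
      - axis i 1 \<bullet> (Y k *v axis i 1) - axis j 1 \<bullet> (Y k *v axis j 1)) / 2" for k i j
  proof -
    have "axis j 1 \<bullet> (Y k *v axis i 1) = axis i 1 \<bullet> (Y k *v axis j 1)"
      by (metis sym inner_commute)
    moreover have "Y k $ i $ j = axis i 1 \<bullet> (Y k *v axis j 1)"
      by (simp add: matrix_vector_mul_component inner_axis inner_axis' inner_commute)
    ultimately show ?thesis
      by (simp add: matrix_vector_right_distrib inner_add_left inner_add_right)
  qed
  obtain q where q: "\<And>v. (\<lambda>k. v \<bullet> (Y k *v v)) \<longlonglongrightarrow> q v"
    using conv unfolding convergent_def by metis
  define L where "L i j = (q (axis i 1 + axis j 1) - q (axis i 1) - q (axis j 1)) / 2" for i j
  have L: "(\<lambda>k. Y k $ i $ j) \<longlonglongrightarrow> L i j" for i j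
    unfolding polar L_def by (intro tendsto_intros q) simp
  have "Y \<longlonglongrightarrow> (\<chi> i j. L i j)"
    by (intro vec_tendstoI) (simp add: L)
  then show ?thesis by (auto simp: convergent_def)
qed

text \<open>The iteration for \<open>1 - sqrt (1 - E)\<close>; its increments are polynomials in \<open>E\<close> with nonnegative
  coefficients, so it increases in the Loewner order.\<close>

primrec sqrt_iter :: "real^'n^'n \<Rightarrow> nat \<Rightarrow> real^'n^'n" where
  "sqrt_iter E 0 = 0"
| "sqrt_iter E (Suc k) = (1 / 2) *\<^sub>R (E + sqrt_iter E k ** sqrt_iter E k)"

lemma nonneg_poly_sqrt_iter: "nonneg_poly E (sqrt_iter E k)"
  by (induction k)
    (auto intro!: nonneg_poly.zero nonneg_poly_scale nonneg_poly_add nonneg_poly_self nonneg_poly_mult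
      simp del: scaleR_add_right)

text \<open>The iterates commute, so the difference of their squares factors: the next increment is
  half the previous increment times a sum of two iterates.\<close>

lemma nonneg_poly_sqrt_iter_diff: "nonneg_poly E (sqrt_iter E (Suc k) - sqrt_iter E k)"
proof (induction k)
  case 0
  show ?case using nonneg_poly_scale[OF nonneg_poly_self, of "1/2" E] by simp
next
  case (Suc k)
  let ?a = "sqrt_iter E (Suc k)" and ?b = "sqrt_iter E k"
  have "sqrt_iter E (Suc (Suc k)) - ?a = (1/2) *\<^sub>R (?a ** ?a - ?b ** ?b)"
    by (simp add: scaleR_diff_right[symmetric] del: scaleR_add_right scaleR_diff_right) 
  also have "?a ** ?a - ?b ** ?b = (?a - ?b) ** (?a + ?b)"
    using nonneg_poly_commute[OF nonneg_poly_sqrt_iter nonneg_poly_sqrt_iter, of E "Suc k" k]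
    by (simp only: matrix_add_ldistrib matrix_sub_rdistrib) (simp only: algebra_simps)
  finally show ?case
    using Suc nonneg_poly_sqrt_iter
    by (metis nonneg_poly_scale nonneg_poly_mult nonneg_poly_add zero_le_divide_1_iff zero_le_numeral)
qed

text \<open>The next iterate is the average of two contractions, E and the square of the previous
  iterate. This is the upper bound for the monotone convergence.\<close>

lemma norm_sqrt_iter_le:
  assumes "\<And>v. norm (E *v v) \<le> norm v"
  shows "norm (sqrt_iter E k *v v) \<le> norm v"
proof (induction k arbitrary: v)
  case (Suc k)
  have "norm (sqrt_iter E (Suc k) *v v) = norm (E *v v + sqrt_iter E k *v (sqrt_iter E k *v v)) / 2"
    by (simp add: scaleR_matrix_vector_assoc[symmetric] matrix_vector_mult_add_rdistrib
        matrix_vector_mul_assoc del: scaleR_add_right)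
  also have "\<dots> \<le> (norm v + norm v) / 2"
    using norm_triangle_ineq[of "E *v v" "sqrt_iter E k *v (sqrt_iter E k *v v)"] assms[of v]
      Suc[of v] Suc[of "sqrt_iter E k *v v"] by (intro divide_right_mono) linarith+
  finally show ?case by simp
qed simp

lemma continuous_on_sqrt_iter: "continuous_on UNIV (\<lambda>E. sqrt_iter E k)"
  by (induction k) (auto intro!: continuous_intros)

text \<open>For positive semidefinite A the factor puts A / (1 + norm A) between 0 and the identity;
  the added 1 keeps the division continuous at A = 0.\<close>

definition sqrt_defect :: "real^'n^'n \<Rightarrow> real^'n^'n" where
  "sqrt_defect A = id_mat - (1 / (1 + norm A)) *\<^sub>R A"

text \<open>Put \<tau> = 1 + norm A and E = 1 - A / \<tau>. The limit L of the iteration solves 2 L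
  = E + L^2, that is (1 - L)^2 = A / \<tau>, so sqrt \<tau> (1 - L) is a root. The convergence is
  part of the conclusion because the measurability of the root is read off from it.\<close>

lemma pos_semidef_sqrt_limit:
  fixes A :: "real^'n^'n"
  assumes A: "pos_semidef A"
  obtains B where "pos_semidef B" "B ** B = A"
    "(\<lambda>k. sqrt (1 + norm A) *\<^sub>R (id_mat - sqrt_iter (sqrt_defect A) k)) \<longlonglongrightarrow> B"
proof -
  define \<tau> where "\<tau> = 1 + norm A"
  have \<tau>: "0 < \<tau>" by (simp add: \<tau>_def add_pos_nonneg)
  define E where "E = sqrt_defect A"
  have Ev: "E *v v = v - (1 / \<tau>) *\<^sub>R (A *v v)" for v
    by (simp add: E_def sqrt_defect_def \<tau>_def matrix_vector_mult_diff_rdistrib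
        scaleR_matrix_vector_assoc[symmetric])
  have A_sym: "(A *v x) \<bullet> y = x \<bullet> (A *v y)" and A_nonneg: "0 \<le> v \<bullet> (A *v v)" for x y v
    using A symmetric_dot by (auto simp: pos_semidef_def)
  have E_nonneg: "0 \<le> v \<bullet> (E *v v)" for v
  proof -
    have "v \<bullet> (A *v v) \<le> norm v * norm (A *v v)" by (rule norm_cauchy_schwarz)
    also have "\<dots> \<le> norm v * (norm A * norm v)" by (intro mult_left_mono norm_matrix_vector_le) auto
    also have "\<dots> \<le> \<tau> * (v \<bullet> v)" by (simp add: \<tau>_def dot_square_norm power2_eq_square algebra_simps)
    finally show ?thesis using \<tau> by (simp add: Ev inner_diff_right pos_divide_le_eq mult.commute)
  qed
  have E_psd: "pos_semidef E"
    unfolding pos_semidef_def using E_nonneg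
    by (auto intro!: symmetric_dotI simp: Ev inner_diff_left inner_diff_right A_sym)
  have E_le: "v \<bullet> (E *v v) \<le> v \<bullet> v" for v
    using A_nonneg[of v] \<tau> by (simp add: Ev inner_diff_right)
  \<comment> \<open>The contraction bound comes from the form alone: |E v|^4 is at most the product
    of the forms of E at E v and at v, hence at most |E v|^2 |v|^2.\<close>
  have E_norm: "norm (E *v v) \<le> norm v" for v
  proof (cases "E *v v = 0")
    case False
    let ?e = "(E *v v) \<bullet> (E *v v)"
    have pos: "0 < ?e" using False by simp
    have "?e * ?e \<le> ((E *v v) \<bullet> (E *v (E *v v))) * (v \<bullet> (E *v v))"
      using pos_semidef_cauchy_schwarz[OF E_psd, of "E *v v" v] by (simp add: power2_eq_square)
    also have "\<dots> \<le> ?e * (v \<bullet> v)" by (intro mult_mono E_le E_nonneg) auto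
    finally have "?e \<le> v \<bullet> v" using pos by (simp add: mult_le_cancel_left_pos)
    then show ?thesis by (simp add: norm_le)
  qed simp
  let ?Y = "sqrt_iter E"
  note P = nonneg_poly_pos_semidef[OF E_psd, OF nonneg_poly_sqrt_iter]
  have Y_le: "v \<bullet> (?Y k *v v) \<le> v \<bullet> v" for k v
  proof -
    have "v \<bullet> (?Y k *v v) \<le> norm v * norm (?Y k *v v)" by (rule norm_cauchy_schwarz)
    also have "\<dots> \<le> norm v * norm v" by (intro mult_left_mono norm_sqrt_iter_le E_norm) auto
    finally show ?thesis by (simp add: dot_square_norm power2_eq_square)
  qed
  have "convergent ?Y"
  proof (rule monotone_matrices_convergent[OF _ _ Y_le])
    show "v \<bullet> (?Y k *v v) \<le> v \<bullet> (?Y (Suc k) *v v)" for k v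
      using nonneg_poly_pos_semidef[OF E_psd nonneg_poly_sqrt_iter_diff[of E k]]
      by (simp add: matrix_vector_mult_diff_rdistrib inner_diff_right del: sqrt_iter.simps)
  qed (use P in blast)
  then obtain L where L: "?Y \<longlonglongrightarrow> L" by (auto simp: convergent_def)
  have "(\<lambda>k. ?Y (Suc k)) \<longlonglongrightarrow> (1 / 2) *\<^sub>R (E + L ** L)"
    unfolding sqrt_iter.simps by (intro tendsto_intros tendsto_matrix_matrix L)
  then have fix_L: "L = (1 / 2) *\<^sub>R (E + L ** L)"
    using LIMSEQ_Suc[OF L] LIMSEQ_unique by blast
  have L2: "L ** L = 2 *\<^sub>R L - E"
    using arg_cong[OF fix_L, of "\<lambda>z. 2 *\<^sub>R z"] by simp
  have tv: "(\<lambda>k. x \<bullet> (?Y k *v y)) \<longlonglongrightarrow> x \<bullet> (L *v y)" for x y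
    by (intro tendsto_intros tendsto_matrix_vector L)
  have L_le: "v \<bullet> (L *v v) \<le> v \<bullet> v" for v
    using tv[of v v] by (rule LIMSEQ_le_const2) (use Y_le in blast)
  have L_sym: "(L *v x) \<bullet> y = x \<bullet> (L *v y)" for x y
  proof -
    have "y \<bullet> (?Y k *v x) = x \<bullet> (?Y k *v y)" for k using P by (metis inner_commute)
    then have "(\<lambda>k. x \<bullet> (?Y k *v y)) \<longlonglongrightarrow> y \<bullet> (L *v x)" using tv[of y x] by simp
    from LIMSEQ_unique[OF tv[of x y] this] show ?thesis by (simp add: inner_commute)
  qed
  define B where "B = sqrt \<tau> *\<^sub>R (id_mat - L)"
  have Bv: "B *v v = sqrt \<tau> *\<^sub>R (v - L *v v)" for v
    by (simp add: B_def scaleR_matrix_vector_assoc[symmetric] matrix_vector_mult_diff_rdistrib)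
  have "pos_semidef B"
    unfolding pos_semidef_def using L_le L_sym \<tau>
    by (auto intro!: symmetric_dotI simp: Bv inner_diff_left inner_diff_right)
  moreover have "B ** B = A"
  proof -
    have "B ** B = \<tau> *\<^sub>R ((id_mat - L) ** (id_mat - L))"
      using \<tau> by (simp add: B_def)
    also have "(id_mat - L) ** (id_mat - L) = id_mat - 2 *\<^sub>R L + L ** L"
      by (simp add: matrix_sub_rdistrib matrix_sub_ldistrib scaleR_2)
    also have "\<dots> = (1 / \<tau>) *\<^sub>R A"
      unfolding L2 by (simp add: E_def sqrt_defect_def \<tau>_def)
    finally show ?thesis using \<tau> by simp
  qed
  moreover have "(\<lambda>k. sqrt (1 + norm A) *\<^sub>R (id_mat - sqrt_iter (sqrt_defect A) k)) \<longlonglongrightarrow> B"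
    unfolding B_def \<tau>_def E_def[symmetric] by (intro tendsto_intros L)
  ultimately show thesis by (rule that)
qed

lemma matrix_vector_mult_minus: "(A :: real^'n^'m) *v (- v) = - (A *v v)"
  by (simp add: matrix_vector_mult_def Finite_Cartesian_Product.vec_eq_iff sum_negf)

text \<open>With D = B - C the hypothesis reads B D = - D C. By cyclicity of the trace, the traces
  of D B D and D C D then add up to 0. Both are sums of nonnegative terms, so B D = 0 and C D = 0,
  hence D D = 0 and D = 0. This avoids simultaneous diagonalization.\<close>

lemma pos_semidef_sqrt_unique:
  fixes B C :: "real^'n^'n"
  assumes B: "pos_semidef B" and C: "pos_semidef C" and eq: "B ** B = C ** C"
  shows "B = C"
proof -
  define D where "D = B - C"
  have sB: "(B *v x) \<bullet> y = x \<bullet> (B *v y)" and sC: "(C *v x) \<bullet> y = x \<bullet> (C *v y)" for x y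
    using B C symmetric_dot by (auto simp: pos_semidef_def)
  have Dv: "D *v v = B *v v - C *v v" for v by (simp add: D_def matrix_vector_mult_diff_rdistrib)
  have eqv: "B *v (B *v v) = C *v (C *v v)" for v
    using eq by (simp add: matrix_vector_mul_assoc)
  let ?e = "\<lambda>i. axis i (1::real) :: real^'n"
  have key: "B *v (D *v v) = - (D *v (C *v v))" for v
    by (simp add: Dv eqv matrix_vector_mult_diff_distrib)
  \<comment> \<open>Both sides are traces, of P Q and of Q P.\<close>
  have cyc: "(\<Sum>i\<in>UNIV. ?e i \<bullet> (P *v (Q *v ?e i))) = (\<Sum>i\<in>UNIV. ?e i \<bullet> (Q *v (P *v ?e i)))"
    for P Q :: "real^'n^'n"
  proof -
    have "(\<Sum>i\<in>UNIV. ?e i \<bullet> (P *v (Q *v ?e i))) = (\<Sum>i\<in>UNIV. \<Sum>k\<in>UNIV. P $ i $ k * Q $ k $ i)"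
      by (simp add: inner_axis' matrix_vector_mul_assoc matrix_vector_mul_component inner_axis
          matrix_matrix_mult_def)
    also have "\<dots> = (\<Sum>i\<in>UNIV. \<Sum>k\<in>UNIV. Q $ i $ k * P $ k $ i)"
      by (subst sum.swap) (simp add: mult.commute)
    also have "\<dots> = (\<Sum>i\<in>UNIV. ?e i \<bullet> (Q *v (P *v ?e i)))"
      by (simp add: inner_axis' matrix_vector_mul_assoc matrix_vector_mul_component inner_axis
          matrix_matrix_mult_def)
    finally show ?thesis .
  qed
  have sD: "(D *v x) \<bullet> y = x \<bullet> (D *v y)" for x y
    by (simp add: Dv inner_diff_left inner_diff_right sB sC)
  have "(\<Sum>i\<in>UNIV. (D *v ?e i) \<bullet> (B *v (D *v ?e i))) = (\<Sum>i\<in>UNIV. ?e i \<bullet> (D *v (B *v (D *v ?e i))))"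
    by (simp add: sD)
  also have "\<dots> = - (\<Sum>i\<in>UNIV. ?e i \<bullet> ((D ** D) *v (C *v ?e i)))"
    by (simp add: key matrix_vector_mul_assoc[symmetric] sum_negf matrix_vector_mult_minus)
  also have "(\<Sum>i\<in>UNIV. ?e i \<bullet> ((D ** D) *v (C *v ?e i))) = (\<Sum>i\<in>UNIV. ?e i \<bullet> ((D ** C) *v (D *v ?e i)))"
    using cyc[of D "D ** C"] by (simp add: matrix_vector_mul_assoc matrix_mul_assoc)
  also have "\<dots> = (\<Sum>i\<in>UNIV. (D *v ?e i) \<bullet> (C *v (D *v ?e i)))"
    by (simp add: sD matrix_vector_mul_assoc[symmetric])
  finally have sum0: "(\<Sum>i\<in>UNIV. (D *v ?e i) \<bullet> (B *v (D *v ?e i)) + (D *v ?e i) \<bullet> (C *v (D *v ?e i))) = 0"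
    by (simp add: sum.distrib)
  have nB: "0 \<le> v \<bullet> (B *v v)" and nC: "0 \<le> v \<bullet> (C *v v)" for v
    using B C by (auto simp: pos_semidef_def)
  have "(D *v ?e i) \<bullet> (B *v (D *v ?e i)) + (D *v ?e i) \<bullet> (C *v (D *v ?e i)) = 0" for i
    using sum0 nB nC by (subst (asm) sum_nonneg_eq_0_iff) (auto intro: add_nonneg_nonneg)
  then have "(D *v ?e i) \<bullet> (B *v (D *v ?e i)) = 0" "(D *v ?e i) \<bullet> (C *v (D *v ?e i)) = 0" for i
    using nB nC by (metis add_nonneg_eq_0_iff)+
  then have "B *v (D *v ?e i) = 0" "C *v (D *v ?e i) = 0" for i
    using pos_semidef_kernel B C by blast+
  then have "D *v (D *v ?e i) = 0" for i by (simp only: Dv[of "D *v ?e i"]) simp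
  then have "D *v ?e i = 0" for i using sD[of "?e i" "D *v ?e i"] by simp
  then have "(D *v ?e i) $ j = 0" for i j by simp
  then have "D $ j $ i = 0" for i j
    by (simp add: matrix_vector_mul_component inner_axis)
  then have "D = 0" by (simp add: Finite_Cartesian_Product.vec_eq_iff)
  then show ?thesis by (simp add: D_def)
qed

lemma matrix_sqrt_eqI: "pos_semidef B \<Longrightarrow> B ** B = A \<Longrightarrow> matrix_sqrt A = B"
  unfolding matrix_sqrt_def using pos_semidef_sqrt_unique by (intro the_equality) auto

lemma matrix_sqrt_props:
  assumes "pos_semidef A"
  shows "pos_semidef (matrix_sqrt A)" "matrix_sqrt A ** matrix_sqrt A = A"
  using pos_semidef_sqrt_limit[OF assms] matrix_sqrt_eqI by metis+

lemma pos_semidef_square: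
  assumes "pos_semidef B"
  shows "pos_semidef (B ** B)"
proof -
  have s: "(B *v x) \<bullet> y = x \<bullet> (B *v y)" for x y
    using assms symmetric_dot by (auto simp: pos_semidef_def)
  show ?thesis
    unfolding pos_semidef_def
  proof
    show "is_symmetric (B ** B)"
      by (rule symmetric_dotI) (simp add: matrix_vector_mul_assoc[symmetric] s)
    have "v \<bullet> ((B ** B) *v v) = (B *v v) \<bullet> (B *v v)" for v
      by (simp add: matrix_vector_mul_assoc[symmetric] s)
    then show "\<forall>v. 0 \<le> v \<bullet> ((B ** B) *v v)" by simp
  qed
qed

section \<open>Borel measurability of the root and of the inverse\<close>

text \<open>On the closed set of positive semidefinite matrices the root is a pointwise limit of
  continuous functions. Elsewhere no positive semidefinite root exists, since the square of one
  would be positive semidefinite, and \<open>THE\<close> takes one fixed value.\<close>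

lemma borel_measurable_matrix_sqrt:
  "(matrix_sqrt :: real^'n^'n \<Rightarrow> _) \<in> borel_measurable borel"
proof -
  let ?S = "{A :: real^'n^'n. pos_semidef A}"
  let ?f = "\<lambda>k A :: real^'n^'n. if A \<in> ?S
     then sqrt (1 + norm A) *\<^sub>R (id_mat - sqrt_iter (sqrt_defect A) k) else (THE B. False)"
  have "?f k \<in> borel_measurable borel" for k
  proof (rule measurable_If_set)
    have "continuous_on UNIV (sqrt_defect :: real^'n^'n \<Rightarrow> _)"
      unfolding sqrt_defect_def
      by (intro continuous_intros ballI) (simp add: add_pos_nonneg order_less_imp_not_eq2)
    then have "continuous_on UNIV (\<lambda>A :: real^'n^'n. sqrt_iter (sqrt_defect A) k)"
      using continuous_on_compose2[OF continuous_on_sqrt_iter] by blast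
    then show "(\<lambda>A :: real^'n^'n. sqrt (1 + norm A) *\<^sub>R (id_mat - sqrt_iter (sqrt_defect A) k))
        \<in> borel_measurable borel"
      by (intro borel_measurable_continuous_onI continuous_intros)
  qed (auto intro!: borel_closed closed_pos_semidef)
  moreover have "(\<lambda>k. ?f k A) \<longlonglongrightarrow> matrix_sqrt A" for A :: "real^'n^'n"
  proof (cases "pos_semidef A")
    case True
    obtain B where B: "pos_semidef B" "B ** B = A"
      "(\<lambda>k. sqrt (1 + norm A) *\<^sub>R (id_mat - sqrt_iter (sqrt_defect A) k)) \<longlonglongrightarrow> B"
      using pos_semidef_sqrt_limit[OF True] by blast
    show ?thesis using B(3) True by (simp add: matrix_sqrt_eqI[OF B(1,2)])
  next
    case False
    then have "(\<lambda>B. pos_semidef B \<and> B ** B = A) = (\<lambda>B. False)" using pos_semidef_square by blast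
    then show ?thesis using False by (simp add: matrix_sqrt_def)
  qed
  ultimately show ?thesis by (rule borel_measurable_LIMSEQ_metric)
qed

text \<open>Cramer's rule writes the entry as a quotient of two determinants wherever the matrix is
  nonsingular.\<close>

lemma borel_measurable_matrix_inv_component:
  "(\<lambda>A :: real^'n^'n. matrix_inv A $ i $ j) \<in> borel_measurable borel"
proof -
  let ?D = "Determinants.det"
  define \<phi> where "\<phi> A = ?D (\<chi> p q. if q = i then axis j 1 $ p else A $ p $ q) / ?D A" for A :: "real^'n^'n"
  \<comment> \<open>At a singular matrix the predicate under \<open>SOME\<close> is identically
    false, so this constant is the value of \<open>matrix_inv\<close> there.\<close>
  define k where "k = (SOME A'::real^'n^'n. False)"
  have cont: "continuous_on UNIV (?D :: real^'n^'n \<Rightarrow> real)"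
    unfolding Determinants.det_def by (intro continuous_intros continuous_on_component)
  have m: "(?D :: real^'n^'n \<Rightarrow> real) \<in> borel_measurable borel"
    using cont by (rule borel_measurable_continuous_onI)
  have "continuous_on UNIV (\<lambda>A :: real^'n^'n. if q = i then axis j 1 $ p else A $ p $ q)" for p q
    by (cases "q = i") (auto intro!: continuous_on_component continuous_intros)
  then have "continuous_on UNIV (\<lambda>A :: real^'n^'n. (\<chi> p q. if q = i then axis j 1 $ p else A $ p $ q) :: real^'n^'n)"
    by (intro continuous_on_vec_lambda)
  from continuous_on_compose2[OF cont this]
  have "\<phi> \<in> borel_measurable borel"
    unfolding \<phi>_def by (intro borel_measurable_divide m borel_measurable_continuous_onI) auto
  then have "(\<lambda>A. if ?D A = 0 then k $ i $ j else \<phi> A) \<in> borel_measurable borel"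
    using m by measurable
  moreover have "matrix_inv A $ i $ j = (if ?D A = 0 then k $ i $ j else \<phi> A)" for A :: "real^'n^'n"
  proof (cases "?D A = 0")
    case True
    then have "\<not> invertible A" by (simp add: invertible_det_nz)
    then have "(\<lambda>A'. A ** A' = id_mat \<and> A' ** A = id_mat) = (\<lambda>A'. False)"
      unfolding invertible_def by blast
    then show ?thesis using True by (simp add: matrix_inv_def k_def)
  next
    case False
    then have inv: "A ** matrix_inv A = id_mat" by (simp add: invertible_det_nz matrix_inv_right)
    have "A *v (matrix_inv A *v axis j 1) = axis j 1"
      by (simp add: matrix_vector_mul_assoc inv)
    then have "matrix_inv A *v axis j 1 = (\<chi> k. ?D (\<chi> p q. if q = k then axis j 1 $ p else A $ p $ q) / ?D A)"
      using cramer[OF False] by blast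
    from arg_cong[OF this, of "\<lambda>v. v $ i"] show ?thesis
      using False by (simp add: \<phi>_def matrix_vector_mul_component inner_axis)
  qed
  ultimately show ?thesis by simp
qed

lemma borel_measurable_matrixI:
  fixes f :: "'a \<Rightarrow> real^'n^'m"
  assumes "\<And>i j. (\<lambda>\<omega>. f \<omega> $ i $ j) \<in> borel_measurable N"
  shows "f \<in> borel_measurable N"
proof (rule borel_measurable_euclidean_space[THEN iffD2], rule ballI)
  fix b :: "real^'n^'m" assume "b \<in> Basis"
  then obtain i j where "b = axis i (axis j 1)" by (auto simp: Basis_vec_def)
  then show "(\<lambda>\<omega>. f \<omega> \<bullet> b) \<in> borel_measurable N" using assms[of i j] by (simp add: inner_axis)
qed

lemma borel_measurable_vecI:
  fixes g :: "'a \<Rightarrow> real^'n"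
  assumes "\<And>i. (\<lambda>\<omega>. g \<omega> $ i) \<in> borel_measurable N"
  shows "g \<in> borel_measurable N"
proof (rule borel_measurable_euclidean_space[THEN iffD2], rule ballI)
  fix b :: "real^'n" assume "b \<in> Basis"
  then obtain i where "b = axis i 1" by (auto simp: Basis_vec_def)
  then show "(\<lambda>\<omega>. g \<omega> \<bullet> b) \<in> borel_measurable N" using assms[of i] by (simp add: inner_axis)
qed

lemma borel_measurable_matrix_inv: "(matrix_inv :: real^'n^'n \<Rightarrow> _) \<in> borel_measurable borel"
  by (rule borel_measurable_matrixI) (rule borel_measurable_matrix_inv_component)

text \<open>Cauchy-Schwarz for the form of S between c and the solution e of S e = c. This is how a
  bound on the inverse of the conditional variance controls the weights of the errors.\<close>

lemma pos_def_inverse_bound: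
  fixes S :: "real^'n^'n"
  assumes S: "pos_semidef S" and inv: "invertible S"
  shows "c \<bullet> c \<le> (c \<bullet> (S *v c)) * norm (matrix_inv S)"
proof (cases "c = 0")
  case False
  define e where "e = matrix_inv S *v c"
  have Se: "S *v e = c" by (simp add: e_def matrix_vector_mul_assoc matrix_inv_right[OF inv])
  have "(c \<bullet> c) * (c \<bullet> c) \<le> (c \<bullet> (S *v c)) * (e \<bullet> c)"
    using pos_semidef_cauchy_schwarz[OF S, of c e] by (simp add: Se power2_eq_square)
  also have "e \<bullet> c \<le> norm e * norm c" by (rule norm_cauchy_schwarz)
  also have "\<dots> \<le> norm (matrix_inv S) * norm c * norm c"
    unfolding e_def by (intro mult_right_mono norm_matrix_vector_le) auto
  also have "\<dots> = norm (matrix_inv S) * (c \<bullet> c)" by (simp add: dot_square_norm power2_eq_square)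
  finally have "(c \<bullet> c) * (c \<bullet> c) \<le> (c \<bullet> (S *v c)) * norm (matrix_inv S) * (c \<bullet> c)"
    using S by (simp add: pos_semidef_def mult_left_mono mult.assoc)
  moreover have "0 < c \<bullet> c" using False by simp
  ultimately show ?thesis by (simp only: mult_le_cancel_right_pos)
qed simp

section \<open>The annihilator matrix\<close>

text \<open>Keeps index sets in the form \<open>{1..n}\<close>.\<close>

declare One_nat_def [simp del]

lemma gram_carrier [simp]: "gram n K w \<in> carrier_mat K K"
  by (simp add: gram_def)

section \<open>Inverses and determinants in varying dimension\<close>

lemma mat_inv_singular:
  assumes "A \<in> carrier_mat K K" "Determinant.det A = 0"
  shows "mat_inv A = 0\<^sub>m K K"
proof (cases "mat_inverse A")
  case None
  then show ?thesis using assms by (simp add: mat_inv_def)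
next
  case (Some B)
  from mat_inverse(2)[OF assms(1) Some] have "A * B = 1\<^sub>m K" "B \<in> carrier_mat K K" by auto
  then have "Determinant.det A * Determinant.det B = 1"
    using det_mult[OF assms(1), of B] by simp
  then show ?thesis using assms(2) by simp
qed

lemma mat_inv_nonsingular:
  assumes A: "A \<in> carrier_mat K K" and "Determinant.det A \<noteq> 0"
  shows "A * mat_inv A = 1\<^sub>m K" "mat_inv A * A = 1\<^sub>m K" "mat_inv A \<in> carrier_mat K K"
proof -
  have "mat_inverse A \<noteq> None"
    using mat_inverse(1)[OF A, where b = "()"] det_non_zero_imp_unit[OF A assms(2), where b = "()"] by blast
  then obtain B where "mat_inverse A = Some B" by blast
  with mat_inverse(2)[OF A this]
  show "A * mat_inv A = 1\<^sub>m K" "mat_inv A * A = 1\<^sub>m K" "mat_inv A \<in> carrier_mat K K"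
    by (auto simp: mat_inv_def)
qed

lemma mat_inv_carrier: "A \<in> carrier_mat K K \<Longrightarrow> mat_inv A \<in> carrier_mat K K"
  using mat_inv_singular[of A K] mat_inv_nonsingular(3)[of A K] by fastforce

text \<open>The adjugate formula makes the entries rational functions of those of A, which gives
  measurability on the nonsingular matrices; on the singular ones \<open>mat_inv\<close> is
  0.\<close>

lemma mat_inv_eq_adj:
  assumes A: "A \<in> carrier_mat K K" and d: "Determinant.det A \<noteq> 0" and k: "k < K" "l < K"
  shows "mat_inv A $$ (k, l) = cofactor A l k / Determinant.det A"
proof -
  note I = mat_inv_nonsingular[OF A d] and J = adj_mat[OF A]
  have "adj_mat A = (mat_inv A * A) * adj_mat A" using I J by simp
  also have "\<dots> = mat_inv A * (Determinant.det A \<cdot>\<^sub>m 1\<^sub>m K)"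
    using I(3) A J by (simp add: assoc_mult_mat[of _ K K _ K _ K])
  also have "\<dots> = Determinant.det A \<cdot>\<^sub>m mat_inv A"
    using I(3) by (simp add: mult_smult_distrib[of _ K K _ K])
  finally have "adj_mat A $$ (k, l) = Determinant.det A * mat_inv A $$ (k, l)" using I(3) k by simp
  then show ?thesis using A k d by (simp add: adj_mat_def field_simps)
qed

lemma borel_measurable_det:
  assumes "\<And>\<omega>. A \<omega> \<in> carrier_mat K K"
    and "\<And>k l. k < K \<Longrightarrow> l < K \<Longrightarrow> (\<lambda>\<omega>. A \<omega> $$ (k, l)) \<in> borel_measurable N"
  shows "(\<lambda>\<omega>. Determinant.det (A \<omega>) :: real) \<in> borel_measurable N"
proof -
  have "(\<lambda>\<omega>. \<Sum>p | p permutes {0..<K}. signof p * (\<Prod>i = 0..<K. A \<omega> $$ (i, p i))) \<in> borel_measurable N"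
    by (intro borel_measurable_sum borel_measurable_times borel_measurable_prod borel_measurable_const
        assms(2)) (auto dest: permutes_in_image)
  then show ?thesis by (simp add: det_def'[OF assms(1)])
qed

lemma borel_measurable_mat_inv_entry:
  fixes A :: "'a \<Rightarrow> real mat"
  assumes A: "\<And>\<omega>. A \<omega> \<in> carrier_mat K K"
    and m: "\<And>k l. k < K \<Longrightarrow> l < K \<Longrightarrow> (\<lambda>\<omega>. A \<omega> $$ (k, l)) \<in> borel_measurable N"
    and k: "k < K" "l < K"
  shows "(\<lambda>\<omega>. mat_inv (A \<omega>) $$ (k, l)) \<in> borel_measurable N"
proof -
  have "(\<lambda>\<omega>. Determinant.det (mat_delete (A \<omega>) l k)) \<in> borel_measurable N"
  proof (rule borel_measurable_det)
    show "mat_delete (A \<omega>) l k \<in> carrier_mat (K - 1) (K - 1)" for \<omega>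
      using A by (rule mat_delete_carrier)
    fix a b assume ab: "a < K - 1" "b < K - 1"
    have "mat_delete (A \<omega>) l k $$ (a, b) = A \<omega> $$ (if a < l then a else Suc a, if b < k then b else Suc b)" for \<omega>
      using A[of \<omega>] ab k by (simp add: mat_delete_def)
    then show "(\<lambda>\<omega>. mat_delete (A \<omega>) l k $$ (a, b)) \<in> borel_measurable N"
      using ab k by (simp add: m)
  qed
  then have "(\<lambda>\<omega>. cofactor (A \<omega>) l k / Determinant.det (A \<omega>)) \<in> borel_measurable N"
    unfolding cofactor_def using borel_measurable_det[OF A m] by measurable
  then have "(\<lambda>\<omega>. if Determinant.det (A \<omega>) = 0 then 0 else cofactor (A \<omega>) l k / Determinant.det (A \<omega>))
      \<in> borel_measurable N"
    using borel_measurable_det[OF A m] by measurable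
  moreover have "mat_inv (A \<omega>) $$ (k, l)
      = (if Determinant.det (A \<omega>) = 0 then 0 else cofactor (A \<omega>) l k / Determinant.det (A \<omega>))" for \<omega>
    using mat_inv_singular[OF A, of \<omega>] mat_inv_eq_adj[OF A _ k, of \<omega>] k by simp
  ultimately show ?thesis by simp
qed

lemma quadratic_form_mat_inv:
  assumes A: "A \<in> carrier_mat K K" and a: "a \<in> carrier_vec K" and b: "b \<in> carrier_vec K"
  shows "scalar_prod a (mat_inv A *\<^sub>v b) = (\<Sum>k<K. \<Sum>l<K. a $v k * mat_inv A $$ (k, l) * b $v l)"
  using mat_inv_carrier[OF A] a b
  by (auto simp: scalar_prod_def sum_distrib_left mult.assoc lessThan_atLeast0 intro!: sum.cong)

lemma annihilator_expand:
  assumes "w i \<in> carrier_vec K" "w j \<in> carrier_vec K"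
  shows "annihilator n K w i j =
    (if i = j then 1 else 0) - (\<Sum>k<K. \<Sum>l<K. w i $v k * mat_inv (gram n K w) $$ (k, l) * w j $v l)"
  unfolding annihilator_def by (simp add: quadratic_form_mat_inv[OF gram_carrier assms])

lemma borel_measurable_annihilator:
  assumes w: "\<And>i \<omega>. i \<in> {1..n} \<Longrightarrow> \<omega> \<in> space N \<Longrightarrow> w i \<omega> \<in> carrier_vec K"
    and m: "\<And>i l. i \<in> {1..n} \<Longrightarrow> l < K \<Longrightarrow> (\<lambda>\<omega>. w i \<omega> $v l) \<in> borel_measurable N"
    and i: "i \<in> {1..n}" "j \<in> {1..n}"
  shows "(\<lambda>\<omega>. annihilator n K (\<lambda>i. w i \<omega>) i j) \<in> borel_measurable N"
proof -
  have g: "(\<lambda>\<omega>. gram n K (\<lambda>i. w i \<omega>) $$ (k, l)) \<in> borel_measurable N" if "k < K" "l < K" for k l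
    using that by (simp add: gram_def) (intro borel_measurable_sum borel_measurable_times m)
  have "(\<lambda>\<omega>. (if i = j then 1 else 0) - (\<Sum>k<K. \<Sum>l<K. w i \<omega> $v k *
      mat_inv (gram n K (\<lambda>i. w i \<omega>)) $$ (k, l) * w j \<omega> $v l)) \<in> borel_measurable N"
    using i by (intro borel_measurable_diff borel_measurable_const borel_measurable_sum
        borel_measurable_times m borel_measurable_mat_inv_entry[OF gram_carrier g]) auto
  then show ?thesis
    by (rule measurable_cong[THEN iffD1, rotated])
      (rule annihilator_expand[where w = "\<lambda>i. w i _", symmetric], simp_all only: w i)
qed

text \<open>A singular matrix has the eigenvalue 0. Nonsingularity is the form in which the
  projection algebra uses the condition on the Gram matrix.\<close>

lemma mat_lambda_min_pos_det:
  assumes A: "A \<in> carrier_mat K K" and pos: "0 < mat_lambda_min A"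
  shows "Determinant.det A \<noteq> 0"
proof
  assume "Determinant.det A = 0"
  then obtain v where v: "v \<in> carrier_vec K" "v \<noteq> 0\<^sub>v K" "A *\<^sub>v v = 0\<^sub>v K"
    using det_0_iff_vec_prod_zero_field[OF A] by blast
  then have "eigenvector A v 0" using A by (auto simp: eigenvector_def)
  then have "0 \<in> spectrum A" by (auto simp: spectrum_def eigenvalue_def)
  then have "Min (spectrum A) \<le> 0" using card_finite_spectrum(1)[OF A] by (intro Min_le)
  then show False using pos by (simp add: mat_lambda_min_def)
qed

section \<open>The projection off the design\<close>

text \<open>The locale is deterministic; it gets interpreted at single outcomes whose Gram matrix is
  nonsingular.\<close>

locale full_rank_design =
  fixes n K :: nat and w :: "nat \<Rightarrow> real vec"
  assumes w_carrier: "i \<in> {1..n} \<Longrightarrow> w i \<in> carrier_vec K"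
    and det_gram: "Determinant.det (gram n K w) \<noteq> 0"
begin

abbreviation "P \<equiv> \<lambda>k l. mat_inv (gram n K w) $$ (k, l)"
abbreviation "A \<equiv> annihilator n K w"

lemma gram_entry: "k < K \<Longrightarrow> l < K \<Longrightarrow> gram n K w $$ (k, l) = (\<Sum>i=1..n. w i $v k * w i $v l)"
  by (simp add: gram_def)

lemma P_gram:
  assumes "k < K" "m < K"
  shows "(\<Sum>l<K. P k l * (\<Sum>j=1..n. w j $v l * w j $v m)) = (if k = m then 1 else 0)"
proof -
  note I = mat_inv_nonsingular[OF gram_carrier det_gram]
  have "(mat_inv (gram n K w) * gram n K w) $$ (k, m) = (\<Sum>l<K. P k l * gram n K w $$ (l, m))"
    using assms I(3) carrier_matD[OF gram_carrier, of n K w]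
    by (auto simp: scalar_prod_def lessThan_atLeast0 intro!: sum.cong)
  then show ?thesis using assms by (simp add: I(2) gram_entry)
qed

lemma P_sym:
  assumes "k < K" "l < K"
  shows "P k l = P l k"
proof -
  let ?G = "gram n K w"
  let ?I = "mat_inv ?G"
  note I = mat_inv_nonsingular[OF gram_carrier det_gram]
  have G: "transpose_mat ?G = ?G" by (rule eq_matI) (auto simp: gram_def mult.commute)
  have "transpose_mat ?I * ?G = transpose_mat (?G * ?I)"
    using transpose_mult[OF gram_carrier I(3)] G by simp
  then have "transpose_mat ?I * ?G = 1\<^sub>m K" using I by simp
  then have "(transpose_mat ?I * ?G) * ?I = ?I" using I by simp
  moreover have "(transpose_mat ?I * ?G) * ?I = transpose_mat ?I"
    using I by (simp add: assoc_mult_mat[of _ K K _ K _ K])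
  ultimately have "transpose_mat ?I = ?I" by simp
  from arg_cong[OF this, of "\<lambda>B. B $$ (l, k)"] show ?thesis using assms I(3) by simp
qed

text \<open>In matrix form, with rows w_i' in W: M W = W - W (W'W)^-1 (W'W) = 0.\<close>

lemma annihilator_kills_design:
  assumes "i \<in> {1..n}" "m < K"
  shows "(\<Sum>j=1..n. A i j * w j $v m) = 0"
proof -
  have "(\<Sum>j=1..n. A i j * w j $v m)
      = (\<Sum>j=1..n. (if i = j then w j $v m else 0)) -
        (\<Sum>j=1..n. \<Sum>k<K. \<Sum>l<K. w i $v k * (P k l * (w j $v l * w j $v m)))"
    using assms w_carrier
    by (simp add: annihilator_expand left_diff_distrib sum_subtractf sum_distrib_right mult.assoc
        if_distrib[of "\<lambda>z. z * _"] cong: if_cong)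
  also have "(\<Sum>j=1..n. \<Sum>k<K. \<Sum>l<K. w i $v k * (P k l * (w j $v l * w j $v m)))
      = (\<Sum>k<K. \<Sum>j=1..n. \<Sum>l<K. w i $v k * (P k l * (w j $v l * w j $v m)))"
    by (rule sum.swap)
  also have "\<dots> = (\<Sum>k<K. \<Sum>l<K. \<Sum>j=1..n. w i $v k * (P k l * (w j $v l * w j $v m)))"
    by (intro sum.cong sum.swap refl)
  also have "\<dots> = (\<Sum>k<K. w i $v k * (\<Sum>l<K. P k l * (\<Sum>j=1..n. w j $v l * w j $v m)))"
    by (simp add: sum_distrib_left)
  also have "\<dots> = (\<Sum>k<K. w i $v k * (if k = m then 1 else 0))"
    using assms by (intro sum.cong refl) (simp only: P_gram lessThan_iff)
  finally show ?thesis using assms by (simp add: if_distrib cong: if_cong)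
qed

lemma annihilator_sym:
  assumes "i \<in> {1..n}" "j \<in> {1..n}"
  shows "A i j = A j i"
proof -
  have "(\<Sum>k<K. \<Sum>l<K. w i $v k * P k l * w j $v l) = (\<Sum>k<K. \<Sum>l<K. w j $v k * P k l * w i $v l)"
    by (subst sum.swap) (auto intro!: sum.cong simp: P_sym)
  then show ?thesis using assms by (simp add: annihilator_expand w_carrier)
qed

text \<open>Expanding only the second factor of M M leaves M minus a product that contains M W,
  which is 0.\<close>

lemma annihilator_idempotent:
  assumes "i \<in> {1..n}" "j \<in> {1..n}"
  shows "(\<Sum>k=1..n. A i k * A k j) = A i j"
proof -
  have "(\<Sum>k=1..n. A i k * A k j)
      = (\<Sum>k=1..n. (if k = j then A i k else 0)) -
        (\<Sum>k=1..n. \<Sum>a<K. \<Sum>b<K. A i k * w k $v a * (P a b * w j $v b))"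
    using assms w_carrier
    by (simp add: annihilator_expand[of w _ K j] right_diff_distrib sum_subtractf sum_distrib_left mult.assoc
        if_distrib[of "\<lambda>z. _ * z"] cong: if_cong)
  also have "(\<Sum>k=1..n. \<Sum>a<K. \<Sum>b<K. A i k * w k $v a * (P a b * w j $v b))
      = (\<Sum>a<K. \<Sum>k=1..n. \<Sum>b<K. A i k * w k $v a * (P a b * w j $v b))"
    by (rule sum.swap)
  also have "\<dots> = (\<Sum>a<K. \<Sum>b<K. (\<Sum>k=1..n. A i k * w k $v a) * (P a b * w j $v b))"
  proof (rule sum.cong[OF refl])
    fix a
    show "(\<Sum>k=1..n. \<Sum>b<K. A i k * w k $v a * (P a b * w j $v b))
        = (\<Sum>b<K. (\<Sum>k=1..n. A i k * w k $v a) * (P a b * w j $v b))"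
      by (subst sum.swap) (simp only: sum_distrib_right)
  qed
  also have "\<dots> = 0" using assms by (simp add: annihilator_kills_design)
  finally show ?thesis using assms by simp
qed

text \<open>This is M' M = M, which follows from symmetry and idempotence.\<close>

lemma residual_orthogonal:
  fixes a b :: "nat \<Rightarrow> real"
  shows "(\<Sum>i=1..n. (\<Sum>j=1..n. A i j * a j) * (\<Sum>j=1..n. A i j * b j))
    = (\<Sum>i=1..n. (\<Sum>j=1..n. A i j * a j) * b i)"
proof -
  have "(\<Sum>i=1..n. (\<Sum>j=1..n. A i j * a j) * (\<Sum>j=1..n. A i j * b j))
      = (\<Sum>i=1..n. \<Sum>j=1..n. \<Sum>k=1..n. A i k * A i j * (a k * b j))"
    by (simp add: sum_distrib_left sum_distrib_right mult_ac)
  also have "\<dots> = (\<Sum>j=1..n. \<Sum>k=1..n. \<Sum>i=1..n. A i k * A i j * (a k * b j))"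
  proof -
    have "(\<Sum>i=1..n. \<Sum>j=1..n. \<Sum>k=1..n. A i k * A i j * (a k * b j))
        = (\<Sum>j=1..n. \<Sum>i=1..n. \<Sum>k=1..n. A i k * A i j * (a k * b j))"
      by (rule sum.swap)
    also have "\<dots> = (\<Sum>j=1..n. \<Sum>k=1..n. \<Sum>i=1..n. A i k * A i j * (a k * b j))"
      by (rule sum.cong[OF refl]) (rule sum.swap)
    finally show ?thesis .
  qed
  also have "\<dots> = (\<Sum>j=1..n. \<Sum>k=1..n. (\<Sum>i=1..n. A j i * A i k) * (a k * b j))"
  proof -
    have "(\<Sum>i=1..n. A i k * A i j * (a k * b j)) = (\<Sum>i=1..n. A j i * A i k) * (a k * b j)"
      if "j \<in> {1..n}" for j k
      unfolding sum_distrib_right by (rule sum.cong) (use that in \<open>simp_all add: annihilator_sym[of j] mult.commute\<close>)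
    then show ?thesis by (intro sum.cong refl) blast
  qed
  also have "\<dots> = (\<Sum>i=1..n. (\<Sum>j=1..n. A i j * a j) * b i)"
    by (simp add: annihilator_idempotent sum_distrib_right mult.assoc)
  finally show ?thesis .
qed

lemma residual_component: "residual n K w z i $ p = (\<Sum>j=1..n. A i j * z j $ p)"
  by (simp add: residual_def)

lemma sum_outer_residual:
  fixes z z' :: "nat \<Rightarrow> real^'d"
  shows "(\<Sum>i=1..n. outer (residual n K w z i) (residual n K w z' i))
    = (\<Sum>i=1..n. outer (residual n K w z i) (z' i))"
  by (simp add: Finite_Cartesian_Product.vec_eq_iff outer_def residual_component residual_orthogonal
      del: One_nat_def)

text \<open>M annihilates every linear combination of the controls. Hence \<open>v_pop\<close> may
  replace x under the residuals.\<close>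

lemma residual_design_combination:
  fixes z :: "nat \<Rightarrow> real^'d"
  assumes "\<And>j p. j \<in> {1..n} \<Longrightarrow> z j $ p = z' j $ p + (\<Sum>l<K. L p l * w j $v l)" and i: "i \<in> {1..n}"
  shows "residual n K w z i = residual n K w z' i"
proof -
  have "(\<Sum>j=1..n. A i j * (\<Sum>l<K. L p l * w j $v l)) = 0" for p
  proof -
    have "(\<Sum>j=1..n. A i j * (\<Sum>l<K. L p l * w j $v l)) = (\<Sum>l<K. L p l * (\<Sum>j=1..n. A i j * w j $v l))"
      by (simp only: sum_distrib_left mult.left_commute[of "A i _"]) (rule sum.swap)
    then show ?thesis using i by (simp add: annihilator_kills_design)
  qed
  then show ?thesis
    by (simp add: Finite_Cartesian_Product.vec_eq_iff residual_component assms(1) distrib_left sum.distrib)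
qed

text \<open>The transposed identity W' M = 0. It removes the term of the controls from the
  estimator.\<close>

lemma residual_kills_design: "l < K \<Longrightarrow> (\<Sum>i=1..n. w i $v l *\<^sub>R residual n K w (z :: nat \<Rightarrow> real^'d) i) = 0"
proof -
  assume l: "l < K"
  have "(\<Sum>i=1..n. w i $v l * (\<Sum>j=1..n. A i j * z j $ p)) = 0" for p
  proof -
    have "(\<Sum>i=1..n. w i $v l * (\<Sum>j=1..n. A i j * z j $ p))
        = (\<Sum>j=1..n. \<Sum>i=1..n. w i $v l * (A i j * z j $ p))"
      by (simp only: sum_distrib_left) (rule sum.swap)
    also have "\<dots> = (\<Sum>j=1..n. z j $ p * (\<Sum>i=1..n. A j i * w i $v l))"
      by (auto intro!: sum.cong simp: sum_distrib_left annihilator_sym)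
    also have "\<dots> = 0" using l by (simp add: annihilator_kills_design)
    finally show ?thesis .
  qed
  then show ?thesis by (simp add: Finite_Cartesian_Product.vec_eq_iff residual_component)
qed

text \<open>Pythagoras: residuals have the same inner product with z as with themselves, so the gap
  is the sum of |z_i - r_i|^2.\<close>

lemma sum_norm_residual_le:
  fixes z :: "nat \<Rightarrow> real^'d"
  shows "(\<Sum>i=1..n. (norm (residual n K w z i))\<^sup>2) \<le> (\<Sum>i=1..n. (norm (z i))\<^sup>2)"
proof -
  let ?r = "residual n K w z"
  have orth: "(\<Sum>i=1..n. ?r i \<bullet> ?r i) = (\<Sum>i=1..n. ?r i \<bullet> z i)"
    unfolding inner_vec_def
    by (subst (1 2) sum.swap) (simp add: residual_component residual_orthogonal del: One_nat_def)
  have "0 \<le> (\<Sum>i=1..n. (norm (z i - ?r i))\<^sup>2)" by (intro sum_nonneg) simp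
  also have "\<dots> = (\<Sum>i=1..n. (norm (z i))\<^sup>2) - (\<Sum>i=1..n. ?r i \<bullet> z i) - (\<Sum>i=1..n. ?r i \<bullet> z i)
      + (\<Sum>i=1..n. ?r i \<bullet> ?r i)"
    by (simp add: power2_norm_eq_inner inner_diff_left inner_diff_right sum_subtractf sum.distrib
        inner_commute sum_distrib_left[symmetric])
  finally show ?thesis by (simp add: orth power2_norm_eq_inner)
qed

end

section \<open>Characteristic functions and convergence in distribution\<close>

definition normal_kernel :: "real^'d \<Rightarrow> real" where
  "normal_kernel z = (\<Prod>a\<in>UNIV. std_normal_density (z $ a))"

lemma std_normal_eq: "std_normal = density lborel (\<lambda>z. ennreal (normal_kernel z))"
  by (simp add: std_normal_def normal_kernel_def)

lemma normal_kernel_nonneg: "0 \<le> normal_kernel z"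
  unfolding normal_kernel_def by (intro prod_nonneg) simp

lemma axis_bij_Basis: "bij_betw (\<lambda>a. axis a (1::real)) (UNIV :: 'd::finite set) Basis"
  by (auto simp: bij_betw_def inj_on_def axis_eq_axis Basis_vec_def)

lemma prod_components:
  fixes z :: "real^'d"
  shows "(\<Prod>a\<in>UNIV. g (z $ a)) = (\<Prod>b\<in>Basis. g (z \<bullet> b))"
  by (subst prod.reindex_bij_betw[OF axis_bij_Basis, symmetric]) (simp add: inner_axis)

lemma normal_kernel_Basis: "normal_kernel (z :: real^'d) = (\<Prod>b\<in>Basis. std_normal_density (z \<bullet> b))"
  unfolding normal_kernel_def by (rule prod_components)

lemma continuous_on_normal_kernel: "continuous_on S (normal_kernel :: real^'d \<Rightarrow> real)"
  unfolding normal_kernel_def std_normal_density_def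
  by (intro continuous_intros continuous_on_component) auto

lemma borel_measurable_normal_kernel [measurable]: "(normal_kernel :: real^'d \<Rightarrow> real) \<in> borel_measurable borel"
  by (intro borel_measurable_continuous_onI continuous_on_normal_kernel)

lemma space_std_normal [simp]: "space std_normal = UNIV"
  and sets_std_normal [simp, measurable_cong]: "sets std_normal = sets borel"
  by (simp_all add: std_normal_eq)

lemma prob_space_std_normal: "prob_space (std_normal :: (real^'d) measure)"
proof
  interpret N: prob_space "density lborel std_normal_density" by (rule prob_space_normal_density) simp
  have one: "(\<integral>\<^sup>+x. ennreal (std_normal_density x) \<partial>lborel) = 1"
    using N.emeasure_space_1 by (simp add: emeasure_density)
  have "emeasure (std_normal :: (real^'d) measure) (space std_normal)
      = (\<integral>\<^sup>+z. (\<Prod>b\<in>Basis. ennreal (std_normal_density (z \<bullet> b))) \<partial>(lborel :: (real^'d) measure))"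
    by (simp add: std_normal_eq emeasure_density normal_kernel_Basis prod_ennreal)
  also have "\<dots> = 1" by (subst nn_integral_lborel_prod) (simp_all add: one)
  finally show "emeasure (std_normal :: (real^'d) measure) (space std_normal) = 1" .
qed

lemma integral_std_normal:
  fixes f :: "real^'d \<Rightarrow> 'b::{banach, second_countable_topology}"
  assumes [measurable]: "f \<in> borel_measurable borel"
  shows "(\<integral>z. f z \<partial>std_normal) = (\<integral>z. normal_kernel z *\<^sub>R f z \<partial>lborel)"
  unfolding std_normal_eq by (rule integral_density) (auto simp: normal_kernel_nonneg)

lemma iexp_sum: "finite A \<Longrightarrow> iexp (\<Sum>b\<in>A. g b) = (\<Prod>b\<in>A. iexp (g b))"
  by (simp add: sum_distrib_left exp_sum)

text \<open>\<open>lborel\<close> is the image of a product of one-dimensional Lebesgue measures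
  under the basis expansion, so the integral factors into one-dimensional Gaussian characteristic
  functions.\<close>

lemma char_std_normal:
  "(\<integral>z. iexp (t \<bullet> z) \<partial>std_normal) = complex_of_real (exp (- ((norm (t :: real^'d))\<^sup>2) / 2))"
proof -
  interpret L: product_sigma_finite "\<lambda>_ :: real^'d. lborel :: real measure"
    by standard
  let ?h = "\<lambda>b x. std_normal_density x *\<^sub>R iexp ((t \<bullet> b) * x)"
  have "(\<integral>x. ?h b x \<partial>lborel) = char std_normal_distribution (t \<bullet> b)" for b
    unfolding char_def by (subst integral_density) (auto simp: std_normal_density_def)
  then have one: "(\<integral>x. ?h b x \<partial>lborel) = complex_of_real (exp (- (t \<bullet> b)\<^sup>2 / 2))" for b
    by (simp add: char_std_normal_distribution)
  have int: "integrable lborel (?h b)" for b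
  proof (rule Bochner_Integration.integrable_bound)
    show "integrable lborel std_normal_density" by simp
  qed (auto simp: norm_mult)
  have "(\<integral>z. iexp (t \<bullet> z) \<partial>std_normal) = (\<integral>z. (\<Prod>b\<in>Basis. ?h b (z \<bullet> b)) \<partial>lborel)"
  proof (subst integral_std_normal)
    have "iexp (t \<bullet> z) = (\<Prod>b\<in>Basis. iexp ((t \<bullet> b) * (z \<bullet> b)))" for z
      unfolding euclidean_inner[of t z] by (rule iexp_sum) simp
    then show "(\<integral>z. normal_kernel z *\<^sub>R iexp (t \<bullet> z) \<partial>lborel) = (\<integral>z. (\<Prod>b\<in>Basis. ?h b (z \<bullet> b)) \<partial>lborel)"
      by (simp only: normal_kernel_Basis scaleR_conv_of_real prod.distrib of_real_prod)
  qed simp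
  also have "\<dots> = (\<integral>f. (\<Prod>b\<in>Basis. ?h b ((\<Sum>c\<in>Basis. f c *\<^sub>R c) \<bullet> b)) \<partial>(\<Pi>\<^sub>M b\<in>(Basis :: (real^'d) set). lborel))"
  proof -
    define F where "F = (\<lambda>z :: real^'d. (\<Prod>b\<in>Basis. ?h b (z \<bullet> b)))"
    let ?P = "\<Pi>\<^sub>M b\<in>(Basis :: (real^'d) set). (lborel :: real measure)"
    let ?s = "\<lambda>f. \<Sum>b\<in>(Basis :: (real^'d) set). f b *\<^sub>R b"
    have "integral\<^sup>L lborel F = integral\<^sup>L (distr ?P borel ?s) F"
      by (rule arg_cong[OF lborel_eq, where f = "\<lambda>m. integral\<^sup>L m F"])
    also have "\<dots> = (\<integral>f. F (?s f) \<partial>?P)"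
      unfolding F_def by (rule integral_distr) measurable
    finally show ?thesis unfolding F_def .
  qed
  also have "\<dots> = (\<integral>f. (\<Prod>b\<in>Basis. ?h b (f b)) \<partial>(\<Pi>\<^sub>M b\<in>(Basis :: (real^'d) set). lborel))"
    by (intro Bochner_Integration.integral_cong refl prod.cong) (simp_all add: inner_sum_left_Basis)
  also have "\<dots> = (\<Prod>b\<in>Basis. (\<integral>x. ?h b x \<partial>lborel))"
    by (intro L.product_integral_prod int) simp
  also have "\<dots> = (\<Prod>b\<in>Basis. complex_of_real (exp (- (t \<bullet> b)\<^sup>2 / 2)))" by (simp only: one)
  also have "\<dots> = complex_of_real (exp (\<Sum>b\<in>Basis. - (t \<bullet> b)\<^sup>2 / 2))"
    by (simp only: exp_sum[OF finite_Basis] of_real_prod)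
  also have "(\<Sum>b\<in>Basis. - (t \<bullet> b)\<^sup>2 / 2) = - ((norm t)\<^sup>2) / 2"
    unfolding power2_norm_eq_inner
    by (subst (2) euclidean_inner) (simp add: sum_negf sum_divide_distrib[symmetric] power2_eq_square)
  finally show ?thesis .
qed

text \<open>Up to a constant the Gaussian density is its own Fourier transform. This takes the place
  of a general inversion formula.\<close>

lemma normal_kernel_char:
  "complex_of_real (normal_kernel (v :: real^'d)) = of_real (normal_kernel (0::real^'d)) * (\<integral>z. iexp (v \<bullet> z) \<partial>std_normal)"
proof -
  have "normal_kernel v = normal_kernel (0::real^'d) * exp (- ((norm v)\<^sup>2) / 2)"
  proof -
    have "normal_kernel v = (\<Prod>b\<in>(Basis :: (real^'d) set). (1 / sqrt (2 * pi)) * exp (- (v \<bullet> b)\<^sup>2 / 2))"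
      by (simp add: normal_kernel_Basis std_normal_density_def)
    also have "\<dots> = (\<Prod>b\<in>(Basis :: (real^'d) set). 1 / sqrt (2 * pi)) * exp (\<Sum>b\<in>Basis. - (v \<bullet> b)\<^sup>2 / 2)"
      by (simp only: prod.distrib exp_sum[OF finite_Basis])
    also have "(\<Sum>b\<in>Basis. - (v \<bullet> b)\<^sup>2 / 2) = - ((norm v)\<^sup>2) / 2"
      unfolding power2_norm_eq_inner
      by (subst (2) euclidean_inner) (simp add: sum_negf sum_divide_distrib[symmetric] power2_eq_square)
    also have "(\<Prod>b\<in>(Basis :: (real^'d) set). 1 / sqrt (2 * pi)) = normal_kernel (0::real^'d)"
      by (simp add: normal_kernel_Basis std_normal_density_def)
    finally show ?thesis by simp
  qed
  then show ?thesis by (simp add: char_std_normal)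
qed

text \<open>In the formula above the integral has modulus at most 1. The bound supplies dominating
  functions below.\<close>

lemma normal_kernel_le: "normal_kernel (v :: real^'d) \<le> normal_kernel (0::real^'d)"
proof -
  interpret prob_space "std_normal :: (real^'d) measure" by (rule prob_space_std_normal)
  have "norm (\<integral>z. iexp (v \<bullet> z) \<partial>std_normal) \<le> (\<integral>z. norm (iexp (v \<bullet> z)) \<partial>std_normal)"
    by (rule integral_norm_bound)
  then have "norm (\<integral>z. iexp (v \<bullet> z) \<partial>std_normal) \<le> 1" by (simp add: prob_space[simplified])
  then have "norm (complex_of_real (normal_kernel v)) \<le> normal_kernel (0::real^'d) * 1"
    unfolding normal_kernel_char[of v] norm_mult
    by (intro mult_mono) (auto simp: normal_kernel_nonneg)
  then show ?thesis using normal_kernel_nonneg[of v] by simp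
qed

section \<open>Gaussian smoothing of a law\<close>

context
  fixes N :: "'a measure" and Z :: "'a \<Rightarrow> real^'d" and s :: real
  assumes N: "prob_space N" and Z [measurable]: "Z \<in> borel_measurable N" and s: "0 < s"
begin

interpretation N: prob_space N by (rule N)
interpretation G: prob_space "std_normal :: (real^'d) measure" by (rule prob_space_std_normal)
interpretation NG: pair_prob_space N "std_normal :: (real^'d) measure" by standard
interpretation NL: pair_sigma_finite N "lborel :: (real^'d) measure" by standard

text \<open>Up to the factor s to the power d, the left side is the density at y of Z plus s times
  an independent standard normal vector. The kernel is a Gaussian average of exponentials, and
  exchanging the integrals brings in the characteristic function of Z.\<close>

lemma smoothed_density:
  "complex_of_real (\<integral>\<omega>. normal_kernel ((1 / s) *\<^sub>R (y - Z \<omega>)) \<partial>N)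
     = of_real (normal_kernel (0::real^'d)) *
       (\<integral>z. iexp (((1 / s) *\<^sub>R y) \<bullet> z) * (\<integral>\<omega>. iexp ((- (1 / s) *\<^sub>R z) \<bullet> Z \<omega>) \<partial>N) \<partial>std_normal)"
proof -
  let ?e = "\<lambda>\<omega> z. iexp (((1 / s) *\<^sub>R y) \<bullet> z) * iexp ((- (1 / s) *\<^sub>R z) \<bullet> Z \<omega>)"
  have "complex_of_real (\<integral>\<omega>. normal_kernel ((1 / s) *\<^sub>R (y - Z \<omega>)) \<partial>N)
      = (\<integral>\<omega>. complex_of_real (normal_kernel ((1 / s) *\<^sub>R (y - Z \<omega>))) \<partial>N)"
    by (rule integral_complex_of_real[symmetric])
  also have "\<dots> = (\<integral>\<omega>. of_real (normal_kernel (0::real^'d)) * (\<integral>z. iexp (((1 / s) *\<^sub>R (y - Z \<omega>)) \<bullet> z) \<partial>std_normal) \<partial>N)"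
    by (intro Bochner_Integration.integral_cong refl) (rule normal_kernel_char)
  also have "\<dots> = of_real (normal_kernel (0::real^'d)) * (\<integral>\<omega>. (\<integral>z. ?e \<omega> z \<partial>std_normal) \<partial>N)"
    by (simp add: exp_add[symmetric] inner_diff_left inner_commute algebra_simps diff_divide_distrib)
  also have "(\<integral>\<omega>. (\<integral>z. ?e \<omega> z \<partial>std_normal) \<partial>N) = (\<integral>z. (\<integral>\<omega>. ?e \<omega> z \<partial>N) \<partial>std_normal)"
  proof -
    have "(\<lambda>p. ?e (fst p) (snd p)) \<in> borel_measurable (N \<Otimes>\<^sub>M std_normal)" by measurable
    then have "integrable (N \<Otimes>\<^sub>M std_normal) (\<lambda>p. ?e (fst p) (snd p))"
      by (intro NG.P.integrable_const_bound[of _ 1]) (auto simp: norm_mult)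
    then have "integrable (N \<Otimes>\<^sub>M std_normal) (case_prod ?e)" by (simp add: split_beta')
    from NG.Fubini_integral[OF this] show ?thesis by simp
  qed
  finally show ?thesis by simp
qed

lemma normal_smoothing:
  fixes f :: "real^'d \<Rightarrow> real"
  assumes [measurable]: "f \<in> borel_measurable borel"
  shows "(\<integral>z. f (x + s *\<^sub>R z) \<partial>std_normal)
    = (\<integral>y. f y * normal_kernel ((1 / s) *\<^sub>R (y - x)) \<partial>lborel) / s ^ DIM(real^'d)"
proof -
  have "(\<integral>y. f y * normal_kernel ((1 / s) *\<^sub>R (y - x)) \<partial>lborel)
      = (\<integral>y. f y * normal_kernel ((1 / s) *\<^sub>R (y - x)) \<partial>density (distr lborel borel (\<lambda>y. x + s *\<^sub>R y)) (\<lambda>_. \<bar>s\<bar> ^ DIM(real^'d)))"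
    using s by (subst lborel_affine[of s x]) simp_all
  also have "\<dots> = (\<integral>z. s ^ DIM(real^'d) * (f (x + s *\<^sub>R z) * normal_kernel z) \<partial>lborel)"
    using s by (subst integral_density, simp, simp, simp, subst integral_distr) simp_all
  also have "\<dots> = s ^ DIM(real^'d) * (\<integral>z. f (x + s *\<^sub>R z) \<partial>std_normal)"
    by (simp add: integral_std_normal mult.commute)
  finally show ?thesis using s by simp
qed

text \<open>Integrates f against the density of the smoothed law. Lebesgue integrability of f
  justifies the exchange of integrals, which is why compactly supported f come first.\<close>

lemma smoothed_expectation:
  fixes f :: "real^'d \<Rightarrow> real"
  assumes f: "integrable lborel f"
  shows "(\<integral>\<omega>. (\<integral>z. f (Z \<omega> + s *\<^sub>R z) \<partial>std_normal) \<partial>N)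
    = (\<integral>y. f y * (\<integral>\<omega>. normal_kernel ((1 / s) *\<^sub>R (y - Z \<omega>)) \<partial>N) \<partial>lborel) / s ^ DIM(real^'d)"
proof -
  have [measurable]: "f \<in> borel_measurable borel" using f by auto
  let ?e = "\<lambda>\<omega> y. f y * normal_kernel ((1 / s) *\<^sub>R (y - Z \<omega>))"
  have "integrable (N \<Otimes>\<^sub>M lborel) (\<lambda>(\<omega>, y). f y)"
  proof (rule NL.Fubini_integrable)
    show "integrable N (\<lambda>x. \<integral>y. norm (case (x, y) of (\<omega>, y) \<Rightarrow> f y) \<partial>lborel)" by simp
  qed (use f in auto)
  then have "integrable (N \<Otimes>\<^sub>M lborel) (\<lambda>z. normal_kernel (0::real^'d) * (case z of (\<omega>, y) \<Rightarrow> f y))"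
    by (rule integrable_mult_right)
  then have "integrable (N \<Otimes>\<^sub>M lborel) (case_prod ?e)"
  proof (rule Bochner_Integration.integrable_bound)
    show "AE p in N \<Otimes>\<^sub>M lborel. norm (case_prod ?e p) \<le> norm (normal_kernel (0::real^'d) * (case p of (\<omega>, y) \<Rightarrow> f y))"
    proof (rule AE_I2)
      fix p :: "'a \<times> (real^'d)"
      have "normal_kernel ((1 / s) *\<^sub>R (snd p - Z (fst p))) * \<bar>f (snd p)\<bar> \<le> normal_kernel (0::real^'d) * \<bar>f (snd p)\<bar>"
        by (intro mult_right_mono normal_kernel_le) simp
      then show "norm (case_prod ?e p) \<le> norm (normal_kernel (0::real^'d) * (case p of (\<omega>, y) \<Rightarrow> f y))"
        by (simp add: split_beta' abs_mult normal_kernel_nonneg mult.commute)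
    qed
  qed measurable
  from NL.Fubini_integral[OF this] show ?thesis
    by (simp add: normal_smoothing)
qed

end

lemma std_normal_tail:
  assumes "0 < e"
  obtains R where "0 < R" "measure (std_normal :: (real^'d) measure) {z. R < norm z} < e"
proof -
  interpret prob_space "std_normal :: (real^'d) measure" by (rule prob_space_std_normal)
  have "(\<lambda>k. prob {z. real k < norm z}) \<longlonglongrightarrow> prob (\<Inter>k. {z. real k < norm z})"
    by (rule finite_Lim_measure_decseq) (auto simp: decseq_def)
  moreover have "(\<Inter>k. {z::real^'d. real k < norm z}) = {}"
    by auto (meson real_arch_simple not_less)
  ultimately have "(\<lambda>k. prob {z. real k < norm z}) \<longlonglongrightarrow> 0" by simp
  then have "\<forall>\<^sub>F k in sequentially. prob {z. real k < norm z} < e" using assms by (rule order_tendstoD)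
  then have "\<forall>\<^sub>F k in sequentially. prob {z. real k < norm z} < e \<and> 0 < k"
    using eventually_gt_at_top by (rule eventually_conj)
  then obtain k where "prob {z. real k < norm z} < e" "0 < k" using eventually_happens by fastforce
  then show thesis using that[of "real k"] by simp
qed

lemma normal_smoothing_close:
  fixes f :: "real^'d \<Rightarrow> real"
  assumes uc: "uniformly_continuous_on UNIV f" and B: "\<And>x. \<bar>f x\<bar> \<le> B" and e: "0 < e"
  obtains s where "0 < s" "\<And>x. \<bar>(\<integral>z. f (x + s *\<^sub>R z) \<partial>std_normal) - f x\<bar> \<le> e"
proof -
  interpret prob_space "std_normal :: (real^'d) measure" by (rule prob_space_std_normal)
  have [measurable]: "f \<in> borel_measurable borel"
    using uniformly_continuous_imp_continuous[OF uc] by (rule borel_measurable_continuous_onI)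
  have B0: "0 \<le> B" using B[of 0] by linarith
  obtain \<delta> where \<delta>: "0 < \<delta>" "\<And>x y. dist x y < \<delta> \<Longrightarrow> dist (f x) (f y) < e / 2"
    using uc e unfolding uniformly_continuous_on_def by (metis UNIV_I dist_commute half_gt_zero)
  \<comment> \<open>With this tail the part |z| > R contributes at most 2 B e / (4 (B + 1)) <= e /
    2.\<close>
  obtain R where R: "0 < R" "prob {z. R < norm z} < e / (4 * (B + 1))"
    using std_normal_tail[of "e / (4 * (B + 1))"] e B0 by auto
  \<comment> \<open>For |z| <= R the shift s |z| is then at most \<delta> / 2.\<close>
  define s where "s = \<delta> / (2 * R)"
  have s: "0 < s" using \<delta> R by (simp add: s_def)
  have "\<bar>(\<integral>z. f (x + s *\<^sub>R z) \<partial>std_normal) - f x\<bar> \<le> e" for x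
  proof -
    have int: "integrable std_normal (\<lambda>z. f (x + s *\<^sub>R z))"
      by (rule integrable_const_bound[of _ B]) (auto simp: B)
    have pt: "\<bar>f (x + s *\<^sub>R z) - f x\<bar> \<le> e / 2 + 2 * B * indicator {z::real^'d. R < norm z} z" for z
    proof (cases "R < norm z")
      case True
      have "\<bar>f (x + s *\<^sub>R z) - f x\<bar> \<le> 2 * B" using B[of x] B[of "x + s *\<^sub>R z"] by linarith
      then show ?thesis using True e by simp
    next
      case False
      have "dist (x + s *\<^sub>R z) x = s * norm z" using s by (simp add: dist_norm)
      also have "\<dots> \<le> s * R" using False s by (intro mult_left_mono) auto
      also have "\<dots> < \<delta>" using R \<delta> by (simp add: s_def)
      finally show ?thesis using \<delta>(2)[of "x + s *\<^sub>R z" x] False by (simp add: dist_real_def)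
    qed
    have "\<bar>(\<integral>z. f (x + s *\<^sub>R z) \<partial>std_normal) - f x\<bar> = \<bar>\<integral>z. f (x + s *\<^sub>R z) - f x \<partial>std_normal\<bar>"
      using int by (simp add: prob_space[simplified])
    also have "\<dots> \<le> (\<integral>z. \<bar>f (x + s *\<^sub>R z) - f x\<bar> \<partial>std_normal)" by (rule integral_abs_bound)
    also have "\<dots> \<le> (\<integral>z. e / 2 + 2 * B * indicator {z::real^'d. R < norm z} z \<partial>std_normal)"
    proof (rule Bochner_Integration.integral_mono)
      show "integrable std_normal (\<lambda>z. e / 2 + 2 * B * indicator {z::real^'d. R < norm z} z)"
        by (intro Bochner_Integration.integrable_add integrable_const integrable_mult_right
            integrable_real_indicator) (auto simp: emeasure_eq_measure)
    qed (use int pt in auto)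
    also have "\<dots> = e / 2 + 2 * B * prob {z. R < norm z}"
      by (subst Bochner_Integration.integral_add) (auto simp: emeasure_eq_measure prob_space[simplified])
    also have "\<dots> \<le> e / 2 + 2 * B * (e / (4 * (B + 1)))"
      using R B0 by (intro add_left_mono mult_left_mono) auto
    also have "\<dots> \<le> e" using B0 e by (simp add: field_simps)
    finally show ?thesis .
  qed
  then show thesis using s that by blast
qed

section \<open>Weak convergence from characteristic functions\<close>

locale char_convergence =
  fixes M :: "nat \<Rightarrow> 'a measure" and Z :: "nat \<Rightarrow> 'a \<Rightarrow> real^'d"
  assumes prob: "\<And>n. prob_space (M n)" and Z [measurable]: "\<And>n. Z n \<in> borel_measurable (M n)"
    and char_conv: "\<And>t. (\<lambda>n. \<integral>\<omega>. iexp (t \<bullet> Z n \<omega>) \<partial>M n) \<longlonglongrightarrow> complex_of_real (exp (- ((norm t)\<^sup>2) / 2))"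
begin

text \<open>In the Fourier form the characteristic functions stand under a probability measure and
  are bounded by 1, so their pointwise convergence suffices for dominated convergence.\<close>

lemma smoothed_density_tendsto:
  assumes s: "0 < s"
  shows "(\<lambda>n. \<integral>\<omega>. normal_kernel ((1 / s) *\<^sub>R (y - Z n \<omega>)) \<partial>M n)
    \<longlonglongrightarrow> (\<integral>x. normal_kernel ((1 / s) *\<^sub>R (y - x)) \<partial>std_normal)"
proof -
  interpret G: prob_space "std_normal :: (real^'d) measure" by (rule prob_space_std_normal)
  let ?\<phi> = "\<lambda>n z. \<integral>\<omega>. iexp ((- (1 / s) *\<^sub>R z) \<bullet> Z n \<omega>) \<partial>M n"
  let ?\<psi> = "\<lambda>z :: real^'d. \<integral>x. iexp ((- (1 / s) *\<^sub>R z) \<bullet> x) \<partial>std_normal"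
  have meas: "?\<phi> n \<in> borel_measurable borel" for n
  proof -
    interpret prob_space "M n" by (rule prob)
    have [measurable]: "Z n \<in> borel_measurable (M n)" by (rule Z)
    have "(\<lambda>p. iexp ((- (1 / s) *\<^sub>R fst p) \<bullet> Z n (snd p))) \<in> borel_measurable (borel \<Otimes>\<^sub>M M n)"
      by measurable
    then show ?thesis by (intro borel_measurable_lebesgue_integral) (simp add: split_beta')
  qed
  have "(\<lambda>n. \<integral>z. iexp (((1 / s) *\<^sub>R y) \<bullet> z) * ?\<phi> n z \<partial>std_normal)
      \<longlonglongrightarrow> (\<integral>z. iexp (((1 / s) *\<^sub>R y) \<bullet> z) * ?\<psi> z \<partial>std_normal)"
  proof (rule integral_dominated_convergence[where w = "\<lambda>_. 1"])
    show "(\<lambda>z. iexp (((1 / s) *\<^sub>R y) \<bullet> z) * ?\<phi> n z) \<in> borel_measurable std_normal" for n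
      using meas[of n] by measurable
    show "AE z in std_normal. (\<lambda>n. iexp (((1 / s) *\<^sub>R y) \<bullet> z) * ?\<phi> n z)
        \<longlonglongrightarrow> iexp (((1 / s) *\<^sub>R y) \<bullet> z) * ?\<psi> z"
      unfolding char_std_normal by (intro AE_I2 tendsto_mult tendsto_const char_conv)
    show "AE z in std_normal. norm (iexp (((1 / s) *\<^sub>R y) \<bullet> z) * ?\<phi> n z) \<le> 1" for n
    proof (intro AE_I2)
      fix z :: "real^'d"
      interpret prob_space "M n" by (rule prob)
      have "norm (?\<phi> n z) \<le> (\<integral>\<omega>. norm (iexp ((- (1 / s) *\<^sub>R z) \<bullet> Z n \<omega>)) \<partial>M n)"
        by (rule integral_norm_bound)
      then show "norm (iexp (((1 / s) *\<^sub>R y) \<bullet> z) * ?\<phi> n z) \<le> 1" by (simp add: norm_mult prob_space)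
    qed
    show "(\<lambda>z. iexp (((1 / s) *\<^sub>R y) \<bullet> z) * ?\<psi> z) \<in> borel_measurable std_normal"
      unfolding char_std_normal by measurable
    show "integrable std_normal (\<lambda>_ :: real^'d. 1 :: real)" by simp
  qed
  from tendsto_mult_left[OF this, of "of_real (normal_kernel (0::real^'d))"]
  have "(\<lambda>n. complex_of_real (\<integral>\<omega>. normal_kernel ((1 / s) *\<^sub>R (y - Z n \<omega>)) \<partial>M n))
      \<longlonglongrightarrow> complex_of_real (\<integral>x. normal_kernel ((1 / s) *\<^sub>R (y - x)) \<partial>std_normal)"
    unfolding smoothed_density[OF prob Z s]
      smoothed_density[OF prob_space_std_normal _ s, of "\<lambda>x. x", OF measurable_ident_sets[OF sets_std_normal]]
    by simp
  then show ?thesis unfolding tendsto_of_real_iff .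
qed

end

lemma smoothing_expectation_close:
  fixes f :: "real^'d \<Rightarrow> real"
  assumes N: "prob_space N" and Y [measurable]: "Y \<in> borel_measurable N"
    and [measurable]: "f \<in> borel_measurable borel"
    and s: "\<And>x. \<bar>(\<integral>z. f (x + s *\<^sub>R z) \<partial>std_normal) - f x\<bar> \<le> r" and B: "\<And>x. \<bar>f x\<bar> \<le> B"
  shows "\<bar>(\<integral>\<omega>. (\<integral>z. f (Y \<omega> + s *\<^sub>R z) \<partial>std_normal) \<partial>N) - (\<integral>\<omega>. f (Y \<omega>) \<partial>N)\<bar> \<le> r"
proof -
  interpret prob_space N by (rule N)
  interpret G: prob_space "std_normal :: (real^'d) measure" by (rule prob_space_std_normal)
  let ?g = "\<lambda>x. \<integral>z. f (x + s *\<^sub>R z) \<partial>std_normal"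
  have g_meas [measurable]: "?g \<in> borel_measurable borel" by measurable
  have g_bound: "\<bar>?g x\<bar> \<le> B + r" for x using s[of x] B[of x] by linarith
  have i1: "integrable N (\<lambda>\<omega>. ?g (Y \<omega>))"
    by (rule integrable_const_bound[of _ "B + r"]) (use g_bound in auto)
  have i2: "integrable N (\<lambda>\<omega>. f (Y \<omega>))"
    by (rule integrable_const_bound[of _ B]) (use B in auto)
  have "\<bar>(\<integral>\<omega>. ?g (Y \<omega>) - f (Y \<omega>) \<partial>N)\<bar> \<le> (\<integral>\<omega>. \<bar>?g (Y \<omega>) - f (Y \<omega>)\<bar> \<partial>N)"
    by (rule integral_abs_bound)
  also have "\<dots> \<le> (\<integral>\<omega>. r \<partial>N)"
    by (rule Bochner_Integration.integral_mono) (use i1 i2 s in auto)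
  finally show ?thesis using i1 i2 by (simp add: prob_space)
qed

lemma cutoff_expectation_close:
  fixes f g :: "real^'d \<Rightarrow> real"
  assumes N: "prob_space N" and Y [measurable]: "Y \<in> borel_measurable N"
    and [measurable]: "f \<in> borel_measurable borel" "g \<in> borel_measurable borel"
    and B: "0 < B" "\<And>x. \<bar>f x\<bar> \<le> B" and g01: "\<And>x. 0 \<le> g x" "\<And>x. g x \<le> 1"
  shows "\<bar>(\<integral>\<omega>. f (Y \<omega>) \<partial>N) - (\<integral>\<omega>. f (Y \<omega>) * g (Y \<omega>) \<partial>N)\<bar> \<le> B * (1 - (\<integral>\<omega>. g (Y \<omega>) \<partial>N))"
proof -
  interpret prob_space N by (rule N)
  have i1: "integrable N (\<lambda>\<omega>. f (Y \<omega>))" by (rule integrable_const_bound[of _ B]) (use B in auto)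
  have i2: "integrable N (\<lambda>\<omega>. g (Y \<omega>))" by (rule integrable_const_bound[of _ 1]) (use g01 in auto)
  have "\<bar>f x * g x\<bar> \<le> B * 1" for x
    unfolding abs_mult using B g01 by (intro mult_mono) auto
  then have i3: "integrable N (\<lambda>\<omega>. f (Y \<omega>) * g (Y \<omega>))"
    by (intro integrable_const_bound[of _ B]) auto
  have "\<bar>\<integral>\<omega>. f (Y \<omega>) - f (Y \<omega>) * g (Y \<omega>) \<partial>N\<bar> \<le> (\<integral>\<omega>. \<bar>f (Y \<omega>) - f (Y \<omega>) * g (Y \<omega>)\<bar> \<partial>N)"
    by (rule integral_abs_bound)
  also have "\<dots> \<le> (\<integral>\<omega>. B * (1 - g (Y \<omega>)) \<partial>N)"
  proof (rule Bochner_Integration.integral_mono)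
    fix \<omega>
    have "f (Y \<omega>) - f (Y \<omega>) * g (Y \<omega>) = f (Y \<omega>) * (1 - g (Y \<omega>))" by (simp add: right_diff_distrib)
    then have "\<bar>f (Y \<omega>) - f (Y \<omega>) * g (Y \<omega>)\<bar> = \<bar>f (Y \<omega>)\<bar> * (1 - g (Y \<omega>))"
      using g01(2)[of "Y \<omega>"] by (simp add: abs_mult)
    also have "\<dots> \<le> B * (1 - g (Y \<omega>))" using B g01 by (intro mult_right_mono) auto
    finally show "\<bar>f (Y \<omega>) - f (Y \<omega>) * g (Y \<omega>)\<bar> \<le> B * (1 - g (Y \<omega>))" .
  qed (use i1 i2 i3 in auto)
  finally show ?thesis using i1 i2 i3 by (simp add: prob_space)
qed

text \<open>Two points at distance below 1 either both lie in the ball of radius |R| + 1, which is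
  compact, or both lie outside the ball of radius R, where f is 0.\<close>

lemma compact_support_uniformly_continuous:
  fixes f :: "'b::euclidean_space \<Rightarrow> real"
  assumes f: "continuous_on UNIV f" and supp: "\<And>x. R < norm x \<Longrightarrow> f x = 0"
  shows "uniformly_continuous_on UNIV f"
  unfolding uniformly_continuous_on_def
proof (intro allI impI)
  fix e :: real assume e: "0 < e"
  have "compact (cball (0::'b) (\<bar>R\<bar> + 1))" by simp
  then have "uniformly_continuous_on (cball 0 (\<bar>R\<bar> + 1)) f"
    by (intro compact_uniformly_continuous continuous_on_subset[OF f]) auto
  then obtain d where d: "0 < d" and dd: "\<forall>x\<in>cball 0 (\<bar>R\<bar> + 1). \<forall>x'\<in>cball 0 (\<bar>R\<bar> + 1). dist x' x < d \<longrightarrow> dist (f x') (f x) < e"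
    unfolding uniformly_continuous_on_def using e by blast
  have "dist (f x') (f x) < e" if x: "dist x' x < min d 1" for x x'
  proof (cases "norm x \<le> \<bar>R\<bar> + 1 \<and> norm x' \<le> \<bar>R\<bar> + 1")
    case True
    then show ?thesis using dd x by (simp add: dist_norm)
  next
    case False
    moreover have "norm x \<le> norm x' + 1" "norm x' \<le> norm x + 1"
      using x norm_triangle_sub[of x x'] norm_triangle_sub[of x' x]
      by (auto simp: dist_norm norm_minus_commute)
    ultimately have "R < norm x" "R < norm x'" by linarith+
    then show ?thesis using supp e by simp
  qed
  then show "\<exists>d>0. \<forall>x\<in>UNIV. \<forall>x'\<in>UNIV. dist x' x < d \<longrightarrow> dist (f x') (f x) < e"
    using d by (intro exI[of _ "min d 1"]) auto
qed

context char_convergence begin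

text \<open>Compact support makes f integrable and uniformly continuous. Integrability gives the
  limit for the smoothed f, by dominated convergence of the densities; uniform continuity makes the
  smoothing cost at most r / 4 on each side.\<close>

lemma expectation_tendsto_compact_support:
  fixes f :: "real^'d \<Rightarrow> real"
  assumes f: "continuous_on UNIV f" and supp: "\<And>x. R < norm x \<Longrightarrow> f x = 0"
  shows "(\<lambda>n. \<integral>\<omega>. f (Z n \<omega>) \<partial>M n) \<longlonglongrightarrow> (\<integral>z. f z \<partial>std_normal)"
proof -
  interpret G: prob_space "std_normal :: (real^'d) measure" by (rule prob_space_std_normal)
  have [measurable]: "f \<in> borel_measurable borel" using f by (rule borel_measurable_continuous_onI)
  have cpt: "compact (cball (0::real^'d) (\<bar>R\<bar> + 1))" by simp
  have "bounded (f ` cball 0 (\<bar>R\<bar> + 1))"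
    by (intro compact_imp_bounded compact_continuous_image cpt continuous_on_subset[OF f]) auto
  then obtain B where B1: "0 < B" "\<forall>y\<in>f ` cball 0 (\<bar>R\<bar> + 1). norm y \<le> B"
    unfolding bounded_pos by blast
  have B0: "0 \<le> B" using B1 by simp
  have B': "\<bar>f x\<bar> \<le> B" if "norm x \<le> \<bar>R\<bar> + 1" for x using B1(2) that by auto
  have B: "\<bar>f x\<bar> \<le> B" for x
    using B'[of x] supp[of x] B0 by (cases "norm x \<le> \<bar>R\<bar> + 1") auto
  have uc: "uniformly_continuous_on UNIV f"
    using f supp by (rule compact_support_uniformly_continuous)
  have int: "integrable lborel f"
  proof (rule Bochner_Integration.integrable_bound)
    show "integrable lborel (\<lambda>x. B * indicator (cball (0::real^'d) (\<bar>R\<bar> + 1)) x)"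
      using emeasure_bounded_finite[OF compact_imp_bounded[OF cpt]] by (auto simp: less_top)
    show "AE x in lborel. norm (f x) \<le> norm (B * indicator (cball 0 (\<bar>R\<bar> + 1)) x)"
      using B B0 supp by (auto simp: indicator_def)
  qed simp
  show ?thesis
  proof (rule LIMSEQ_I)
    fix r :: real assume r: "0 < r"
    obtain s where s: "0 < s" "\<And>x. \<bar>(\<integral>z. f (x + s *\<^sub>R z) \<partial>std_normal) - f x\<bar> \<le> r / 4"
      using normal_smoothing_close[OF uc B, of "r / 4"] r by auto
    let ?g = "\<lambda>x. \<integral>z. f (x + s *\<^sub>R z) \<partial>std_normal"
    have g_lim: "(\<lambda>n. \<integral>\<omega>. ?g (Z n \<omega>) \<partial>M n) \<longlonglongrightarrow> (\<integral>x. ?g x \<partial>std_normal)"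
    proof -
      have "(\<lambda>n. \<integral>y. f y * (\<integral>\<omega>. normal_kernel ((1 / s) *\<^sub>R (y - Z n \<omega>)) \<partial>M n) \<partial>lborel)
          \<longlonglongrightarrow> (\<integral>y. f y * (\<integral>x. normal_kernel ((1 / s) *\<^sub>R (y - x)) \<partial>std_normal) \<partial>lborel)"
      proof (rule integral_dominated_convergence[where w = "\<lambda>y. \<bar>f y\<bar> * normal_kernel (0::real^'d)"])
        show "(\<lambda>y. f y * (\<integral>\<omega>. normal_kernel ((1 / s) *\<^sub>R (y - Z n \<omega>)) \<partial>M n)) \<in> borel_measurable lborel" for n
        proof -
          interpret prob_space "M n" by (rule prob)
          show ?thesis by measurable
        qed
        show "AE y in lborel. norm (f y * (\<integral>\<omega>. normal_kernel ((1 / s) *\<^sub>R (y - Z n \<omega>)) \<partial>M n))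
            \<le> \<bar>f y\<bar> * normal_kernel (0::real^'d)" for n
        proof (intro AE_I2)
          fix y
          interpret prob_space "M n" by (rule prob)
          have "(\<integral>\<omega>. normal_kernel ((1 / s) *\<^sub>R (y - Z n \<omega>)) \<partial>M n) \<le> (\<integral>\<omega>. normal_kernel (0::real^'d) \<partial>M n)"
            by (intro Bochner_Integration.integral_mono integrable_const_bound[of _ "normal_kernel (0::real^'d)"])
              (auto simp: normal_kernel_nonneg normal_kernel_le)
          then have "(\<integral>\<omega>. normal_kernel ((1 / s) *\<^sub>R (y - Z n \<omega>)) \<partial>M n) \<le> normal_kernel (0::real^'d)"
            by (simp add: prob_space)
          moreover have "0 \<le> (\<integral>\<omega>. normal_kernel ((1 / s) *\<^sub>R (y - Z n \<omega>)) \<partial>M n)"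
            by (simp add: normal_kernel_nonneg)
          ultimately show "norm (f y * (\<integral>\<omega>. normal_kernel ((1 / s) *\<^sub>R (y - Z n \<omega>)) \<partial>M n))
            \<le> \<bar>f y\<bar> * normal_kernel (0::real^'d)"
            by (simp add: abs_mult mult_left_mono)
        qed
        show "AE y in lborel. (\<lambda>n. f y * (\<integral>\<omega>. normal_kernel ((1 / s) *\<^sub>R (y - Z n \<omega>)) \<partial>M n))
            \<longlonglongrightarrow> f y * (\<integral>x. normal_kernel ((1 / s) *\<^sub>R (y - x)) \<partial>std_normal)"
          by (intro AE_I2 tendsto_mult tendsto_const smoothed_density_tendsto s)
      qed (use int in auto)
      from tendsto_divide[OF this tendsto_const[of "s ^ DIM(real^'d)"]] show ?thesis
        unfolding smoothed_expectation[OF prob Z s(1) int]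
          smoothed_expectation[OF prob_space_std_normal _ s(1) int, of "\<lambda>x. x", OF measurable_ident_sets[OF sets_std_normal]]
        using s by simp
    qed
    from LIMSEQ_D[OF this, of "r / 4"] r obtain n0 where
      n0: "\<And>n. n0 \<le> n \<Longrightarrow> \<bar>(\<integral>\<omega>. ?g (Z n \<omega>) \<partial>M n) - (\<integral>x. ?g x \<partial>std_normal)\<bar> < r / 4" by auto
    show "\<exists>no. \<forall>n\<ge>no. norm ((\<integral>\<omega>. f (Z n \<omega>) \<partial>M n) - (\<integral>z. f z \<partial>std_normal)) < r"
    proof (intro exI allI impI)
      fix n assume n: "n0 \<le> n"
      have c1: "\<bar>(\<integral>\<omega>. ?g (Z n \<omega>) \<partial>M n) - (\<integral>\<omega>. f (Z n \<omega>) \<partial>M n)\<bar> \<le> r / 4" 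
        by (rule smoothing_expectation_close[OF prob Z _ s(2) B]) simp
      have c2: "\<bar>(\<integral>x. ?g x \<partial>std_normal) - (\<integral>x. f x \<partial>std_normal)\<bar> \<le> r / 4"
        
        by (rule smoothing_expectation_close[OF prob_space_std_normal _ _ s(2) B, of "\<lambda>x. x"]) simp_all
      show "norm ((\<integral>\<omega>. f (Z n \<omega>) \<partial>M n) - (\<integral>z. f z \<partial>std_normal)) < r"
        using c1 c2 n0[OF n] r unfolding real_norm_def by linarith
    qed
  qed
qed

text \<open>Compactly supported functions do not detect mass that escapes to infinity. The cutoff g
  excludes this: its expectations tend to its Gaussian expectation, which is close to 1, so the laws
  of \<open>Z n\<close> put little mass where f and f g differ.\<close>

theorem Levy_std_normal: "conv_in_dist M Z std_normal"
  unfolding conv_in_dist_def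
proof (intro allI impI, elim conjE)
  fix f :: "real^'d \<Rightarrow> real" assume f: "continuous_on UNIV f" and "bounded (range f)"
  then obtain B where B: "0 < B" "\<And>x. \<bar>f x\<bar> \<le> B" by (auto simp: bounded_pos)
  interpret G: prob_space "std_normal :: (real^'d) measure" by (rule prob_space_std_normal)
  have [measurable]: "f \<in> borel_measurable borel" using f by (rule borel_measurable_continuous_onI)
  show "(\<lambda>n. \<integral>\<omega>. f (Z n \<omega>) \<partial>M n) \<longlonglongrightarrow> (\<integral>z. f z \<partial>std_normal)"
  proof (rule LIMSEQ_I)
    fix r :: real assume r: "0 < r"
    obtain R where R: "0 < R" "G.prob {z. R < norm z} < r / (8 * B)"
      using std_normal_tail[of "r / (8 * B)"] r B by auto
    define g where "g z = max 0 (min 1 (R + 1 - norm z))" for z :: "real^'d"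
    have g_cont: "continuous_on UNIV g" unfolding g_def by (intro continuous_intros)
    then have [measurable]: "g \<in> borel_measurable borel" by (rule borel_measurable_continuous_onI)
    have g01: "0 \<le> g z" "g z \<le> 1" for z by (auto simp: g_def)
    have g_ge: "1 - indicator {z::real^'d. R < norm z} z \<le> g z" for z by (auto simp: g_def indicator_def)
    have "1 - r / (8 * B) \<le> (\<integral>z. 1 - indicator {z::real^'d. R < norm z} z \<partial>std_normal)"
      using R by (simp add: G.prob_space[simplified] G.emeasure_eq_measure)
    also have "\<dots> \<le> (\<integral>z. g z \<partial>std_normal)"
      by (intro Bochner_Integration.integral_mono G.integrable_const_bound[of _ 1]) (use g01 g_ge in \<open>auto simp: indicator_def\<close>)
    finally have gG: "1 - r / (8 * B) \<le> (\<integral>z. g z \<partial>std_normal)" .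
    have "(\<lambda>n. \<integral>\<omega>. g (Z n \<omega>) \<partial>M n) \<longlonglongrightarrow> (\<integral>z. g z \<partial>std_normal)"
      by (rule expectation_tendsto_compact_support[OF g_cont, of "R + 1"]) (simp add: g_def)
    from LIMSEQ_D[OF this, of "r / (8 * B)"] r B obtain n1 where
      n1: "\<And>n. n1 \<le> n \<Longrightarrow> \<bar>(\<integral>\<omega>. g (Z n \<omega>) \<partial>M n) - (\<integral>z. g z \<partial>std_normal)\<bar> < r / (8 * B)" by auto
    have "(\<lambda>n. \<integral>\<omega>. f (Z n \<omega>) * g (Z n \<omega>) \<partial>M n) \<longlonglongrightarrow> (\<integral>z. f z * g z \<partial>std_normal)"
      by (rule expectation_tendsto_compact_support[of "\<lambda>z. f z * g z" "R + 1"])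
        (auto intro!: continuous_intros f g_cont simp: g_def)
    from LIMSEQ_D[OF this, of "r / 4"] r obtain n2 where
      n2: "\<And>n. n2 \<le> n \<Longrightarrow>
        \<bar>(\<integral>\<omega>. f (Z n \<omega>) * g (Z n \<omega>) \<partial>M n) - (\<integral>z. f z * g z \<partial>std_normal)\<bar> < r / 4" by auto
    show "\<exists>no. \<forall>n\<ge>no. norm ((\<integral>\<omega>. f (Z n \<omega>) \<partial>M n) - (\<integral>z. f z \<partial>std_normal)) < r"
    proof (intro exI allI impI)
      fix n assume n: "max n1 n2 \<le> n"
      have s1: "\<bar>(\<integral>\<omega>. f (Z n \<omega>) \<partial>M n) - (\<integral>\<omega>. f (Z n \<omega>) * g (Z n \<omega>) \<partial>M n)\<bar>
          \<le> B * (1 - (\<integral>\<omega>. g (Z n \<omega>) \<partial>M n))" 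
        by (rule cutoff_expectation_close[OF prob Z _ _ B g01]) simp_all
      have s2: "\<bar>(\<integral>z. f z \<partial>std_normal) - (\<integral>z. f z * g z \<partial>std_normal)\<bar>
          \<le> B * (1 - (\<integral>z. g z \<partial>std_normal))"
        
        by (rule cutoff_expectation_close[OF prob_space_std_normal _ _ _ B g01, of "\<lambda>x. x"]) simp_all
      have e1: "B * (1 - (\<integral>\<omega>. g (Z n \<omega>) \<partial>M n)) \<le> B * (2 * (r / (8 * B)))"
        using n1[of n] n gG B by (intro mult_left_mono) auto
      have e2: "B * (1 - (\<integral>z. g z \<partial>std_normal)) \<le> B * (r / (8 * B))"
        using gG B by (intro mult_left_mono) auto
      \<comment> \<open>The three errors add up to r / 4 + r / 8 + r / 4, which is less than
        r.\<close>
      have "B * (2 * (r / (8 * B))) = r / 4" "B * (r / (8 * B)) = r / 8" using B by auto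
      then show "norm ((\<integral>\<omega>. f (Z n \<omega>) \<partial>M n) - (\<integral>z. f z \<partial>std_normal)) < r"
        using s1 s2 e1 e2 n2[of n] n r unfolding real_norm_def by linarith
    qed
  qed
qed

end

section \<open>Conditional independence\<close>

context prob_space
begin

lemma sigma_finite_subalgebraI: "subalgebra M F \<Longrightarrow> sigma_finite_subalgebra M F"
  by (intro finite_measure_subalgebra_is_sigma_finite finite_measure_subalgebra.intro
      finite_measure_subalgebra_axioms.intro finite_measure_axioms)

text \<open>Uniqueness of finite measures on an intersection-stable generator, for the measures with
  densities f and g. They live on all of M and are first restricted to the sigma-algebra generated
  by C.\<close>

lemma nn_integral_eq_on_generated:
  assumes [measurable]: "f \<in> borel_measurable M" "g \<in> borel_measurable M"
    and fin: "(\<integral>\<^sup>+\<omega>. f \<omega> \<partial>M) \<noteq> \<infinity>"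
    and C: "C \<subseteq> sets M" "Int_stable C" "space M \<in> C"
    and eq: "\<And>c. c \<in> C \<Longrightarrow> (\<integral>\<^sup>+\<omega>. f \<omega> * indicator c \<omega> \<partial>M) = (\<integral>\<^sup>+\<omega>. g \<omega> * indicator c \<omega> \<partial>M)"
    and c: "c \<in> sigma_sets (space M) C"
  shows "(\<integral>\<^sup>+\<omega>. f \<omega> * indicator c \<omega> \<partial>M) = (\<integral>\<^sup>+\<omega>. g \<omega> * indicator c \<omega> \<partial>M)"
proof -
  let ?S = "sigma (space M) C"
  have CP: "C \<subseteq> Pow (space M)" using C(1) sets.sets_into_space by blast
  have sub: "subalgebra (density M k) ?S" for k
    unfolding subalgebra_def using CP C(1) sets.sigma_sets_subset[of C M] by simp
  have em: "emeasure (restr_to_subalg (density M k) ?S) b = (\<integral>\<^sup>+\<omega>. k \<omega> * indicator b \<omega> \<partial>M)"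
    if [measurable]: "k \<in> borel_measurable M" and b: "b \<in> sigma_sets (space M) C" for k b
  proof -
    have "b \<in> sets M" using b C(1) sets.sigma_sets_subset[of C M] by blast
    then show ?thesis using b CP by (subst emeasure_restr_to_subalg[OF sub]) (simp_all add: emeasure_density)
  qed
  have "restr_to_subalg (density M f) ?S = restr_to_subalg (density M g) ?S"
  proof (rule measure_eqI_generator_eq[where A = "\<lambda>_. space M" and \<Omega> = "space M" and E = C])
    show "sets (restr_to_subalg (density M f) ?S) = sigma_sets (space M) C"
      "sets (restr_to_subalg (density M g) ?S) = sigma_sets (space M) C"
      using CP by (simp_all add: sets_restr_to_subalg[OF sub])
    show "emeasure (restr_to_subalg (density M f) ?S) (space M) \<noteq> \<infinity>" for i :: nat
    proof -
      have "(\<integral>\<^sup>+\<omega>. f \<omega> * indicator (space M) \<omega> \<partial>M) = (\<integral>\<^sup>+\<omega>. f \<omega> \<partial>M)"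
        by (intro nn_integral_cong) simp
      then show ?thesis using fin by (simp add: em sigma_sets_top)
    qed
  qed (use C CP eq em in auto)
  then show ?thesis using em[of f c] em[of g c] c by simp
qed

lemma nn_cond_exp_indicator_le_1:
  assumes F: "subalgebra M F" and B: "B \<in> sets M"
  shows "AE \<omega> in M. nn_cond_exp M F (indicator B) \<omega> \<le> 1"
proof -
  interpret F: sigma_finite_subalgebra M F by (rule sigma_finite_subalgebraI[OF F])
  have "AE \<omega> in M. nn_cond_exp M F (indicator B) \<omega> \<le> nn_cond_exp M F (\<lambda>_. 1) \<omega>"
    by (rule F.nn_cond_exp_mono) (use B in \<open>auto simp: indicator_def\<close>)
  moreover have "AE \<omega> in M. 1 = nn_cond_exp M F (\<lambda>_. 1) \<omega>" by (rule F.nn_cond_exp_F_meas) simp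
  ultimately show ?thesis by eventually_elim simp
qed

text \<open>Conditional independence is stated with \<open>real_cond_exp\<close>, whereas the
  computations below use \<open>nn_cond_exp\<close>, which asks for no integrability. This is the
  passage between them.\<close>

lemma nn_cond_exp_indicator_eq_real:
  assumes F: "subalgebra M F" and B: "B \<in> sets M"
  shows "AE \<omega> in M. nn_cond_exp M F (indicator B) \<omega> = ennreal (real_cond_exp M F (indicator B) \<omega>)
    \<and> 0 \<le> real_cond_exp M F (indicator B) \<omega>"
proof -
  interpret F: sigma_finite_subalgebra M F by (rule sigma_finite_subalgebraI[OF F])
  have "AE \<omega> in M. 0 = nn_cond_exp M F (\<lambda>_. 0) \<omega>" by (rule F.nn_cond_exp_F_meas) simp
  then show ?thesis using nn_cond_exp_indicator_le_1[OF F B]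
  proof eventually_elim
    case (elim \<omega>)
    have "(\<lambda>x. ennreal (- indicator B x)) = (\<lambda>x. 0)" by (auto simp: indicator_def ennreal_neg)
    moreover have "(\<lambda>x. ennreal (indicator B x)) = indicator B" by (auto simp: indicator_def)
    ultimately have "real_cond_exp M F (indicator B) \<omega> = enn2real (nn_cond_exp M F (indicator B) \<omega>)"
      using elim(1) by (simp add: real_cond_exp_def)
    moreover have "nn_cond_exp M F (indicator B) \<omega> < \<top>" using elim(2) by (simp add: order_le_less_trans)
    ultimately show ?case by simp
  qed
qed

text \<open>If the sigma-algebra \<open>A\<close> and the events in \<open>P\<close> are independent given \<open>W\<close>, and \<open>D\<close> lies between \<open>W\<close> and
  \<open>W \<or> A\<close>, then adding \<open>P\<close> to \<open>D\<close> does not change the conditional expectation of \<open>W \<or> A\<close>-measurable functions.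
  Both \<open>E[1\<^sub>p | D]\<close> and \<open>E[1\<^sub>p | W \<or> A]\<close> equal \<open>E[1\<^sub>p | W]\<close>, which gives the identity on the generating events
  \<open>d \<inter> p\<close>.\<close>

lemma nn_cond_exp_weak_union:
  assumes W: "subalgebra M W" and A: "subalgebra M A" and D: "subalgebra M D" and G: "subalgebra M G"
    and WD: "sets W \<subseteq> sets D" and DS: "sets D \<subseteq> sigma_sets (space M) (sets W \<union> sets A)"
    and DG: "sets D \<subseteq> sets G" and GH: "sets G \<subseteq> sigma_sets (space M) (sets D \<union> P)"
    and P: "P \<subseteq> sets M" "Int_stable P" "space M \<in> P"
    and indep: "\<And>e p. e \<in> sets A \<Longrightarrow> p \<in> P \<Longrightarrow> AE \<omega> in M.
      real_cond_exp M W (indicator (e \<inter> p)) \<omega> = real_cond_exp M W (indicator e) \<omega> * real_cond_exp M W (indicator p) \<omega>"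
    and f: "f \<in> borel_measurable (sigma (space M) (sets W \<union> sets A))"
  shows "AE \<omega> in M. nn_cond_exp M G f \<omega> = nn_cond_exp M D f \<omega>"
proof -
  let ?S = "sigma (space M) (sets W \<union> sets A)"
  have subs: "sets W \<subseteq> sets M" "sets A \<subseteq> sets M" "sets D \<subseteq> sets M" "sets G \<subseteq> sets M"
    and sp: "space W = space M" "space A = space M" "space D = space M" "space G = space M"
    using W A D G by (auto simp: subalgebra_def)
  have SP: "sets W \<union> sets A \<subseteq> Pow (space M)"
    using sets.space_closed[of W] sets.space_closed[of A] sp by simp
  have setsS: "sets ?S = sigma_sets (space M) (sets W \<union> sets A)" using SP by simp
  have S: "subalgebra M ?S"
    unfolding subalgebra_def using SP subs sets.sigma_sets_subset[of "sets W \<union> sets A" M] by simp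
  have D_S: "subalgebra ?S D" using DS SP sp by (simp add: subalgebra_def)
  have W_D: "subalgebra D W" and D_G: "subalgebra G D" using WD DG sp by (simp_all add: subalgebra_def)
  interpret W: sigma_finite_subalgebra M W by (rule sigma_finite_subalgebraI[OF W])
  interpret D: sigma_finite_subalgebra M D by (rule sigma_finite_subalgebraI[OF D])
  interpret G: sigma_finite_subalgebra M G by (rule sigma_finite_subalgebraI[OF G])
  interpret S: sigma_finite_subalgebra M ?S by (rule sigma_finite_subalgebraI[OF S])
  note M_S = measurable_from_subalg[OF S] and M_D = measurable_from_subalg[OF D]
    and S_D = measurable_from_subalg[OF D_S] and D_W = measurable_from_subalg[OF W_D]
  have fin1: "(\<integral>\<^sup>+\<omega>. indicator b \<omega> \<partial>M) \<noteq> \<infinity>" if "b \<in> sets M" for b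
    using that by (simp add: emeasure_eq_measure)

  have step1: "AE \<omega> in M. nn_cond_exp M W (indicator p) \<omega> = nn_cond_exp M ?S (indicator p) \<omega>" if p: "p \<in> P" for p
  proof (rule S.nn_cond_exp_charact)
    have [measurable]: "p \<in> sets M" by (rule subsetD[OF P(1) p])
    let ?C = "{w \<inter> e | w e. w \<in> sets W \<and> e \<in> sets A}"
    fix c assume "c \<in> sets ?S"
    have "sets W \<union> sets A \<subseteq> ?C"
    proof
      fix b assume "b \<in> sets W \<union> sets A"
      then show "b \<in> ?C"
      proof
        assume "b \<in> sets W"
        moreover have "b = b \<inter> space M" using \<open>b \<in> sets W\<close> sp sets.sets_into_space[of b W] by auto
        moreover have "space M \<in> sets A" using sets.top[of A] sp by simp
        ultimately show ?thesis by blast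
      next
        assume "b \<in> sets A"
        moreover have "b = space M \<inter> b" using \<open>b \<in> sets A\<close> sp sets.sets_into_space[of b A] by auto
        moreover have "space M \<in> sets W" using sets.top[of W] sp by simp
        ultimately show ?thesis by blast
      qed
    qed
    then have "sigma_sets (space M) (sets W \<union> sets A) \<subseteq> sigma_sets (space M) ?C" by (rule sigma_sets_mono')
    then have c: "c \<in> sigma_sets (space M) ?C" using \<open>c \<in> sets ?S\<close> unfolding setsS by (rule subsetD)
    have "(\<integral>\<^sup>+\<omega>. indicator p \<omega> * indicator c \<omega> \<partial>M) = (\<integral>\<^sup>+\<omega>. nn_cond_exp M W (indicator p) \<omega> * indicator c \<omega> \<partial>M)"
    proof (rule nn_integral_eq_on_generated[OF _ _ fin1 _ _ _ _ c])
      have "w \<inter> e \<in> sets M" if "w \<in> sets W" "e \<in> sets A" for w e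
        using subsetD[OF subs(1) that(1)] subsetD[OF subs(2) that(2)] by (rule sets.Int)
      then show "?C \<subseteq> sets M" by fast
      show "Int_stable ?C"
      proof (rule Int_stableI)
        fix a b assume "a \<in> ?C" "b \<in> ?C"
        then obtain w e w' e' where "a = w \<inter> e" "b = w' \<inter> e'" "w \<in> sets W" "w' \<in> sets W" "e \<in> sets A" "e' \<in> sets A"
          by blast
        then have "a \<inter> b = (w \<inter> w') \<inter> (e \<inter> e')" "w \<inter> w' \<in> sets W" "e \<inter> e' \<in> sets A"
          by (simp_all only: sets.Int Int_ac)
        then show "a \<inter> b \<in> ?C" by (intro CollectI exI conjI)
      qed
      have "space M \<in> sets W" "space M \<in> sets A" using sets.top[of W] sets.top[of A] sp by simp_all
      then show "space M \<in> ?C" by blast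
      fix b assume "b \<in> ?C"
      then obtain w e where b: "b = w \<inter> e" and w [measurable]: "w \<in> sets W" and e: "e \<in> sets A" by blast
      have [measurable]: "e \<in> sets M" "w \<in> sets M" by (rule subsetD[OF subs(2) e], rule subsetD[OF subs(1) w])
      have ae: "AE \<omega> in M. nn_cond_exp M W (indicator (e \<inter> p)) \<omega>
          = nn_cond_exp M W (indicator p) \<omega> * nn_cond_exp M W (indicator e) \<omega>"
      proof -
        have "e \<in> sets M" "p \<in> sets M" "e \<inter> p \<in> sets M" by measurable
        note this[THEN nn_cond_exp_indicator_eq_real[OF W]]
        with indep[OF e p] show ?thesis by eventually_elim (simp add: ennreal_mult mult.commute)
      qed
      have "(\<integral>\<^sup>+\<omega>. indicator p \<omega> * indicator b \<omega> \<partial>M) = (\<integral>\<^sup>+\<omega>. indicator w \<omega> * indicator (e \<inter> p) \<omega> \<partial>M)"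
        unfolding b by (intro nn_integral_cong) (auto simp: indicator_def)
      also have "\<dots> = (\<integral>\<^sup>+\<omega>. indicator w \<omega> * nn_cond_exp M W (indicator (e \<inter> p)) \<omega> \<partial>M)"
        by (rule W.nn_cond_exp_intg[symmetric]) simp_all
      also have "\<dots> = (\<integral>\<^sup>+\<omega>. (indicator w \<omega> * nn_cond_exp M W (indicator p) \<omega>) * nn_cond_exp M W (indicator e) \<omega> \<partial>M)"
        by (rule nn_integral_cong_AE, use ae in eventually_elim) (simp add: mult.assoc)
      also have "\<dots> = (\<integral>\<^sup>+\<omega>. (indicator w \<omega> * nn_cond_exp M W (indicator p) \<omega>) * indicator e \<omega> \<partial>M)"
        by (rule W.nn_cond_exp_intg) simp_all
      also have "\<dots> = (\<integral>\<^sup>+\<omega>. nn_cond_exp M W (indicator p) \<omega> * indicator b \<omega> \<partial>M)"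
        unfolding b by (intro nn_integral_cong) (auto simp: indicator_def)
      finally show "(\<integral>\<^sup>+\<omega>. indicator p \<omega> * indicator b \<omega> \<partial>M)
          = (\<integral>\<^sup>+\<omega>. nn_cond_exp M W (indicator p) \<omega> * indicator b \<omega> \<partial>M)" .
    qed simp_all
    then show "(\<integral>\<^sup>+\<omega>\<in>c. indicator p \<omega> \<partial>M) = (\<integral>\<^sup>+\<omega>\<in>c. nn_cond_exp M W (indicator p) \<omega> \<partial>M)" .
  next
    show "indicator p \<in> borel_measurable M" using subsetD[OF P(1) p] by simp
    show "nn_cond_exp M W (indicator p) \<in> borel_measurable ?S" by (intro S_D D_W) simp
  qed

  have step2: "(\<integral>\<^sup>+\<omega>. indicator c \<omega> * indicator h \<omega> \<partial>M) = (\<integral>\<^sup>+\<omega>. nn_cond_exp M D (indicator c) \<omega> * indicator h \<omega> \<partial>M)"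
    if c [measurable]: "c \<in> sets ?S" and h: "h \<in> sets G" for c h
  proof -
    let ?C = "{d \<inter> p | d p. d \<in> sets D \<and> p \<in> P}"
    have cM [measurable]: "c \<in> sets M" using c S by (auto simp: subalgebra_def)
    have "sets D \<union> P \<subseteq> ?C"
    proof
      fix b assume "b \<in> sets D \<union> P"
      then show "b \<in> ?C"
      proof
        assume "b \<in> sets D"
        moreover have "b = b \<inter> space M" using \<open>b \<in> sets D\<close> sp sets.sets_into_space[of b D] by auto
        ultimately show ?thesis using P(3) by blast
      next
        assume "b \<in> P"
        moreover have "b = space M \<inter> b" using \<open>b \<in> P\<close> P(1) sets.sets_into_space[of b M] by auto
        moreover have "space M \<in> sets D" using sets.top[of D] sp by simp
        ultimately show ?thesis by blast
      qed
    qed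
    then have "sigma_sets (space M) (sets D \<union> P) \<subseteq> sigma_sets (space M) ?C" by (rule sigma_sets_mono')
    then have hC: "h \<in> sigma_sets (space M) ?C" using subsetD[OF GH h] by (rule subsetD)
    show ?thesis
    proof (rule nn_integral_eq_on_generated[OF _ _ fin1 _ _ _ _ hC])
      have "d \<inter> p \<in> sets M" if "d \<in> sets D" "p \<in> P" for d p
        using subsetD[OF subs(3) that(1)] subsetD[OF P(1) that(2)] by (rule sets.Int)
      then show "?C \<subseteq> sets M" by fast
      show "Int_stable ?C"
      proof (rule Int_stableI)
        fix a b assume "a \<in> ?C" "b \<in> ?C"
        then obtain w e w' e' where "a = w \<inter> e" "b = w' \<inter> e'" "w \<in> sets D" "w' \<in> sets D" "e \<in> P" "e' \<in> P"
          by blast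
        then have "a \<inter> b = (w \<inter> w') \<inter> (e \<inter> e')" "w \<inter> w' \<in> sets D" "e \<inter> e' \<in> P"
          using P(2) by (simp_all only: sets.Int Int_ac Int_stable_def)
        then show "a \<inter> b \<in> ?C" by (intro CollectI exI conjI)
      qed
      have "space M \<in> sets D" using sets.top[of D] sp by simp
      then show "space M \<in> ?C" using P(3) by blast
      fix b assume "b \<in> ?C"
      then obtain d p where b: "b = d \<inter> p" and d [measurable]: "d \<in> sets D" and p: "p \<in> P" by blast
      have [measurable]: "d \<in> sets M" "p \<in> sets M" by (rule subsetD[OF subs(3) d], rule subsetD[OF P(1) p])
      have dS [measurable]: "d \<in> sets ?S" unfolding setsS by (rule subsetD[OF DS d])
      have WpD [measurable]: "nn_cond_exp M W (indicator p) \<in> borel_measurable D" by (rule D_W) simp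
      have DcS [measurable]: "nn_cond_exp M D (indicator c) \<in> borel_measurable ?S" by (rule S_D) simp
      \<comment> \<open>\<open>step1\<close> in integrated form. It is used in both directions: p
        first gives way to a D-measurable function, so that c can be conditioned on D, and then p
        returns.\<close>
      have key: "(\<integral>\<^sup>+\<omega>. k \<omega> * indicator p \<omega> \<partial>M) = (\<integral>\<^sup>+\<omega>. k \<omega> * nn_cond_exp M W (indicator p) \<omega> \<partial>M)"
        if k: "k \<in> borel_measurable ?S" for k
      proof -
        have "(\<integral>\<^sup>+\<omega>. k \<omega> * indicator p \<omega> \<partial>M) = (\<integral>\<^sup>+\<omega>. k \<omega> * nn_cond_exp M ?S (indicator p) \<omega> \<partial>M)"
          by (rule S.nn_cond_exp_intg[symmetric]) (use k in simp_all)
        also have "\<dots> = (\<integral>\<^sup>+\<omega>. k \<omega> * nn_cond_exp M W (indicator p) \<omega> \<partial>M)"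
          by (rule nn_integral_cong_AE, use step1[OF p] in eventually_elim) simp
        finally show ?thesis .
      qed
      have "(\<integral>\<^sup>+\<omega>. indicator c \<omega> * indicator b \<omega> \<partial>M) = (\<integral>\<^sup>+\<omega>. (indicator c \<omega> * indicator d \<omega>) * indicator p \<omega> \<partial>M)"
        unfolding b by (intro nn_integral_cong) (auto simp: indicator_def)
      also have "\<dots> = (\<integral>\<^sup>+\<omega>. (indicator c \<omega> * indicator d \<omega>) * nn_cond_exp M W (indicator p) \<omega> \<partial>M)"
        by (rule key) simp
      also have "\<dots> = (\<integral>\<^sup>+\<omega>. (indicator d \<omega> * nn_cond_exp M W (indicator p) \<omega>) * indicator c \<omega> \<partial>M)"
        by (simp add: mult_ac)
      also have "\<dots> = (\<integral>\<^sup>+\<omega>. (indicator d \<omega> * nn_cond_exp M W (indicator p) \<omega>) * nn_cond_exp M D (indicator c) \<omega> \<partial>M)"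
        by (rule D.nn_cond_exp_intg[symmetric]) simp_all
      also have "\<dots> = (\<integral>\<^sup>+\<omega>. (indicator d \<omega> * nn_cond_exp M D (indicator c) \<omega>) * nn_cond_exp M W (indicator p) \<omega> \<partial>M)"
        by (simp add: mult_ac)
      also have "\<dots> = (\<integral>\<^sup>+\<omega>. (indicator d \<omega> * nn_cond_exp M D (indicator c) \<omega>) * indicator p \<omega> \<partial>M)"
        by (rule key[symmetric]) simp
      also have "\<dots> = (\<integral>\<^sup>+\<omega>. nn_cond_exp M D (indicator c) \<omega> * indicator b \<omega> \<partial>M)"
        unfolding b by (intro nn_integral_cong) (auto simp: indicator_def)
      finally show "(\<integral>\<^sup>+\<omega>. indicator c \<omega> * indicator b \<omega> \<partial>M)
          = (\<integral>\<^sup>+\<omega>. nn_cond_exp M D (indicator c) \<omega> * indicator b \<omega> \<partial>M)" .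
    qed simp_all
  qed

  \<comment> \<open>\<open>step2\<close> with the roles of c and h exchanged. In this form it
    extends from events c to nonnegative functions f by the defining property of conditional
    expectations, without approximation by simple functions.\<close>
  have step3: "AE \<omega> in M. nn_cond_exp M D (indicator h) \<omega> = nn_cond_exp M ?S (indicator h) \<omega>" if h: "h \<in> sets G" for h
  proof (rule S.nn_cond_exp_charact)
    have [measurable]: "h \<in> sets M" by (rule subsetD[OF subs(4) h])
    fix c assume c [measurable]: "c \<in> sets ?S"
    have [measurable]: "c \<in> sets M" using c S by (auto simp: subalgebra_def)
    have "(\<integral>\<^sup>+\<omega>. indicator h \<omega> * indicator c \<omega> \<partial>M) = (\<integral>\<^sup>+\<omega>. nn_cond_exp M D (indicator c) \<omega> * indicator h \<omega> \<partial>M)"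
      using step2[OF c h] by (simp add: mult.commute)
    also have "\<dots> = (\<integral>\<^sup>+\<omega>. nn_cond_exp M D (indicator c) \<omega> * nn_cond_exp M D (indicator h) \<omega> \<partial>M)"
      by (rule D.nn_cond_exp_intg[symmetric]) simp_all
    also have "\<dots> = (\<integral>\<^sup>+\<omega>. nn_cond_exp M D (indicator h) \<omega> * nn_cond_exp M D (indicator c) \<omega> \<partial>M)"
      by (simp add: mult.commute)
    also have "\<dots> = (\<integral>\<^sup>+\<omega>. nn_cond_exp M D (indicator h) \<omega> * indicator c \<omega> \<partial>M)"
      by (rule D.nn_cond_exp_intg) simp_all
    finally show "(\<integral>\<^sup>+\<omega>\<in>c. indicator h \<omega> \<partial>M) = (\<integral>\<^sup>+\<omega>\<in>c. nn_cond_exp M D (indicator h) \<omega> \<partial>M)" .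
  next
    show "indicator h \<in> borel_measurable M" using subsetD[OF subs(4) h] by simp
    show "nn_cond_exp M D (indicator h) \<in> borel_measurable ?S" by (intro S_D) simp
  qed

  have fM [measurable]: "f \<in> borel_measurable M" using f by (rule M_S)
  have "AE \<omega> in M. nn_cond_exp M D f \<omega> = nn_cond_exp M G f \<omega>"
  proof (rule G.nn_cond_exp_charact)
    fix h assume h: "h \<in> sets G"
    have [measurable]: "h \<in> sets M" by (rule subsetD[OF subs(4) h])
    have "(\<integral>\<^sup>+\<omega>. f \<omega> * indicator h \<omega> \<partial>M) = (\<integral>\<^sup>+\<omega>. f \<omega> * nn_cond_exp M ?S (indicator h) \<omega> \<partial>M)"
      by (rule S.nn_cond_exp_intg[symmetric]) (use f in simp_all)
    also have "\<dots> = (\<integral>\<^sup>+\<omega>. nn_cond_exp M D (indicator h) \<omega> * f \<omega> \<partial>M)"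
      by (rule nn_integral_cong_AE, use step3[OF h] in eventually_elim) (simp add: mult.commute)
    also have "\<dots> = (\<integral>\<^sup>+\<omega>. nn_cond_exp M D (indicator h) \<omega> * nn_cond_exp M D f \<omega> \<partial>M)"
      by (rule D.nn_cond_exp_intg[symmetric]) simp_all
    also have "\<dots> = (\<integral>\<^sup>+\<omega>. nn_cond_exp M D f \<omega> * nn_cond_exp M D (indicator h) \<omega> \<partial>M)"
      by (simp add: mult.commute)
    also have "\<dots> = (\<integral>\<^sup>+\<omega>. nn_cond_exp M D f \<omega> * indicator h \<omega> \<partial>M)"
      by (rule D.nn_cond_exp_intg) simp_all
    finally show "(\<integral>\<^sup>+\<omega>\<in>h. f \<omega> \<partial>M) = (\<integral>\<^sup>+\<omega>\<in>h. nn_cond_exp M D f \<omega> \<partial>M)" .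
  next
    show "nn_cond_exp M D f \<in> borel_measurable G" by (rule measurable_from_subalg[OF D_G]) simp
  qed simp
  then show ?thesis by eventually_elim simp
qed

end

section \<open>Comparison of characteristic functions\<close>

text \<open>The lower bound is the tangent line. For the upper one, exp y >= 1 + y + y^2 / 2, and (1
  - y + y^2 / 2) (1 + y + y^2 / 2) = 1 + y^4 / 4 >= 1.\<close>

lemma exp_minus_quadratic:
  fixes y :: real
  assumes "0 \<le> y"
  shows "\<bar>exp (- y) - (1 - y)\<bar> \<le> y\<^sup>2 / 2"
proof -
  have lo: "1 - y \<le> exp (- y)" using exp_ge_add_one_self[of "- y"] by simp
  have p: "0 < 1 + y + y\<^sup>2 / 2" using assms by (intro add_pos_nonneg) auto
  have "1 + y + y\<^sup>2 / 2 \<le> exp y" by (rule exp_lower_Taylor_quadratic[OF assms])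
  then have "exp (- y) \<le> 1 / (1 + y + y\<^sup>2 / 2)"
    using p by (simp add: exp_minus inverse_eq_divide frac_le)
  also have "\<dots> \<le> 1 - y + y\<^sup>2 / 2"
  proof -
    have "(1 - y + y\<^sup>2 / 2) * (1 + y + y\<^sup>2 / 2) = 1 + (y\<^sup>2)\<^sup>2 / 4"
      by (simp add: power2_eq_square field_simps)
    then have "1 \<le> (1 - y + y\<^sup>2 / 2) * (1 + y + y\<^sup>2 / 2)" by simp
    then show ?thesis using p by (simp add: pos_divide_le_eq)
  qed
  finally show ?thesis using lo by simp
qed

lemma iexp_quadratic: "cmod (iexp x - (1 + \<i> * of_real x - of_real (x\<^sup>2 / 2))) \<le> \<bar>x\<bar> ^ 3 / 6"
proof -
  have "(\<Sum>k\<le>2. (\<i> * complex_of_real x) ^ k / fact k) = 1 + \<i> * of_real x - of_real (x\<^sup>2 / 2)"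
    by (simp add: numeral_2_eq_2 power2_eq_square field_simps)
  moreover have "(fact (Suc 2) :: real) = 6" by (simp add: fact_numeral)
  ultimately show ?thesis using iexp_approx1[of x 2] by (simp add: numeral_3_eq_3 numeral_2_eq_2)
qed

context prob_space
begin

text \<open>Reduces complex multipliers to the real ones of the hypothesis: real and imaginary part
  are again measurable and bounded by 1.\<close>

lemma complex_integral_orthogonal:
  fixes f :: "'a \<Rightarrow> real" and R :: "'a \<Rightarrow> complex"
  assumes sub: "subalgebra M H" and f: "integrable M f"
    and R: "R \<in> borel_measurable H" "\<And>\<omega>. cmod (R \<omega>) \<le> 1"
    and orth: "\<And>r. r \<in> borel_measurable H \<Longrightarrow> (\<And>\<omega>. \<bar>r \<omega>\<bar> \<le> 1) \<Longrightarrow> (\<integral>\<omega>. r \<omega> * f \<omega> \<partial>M) = 0"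
  shows "integrable M (\<lambda>\<omega>. R \<omega> * of_real (f \<omega>))" "(\<integral>\<omega>. R \<omega> * of_real (f \<omega>) \<partial>M) = 0"
proof -
  have [measurable]: "R \<in> borel_measurable M" "f \<in> borel_measurable M"
    using measurable_from_subalg[OF sub R(1)] f by auto
  show int: "integrable M (\<lambda>\<omega>. R \<omega> * of_real (f \<omega>))"
  proof (rule Bochner_Integration.integrable_bound[OF f])
    show "AE \<omega> in M. norm (R \<omega> * of_real (f \<omega>)) \<le> norm (f \<omega>)"
      using R(2) by (intro AE_I2) (simp add: norm_mult mult_left_le_one_le)
  qed measurable
  have "Re (\<integral>\<omega>. R \<omega> * of_real (f \<omega>) \<partial>M) = (\<integral>\<omega>. Re (R \<omega>) * f \<omega> \<partial>M)"
    by (subst integral_Re[OF int, symmetric]) simp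
  also have "\<dots> = 0"
    using R by (intro orth measurable_compose[OF R(1)]) (auto intro: order_trans[OF abs_Re_le_cmod])
  finally have re: "Re (\<integral>\<omega>. R \<omega> * of_real (f \<omega>) \<partial>M) = 0" .
  have "Im (\<integral>\<omega>. R \<omega> * of_real (f \<omega>) \<partial>M) = (\<integral>\<omega>. Im (R \<omega>) * f \<omega> \<partial>M)"
    by (subst integral_Im[OF int, symmetric]) simp
  also have "\<dots> = 0"
    using R by (intro orth measurable_compose[OF R(1)]) (auto intro: order_trans[OF abs_Im_le_cmod])
  finally show "(\<integral>\<omega>. R \<omega> * of_real (f \<omega>) \<partial>M) = 0" using re by (simp add: complex_eq_iff)
qed

text \<open>Lindeberg's telescoping: the mixed terms carry \<open>iexp (\<xi> h)\<close> for the clusters before \<open>g\<close> and \<open>exp (- s h / 2)\<close>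
  for those after it, so the factor multiplying the \<open>g\<close>-th difference is measurable in \<open>H g\<close>. The orthogonality
  hypotheses say that, given \<open>H g\<close>, \<open>\<xi> g\<close> has mean \<open>0\<close> and variance \<open>s g\<close>; they are stated with bounded multipliers to
  avoid conditional expectations.\<close>

lemma char_sum_close:
  fixes \<xi> s :: "nat \<Rightarrow> 'a \<Rightarrow> real" and H :: "nat \<Rightarrow> 'a measure" and m :: nat
  assumes sub: "\<And>g. g < m \<Longrightarrow> subalgebra M (H g)"
    and \<xi>H: "\<And>g h. g < m \<Longrightarrow> h < m \<Longrightarrow> h \<noteq> g \<Longrightarrow> \<xi> h \<in> borel_measurable (H g)"
    and sH: "\<And>g h. g < m \<Longrightarrow> h < m \<Longrightarrow> s h \<in> borel_measurable (H g)"
    and \<xi>M: "\<And>g. g < m \<Longrightarrow> \<xi> g \<in> borel_measurable M"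
    and s0: "\<And>g \<omega>. g < m \<Longrightarrow> 0 \<le> s g \<omega>"
    and int: "\<And>g. g < m \<Longrightarrow> integrable M (\<xi> g)" "\<And>g. g < m \<Longrightarrow> integrable M (\<lambda>\<omega>. (\<xi> g \<omega>)\<^sup>2)"
      "\<And>g. g < m \<Longrightarrow> integrable M (\<lambda>\<omega>. \<bar>\<xi> g \<omega>\<bar> ^ 3)"
      "\<And>g. g < m \<Longrightarrow> integrable M (s g)" "\<And>g. g < m \<Longrightarrow> integrable M (\<lambda>\<omega>. (s g \<omega>)\<^sup>2)"
    and orth1: "\<And>g r. g < m \<Longrightarrow> r \<in> borel_measurable (H g) \<Longrightarrow> (\<And>\<omega>. \<bar>r \<omega>\<bar> \<le> 1) \<Longrightarrow>
      (\<integral>\<omega>. r \<omega> * \<xi> g \<omega> \<partial>M) = 0"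
    and orth2: "\<And>g r. g < m \<Longrightarrow> r \<in> borel_measurable (H g) \<Longrightarrow> (\<And>\<omega>. \<bar>r \<omega>\<bar> \<le> 1) \<Longrightarrow>
      (\<integral>\<omega>. r \<omega> * ((\<xi> g \<omega>)\<^sup>2 - s g \<omega>) \<partial>M) = 0"
  shows "cmod ((\<integral>\<omega>. iexp (\<Sum>g<m. \<xi> g \<omega>) \<partial>M) - (\<integral>\<omega>. of_real (exp (- (\<Sum>g<m. s g \<omega>) / 2)) \<partial>M))
    \<le> (\<Sum>g<m. \<integral>\<omega>. \<bar>\<xi> g \<omega>\<bar> ^ 3 / 6 + (s g \<omega>)\<^sup>2 / 8 \<partial>M)"
proof -
  define U where "U k \<omega> = iexp (\<Sum>h<k. \<xi> h \<omega>) * of_real (exp (- (\<Sum>h\<in>{k..<m}. s h \<omega>) / 2))" for k \<omega>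
  define R where "R k \<omega> = iexp (\<Sum>h<k. \<xi> h \<omega>) * of_real (exp (- (\<Sum>h\<in>{Suc k..<m}. s h \<omega>) / 2))" for k \<omega>
  have sM: "s g \<in> borel_measurable M" if "g < m" for g
    using sH[OF that that] sub[OF that] by (rule measurable_from_subalg[rotated])
  have exp_le: "exp (- (\<Sum>h\<in>{k..<m}. s h \<omega>) / 2) \<le> 1" for k \<omega>
    by (simp, intro sum_nonneg) (simp add: s0)
  have U_int: "integrable M (U k)" if "k \<le> m" for k
  proof (rule integrable_const_bound[of _ 1])
    have "(\<lambda>\<omega>. \<Sum>h<k. \<xi> h \<omega>) \<in> borel_measurable M" "(\<lambda>\<omega>. \<Sum>h\<in>{k..<m}. s h \<omega>) \<in> borel_measurable M"
      using that by (auto intro!: borel_measurable_sum \<xi>M sM)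
    then show "U k \<in> borel_measurable M" unfolding U_def by measurable
    show "AE \<omega> in M. norm (U k \<omega>) \<le> 1" using exp_le by (simp add: U_def norm_mult)
  qed
  have R_le: "cmod (R k \<omega>) \<le> 1" for k \<omega> using exp_le by (simp add: R_def norm_mult)
  have step: "cmod ((\<integral>\<omega>. U (Suc k) \<omega> \<partial>M) - (\<integral>\<omega>. U k \<omega> \<partial>M)) \<le> (\<integral>\<omega>. \<bar>\<xi> k \<omega>\<bar> ^ 3 / 6 + (s k \<omega>)\<^sup>2 / 8 \<partial>M)"
    if k: "k < m" for k
  proof -
    have RH: "R k \<in> borel_measurable (H k)"
    proof -
      have "(\<lambda>\<omega>. \<Sum>h<k. \<xi> h \<omega>) \<in> borel_measurable (H k)" "(\<lambda>\<omega>. \<Sum>h\<in>{Suc k..<m}. s h \<omega>) \<in> borel_measurable (H k)"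
        using k by (auto intro!: borel_measurable_sum \<xi>H sH)
      then show ?thesis unfolding R_def by measurable
    qed
    have [measurable]: "R k \<in> borel_measurable M" "\<xi> k \<in> borel_measurable M" "s k \<in> borel_measurable M"
      using measurable_from_subalg[OF sub[OF k] RH] \<xi>M[OF k] sM[OF k] by auto
    have i1: "integrable M (\<lambda>\<omega>. R k \<omega> * of_real (\<xi> k \<omega>))" and z1: "(\<integral>\<omega>. R k \<omega> * of_real (\<xi> k \<omega>) \<partial>M) = 0"
      using complex_integral_orthogonal[OF sub[OF k] int(1)[OF k] RH R_le orth1[OF k]] by auto
    have id: "integrable M (\<lambda>\<omega>. (\<xi> k \<omega>)\<^sup>2 - s k \<omega>)" using int k by auto
    have i2: "integrable M (\<lambda>\<omega>. R k \<omega> * of_real ((\<xi> k \<omega>)\<^sup>2 - s k \<omega>))"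
      and z2: "(\<integral>\<omega>. R k \<omega> * of_real ((\<xi> k \<omega>)\<^sup>2 - s k \<omega>) \<partial>M) = 0"
      using complex_integral_orthogonal[OF sub[OF k] id RH R_le orth2[OF k]] by auto
    define a where "a \<omega> = iexp (\<xi> k \<omega>) - (1 + \<i> * of_real (\<xi> k \<omega>) - of_real ((\<xi> k \<omega>)\<^sup>2 / 2))" for \<omega>
    define b where "b \<omega> = exp (- (s k \<omega> / 2)) - (1 - s k \<omega> / 2)" for \<omega>
    have a_le: "cmod (a \<omega>) \<le> \<bar>\<xi> k \<omega>\<bar> ^ 3 / 6" for \<omega> unfolding a_def by (rule iexp_quadratic)
    have b_le: "\<bar>b \<omega>\<bar> \<le> (s k \<omega>)\<^sup>2 / 8" for \<omega>
      using exp_minus_quadratic[of "s k \<omega> / 2"] s0[OF k, of \<omega>] by (simp add: b_def power_divide)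
    have [measurable]: "a \<in> borel_measurable M" "b \<in> borel_measurable M" unfolding a_def b_def by measurable
    have dom: "integrable M (\<lambda>\<omega>. \<bar>\<xi> k \<omega>\<bar> ^ 3 / 6 + (s k \<omega>)\<^sup>2 / 8)"
      using int(3,5) k by auto
    have ab_le: "cmod (R k \<omega> * (a \<omega> - of_real (b \<omega>))) \<le> \<bar>\<xi> k \<omega>\<bar> ^ 3 / 6 + (s k \<omega>)\<^sup>2 / 8" for \<omega>
    proof -
      have "cmod (R k \<omega> * (a \<omega> - of_real (b \<omega>))) \<le> 1 * cmod (a \<omega> - of_real (b \<omega>))"
        unfolding norm_mult by (intro mult_right_mono R_le) simp
      also have "\<dots> \<le> cmod (a \<omega>) + \<bar>b \<omega>\<bar>" using norm_triangle_ineq4[of "a \<omega>" "of_real (b \<omega>)"] by simp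
      finally show ?thesis using a_le[of \<omega>] b_le[of \<omega>] by linarith
    qed
    have i3: "integrable M (\<lambda>\<omega>. R k \<omega> * (a \<omega> - of_real (b \<omega>)))"
      by (rule Bochner_Integration.integrable_bound[OF dom]) (use ab_le s0[OF k] in \<open>auto intro!: AE_I2 order_trans[OF ab_le]\<close>)
    have U_Suc: "U (Suc k) \<omega> = R k \<omega> * iexp (\<xi> k \<omega>)" for \<omega>
      by (simp add: U_def R_def distrib_left exp_add mult_ac)
    have U_k: "U k \<omega> = R k \<omega> * of_real (exp (- (s k \<omega> / 2)))" for \<omega>
    proof -
      have "(\<Sum>h\<in>{k..<m}. s h \<omega>) = s k \<omega> + (\<Sum>h\<in>{Suc k..<m}. s h \<omega>)"
        using k by (simp add: sum.atLeast_Suc_lessThan)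
      then have "- (\<Sum>h\<in>{k..<m}. s h \<omega>) / 2 = - (\<Sum>h\<in>{Suc k..<m}. s h \<omega>) / 2 + - (s k \<omega> / 2)" by simp
      then show ?thesis unfolding U_def R_def by (simp only: exp_add of_real_mult mult_ac)
    qed
    \<comment> \<open>Both expansions start with 1. Besides the remainders a and b there is a mean
      term and a variance term, and these two integrate to 0 by the orthogonality
      hypotheses.\<close>
    have "U (Suc k) \<omega> - U k \<omega> = R k \<omega> * (a \<omega> - of_real (b \<omega>)) + \<i> * (R k \<omega> * of_real (\<xi> k \<omega>))
        - (1 / 2) * (R k \<omega> * of_real ((\<xi> k \<omega>)\<^sup>2 - s k \<omega>))" for \<omega>
      unfolding U_Suc U_k a_def b_def by (simp add: algebra_simps)
    then have "(\<integral>\<omega>. U (Suc k) \<omega> - U k \<omega> \<partial>M) = (\<integral>\<omega>. R k \<omega> * (a \<omega> - of_real (b \<omega>)) + \<i> * (R k \<omega> * of_real (\<xi> k \<omega>))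
        - (1 / 2) * (R k \<omega> * of_real ((\<xi> k \<omega>)\<^sup>2 - s k \<omega>)) \<partial>M)" by simp
    also have "\<dots> = (\<integral>\<omega>. R k \<omega> * (a \<omega> - of_real (b \<omega>)) \<partial>M) + \<i> * (\<integral>\<omega>. R k \<omega> * of_real (\<xi> k \<omega>) \<partial>M)
        - (1 / 2) * (\<integral>\<omega>. R k \<omega> * of_real ((\<xi> k \<omega>)\<^sup>2 - s k \<omega>) \<partial>M)"
      using i1 i2 i3
      by (subst Bochner_Integration.integral_diff, simp, simp, subst Bochner_Integration.integral_add, simp, simp)
        (simp only: integral_mult_right_zero)
    also have "\<dots> = (\<integral>\<omega>. R k \<omega> * (a \<omega> - of_real (b \<omega>)) \<partial>M)" by (simp only: z1 z2) simp
    finally have eq: "(\<integral>\<omega>. U (Suc k) \<omega> \<partial>M) - (\<integral>\<omega>. U k \<omega> \<partial>M) = (\<integral>\<omega>. R k \<omega> * (a \<omega> - of_real (b \<omega>)) \<partial>M)"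
      using U_int k by (subst (asm) Bochner_Integration.integral_diff) simp_all
    have "cmod (\<integral>\<omega>. R k \<omega> * (a \<omega> - of_real (b \<omega>)) \<partial>M) \<le> (\<integral>\<omega>. cmod (R k \<omega> * (a \<omega> - of_real (b \<omega>))) \<partial>M)"
      by (rule integral_norm_bound)
    also have "\<dots> \<le> (\<integral>\<omega>. \<bar>\<xi> k \<omega>\<bar> ^ 3 / 6 + (s k \<omega>)\<^sup>2 / 8 \<partial>M)"
      by (intro Bochner_Integration.integral_mono integrable_norm i3 dom ab_le)
    finally show ?thesis unfolding eq .
  qed
  have "(\<integral>\<omega>. U m \<omega> \<partial>M) - (\<integral>\<omega>. U 0 \<omega> \<partial>M) = (\<Sum>k<m. (\<integral>\<omega>. U (Suc k) \<omega> \<partial>M) - (\<integral>\<omega>. U k \<omega> \<partial>M))"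
    by (rule sum_lessThan_telescope[where f = "\<lambda>k. \<integral>\<omega>. U k \<omega> \<partial>M", symmetric])
  also have "cmod \<dots> \<le> (\<Sum>k<m. \<integral>\<omega>. \<bar>\<xi> k \<omega>\<bar> ^ 3 / 6 + (s k \<omega>)\<^sup>2 / 8 \<partial>M)"
    by (intro sum_norm_le step) simp
  finally show ?thesis by (simp add: U_def lessThan_atLeast0)
qed

end

section \<open>Clustered regression\<close>

lemma preimages_subset_sets:
  "(\<And>i. i \<in> I \<Longrightarrow> f i \<in> borel_measurable M) \<Longrightarrow> preimages M I f \<subseteq> sets M"
  unfolding preimages_def by (auto intro: measurable_sets)

lemma preimages_mono: "I \<subseteq> J \<Longrightarrow> preimages M I f \<subseteq> preimages M J f"
  unfolding preimages_def by auto

lemma measurable_sigma_preimages: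
  fixes f :: "'i \<Rightarrow> 'a \<Rightarrow> 'b::topological_space"
  assumes "i \<in> I" "preimages M I f \<subseteq> S" "S \<subseteq> sets M"
  shows "f i \<in> borel_measurable (sigma (space M) S)"
proof (rule measurableI)
  have S: "S \<subseteq> Pow (space M)" using assms(3) sets.space_closed by (rule subset_trans)
  fix B :: "'b set" assume "B \<in> sets borel"
  then have "f i -` B \<inter> space M \<in> S" using assms(1,2) unfolding preimages_def by fast
  then show "f i -` B \<inter> space (sigma (space M) S) \<in> sets (sigma (space M) S)"
    using S by (auto simp: space_measure_of)
qed simp

lemma subalgebra_sigma: "S \<subseteq> sets M \<Longrightarrow> subalgebra M (sigma (space M) S)"
  using sets.space_closed[of M] sets.sigma_sets_subset[of S M]
  by (simp add: subalgebra_def space_measure_of_conv sets_measure_of subset_trans)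

lemma sets_sigma_subset: "S \<subseteq> sets M \<Longrightarrow> sets (sigma (space M) S) = sigma_sets (space M) S"
  using sets.space_closed[of M] by (intro sets_measure_of) (rule subset_trans)

section \<open>The sigma-algebras of one clustered sample\<close>

locale clustered_regression = prob_space M for M :: "'a measure" +
  fixes n K G :: nat and u :: "nat \<Rightarrow> 'a \<Rightarrow> real" and x :: "nat \<Rightarrow> 'a \<Rightarrow> real^'d"
    and w :: "nat \<Rightarrow> 'a \<Rightarrow> real vec" and T :: "nat \<Rightarrow> nat set"
  assumes x_meas: "i \<in> {1..n} \<Longrightarrow> x i \<in> borel_measurable M"
    and u_meas: "i \<in> {1..n} \<Longrightarrow> u i \<in> borel_measurable M"
    and w_carrier: "i \<in> {1..n} \<Longrightarrow> \<omega> \<in> space M \<Longrightarrow> w i \<omega> \<in> carrier_vec K"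
    and w_meas: "i \<in> {1..n} \<Longrightarrow> l < K \<Longrightarrow> (\<lambda>\<omega>. w i \<omega> $v l) \<in> borel_measurable M"
    and u_int: "i \<in> {1..n} \<Longrightarrow> integrable M (u i)"
    and part: "partition_on {1..n} (T ` {1..G})"
    and inj_T: "inj_on T {1..G}"
    and indep: "cond_indep M (sigma_W M n K w) (\<lambda>g. sigma_cluster M (T g) u x) {1..G}"
    and exog: "i \<in> {1..n} \<Longrightarrow> AE \<omega> in M. real_cond_exp M (sigma_XW M n K x w) (u i) \<omega> = 0"
begin

abbreviation "W \<equiv> sigma_W M n K w"
abbreviation "F \<equiv> sigma_XW M n K x w"
abbreviation "A g \<equiv> sigma_cluster M (T g) u x"
abbreviation "WX g \<equiv> sigma (space M) (preimages M (T g) x \<union> W_preimages M n K w)"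
abbreviation "others g \<equiv> {space M \<inter> (\<Inter>h\<in>{1..G} - {g}. E h) | E. \<forall>h\<in>{1..G} - {g}. E h \<in> sets (A h)}"
text \<open>Contains F and the errors of all clusters except g, see \<open>sub_H_F\<close> and
  \<open>sub_H_A\<close>. \<open>others g\<close> consists of intersections of one event per cluster
  and is not itself a sigma-algebra: the uniqueness argument wants an intersection-stable family on
  which the product formula applies directly.\<close>

definition "H g = sigma (space M) (sets (WX g) \<union> others g)"
abbreviation "v i \<omega> \<equiv> vhat n K x w i \<omega>"

lemma T_subset: "g \<in> {1..G} \<Longrightarrow> T g \<subseteq> {1..n}"
  using part unfolding partition_on_def by blast

lemma T_cover: "i \<in> {1..n} \<Longrightarrow> \<exists>g\<in>{1..G}. i \<in> T g"
  using part unfolding partition_on_def by blast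

lemma T_disjoint: "g \<in> {1..G} \<Longrightarrow> h \<in> {1..G} \<Longrightarrow> g \<noteq> h \<Longrightarrow> T g \<inter> T h = {}"
proof -
  assume gh: "g \<in> {1..G}" "h \<in> {1..G}" "g \<noteq> h"
  then have "T g \<noteq> T h" using inj_T by (auto dest: inj_onD)
  then show "T g \<inter> T h = {}" using disjointD[OF partition_onD2[OF part]] gh by blast
qed

lemma sum_clusters: "(\<Sum>g=1..G. \<Sum>i\<in>T g. f i) = (\<Sum>i=1..n. f i)"
proof -
  have "(\<Sum>g\<in>{1..G}. \<Sum>i\<in>T g. f i) = sum f (\<Union>g\<in>{1..G}. T g)"
    by (rule sum.UNION_disjoint[symmetric]) (use T_disjoint finite_subset[OF T_subset] in auto)
  moreover have "(\<Union>g\<in>{1..G}. T g) = {1..n}" using part unfolding partition_on_def by blast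
  ultimately show ?thesis by simp
qed

lemma W_preimages_sets: "W_preimages M n K w \<subseteq> sets M"
  unfolding W_preimages_def by (intro preimages_subset_sets) (auto intro!: w_meas)

lemma x_preimages_sets: "I \<subseteq> {1..n} \<Longrightarrow> preimages M I x \<subseteq> sets M"
  by (intro preimages_subset_sets x_meas) blast

lemma sub_W: "subalgebra M W"
  unfolding sigma_W_def by (intro subalgebra_sigma W_preimages_sets)

lemma sub_F: "subalgebra M F"
  unfolding sigma_XW_def by (intro subalgebra_sigma Un_least W_preimages_sets x_preimages_sets) simp

lemma cluster_preimages_sets: "g \<in> {1..G} \<Longrightarrow> preimages M (T g) (\<lambda>i \<omega>. (u i \<omega>, x i \<omega>)) \<subseteq> sets M"
proof (intro preimages_subset_sets borel_measurable_Pair)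
  fix i assume "g \<in> {1..G}" "i \<in> T g"
  then have "i \<in> {1..n}" using T_subset by blast
  then show "u i \<in> borel_measurable M" "x i \<in> borel_measurable M" by (auto intro: u_meas x_meas)
qed

lemma sub_A: "g \<in> {1..G} \<Longrightarrow> subalgebra M (A g)"
  unfolding sigma_cluster_def by (intro subalgebra_sigma cluster_preimages_sets)

lemma sub_WX: "g \<in> {1..G} \<Longrightarrow> subalgebra M (WX g)"
  by (intro subalgebra_sigma Un_least W_preimages_sets x_preimages_sets T_subset)

lemma A_measurable:
  assumes "g \<in> {1..G}" "i \<in> T g"
  shows "u i \<in> borel_measurable (A g)" "x i \<in> borel_measurable (A g)"
proof -
  have p: "(\<lambda>\<omega>. (u i \<omega>, x i \<omega>)) \<in> borel_measurable (A g)"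
    unfolding sigma_cluster_def
    by (rule measurable_sigma_preimages[OF assms(2) order_refl cluster_preimages_sets[OF assms(1)]])
  show "u i \<in> borel_measurable (A g)"
    using measurable_compose[OF p borel_measurable_continuous_onI[of fst]] by (simp add: continuous_on_fst)
  show "x i \<in> borel_measurable (A g)"
    using measurable_compose[OF p borel_measurable_continuous_onI[of snd]] by (simp add: continuous_on_snd)
qed

lemma sets_W_subset: "sets W \<subseteq> sigma_sets (space M) S" if "W_preimages M n K w \<subseteq> S" for S
  unfolding sigma_W_def sets_sigma_subset[OF W_preimages_sets] by (rule sigma_sets_mono'[OF that])

lemma sub_F_W: "subalgebra F W"
proof -
  have "sets W \<subseteq> sigma_sets (space M) (preimages M {1..n} x \<union> W_preimages M n K w)"
    by (rule sets_W_subset) simp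
  then show ?thesis
    unfolding subalgebra_def using sub_W sub_F
    by (simp add: subalgebra_def sigma_XW_def sets_sigma_subset W_preimages_sets x_preimages_sets)
qed

lemma x_F:
  assumes "i \<in> {1..n}"
  shows "x i \<in> borel_measurable F"
  unfolding sigma_XW_def
  by (rule measurable_sigma_preimages[OF assms]) (use W_preimages_sets x_preimages_sets in auto)

lemma w_W:
  assumes "i \<in> {1..n}" "l < K"
  shows "(\<lambda>\<omega>. w i \<omega> $v l) \<in> borel_measurable W"
  using measurable_sigma_preimages[of "(i, l)" "{1..n} \<times> {..<K}" M "\<lambda>(i, l) \<omega>. w i \<omega> $v l" "W_preimages M n K w"]
    assms W_preimages_sets unfolding sigma_W_def by (simp add: W_preimages_def)

lemma vhat_F: "i \<in> {1..n} \<Longrightarrow> (\<lambda>\<omega>. v i \<omega>) \<in> borel_measurable F"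
  unfolding vhat_def residual_def
proof (intro borel_measurable_sum borel_measurable_scaleR x_F)
  fix j assume "i \<in> {1..n}" "j \<in> {1..n}"
  then show "(\<lambda>\<omega>. annihilator n K (\<lambda>j. w j \<omega>) i j) \<in> borel_measurable F"
  proof (intro borel_measurable_annihilator)
    show "w i \<omega> \<in> carrier_vec K" if "i \<in> {1..n}" "\<omega> \<in> space F" for i \<omega>
      using that sub_F by (intro w_carrier) (simp_all add: subalgebra_def)
    show "(\<lambda>\<omega>. w i \<omega> $v l) \<in> borel_measurable F" if "i \<in> {1..n}" "l < K" for i l
      by (rule measurable_from_subalg[OF sub_F_W w_W[OF that]])
  qed
qed auto

lemma others_sets:
  assumes g: "g \<in> {1..G}"
  shows "others g \<subseteq> sets M" "Int_stable (others g)" "space M \<in> others g"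
proof -
  show "others g \<subseteq> sets M"
  proof
    fix p assume "p \<in> others g"
    then obtain E where p: "p = space M \<inter> (\<Inter>h\<in>{1..G} - {g}. E h)" and E: "\<And>h. h \<in> {1..G} - {g} \<Longrightarrow> E h \<in> sets (A h)"
      by blast
    have "E h \<in> sets M" if "h \<in> {1..G} - {g}" for h
      using E[OF that] sub_A[of h] that by (auto simp: subalgebra_def)
    have "(\<Inter>h\<in>{1..G} - {g}. E h) \<inter> space M \<in> sets M"
    \<comment> \<open>For a single cluster the index set is empty and the intersection is the whole
      type, which explains the explicit \<open>space M\<close> in \<open>others g\<close>.\<close>
    proof (cases "{1..G} - {g} = {}")
      case True
      show ?thesis unfolding True by simp
    next
      case False
      then show ?thesis
        using \<open>\<And>h. h \<in> {1..G} - {g} \<Longrightarrow> E h \<in> sets M\<close> by (intro sets.Int sets.finite_INT sets.top) simp_all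
    qed
    then show "p \<in> sets M" by (simp add: p Int_commute)
  qed
  show "Int_stable (others g)"
  proof (rule Int_stableI)
    fix a b assume "a \<in> others g" "b \<in> others g"
    then obtain E E' where "a = space M \<inter> (\<Inter>h\<in>{1..G} - {g}. E h)" "b = space M \<inter> (\<Inter>h\<in>{1..G} - {g}. E' h)"
      and "\<forall>h\<in>{1..G} - {g}. E h \<in> sets (A h)" "\<forall>h\<in>{1..G} - {g}. E' h \<in> sets (A h)" by blast
    then have "a \<inter> b = space M \<inter> (\<Inter>h\<in>{1..G} - {g}. E h \<inter> E' h)" "\<forall>h\<in>{1..G} - {g}. E h \<inter> E' h \<in> sets (A h)"
      by (auto intro: sets.Int)
    then show "a \<inter> b \<in> others g" by (intro CollectI exI[of _ "\<lambda>h. E h \<inter> E' h"] conjI)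
  qed
  have "\<forall>h\<in>{1..G} - {g}. space M \<in> sets (A h)"
    using sub_A sets.top by (metis DiffD1 subalgebra_def)
  moreover have "space M = space M \<inter> (\<Inter>h\<in>{1..G} - {g}. space M)" by auto
  ultimately show "space M \<in> others g" by (intro CollectI exI[of _ "\<lambda>h. space M"] conjI)
qed

lemma A_others:
  assumes g: "g \<in> {1..G}" and h: "h \<in> {1..G}" "h \<noteq> g" and e: "e \<in> sets (A h)"
  shows "e \<in> others g"
proof -
  let ?E = "\<lambda>k. if k = h then e else space M"
  have sp: "space M \<in> sets (A k)" if "k \<in> {1..G}" for k
    using sub_A[OF that] sets.top[of "A k"] by (simp add: subalgebra_def)
  have "\<forall>k\<in>{1..G} - {g}. ?E k \<in> sets (A k)" using e sp by auto
  moreover have "e = space M \<inter> (\<Inter>k\<in>{1..G} - {g}. ?E k)"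
    using h e sub_A[OF h(1)] sets.sets_into_space[OF e] by (auto simp: subalgebra_def split: if_splits)
  ultimately show ?thesis by (intro CollectI exI[of _ ?E] conjI)
qed

lemma H_gen_sets:
  assumes g: "g \<in> {1..G}"
  shows "sets (WX g) \<union> others g \<subseteq> sets M" "sets (H g) = sigma_sets (space M) (sets (WX g) \<union> others g)"
proof -
  show 1: "sets (WX g) \<union> others g \<subseteq> sets M"
    using sub_WX[OF g] others_sets(1)[OF g] unfolding subalgebra_def by (intro Un_least) simp_all
  show "sets (H g) = sigma_sets (space M) (sets (WX g) \<union> others g)"
    unfolding H_def by (rule sets_sigma_subset[OF 1])
qed

lemma sub_H: "g \<in> {1..G} \<Longrightarrow> subalgebra M (H g)"
  unfolding H_def by (intro subalgebra_sigma H_gen_sets(1))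

lemma sub_H_WX: "g \<in> {1..G} \<Longrightarrow> subalgebra (H g) (WX g)"
  using sub_H[of g] sub_WX[of g] H_gen_sets(2)[of g]
  unfolding subalgebra_def by (auto intro: sigma_sets.Basic)

lemma sub_H_A:
  assumes "g \<in> {1..G}" "h \<in> {1..G}" "h \<noteq> g"
  shows "subalgebra (H g) (A h)"
  using sub_H[OF assms(1)] sub_A[OF assms(2)] H_gen_sets(2)[OF assms(1)] A_others[OF assms]
  unfolding subalgebra_def by (auto intro: sigma_sets.Basic)

lemma sub_F_WX: "g \<in> {1..G} \<Longrightarrow> subalgebra F (WX g)"
proof -
  assume g: "g \<in> {1..G}"
  have "preimages M (T g) x \<subseteq> preimages M {1..n} x" by (rule preimages_mono[OF T_subset[OF g]])
  then have "sigma_sets (space M) (preimages M (T g) x \<union> W_preimages M n K w)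
      \<subseteq> sigma_sets (space M) (preimages M {1..n} x \<union> W_preimages M n K w)"
    by (intro sigma_sets_mono') blast
  then show ?thesis
    using W_preimages_sets x_preimages_sets[OF T_subset[OF g]] x_preimages_sets[OF order_refl]
    by (simp add: subalgebra_def sigma_XW_def sets_sigma_subset space_measure_of_conv)
qed

text \<open>A regressor of cluster g is measurable through \<open>WX g\<close>, any other one
  through the sigma-algebra of its own cluster.\<close>

lemma sub_H_F: "g \<in> {1..G} \<Longrightarrow> subalgebra (H g) F"
proof -
  assume g: "g \<in> {1..G}"
  have "preimages M {1..n} x \<union> W_preimages M n K w \<subseteq> sets (H g)"
  proof (rule Un_least)
    have "W_preimages M n K w \<subseteq> sets (WX g)"
      using W_preimages_sets x_preimages_sets[OF T_subset[OF g]] by (auto simp: sets_sigma_subset)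
    then show "W_preimages M n K w \<subseteq> sets (H g)" using sub_H_WX[OF g] by (auto simp: subalgebra_def)
    show "preimages M {1..n} x \<subseteq> sets (H g)"
    proof
      fix b assume "b \<in> preimages M {1..n} x"
      then obtain i B where i: "i \<in> {1..n}" and b: "b = x i -` B \<inter> space M" and B: "B \<in> sets borel"
        unfolding preimages_def by blast
      obtain h where h: "h \<in> {1..G}" "i \<in> T h" using T_cover[OF i] by blast
      have "x i \<in> borel_measurable (H g)"
      proof (cases "h = g")
        case True
        have "x i \<in> borel_measurable (WX g)"
          by (rule measurable_sigma_preimages[of i "T g"])
            (use h True W_preimages_sets x_preimages_sets[OF T_subset[OF g]] in auto)
        then show ?thesis by (rule measurable_from_subalg[OF sub_H_WX[OF g]])
      next
        case False
        then show ?thesis by (intro measurable_from_subalg[OF sub_H_A[OF g h(1)]] A_measurable h)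
      qed
      from measurable_sets[OF this B] show "b \<in> sets (H g)"
        using sub_H[OF g] by (simp add: b subalgebra_def)
    qed
  qed
  then have "sigma_sets (space M) (preimages M {1..n} x \<union> W_preimages M n K w) \<subseteq> sets (H g)"
    using sets.sigma_sets_subset[of _ "H g"] sub_H[OF g] by (simp add: subalgebra_def)
  then show ?thesis
    using sub_H[OF g] W_preimages_sets x_preimages_sets[OF order_refl]
    by (simp add: subalgebra_def sigma_XW_def sets_sigma_subset space_measure_of_conv)
qed

lemma real_cond_exp_W_space: "AE \<omega> in M. real_cond_exp M W (indicator (space M)) \<omega> = 1"
proof -
  interpret W: sigma_finite_subalgebra M W by (rule sigma_finite_subalgebraI[OF sub_W])
  have "AE \<omega> in M. real_cond_exp M W (\<lambda>_. 1) \<omega> = 1" by (rule W.real_cond_exp_F_meas) simp_all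
  moreover have "AE \<omega> in M. real_cond_exp M W (indicator (space M)) \<omega> = real_cond_exp M W (\<lambda>_. 1) \<omega>"
    by (rule W.real_cond_exp_cong) (auto intro!: AE_I2)
  ultimately show ?thesis by eventually_elim simp
qed

text \<open>The product formula over all clusters is used twice, with e and with the whole space in
  slot g. The second use identifies the remaining product as the conditional probability of
  p.\<close>

lemma indep_others:
  assumes g: "g \<in> {1..G}" and e: "e \<in> sets (A g)" and p: "p \<in> others g"
  shows "AE \<omega> in M. real_cond_exp M W (indicator (e \<inter> p)) \<omega>
    = real_cond_exp M W (indicator e) \<omega> * real_cond_exp M W (indicator p) \<omega>"
proof -
  obtain E where pE: "p = space M \<inter> (\<Inter>h\<in>{1..G} - {g}. E h)" and E: "\<And>h. h \<in> {1..G} - {g} \<Longrightarrow> E h \<in> sets (A h)"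
    using p by blast
  have sp: "space M \<in> sets (A g)" using sub_A[OF g] sets.top[of "A g"] by (simp add: subalgebra_def)
  have prod: "AE \<omega> in M. real_cond_exp M W (indicator (c \<inter> p)) \<omega>
      = real_cond_exp M W (indicator c) \<omega> * (\<Prod>h\<in>{1..G} - {g}. real_cond_exp M W (indicator (E h)) \<omega>)"
    if c: "c \<in> sets (A g)" for c
  proof -
    let ?E = "E(g := c)"
    have "c \<subseteq> space M" using sets.sets_into_space[OF c] sub_A[OF g] by (simp add: subalgebra_def)
    then have eq: "(\<Inter>h\<in>{1..G}. ?E h) = c \<inter> p" using g by (auto simp: pE split: if_splits)
    have "\<forall>j\<in>{1..G}. ?E j \<in> sets (A j)" using E c by simp
    then have "AE \<omega> in M. real_cond_exp M W (indicator (\<Inter>h\<in>{1..G}. ?E h)) \<omega>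
        = (\<Prod>h\<in>{1..G}. real_cond_exp M W (indicator (?E h)) \<omega>)"
      using indep[unfolded cond_indep_def, rule_format, of "{1..G}" ?E] g by fastforce
    moreover have "(\<Prod>h\<in>{1..G}. real_cond_exp M W (indicator (?E h)) \<omega>)
      = real_cond_exp M W (indicator c) \<omega> * (\<Prod>h\<in>{1..G} - {g}. real_cond_exp M W (indicator (E h)) \<omega>)" for \<omega>
      by (subst prod.remove[OF _ g]) (auto intro!: prod.cong)
    ultimately show ?thesis unfolding eq by simp
  qed
  have "space M \<inter> p = p" by (auto simp: pE)
  then have "AE \<omega> in M. real_cond_exp M W (indicator p) \<omega>
      = real_cond_exp M W (indicator (space M)) \<omega> * (\<Prod>h\<in>{1..G} - {g}. real_cond_exp M W (indicator (E h)) \<omega>)"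
    using prod[OF sp] by simp
  with prod[OF e] real_cond_exp_W_space show ?thesis by eventually_elim simp
qed

text \<open>Weak union over \<open>WX g\<close>, once towards \<open>H g\<close> and once towards
  F.\<close>

lemma cluster_nn_cond_exp:
  assumes g: "g \<in> {1..G}" and f: "f \<in> borel_measurable (A g)"
  shows "AE \<omega> in M. nn_cond_exp M (H g) f \<omega> = nn_cond_exp M F f \<omega>"
proof -
  let ?S = "sigma (space M) (sets W \<union> sets (A g))"
  have WA: "sets W \<union> sets (A g) \<subseteq> sets M" using sub_W sub_A[OF g] by (auto simp: subalgebra_def)
  have sets_WX: "sets (WX g) = sigma_sets (space M) (preimages M (T g) x \<union> W_preimages M n K w)"
    using W_preimages_sets x_preimages_sets[OF T_subset[OF g]] by (intro sets_sigma_subset) auto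
  have W_WX: "sets W \<subseteq> sets (WX g)" unfolding sets_WX by (rule sets_W_subset) simp
  have WX_S: "sets (WX g) \<subseteq> sigma_sets (space M) (sets W \<union> sets (A g))"
    unfolding sets_WX
  proof (rule sigma_sets_mono', rule Un_least)
    show "W_preimages M n K w \<subseteq> sets W \<union> sets (A g)"
      unfolding sigma_W_def sets_sigma_subset[OF W_preimages_sets] by (auto intro: sigma_sets.Basic)
    show "preimages M (T g) x \<subseteq> sets W \<union> sets (A g)"
    proof
      fix b assume "b \<in> preimages M (T g) x"
      then obtain i B where i: "i \<in> T g" and b: "b = x i -` B \<inter> space M" and B: "B \<in> sets borel"
        unfolding preimages_def by blast
      from measurable_sets[OF A_measurable(2)[OF g i] B] show "b \<in> sets W \<union> sets (A g)"
        using sub_A[OF g] by (simp add: b subalgebra_def)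
    qed
  qed
  have f': "f \<in> borel_measurable ?S"
  proof (rule measurable_from_subalg[OF _ f])
    show "subalgebra ?S (A g)" using WA sub_A[OF g] by (auto simp: subalgebra_def sets_sigma_subset space_measure_of_conv)
  qed
  note wu = nn_cond_exp_weak_union[OF sub_W sub_A[OF g] sub_WX[OF g] _ W_WX WX_S _ _ others_sets[OF g] indep_others[OF g] f']
  have h: "AE \<omega> in M. nn_cond_exp M (H g) f \<omega> = nn_cond_exp M (WX g) f \<omega>"
    by (rule wu[OF sub_H[OF g]]) (use sub_H_WX[OF g] H_gen_sets(2)[OF g] in \<open>auto simp: subalgebra_def\<close>)
  have k: "AE \<omega> in M. nn_cond_exp M F f \<omega> = nn_cond_exp M (WX g) f \<omega>"
    by (rule wu[OF sub_F])
      (use sub_H_F[OF g] sub_F_WX[OF g] H_gen_sets(2)[OF g] in \<open>simp_all add: subalgebra_def\<close>)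
  show ?thesis using h k by eventually_elim simp
qed

lemma cluster_real_cond_exp:
  assumes g: "g \<in> {1..G}" and f [measurable]: "f \<in> borel_measurable (A g)"
  shows "AE \<omega> in M. real_cond_exp M (H g) f \<omega> = real_cond_exp M F f \<omega>"
proof -
  have "AE \<omega> in M. nn_cond_exp M (H g) (\<lambda>x. ennreal (f x)) \<omega> = nn_cond_exp M F (\<lambda>x. ennreal (f x)) \<omega>"
    "AE \<omega> in M. nn_cond_exp M (H g) (\<lambda>x. ennreal (- f x)) \<omega> = nn_cond_exp M F (\<lambda>x. ennreal (- f x)) \<omega>"
    by (rule cluster_nn_cond_exp[OF g]; simp)+
  then show ?thesis by eventually_elim (simp add: real_cond_exp_def)
qed

text \<open>The form in which cluster independence enters the exchange argument. The multiplier r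
  may depend on the errors of the other clusters, although the conditioning is on F alone.\<close>

lemma cluster_integral:
  assumes g: "g \<in> {1..G}" and f: "f \<in> borel_measurable (A g)" and r: "r \<in> borel_measurable (H g)"
    and int: "integrable M (\<lambda>\<omega>. r \<omega> * f \<omega>)"
  shows "integrable M (\<lambda>\<omega>. r \<omega> * real_cond_exp M F f \<omega>)"
    "(\<integral>\<omega>. r \<omega> * f \<omega> \<partial>M) = (\<integral>\<omega>. r \<omega> * real_cond_exp M F f \<omega> \<partial>M)"
proof -
  interpret H: sigma_finite_subalgebra M "H g" by (rule sigma_finite_subalgebraI[OF sub_H[OF g]])
  have [measurable]: "f \<in> borel_measurable M" "r \<in> borel_measurable M"
    using measurable_from_subalg[OF sub_A[OF g] f] measurable_from_subalg[OF sub_H[OF g] r] by auto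
  have ae: "AE \<omega> in M. r \<omega> * real_cond_exp M (H g) f \<omega> = r \<omega> * real_cond_exp M F f \<omega>"
    using cluster_real_cond_exp[OF g f] by eventually_elim simp
  show "integrable M (\<lambda>\<omega>. r \<omega> * real_cond_exp M F f \<omega>)"
    using H.real_cond_exp_intg(1)[OF int r] ae by (subst integrable_cong_AE[symmetric]) auto
  show "(\<integral>\<omega>. r \<omega> * f \<omega> \<partial>M) = (\<integral>\<omega>. r \<omega> * real_cond_exp M F f \<omega> \<partial>M)"
    using H.real_cond_exp_intg(2)[OF int r] ae by (subst integral_cong_AE[OF _ _ ae, symmetric]) auto
qed

end

section \<open>Conditional moments on events\<close>

context sigma_finite_subalgebra
begin

text \<open>Integrability of f is not assumed: the indicator is pulled out of the positive and the
  negative part separately, where nonnegativity is enough.\<close>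

lemma real_cond_exp_localize:
  assumes f [measurable]: "f \<in> borel_measurable M" and S [measurable]: "S \<in> sets F"
  shows "AE \<omega> in M. \<omega> \<in> S \<longrightarrow> real_cond_exp M F f \<omega> = real_cond_exp M F (\<lambda>\<omega>. indicator S \<omega> * f \<omega>) \<omega>"
proof -
  have "(\<lambda>x. ennreal (indicator S x * f x)) = (\<lambda>x. indicator S x * ennreal (f x))"
    "(\<lambda>x. ennreal (- (indicator S x * f x))) = (\<lambda>x. indicator S x * ennreal (- f x))"
    by (auto simp: indicator_def)
  moreover have "AE \<omega> in M. indicator S \<omega> * nn_cond_exp M F (\<lambda>x. ennreal (f x)) \<omega>
      = nn_cond_exp M F (\<lambda>x. indicator S x * ennreal (f x)) \<omega>"
    by (rule nn_cond_exp_prod) simp_all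
  moreover have "AE \<omega> in M. indicator S \<omega> * nn_cond_exp M F (\<lambda>x. ennreal (- f x)) \<omega>
      = nn_cond_exp M F (\<lambda>x. indicator S x * ennreal (- f x)) \<omega>"
    by (rule nn_cond_exp_prod) simp_all
  ultimately show ?thesis
    by (auto simp: real_cond_exp_def elim!: eventually_elim2)
qed

lemma real_cond_exp_cong_on:
  assumes [measurable]: "f \<in> borel_measurable M" "g \<in> borel_measurable M" and S [measurable]: "S \<in> sets F"
    and eq: "AE \<omega> in M. \<omega> \<in> S \<longrightarrow> f \<omega> = g \<omega>"
  shows "AE \<omega> in M. \<omega> \<in> S \<longrightarrow> real_cond_exp M F f \<omega> = real_cond_exp M F g \<omega>"
proof -
  have [measurable]: "S \<in> sets M" using S subalg by (auto simp: subalgebra_def)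
  have "AE \<omega> in M. real_cond_exp M F (\<lambda>\<omega>. indicator S \<omega> * f \<omega>) \<omega>
      = real_cond_exp M F (\<lambda>\<omega>. indicator S \<omega> * g \<omega>) \<omega>"
    by (rule real_cond_exp_cong, use eq in eventually_elim) (auto simp: indicator_def)
  moreover note real_cond_exp_localize[OF assms(1) S] real_cond_exp_localize[OF assms(2) S]
  ultimately show ?thesis by eventually_elim simp
qed

lemma real_cond_exp_finite_sum:
  assumes "finite I" "\<And>i. i \<in> I \<Longrightarrow> integrable M (f i)"
  shows "AE \<omega> in M. real_cond_exp M F (\<lambda>\<omega>. \<Sum>i\<in>I. f i \<omega>) \<omega> = (\<Sum>i\<in>I. real_cond_exp M F (f i) \<omega>)"
  using assms
proof (induction I)
  case empty
  have "AE \<omega> in M. real_cond_exp M F (\<lambda>_. 0) \<omega> = 0" by (rule real_cond_exp_F_meas) simp_all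
  then show ?case by simp
next
  case (insert i I)
  have "AE \<omega> in M. real_cond_exp M F (\<lambda>\<omega>. f i \<omega> + (\<Sum>i\<in>I. f i \<omega>)) \<omega>
      = real_cond_exp M F (f i) \<omega> + real_cond_exp M F (\<lambda>\<omega>. \<Sum>i\<in>I. f i \<omega>) \<omega>"
    by (rule real_cond_exp_add) (use insert in auto)
  moreover have "AE \<omega> in M. real_cond_exp M F (\<lambda>\<omega>. \<Sum>i\<in>I. f i \<omega>) \<omega> = (\<Sum>i\<in>I. real_cond_exp M F (f i) \<omega>)"
    using insert by auto
  ultimately show ?case by eventually_elim (simp add: insert.hyps)
qed

text \<open>Turns a bound on a conditional moment that holds on an F-measurable event into an
  unconditional one, for weights supported on that event.\<close>

lemma nn_integral_localized_le:
  assumes f [measurable]: "f \<in> borel_measurable F" and g [measurable]: "g \<in> borel_measurable M"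
    and b: "\<And>\<omega>. \<omega> \<in> space M \<Longrightarrow> f \<omega> \<noteq> 0 \<Longrightarrow> nn_cond_exp M F g \<omega> \<le> b"
  shows "(\<integral>\<^sup>+\<omega>. f \<omega> * g \<omega> \<partial>M) \<le> b * (\<integral>\<^sup>+\<omega>. f \<omega> \<partial>M)"
proof -
  have [measurable]: "f \<in> borel_measurable M" by (rule measurable_from_subalg[OF subalg f])
  have "(\<integral>\<^sup>+\<omega>. f \<omega> * g \<omega> \<partial>M) = (\<integral>\<^sup>+\<omega>. f \<omega> * nn_cond_exp M F g \<omega> \<partial>M)"
    by (rule nn_cond_exp_intg[symmetric]) simp_all
  also have "\<dots> \<le> (\<integral>\<^sup>+\<omega>. b * f \<omega> \<partial>M)"
  proof (rule nn_integral_mono)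
    fix \<omega> assume "\<omega> \<in> space M"
    then show "f \<omega> * nn_cond_exp M F g \<omega> \<le> b * f \<omega>"
      using mult_left_mono[OF b, of \<omega> "f \<omega>"] by (cases "f \<omega> = 0") (simp_all add: mult.commute[of b])
  qed
  also have "\<dots> = b * (\<integral>\<^sup>+\<omega>. f \<omega> \<partial>M)" by (rule nn_integral_cmult) simp
  finally show ?thesis .
qed

end

lemma borel_measurable_component: "(\<lambda>z::real^'d. z $ a) \<in> borel_measurable borel"
  by (intro borel_measurable_continuous_onI continuous_on_component continuous_on_id)

lemma outer_mult_vec: "outer a b *v c = (b \<bullet> c) *\<^sub>R a"
  by (simp add: outer_def Finite_Cartesian_Product.vec_eq_iff matrix_vector_mul_component inner_vec_def
      sum_distrib_left sum_distrib_right mult_ac)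

lemma matrix_sum_mult_vec: "(\<Sum>i\<in>I. B i :: real^'n^'m) *v c = (\<Sum>i\<in>I. B i *v c)"
  by (induction I rule: infinite_finite_induct) (auto simp: matrix_vector_mult_add_rdistrib)

context clustered_regression
begin

abbreviation "\<rho> i j \<equiv> real_cond_exp M F (\<lambda>\<omega>. u i \<omega> * u j \<omega>)"
abbreviation "u2 i \<equiv> nn_cond_exp M F (\<lambda>\<omega>. ennreal ((u i \<omega>)\<^sup>2))"

sublocale F: sigma_finite_subalgebra M F by (rule sigma_finite_subalgebraI[OF sub_F])

lemma from_F: "f \<in> borel_measurable F \<Longrightarrow> f \<in> borel_measurable M"
  by (rule measurable_from_subalg[OF sub_F])

lemma F_sets: "S \<in> sets F \<Longrightarrow> S \<in> sets M"
  using sub_F by (auto simp: subalgebra_def)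

lemma square_integrable_on:
  assumes S: "S \<in> sets F" and i: "i \<in> {1..n}" and b: "\<And>\<omega>. \<omega> \<in> S \<Longrightarrow> u2 i \<omega> \<le> ennreal b"
  shows "integrable M (\<lambda>\<omega>. indicator S \<omega> * (u i \<omega>)\<^sup>2)"
proof (rule integrableI_bounded)
  have [measurable]: "u i \<in> borel_measurable M" "S \<in> sets M" using u_meas[OF i] F_sets[OF S] by auto
  show "(\<lambda>\<omega>. indicator S \<omega> * (u i \<omega>)\<^sup>2) \<in> borel_measurable M" by measurable
  have "(\<integral>\<^sup>+\<omega>. ennreal (norm (indicator S \<omega> * (u i \<omega>)\<^sup>2)) \<partial>M) = (\<integral>\<^sup>+\<omega>. indicator S \<omega> * ennreal ((u i \<omega>)\<^sup>2) \<partial>M)"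
    by (intro nn_integral_cong) (auto simp: indicator_def)
  also have "\<dots> \<le> ennreal b * (\<integral>\<^sup>+\<omega>. indicator S \<omega> \<partial>M)"
    by (rule F.nn_integral_localized_le) (use S b in \<open>auto simp: indicator_def split: if_splits\<close>)
  also have "\<dots> < \<infinity>" by (simp add: emeasure_eq_measure ennreal_mult[symmetric] ennreal_mult_less_top)
  finally show "(\<integral>\<^sup>+\<omega>. ennreal (norm (indicator S \<omega> * (u i \<omega>)\<^sup>2)) \<partial>M) < \<infinity>" .
qed

lemma product_integrable_on:
  assumes S: "S \<in> sets F" and i: "i \<in> {1..n}" and j: "j \<in> {1..n}"
    and b: "\<And>k \<omega>. k \<in> {1..n} \<Longrightarrow> \<omega> \<in> S \<Longrightarrow> u2 k \<omega> \<le> ennreal b"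
    and a: "a \<in> borel_measurable M" "\<And>\<omega>. \<omega> \<in> S \<Longrightarrow> \<bar>a \<omega>\<bar> \<le> c"
  shows "integrable M (\<lambda>\<omega>. (indicator S \<omega> * a \<omega>) * (u i \<omega> * u j \<omega>))"
proof (rule Bochner_Integration.integrable_bound)
  show "integrable M (\<lambda>\<omega>. c * (indicator S \<omega> * (u i \<omega>)\<^sup>2 + indicator S \<omega> * (u j \<omega>)\<^sup>2))"
    using square_integrable_on[OF S i b[OF i]] square_integrable_on[OF S j b[OF j]] by auto
  have [measurable]: "u i \<in> borel_measurable M" "u j \<in> borel_measurable M" "S \<in> sets M"
    using u_meas i j F_sets[OF S] by auto
  note a(1)[measurable]
  show "(\<lambda>\<omega>. (indicator S \<omega> * a \<omega>) * (u i \<omega> * u j \<omega>)) \<in> borel_measurable M" by measurable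
  show "AE \<omega> in M. norm ((indicator S \<omega> * a \<omega>) * (u i \<omega> * u j \<omega>))
      \<le> norm (c * (indicator S \<omega> * (u i \<omega>)\<^sup>2 + indicator S \<omega> * (u j \<omega>)\<^sup>2))"
  proof (intro AE_I2)
    fix \<omega>
    have "\<bar>u i \<omega> * u j \<omega>\<bar> \<le> (u i \<omega>)\<^sup>2 + (u j \<omega>)\<^sup>2"
    proof -
      have "0 \<le> \<bar>u i \<omega>\<bar> * \<bar>u j \<omega>\<bar>" by simp
      moreover have "2 * (\<bar>u i \<omega>\<bar> * \<bar>u j \<omega>\<bar>) \<le> (u i \<omega>)\<^sup>2 + (u j \<omega>)\<^sup>2"
        using sum_squares_bound[of "\<bar>u i \<omega>\<bar>" "\<bar>u j \<omega>\<bar>"] by (simp add: mult.assoc)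
      ultimately show ?thesis unfolding abs_mult by linarith
    qed
    then have "\<bar>a \<omega> * (u i \<omega> * u j \<omega>)\<bar> \<le> c * ((u i \<omega>)\<^sup>2 + (u j \<omega>)\<^sup>2)" if "\<omega> \<in> S"
      unfolding abs_mult[of "a \<omega>"] using a(2)[OF that] by (intro mult_mono) auto
    then show "norm ((indicator S \<omega> * a \<omega>) * (u i \<omega> * u j \<omega>))
      \<le> norm (c * (indicator S \<omega> * (u i \<omega>)\<^sup>2 + indicator S \<omega> * (u j \<omega>)\<^sup>2))"
      by (auto simp: indicator_def distrib_left intro: order_trans[OF _ abs_ge_self])
  qed
qed

text \<open>The products may fail to be integrable off S. Localization inserts the indicator of S,
  after which each summand is integrable and its F-measurable coefficient can be pulled out.\<close>

lemma bilinear_cond_exp: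
  assumes S: "S \<in> sets F" and b: "\<And>k \<omega>. k \<in> {1..n} \<Longrightarrow> \<omega> \<in> S \<Longrightarrow> u2 k \<omega> \<le> ennreal b"
    and f: "\<And>i. i \<in> {1..n} \<Longrightarrow> f i \<in> borel_measurable F" "\<And>i \<omega>. i \<in> {1..n} \<Longrightarrow> \<omega> \<in> S \<Longrightarrow> \<bar>f i \<omega>\<bar> \<le> c"
    and g: "\<And>i. i \<in> {1..n} \<Longrightarrow> g i \<in> borel_measurable F" "\<And>i \<omega>. i \<in> {1..n} \<Longrightarrow> \<omega> \<in> S \<Longrightarrow> \<bar>g i \<omega>\<bar> \<le> c"
  shows "AE \<omega> in M. \<omega> \<in> S \<longrightarrow>
    real_cond_exp M F (\<lambda>\<omega>. (\<Sum>i=1..n. f i \<omega> * u i \<omega>) * (\<Sum>j=1..n. g j \<omega> * u j \<omega>)) \<omega>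
      = (\<Sum>i=1..n. \<Sum>j=1..n. f i \<omega> * g j \<omega> * \<rho> i j \<omega>)"
proof -
  let ?I = "{1..n} \<times> {1..n}"
  let ?h = "\<lambda>(i, j) \<omega>. (indicator S \<omega> * (f i \<omega> * g j \<omega>)) * (u i \<omega> * u j \<omega>)"
  have hI: "integrable M (?h p)" if pI: "p \<in> ?I" for p
  proof -
    obtain i j where p: "p = (i, j)" "i \<in> {1..n}" "j \<in> {1..n}" using pI by blast
    have [measurable]: "f i \<in> borel_measurable M" "g j \<in> borel_measurable M"
      using from_F f(1) g(1) p by auto
    have "\<bar>f i \<omega> * g j \<omega>\<bar> \<le> c * c" if "\<omega> \<in> S" for \<omega>
      unfolding abs_mult using f(2)[OF p(2) that] g(2)[OF p(3) that] by (intro mult_mono) auto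
    then show ?thesis unfolding p by (simp, intro product_integrable_on[OF S p(2,3) b]) simp_all
  qed
  have fm: "f i \<in> borel_measurable M" "g i \<in> borel_measurable M" if "i \<in> {1..n}" for i
    using from_F f(1) g(1) that by auto
  have meas: "(\<lambda>\<omega>. (\<Sum>i=1..n. f i \<omega> * u i \<omega>) * (\<Sum>j=1..n. g j \<omega> * u j \<omega>)) \<in> borel_measurable M"
    by (intro borel_measurable_times borel_measurable_sum fm u_meas)
  have eq: "(\<lambda>\<omega>. indicator S \<omega> * ((\<Sum>i=1..n. f i \<omega> * u i \<omega>) * (\<Sum>j=1..n. g j \<omega> * u j \<omega>))) = (\<lambda>\<omega>. \<Sum>p\<in>?I. ?h p \<omega>)"
  proof
    fix \<omega>
    have "(\<Sum>i=1..n. f i \<omega> * u i \<omega>) * (\<Sum>j=1..n. g j \<omega> * u j \<omega>)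
        = (\<Sum>p\<in>?I. (f (fst p) \<omega> * u (fst p) \<omega>) * (g (snd p) \<omega> * u (snd p) \<omega>))"
      by (simp add: sum_product sum.cartesian_product split_beta)
    then show "indicator S \<omega> * ((\<Sum>i=1..n. f i \<omega> * u i \<omega>) * (\<Sum>j=1..n. g j \<omega> * u j \<omega>)) = (\<Sum>p\<in>?I. ?h p \<omega>)"
      by (elim ssubst, unfold sum_distrib_left, intro sum.cong refl) (simp add: split_beta mult_ac)
  qed
  have each: "AE \<omega> in M. \<forall>p\<in>?I. real_cond_exp M F (?h p) \<omega>
      = (indicator S \<omega> * (f (fst p) \<omega> * g (snd p) \<omega>)) * \<rho> (fst p) (snd p) \<omega>"
  proof (rule AE_finite_allI)
    fix p assume p: "p \<in> ?I"
    then obtain i j where ij: "p = (i, j)" "i \<in> {1..n}" "j \<in> {1..n}" by blast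
    note [measurable] = u_meas[OF ij(2)] u_meas[OF ij(3)] f(1)[OF ij(2)] g(1)[OF ij(3)] S
    show "AE \<omega> in M. real_cond_exp M F (?h p) \<omega>
      = (indicator S \<omega> * (f (fst p) \<omega> * g (snd p) \<omega>)) * \<rho> (fst p) (snd p) \<omega>"
      unfolding ij fst_conv snd_conv prod.case
      by (rule F.real_cond_exp_mult) (use hI[OF p] ij in simp_all)
  qed simp
  have sum: "AE \<omega> in M. real_cond_exp M F (\<lambda>\<omega>. \<Sum>p\<in>?I. ?h p \<omega>) \<omega> = (\<Sum>p\<in>?I. real_cond_exp M F (?h p) \<omega>)"
    by (rule F.real_cond_exp_finite_sum) (use hI in auto)
  from F.real_cond_exp_localize[OF meas S] sum each show ?thesis
    unfolding eq
  proof eventually_elim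
    case (elim \<omega>)
    show ?case
    proof
      assume "\<omega> \<in> S"
      then have "real_cond_exp M F (\<lambda>\<omega>. (\<Sum>i=1..n. f i \<omega> * u i \<omega>) * (\<Sum>j=1..n. g j \<omega> * u j \<omega>)) \<omega>
        = (\<Sum>p\<in>?I. f (fst p) \<omega> * g (snd p) \<omega> * \<rho> (fst p) (snd p) \<omega>)"
        using elim by (simp cong: sum.cong)
      then show "real_cond_exp M F (\<lambda>\<omega>. (\<Sum>i=1..n. f i \<omega> * u i \<omega>) * (\<Sum>j=1..n. g j \<omega> * u j \<omega>)) \<omega>
        = (\<Sum>i=1..n. \<Sum>j=1..n. f i \<omega> * g j \<omega> * \<rho> i j \<omega>)"
        by (simp add: sum.cartesian_product split_beta)
    qed
  qed
qed

lemma linear_cond_exp: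
  assumes S: "S \<in> sets F"
    and f: "\<And>i. i \<in> {1..n} \<Longrightarrow> f i \<in> borel_measurable F" "\<And>i \<omega>. i \<in> {1..n} \<Longrightarrow> \<omega> \<in> S \<Longrightarrow> \<bar>f i \<omega>\<bar> \<le> c"
  shows "AE \<omega> in M. \<omega> \<in> S \<longrightarrow> real_cond_exp M F (\<lambda>\<omega>. \<Sum>i=1..n. f i \<omega> * u i \<omega>) \<omega> = 0"
proof -
  let ?h = "\<lambda>i \<omega>. (indicator S \<omega> * f i \<omega>) * u i \<omega>"
  have fm: "f i \<in> borel_measurable M" if "i \<in> {1..n}" for i using from_F f(1) that by auto
  have SM [measurable]: "S \<in> sets M" by (rule F_sets[OF S])
  have hI: "integrable M (?h i)" if i: "i \<in> {1..n}" for i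
  proof (rule Bochner_Integration.integrable_bound)
    show "integrable M (\<lambda>\<omega>. c * u i \<omega>)" using u_int[OF i] by simp
    show "?h i \<in> borel_measurable M" using u_meas[OF i] fm[OF i] by simp
    show "AE \<omega> in M. norm (?h i \<omega>) \<le> norm (c * u i \<omega>)"
    proof (intro AE_I2)
      fix \<omega>
      have "\<bar>f i \<omega>\<bar> * \<bar>u i \<omega>\<bar> \<le> \<bar>c\<bar> * \<bar>u i \<omega>\<bar>" if "\<omega> \<in> S"
        using f(2)[OF i that] by (intro mult_right_mono) auto
      then show "norm (?h i \<omega>) \<le> norm (c * u i \<omega>)" by (simp add: indicator_def abs_mult)
    qed
  qed
  have meas: "(\<lambda>\<omega>. \<Sum>i=1..n. f i \<omega> * u i \<omega>) \<in> borel_measurable M"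
    by (intro borel_measurable_times borel_measurable_sum fm u_meas)
  have eq: "(\<lambda>\<omega>. indicator S \<omega> * (\<Sum>i=1..n. f i \<omega> * u i \<omega>)) = (\<lambda>\<omega>. \<Sum>i=1..n. ?h i \<omega>)"
    by (simp add: sum_distrib_left mult_ac fun_eq_iff)
  have each: "AE \<omega> in M. \<forall>i\<in>{1..n}. real_cond_exp M F (?h i) \<omega> = 0"
  proof (rule AE_finite_allI)
    fix i assume i: "i \<in> {1..n}"
    note [measurable] = u_meas[OF i] f(1)[OF i] S
    have "AE \<omega> in M. real_cond_exp M F (?h i) \<omega> = (indicator S \<omega> * f i \<omega>) * real_cond_exp M F (u i) \<omega>"
      by (rule F.real_cond_exp_mult) (use hI[OF i] in simp_all)
    then show "AE \<omega> in M. real_cond_exp M F (?h i) \<omega> = 0" using exog[OF i] by eventually_elim simp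
  qed simp
  have sum: "AE \<omega> in M. real_cond_exp M F (\<lambda>\<omega>. \<Sum>i=1..n. ?h i \<omega>) \<omega> = (\<Sum>i=1..n. real_cond_exp M F (?h i) \<omega>)"
    by (rule F.real_cond_exp_finite_sum) (use hI in auto)
  from F.real_cond_exp_localize[OF meas S] sum each show ?thesis
    unfolding eq by eventually_elim simp
qed

text \<open>For i in cluster g the factor u_j belongs to another cluster and is measurable in
  \<open>H g\<close>, so u_i may be replaced by its conditional mean given F, which is 0.\<close>

lemma cross_cluster_uncorrelated:
  assumes S: "S \<in> sets F" and b: "\<And>k \<omega>. k \<in> {1..n} \<Longrightarrow> \<omega> \<in> S \<Longrightarrow> u2 k \<omega> \<le> ennreal b"
    and g: "g \<in> {1..G}" "h \<in> {1..G}" "g \<noteq> h" and i: "i \<in> T g" and j: "j \<in> T h"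
  shows "AE \<omega> in M. \<omega> \<in> S \<longrightarrow> \<rho> i j \<omega> = 0"
proof -
  have ij: "i \<in> {1..n}" "j \<in> {1..n}" using subsetD[OF T_subset] g i j by blast+
  note [measurable] = u_meas[OF ij(1)] u_meas[OF ij(2)]
  have int: "integrable M (\<lambda>\<omega>. indicator S \<omega> * (u i \<omega> * u j \<omega>))"
    using product_integrable_on[OF S ij b, of "\<lambda>_. 1" 1] by simp
  have "AE \<omega> in M. real_cond_exp M F (\<lambda>\<omega>. indicator S \<omega> * (u i \<omega> * u j \<omega>)) \<omega> = 0"
  proof (rule F.real_cond_exp_charact[OF _ int])
    fix B assume B: "B \<in> sets F"
    let ?r = "\<lambda>\<omega>. indicator (B \<inter> S) \<omega> * u j \<omega>"
    have BS: "B \<inter> S \<in> sets F" using B S by simp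
    have r: "?r \<in> borel_measurable (H g)"
    proof (rule borel_measurable_times)
      show "indicator (B \<inter> S) \<in> borel_measurable (H g)"
        by (rule measurable_from_subalg[OF sub_H_F[OF g(1)]]) (use BS in simp)
      show "u j \<in> borel_measurable (H g)"
        using g by (intro measurable_from_subalg[OF sub_H_A[OF g(1,2)]] A_measurable j) auto
    qed
    have "integrable M (\<lambda>\<omega>. indicator (B \<inter> S) \<omega> * 1 * (u i \<omega> * u j \<omega>))"
      by (rule product_integrable_on[OF BS ij b]) auto
    then have ri: "integrable M (\<lambda>\<omega>. ?r \<omega> * u i \<omega>)" by (simp add: mult_ac)
    have "(\<integral>\<omega>\<in>B. indicator S \<omega> * (u i \<omega> * u j \<omega>) \<partial>M) = (\<integral>\<omega>. ?r \<omega> * u i \<omega> \<partial>M)"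
      unfolding set_lebesgue_integral_def
      by (intro Bochner_Integration.integral_cong) (auto simp: indicator_def)
    also have "\<dots> = (\<integral>\<omega>. ?r \<omega> * real_cond_exp M F (u i) \<omega> \<partial>M)"
      by (rule cluster_integral(2)[OF g(1) A_measurable(1)[OF g(1) i] r ri])
    also have "\<dots> = 0" using exog[OF ij(1)] by (intro integral_eq_zero_AE) (elim eventually_mono, simp)
    finally show "(\<integral>\<omega>\<in>B. indicator S \<omega> * (u i \<omega> * u j \<omega>) \<partial>M) = (\<integral>\<omega>\<in>B. 0 \<partial>M)"
      by (simp add: set_lebesgue_integral_def)
  qed simp_all
  moreover have "AE \<omega> in M. \<omega> \<in> S \<longrightarrow> \<rho> i j \<omega> = real_cond_exp M F (\<lambda>\<omega>. indicator S \<omega> * (u i \<omega> * u j \<omega>)) \<omega>"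
    by (rule F.real_cond_exp_localize[OF _ S]) simp
  ultimately show ?thesis by eventually_elim simp
qed

text \<open>The products \<open>vhat\<^sub>i u\<^sub>i\<close> need not be integrable, and \<open>real_cond_exp\<close> can then be a junk value. Conditional moments are
  therefore computed on the \<open>F\<close>-measurable sets \<open>trunc k\<close>, which exhaust the event that all \<open>E[u\<^sub>i\<^sup>2 | F]\<close> are
  finite.\<close>

definition trunc :: "nat \<Rightarrow> 'a set" where
  "trunc k = {\<omega> \<in> space M. \<forall>i\<in>{1..n}. u2 i \<omega> \<le> ennreal (real k) \<and> norm (v i \<omega>) \<le> real k}"

lemma trunc_F: "trunc k \<in> sets F"
proof -
  have [measurable]: "(\<lambda>\<omega>. v i \<omega>) \<in> borel_measurable F" if "i \<in> {1..n}" for i by (rule vhat_F[OF that])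
  have "{\<omega> \<in> space F. u2 i \<omega> \<le> ennreal (real k) \<and> norm (v i \<omega>) \<le> real k} \<in> sets F" if "i \<in> {1..n}" for i
    using that by measurable
  then have "{\<omega> \<in> space F. \<forall>i\<in>{1..n}. u2 i \<omega> \<le> ennreal (real k) \<and> norm (v i \<omega>) \<le> real k} \<in> sets F"
    by (intro sets.sets_Collect_finite_All) auto
  moreover have "space F = space M" using sub_F by (simp only: subalgebra_def)
  ultimately show ?thesis by (simp only: trunc_def)
qed

lemma trunc_exhaust:
  assumes \<omega>: "\<omega> \<in> space M" and fin: "\<forall>i\<in>{1..n}. u2 i \<omega> < \<infinity>"
  shows "\<exists>k. \<omega> \<in> trunc k"
proof -
  \<comment> \<open>A sum dominates each of its nonnegative terms, so one k serves every i.\<close>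
  let ?b = "\<Sum>i=1..n. enn2real (u2 i \<omega>) + norm (v i \<omega>)"
  obtain k where k: "?b \<le> real k" using real_arch_simple by blast
  have le: "enn2real (u2 i \<omega>) + norm (v i \<omega>) \<le> real k" if "i \<in> {1..n}" for i
    using member_le_sum[of i "{1..n}" "\<lambda>i. enn2real (u2 i \<omega>) + norm (v i \<omega>)"] that k by simp
  have "enn2real (u2 i \<omega>) \<le> real k \<and> norm (v i \<omega>) \<le> real k" if "i \<in> {1..n}" for i
    using le[OF that] norm_ge_zero[of "v i \<omega>"] enn2real_nonneg[of "u2 i \<omega>"] by linarith
  moreover have "u2 i \<omega> = ennreal (enn2real (u2 i \<omega>))" if "i \<in> {1..n}" for i
    using fin that by (simp add: less_top)
  ultimately have "u2 i \<omega> \<le> ennreal (real k) \<and> norm (v i \<omega>) \<le> real k" if "i \<in> {1..n}" for i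
    using that by (metis ennreal_leI)
  then have "\<omega> \<in> trunc k" unfolding trunc_def using \<omega> by blast
  then show ?thesis by blast
qed

section \<open>The conditional variance of the score\<close>

abbreviation "score \<omega> \<equiv> (1 / sqrt (real n)) *\<^sub>R (\<Sum>i=1..n. u i \<omega> *\<^sub>R v i \<omega>)"

lemma score_nth: "score \<omega> $ p = (\<Sum>i=1..n. v i \<omega> $ p / sqrt (real n) * u i \<omega>)"
  by (simp add: sum_distrib_left mult_ac sum_divide_distrib)

text \<open>The centering in \<open>cond_variance\<close> vanishes on \<open>trunc k\<close>,
  because the score has conditional mean 0 there. What is left is a conditional second moment,
  computed by \<open>bilinear_cond_exp\<close>.\<close>

lemma Sigma_entry_trunc:
  "AE \<omega> in M. \<omega> \<in> trunc k \<longrightarrow> Sigma_n M n K u x w \<omega> $ p $ q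
     = (\<Sum>i=1..n. \<Sum>j=1..n. (v i \<omega> $ p / sqrt (real n)) * (v j \<omega> $ q / sqrt (real n)) * \<rho> i j \<omega>)"
proof -
  let ?f = "\<lambda>p i \<omega>. v i \<omega> $ p / sqrt (real n)"
  let ?m = "vec_cond_exp M F score"
  have fF: "?f p i \<in> borel_measurable F" if "i \<in> {1..n}" for p i
    by (rule borel_measurable_divide[OF measurable_compose[OF vhat_F[OF that] borel_measurable_component]]) simp
  have fb: "\<bar>?f p i \<omega>\<bar> \<le> real k" if i: "i \<in> {1..n}" and \<omega>: "\<omega> \<in> trunc k" for p i \<omega>
  proof -
    have "1 \<le> n" using i by simp
    then have "1 \<le> sqrt (real n)" by simp
    then have "\<bar>?f p i \<omega>\<bar> \<le> \<bar>v i \<omega> $ p\<bar> / 1" unfolding abs_divide by (intro divide_left_mono) auto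
    also have "\<dots> \<le> norm (v i \<omega>)" using component_le_norm_cart[of "v i \<omega>" p] by simp
    also have "\<dots> \<le> real k" using \<omega> i unfolding trunc_def by blast
    finally show ?thesis .
  qed
  have ub: "u2 i \<omega> \<le> ennreal (real k)" if "i \<in> {1..n}" "\<omega> \<in> trunc k" for i \<omega>
    using that by (auto simp: trunc_def)
  have m0: "AE \<omega> in M. \<omega> \<in> trunc k \<longrightarrow> ?m \<omega> $ p = 0" for p
    unfolding vec_cond_exp_def vec_lambda_beta score_nth by (rule linear_cond_exp[OF trunc_F fF fb])
  have sM: "(\<lambda>\<omega>. score \<omega> $ p) \<in> borel_measurable M" for p
    unfolding score_nth by (intro borel_measurable_sum borel_measurable_times from_F fF u_meas)
  have mM: "(\<lambda>\<omega>. ?m \<omega> $ p) \<in> borel_measurable M" for p unfolding vec_cond_exp_def by simp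
  have "AE \<omega> in M. \<omega> \<in> trunc k \<longrightarrow>
      real_cond_exp M F (\<lambda>\<omega>. (score \<omega> $ p - ?m \<omega> $ p) * (score \<omega> $ q - ?m \<omega> $ q)) \<omega>
      = real_cond_exp M F (\<lambda>\<omega>. score \<omega> $ p * score \<omega> $ q) \<omega>"
  proof (rule F.real_cond_exp_cong_on[OF _ _ trunc_F])
    show "(\<lambda>\<omega>. (score \<omega> $ p - ?m \<omega> $ p) * (score \<omega> $ q - ?m \<omega> $ q)) \<in> borel_measurable M"
      by (intro borel_measurable_times borel_measurable_diff sM mM)
    show "(\<lambda>\<omega>. score \<omega> $ p * score \<omega> $ q) \<in> borel_measurable M" by (intro borel_measurable_times sM)
    show "AE \<omega> in M. \<omega> \<in> trunc k \<longrightarrow>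
      (score \<omega> $ p - ?m \<omega> $ p) * (score \<omega> $ q - ?m \<omega> $ q) = score \<omega> $ p * score \<omega> $ q"
      using m0[of p] m0[of q] by eventually_elim simp
  qed
  moreover have "AE \<omega> in M. \<omega> \<in> trunc k \<longrightarrow> real_cond_exp M F (\<lambda>\<omega>. score \<omega> $ p * score \<omega> $ q) \<omega>
      = (\<Sum>i=1..n. \<Sum>j=1..n. ?f p i \<omega> * ?f q j \<omega> * \<rho> i j \<omega>)"
    unfolding score_nth by (rule bilinear_cond_exp[OF trunc_F ub fF fb fF fb])
  ultimately show ?thesis
    unfolding Sigma_n_def cond_variance_def mat_cond_exp_def outer_def vec_lambda_beta vector_minus_component
    by eventually_elim simp
qed

lemma sum_clusters_diagonal:
  assumes "\<And>g h i j. g \<in> {1..G} \<Longrightarrow> h \<in> {1..G} \<Longrightarrow> g \<noteq> h \<Longrightarrow> i \<in> T g \<Longrightarrow> j \<in> T h \<Longrightarrow> f i j = (0::real)"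
  shows "(\<Sum>i=1..n. \<Sum>j=1..n. f i j) = (\<Sum>g=1..G. \<Sum>i\<in>T g. \<Sum>j\<in>T g. f i j)"
proof -
  have "(\<Sum>i=1..n. \<Sum>j=1..n. f i j) = (\<Sum>g=1..G. \<Sum>i\<in>T g. \<Sum>h=1..G. \<Sum>j\<in>T h. f i j)"
    by (simp only: sum_clusters)
  also have "\<dots> = (\<Sum>g=1..G. \<Sum>i\<in>T g. \<Sum>j\<in>T g. f i j)"
  proof (rule sum.cong[OF refl], rule sum.cong[OF refl])
    fix g i assume g: "g \<in> {1..G}" "i \<in> T g"
    have "(\<Sum>h=1..G. \<Sum>j\<in>T h. f i j) = (\<Sum>h=1..G. if h = g then \<Sum>j\<in>T g. f i j else 0)"
      by (intro sum.cong refl) (auto intro!: sum.neutral assms[OF g(1) _ _ g(2)])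
    then show "(\<Sum>h=1..G. \<Sum>j\<in>T h. f i j) = (\<Sum>j\<in>T g. f i j)" using g by simp
  qed
  finally show ?thesis .
qed

text \<open>Over all k, entries and pairs of observations there are countably many null sets. Off
  their union the formula holds on every \<open>trunc k\<close>, and these exhaust the event in
  question; the pairs from different clusters drop out.\<close>

lemma Sigma_formula:
  "AE \<omega> in M. (\<forall>i\<in>{1..n}. u2 i \<omega> < \<infinity>) \<longrightarrow>
     Sigma_n M n K u x w \<omega> = (1 / real n) *\<^sub>R (\<Sum>g=1..G. \<Sum>i\<in>T g. \<Sum>j\<in>T g. \<rho> i j \<omega> *\<^sub>R outer (v i \<omega>) (v j \<omega>))"
proof -
  have ent: "AE \<omega> in M. \<forall>k. \<forall>p\<in>UNIV. \<forall>q\<in>UNIV. \<omega> \<in> trunc k \<longrightarrow> Sigma_n M n K u x w \<omega> $ p $ q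
     = (\<Sum>i=1..n. \<Sum>j=1..n. (v i \<omega> $ p / sqrt (real n)) * (v j \<omega> $ q / sqrt (real n)) * \<rho> i j \<omega>)"
    unfolding AE_all_countable by (intro allI AE_finite_allI Sigma_entry_trunc) simp_all
  have "AE \<omega> in M. \<forall>k. \<forall>g\<in>{1..G}. \<forall>h\<in>{1..G}. \<forall>i\<in>T g. \<forall>j\<in>T h. g \<noteq> h \<longrightarrow> \<omega> \<in> trunc k \<longrightarrow> \<rho> i j \<omega> = 0"
    unfolding AE_all_countable
  proof (intro allI AE_finite_allI)
    fix k g h i j assume g: "g \<in> {1..G}" "h \<in> {1..G}" "i \<in> T g" "j \<in> T h"
    have "AE \<omega> in M. \<omega> \<in> trunc k \<longrightarrow> \<rho> i j \<omega> = 0" if "g \<noteq> h"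
      by (rule cross_cluster_uncorrelated[OF trunc_F _ g(1,2) that g(3,4), where b = "real k"]) (auto simp: trunc_def)
    then show "AE \<omega> in M. g \<noteq> h \<longrightarrow> \<omega> \<in> trunc k \<longrightarrow> \<rho> i j \<omega> = 0" by auto
  qed (auto intro: finite_subset[OF T_subset])
  from ent this AE_space show ?thesis
  proof eventually_elim
    case (elim \<omega>)
    show ?case
    proof
      assume "\<forall>i\<in>{1..n}. u2 i \<omega> < \<infinity>"
      then obtain k where k: "\<omega> \<in> trunc k" using trunc_exhaust[OF elim(3)] by blast
      have "Sigma_n M n K u x w \<omega> $ p $ q
          = ((1 / real n) *\<^sub>R (\<Sum>g=1..G. \<Sum>i\<in>T g. \<Sum>j\<in>T g. \<rho> i j \<omega> *\<^sub>R outer (v i \<omega>) (v j \<omega>))) $ p $ q" for p q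
      proof -
        have "Sigma_n M n K u x w \<omega> $ p $ q
            = (\<Sum>i=1..n. \<Sum>j=1..n. (v i \<omega> $ p / sqrt (real n)) * (v j \<omega> $ q / sqrt (real n)) * \<rho> i j \<omega>)"
          by (rule elim(1)[rule_format, OF UNIV_I UNIV_I k])
        also have "\<dots> = (\<Sum>g=1..G. \<Sum>i\<in>T g. \<Sum>j\<in>T g. (v i \<omega> $ p / sqrt (real n)) * (v j \<omega> $ q / sqrt (real n)) * \<rho> i j \<omega>)"
        proof (rule sum_clusters_diagonal)
          fix g h i j assume g: "g \<in> {1..G}" "h \<in> {1..G}" "g \<noteq> h" "i \<in> T g" "j \<in> T h"
          have "\<rho> i j \<omega> = 0" by (rule elim(2)[rule_format, OF g(1,2,4,5,3) k])
          then show "(v i \<omega> $ p / sqrt (real n)) * (v j \<omega> $ q / sqrt (real n)) * \<rho> i j \<omega> = 0" by simp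
        qed
        also have "\<dots> = (1 / real n) * (\<Sum>g=1..G. \<Sum>i\<in>T g. \<Sum>j\<in>T g. \<rho> i j \<omega> * (v i \<omega> $ p * v j \<omega> $ q))"
        proof -
          have "(a / sqrt (real n)) * (b / sqrt (real n)) * r = (1 / real n) * (r * (a * b))" for a b r
            by (simp add: mult_ac)
          then show ?thesis by (simp only: sum_distrib_left)
        qed
        finally show ?thesis by (simp add: outer_def)
      qed
      then show "Sigma_n M n K u x w \<omega>
          = (1 / real n) *\<^sub>R (\<Sum>g=1..G. \<Sum>i\<in>T g. \<Sum>j\<in>T g. \<rho> i j \<omega> *\<^sub>R outer (v i \<omega>) (v j \<omega>))"
        by (simp add: Finite_Cartesian_Product.vec_eq_iff)
    qed
  qed
qed

lemma Sigma_symmetric: "is_symmetric (Sigma_n M n K u x w \<omega>)"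
  by (simp add: Sigma_n_def cond_variance_def mat_cond_exp_def outer_def
      Finite_Cartesian_Product.transpose_def Finite_Cartesian_Product.vec_eq_iff mult.commute)

text \<open>On \<open>trunc k\<close> the form at c is the conditional second moment of a scalar,
  the inner product of c with the score.\<close>

lemma Sigma_nonneg_trunc: "AE \<omega> in M. \<omega> \<in> trunc k \<longrightarrow> 0 \<le> c \<bullet> (Sigma_n M n K u x w \<omega> *v c)"
proof -
  let ?f = "\<lambda>i \<omega>. (c \<bullet> v i \<omega>) / sqrt (real n)"
  have fF: "?f i \<in> borel_measurable F" if "i \<in> {1..n}" for i
    by (rule borel_measurable_divide[OF borel_measurable_inner[OF borel_measurable_const vhat_F[OF that]]]) simp
  have fb: "\<bar>?f i \<omega>\<bar> \<le> norm c * real k" if i: "i \<in> {1..n}" and \<omega>: "\<omega> \<in> trunc k" for i \<omega>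
  proof -
    have "1 \<le> n" using i by simp
    then have "1 \<le> sqrt (real n)" by simp
    then have "\<bar>?f i \<omega>\<bar> \<le> \<bar>c \<bullet> v i \<omega>\<bar> / 1" unfolding abs_divide by (intro divide_left_mono) auto
    also have "\<dots> \<le> norm c * norm (v i \<omega>)" using Cauchy_Schwarz_ineq2[of c "v i \<omega>"] by simp
    also have "\<dots> \<le> norm c * real k" using \<omega> i by (intro mult_left_mono) (auto simp: trunc_def)
    finally show ?thesis .
  qed
  have ub: "u2 i \<omega> \<le> ennreal (real k)" if "i \<in> {1..n}" "\<omega> \<in> trunc k" for i \<omega>
    using that by (auto simp: trunc_def)
  have ent: "AE \<omega> in M. \<forall>p\<in>UNIV. \<forall>q\<in>UNIV. \<omega> \<in> trunc k \<longrightarrow> Sigma_n M n K u x w \<omega> $ p $ q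
     = (\<Sum>i=1..n. \<Sum>j=1..n. (v i \<omega> $ p / sqrt (real n)) * (v j \<omega> $ q / sqrt (real n)) * \<rho> i j \<omega>)"
    by (intro AE_finite_allI Sigma_entry_trunc) simp_all
  have "AE \<omega> in M. 0 \<le> real_cond_exp M F (\<lambda>\<omega>. (\<Sum>i=1..n. ?f i \<omega> * u i \<omega>) * (\<Sum>i=1..n. ?f i \<omega> * u i \<omega>)) \<omega>"
    by (rule F.real_cond_exp_pos, simp, intro borel_measurable_times borel_measurable_sum from_F[OF fF] u_meas)
  moreover have "AE \<omega> in M. \<omega> \<in> trunc k \<longrightarrow>
    real_cond_exp M F (\<lambda>\<omega>. (\<Sum>i=1..n. ?f i \<omega> * u i \<omega>) * (\<Sum>i=1..n. ?f i \<omega> * u i \<omega>)) \<omega>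
      = (\<Sum>i=1..n. \<Sum>j=1..n. ?f i \<omega> * ?f j \<omega> * \<rho> i j \<omega>)"
    by (rule bilinear_cond_exp[OF trunc_F ub fF fb fF fb])
  ultimately show ?thesis using ent
  proof eventually_elim
    case (elim \<omega>)
    show ?case
    proof
      assume k: "\<omega> \<in> trunc k"
      have "c \<bullet> (Sigma_n M n K u x w \<omega> *v c) = (\<Sum>p\<in>UNIV. \<Sum>q\<in>UNIV. c $ p * (Sigma_n M n K u x w \<omega> $ p $ q * c $ q))"
        by (simp add: inner_vec_def matrix_vector_mult_def sum_distrib_left)
      also have "\<dots> = (\<Sum>p\<in>UNIV. \<Sum>q\<in>UNIV. \<Sum>i=1..n. \<Sum>j=1..n.
          c $ p * ((v i \<omega> $ p / sqrt (real n)) * (v j \<omega> $ q / sqrt (real n)) * \<rho> i j \<omega> * c $ q))"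
        by (simp only: elim(3)[rule_format, OF UNIV_I UNIV_I k] sum_distrib_left sum_distrib_right)
      also have "\<dots> = (\<Sum>i=1..n. \<Sum>j=1..n. \<Sum>p\<in>UNIV. \<Sum>q\<in>UNIV.
          c $ p * ((v i \<omega> $ p / sqrt (real n)) * (v j \<omega> $ q / sqrt (real n)) * \<rho> i j \<omega> * c $ q))"
        by (simp only: sum.swap[of _ "{1..n}" UNIV])
      also have "\<dots> = (\<Sum>i=1..n. \<Sum>j=1..n. ?f i \<omega> * ?f j \<omega> * \<rho> i j \<omega>)"
        unfolding inner_vec_def sum_divide_distrib
        unfolding sum_product
        unfolding sum_distrib_right
        by (intro sum.cong refl) (simp add: mult_ac)
      finally show "0 \<le> c \<bullet> (Sigma_n M n K u x w \<omega> *v c)" using elim k by simp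
    qed
  qed
qed

text \<open>The exceptional null set of \<open>Sigma_nonneg_trunc\<close> depends on c. A countable
  dense set of vectors makes it common, and continuity of the form covers the remaining
  vectors.\<close>

lemma Sigma_pos_semidef:
  "AE \<omega> in M. (\<forall>i\<in>{1..n}. u2 i \<omega> < \<infinity>) \<longrightarrow> pos_semidef (Sigma_n M n K u x w \<omega>)"
proof -
  obtain D :: "(real^'d) set" where D: "countable D" "\<And>X. open X \<Longrightarrow> X \<noteq> {} \<Longrightarrow> \<exists>d\<in>D. d \<in> X"
    using countable_dense_setE by blast
  have dense: "closure D = UNIV"
  proof (rule ccontr)
    assume "closure D \<noteq> UNIV"
    then obtain d where "d \<in> D" "d \<in> - closure D" using D(2)[of "- closure D"] by blast
    then show False using closure_subset[of D] by blast
  qed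
  have "AE \<omega> in M. \<forall>c\<in>D. \<forall>k. \<omega> \<in> trunc k \<longrightarrow> 0 \<le> c \<bullet> (Sigma_n M n K u x w \<omega> *v c)"
    unfolding AE_ball_countable[OF D(1)] AE_all_countable by (intro ballI allI Sigma_nonneg_trunc)
  with AE_space show ?thesis
  proof eventually_elim
    case (elim \<omega>)
    show ?case
    proof
      assume "\<forall>i\<in>{1..n}. u2 i \<omega> < \<infinity>"
      then obtain k where k: "\<omega> \<in> trunc k" using trunc_exhaust[OF elim(1)] by blast
      let ?C = "{c. 0 \<le> c \<bullet> (Sigma_n M n K u x w \<omega> *v c)}"
      have "closed ?C"
        by (intro closed_Collect_le continuous_on_const continuous_on_inner continuous_on_id
            continuous_on_matrix_vector)
      moreover have "D \<subseteq> ?C" using elim(2) k by blast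
      ultimately have "closure D \<subseteq> ?C" by (rule closure_minimal[rotated])
      then have "?C = UNIV" using dense by blast
      then show "pos_semidef (Sigma_n M n K u x w \<omega>)"
        unfolding pos_semidef_def using Sigma_symmetric by blast
    qed
  qed
qed

end

section \<open>Algebra of the standardized statistic\<close>

lemma matrix_inv_unique:
  fixes A B :: "real^'n^'n"
  assumes "A ** B = id_mat"
  shows "matrix_inv A = B"
proof -
  have "invertible A" using assms invertible_right_inverse by blast
  then have "matrix_inv A ** (A ** B) = B" by (simp add: matrix_mul_assoc matrix_inv_left)
  then show ?thesis using assms by simp
qed

lemma invertible_kerI:
  fixes A :: "real^'n^'n"
  assumes "\<And>v. A *v v = 0 \<Longrightarrow> v = 0"
  shows "invertible A"
  using assms matrix_left_invertible_ker invertible_left_inverse by blast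

lemma symmetric_matrix_inv:
  fixes A :: "real^'n^'n"
  assumes A: "is_symmetric A" and inv: "invertible A"
  shows "(matrix_inv A *v x) \<bullet> y = x \<bullet> (matrix_inv A *v y)"
proof -
  have "(matrix_inv A *v x) \<bullet> y = (matrix_inv A *v x) \<bullet> (A *v (matrix_inv A *v y))"
    by (simp add: matrix_vector_mul_assoc matrix_inv_right[OF inv])
  also have "\<dots> = (A *v (matrix_inv A *v x)) \<bullet> (matrix_inv A *v y)" by (simp only: symmetric_dot[OF A])
  also have "\<dots> = x \<bullet> (matrix_inv A *v y)"
    by (simp add: matrix_vector_mul_assoc matrix_inv_right[OF inv])
  finally show ?thesis .
qed

context full_rank_design
begin

text \<open>\<open>S\<close> stands for the conditional variance at one outcome. Its formula enters
  through \<open>S_ker\<close>: the form sees c through the inner products with the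
  residuals.\<close>

context
  fixes x :: "nat \<Rightarrow> real^'d" and y u :: "nat \<Rightarrow> real" and \<beta> :: "real^'d" and \<gamma> :: "real vec" and S :: "real^'d^'d"
  assumes n: "1 \<le> n" and \<gamma>: "\<gamma> \<in> carrier_vec K"
    and model: "\<And>i. i \<in> {1..n} \<Longrightarrow> y i = \<beta> \<bullet> x i + scalar_prod \<gamma> (w i) + u i"
    and S: "pos_semidef S" "invertible S"
    and S_ker: "\<And>c. (\<And>i. i \<in> {1..n} \<Longrightarrow> c \<bullet> residual n K w x i = 0) \<Longrightarrow> c \<bullet> (S *v c) = 0"
begin

abbreviation "r i \<equiv> residual n K w x i"
abbreviation "Gs \<equiv> \<Sum>i=1..n. outer (r i) (r i)"
abbreviation "\<Gamma> \<equiv> (1 / real n) *\<^sub>R Gs"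

lemma Gamma_mult: "Gs *v c = (\<Sum>i=1..n. (r i \<bullet> c) *\<^sub>R r i)"
  by (simp add: matrix_sum_mult_vec outer_mult_vec)

lemma Gs_invertible: "invertible Gs"
proof (rule invertible_kerI)
  fix c assume "Gs *v c = 0"
  then have "c \<bullet> (\<Sum>i=1..n. (r i \<bullet> c) *\<^sub>R r i) = 0" by (simp add: Gamma_mult)
  then have "(\<Sum>i=1..n. (r i \<bullet> c)\<^sup>2) = 0"
    by (simp add: inner_sum_right power2_eq_square inner_commute)
  then have "c \<bullet> r i = 0" if "i \<in> {1..n}" for i
    using that by (simp add: sum_nonneg_eq_0_iff inner_commute)
  then have "c \<bullet> (S *v c) = 0" by (rule S_ker)
  then have "S *v c = 0" by (rule pos_semidef_kernel[OF S(1)])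
  then have "matrix_inv S *v (S *v c) = 0" by simp
  then show "c = 0" by (simp add: matrix_vector_mul_assoc matrix_inv_left[OF S(2)])
qed

lemma Gs_symmetric: "is_symmetric Gs"
  by (rule symmetric_dotI) (simp add: Gamma_mult inner_sum_left inner_sum_right mult.commute inner_commute)

lemma Gamma_inverse: "matrix_inv \<Gamma> = real n *\<^sub>R matrix_inv Gs"
  by (rule matrix_inv_unique) (use n in \<open>simp add: matrix_inv_right[OF Gs_invertible]\<close>)

lemma Gamma_invertible: "invertible \<Gamma>"
proof -
  have "\<Gamma> ** (real n *\<^sub>R matrix_inv Gs) = id_mat" using n by (simp add: matrix_inv_right[OF Gs_invertible])
  then show ?thesis using invertible_right_inverse by blast
qed

lemma Gamma_symmetric: "is_symmetric \<Gamma>"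
  using Gs_symmetric by (simp add: Finite_Cartesian_Product.transpose_def Finite_Cartesian_Product.vec_eq_iff)

text \<open>Inserting the model, the part of the controls is annihilated, and by orthogonality the
  residuals pair with x as they do with themselves, so \<beta> comes out exactly.\<close>

lemma least_squares_error:
  "sqrt (real n) *\<^sub>R (matrix_inv Gs *v (\<Sum>i=1..n. y i *\<^sub>R r i) - \<beta>)
    = matrix_inv \<Gamma> *v ((1 / sqrt (real n)) *\<^sub>R (\<Sum>i=1..n. u i *\<^sub>R r i))"
proof -
  have "(\<Sum>i=1..n. (\<beta> \<bullet> x i) *\<^sub>R r i) = (\<Sum>i=1..n. outer (r i) (x i)) *v \<beta>"
    by (simp add: matrix_sum_mult_vec outer_mult_vec inner_commute)
  also have "\<dots> = Gs *v \<beta>" by (simp only: sum_outer_residual)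
  finally have 1: "(\<Sum>i=1..n. (\<beta> \<bullet> x i) *\<^sub>R r i) = Gs *v \<beta>" .
  have "(\<Sum>i=1..n. scalar_prod \<gamma> (w i) *\<^sub>R r i) = (\<Sum>i=1..n. \<Sum>l<K. \<gamma> $v l *\<^sub>R (w i $v l *\<^sub>R r i))"
  proof (intro sum.cong refl)
    fix i assume "i \<in> {1..n}"
    then have "dim_vec (w i) = K" using w_carrier by auto
    then show "scalar_prod \<gamma> (w i) *\<^sub>R r i = (\<Sum>l<K. \<gamma> $v l *\<^sub>R (w i $v l *\<^sub>R r i))"
      by (simp add: scalar_prod_def scaleR_sum_left lessThan_atLeast0)
  qed
  also have "\<dots> = (\<Sum>l<K. \<gamma> $v l *\<^sub>R (\<Sum>i=1..n. w i $v l *\<^sub>R r i))"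
    unfolding scaleR_sum_right by (rule sum.swap)
  also have "\<dots> = 0" by (simp add: residual_kills_design)
  finally have 2: "(\<Sum>i=1..n. scalar_prod \<gamma> (w i) *\<^sub>R r i) = 0" .
  have "(\<Sum>i=1..n. y i *\<^sub>R r i) = Gs *v \<beta> + (\<Sum>i=1..n. u i *\<^sub>R r i)"
  proof -
    have "(\<Sum>i=1..n. y i *\<^sub>R r i)
        = (\<Sum>i=1..n. (\<beta> \<bullet> x i) *\<^sub>R r i + scalar_prod \<gamma> (w i) *\<^sub>R r i + u i *\<^sub>R r i)"
      by (intro sum.cong refl) (simp only: model scaleR_add_left)
    then show ?thesis by (simp only: sum.distrib 1 2 add_0_right)
  qed
  then have "matrix_inv Gs *v (\<Sum>i=1..n. y i *\<^sub>R r i) = \<beta> + matrix_inv Gs *v (\<Sum>i=1..n. u i *\<^sub>R r i)"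
    by (simp add: matrix_vector_right_distrib matrix_vector_mul_assoc matrix_inv_left[OF Gs_invertible])
  then have "sqrt (real n) *\<^sub>R (matrix_inv Gs *v (\<Sum>i=1..n. y i *\<^sub>R r i) - \<beta>)
      = sqrt (real n) *\<^sub>R (matrix_inv Gs *v (\<Sum>i=1..n. u i *\<^sub>R r i))" by simp
  also have "\<dots> = matrix_inv \<Gamma> *v ((1 / sqrt (real n)) *\<^sub>R (\<Sum>i=1..n. u i *\<^sub>R r i))"
    unfolding Gamma_inverse by (simp add: matrix_vector_mult_scaleR scaleR_matrix_vector_assoc[symmetric] real_div_sqrt)
  finally show ?thesis .
qed

text \<open>With b = R^-1 t and R R = \<Omega>, the form of S at c equals that of \<Omega> at b,
  which is |R b|^2 = |t|^2. The last claim follows from it by \<open>pos_def_inverse_bound\<close>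
  and keeps the weights of the errors bounded.\<close>

lemma standardized_statistic:
  fixes t :: "real^'d"
  defines "R \<equiv> matrix_sqrt (matrix_inv \<Gamma> ** S ** matrix_inv \<Gamma>)"
  defines "c \<equiv> matrix_inv \<Gamma> *v (matrix_inv R *v t)"
  shows "t \<bullet> (matrix_inv R *v (sqrt (real n) *\<^sub>R (matrix_inv Gs *v (\<Sum>i=1..n. y i *\<^sub>R r i) - \<beta>)))
      = (\<Sum>i=1..n. (c \<bullet> r i) / sqrt (real n) * u i)"
    and "c \<bullet> (S *v c) = t \<bullet> t"
    and "c \<bullet> c \<le> (t \<bullet> t) * norm (matrix_inv S)"
proof -
  let ?Gi = "matrix_inv \<Gamma>"
  let ?\<Omega> = "?Gi ** S ** ?Gi"
  have Gi: "(?Gi *v a) \<bullet> b = a \<bullet> (?Gi *v b)" for a b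
    by (rule symmetric_matrix_inv[OF Gamma_symmetric Gamma_invertible])
  have Sd: "(S *v a) \<bullet> b = a \<bullet> (S *v b)" for a b
    using S(1) symmetric_dot by (auto simp: pos_semidef_def)
  have \<Omega>v: "?\<Omega> *v a = ?Gi *v (S *v (?Gi *v a))" for a by (simp add: matrix_vector_mul_assoc matrix_mul_assoc)
  have \<Omega>: "pos_semidef ?\<Omega>"
    unfolding pos_semidef_def
  proof
    show "is_symmetric ?\<Omega>" by (rule symmetric_dotI) (simp only: \<Omega>v Gi Sd)
    have "a \<bullet> (?\<Omega> *v a) = (?Gi *v a) \<bullet> (S *v (?Gi *v a))" for a by (simp only: \<Omega>v Gi)
    then show "\<forall>a. 0 \<le> a \<bullet> (?\<Omega> *v a)" using S(1) by (simp add: pos_semidef_def)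
  qed
  have R: "pos_semidef R" "R ** R = ?\<Omega>" unfolding R_def by (rule matrix_sqrt_props[OF \<Omega>])+
  have Rs: "is_symmetric R" using R(1) by (simp add: pos_semidef_def)
  have Ri: "invertible R"
  proof (rule invertible_kerI)
    fix a assume "R *v a = 0"
    then have "?\<Omega> *v a = 0" unfolding R(2)[symmetric] by (simp add: matrix_vector_mul_assoc[symmetric])
    then have "\<Gamma> *v (?\<Omega> *v a) = 0" by simp
    then have "S *v (?Gi *v a) = 0" unfolding \<Omega>v by (simp only: matrix_vector_mul_assoc[of \<Gamma>] matrix_inv_right[OF Gamma_invertible] matrix_vector_mul_lid)
    then have "matrix_inv S *v (S *v (?Gi *v a)) = 0" by simp
    then have "?Gi *v a = 0" by (simp only: matrix_vector_mul_assoc[of "matrix_inv S"] matrix_inv_left[OF S(2)] matrix_vector_mul_lid)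
    then have "\<Gamma> *v (?Gi *v a) = 0" by simp
    then show "a = 0" by (simp only: matrix_vector_mul_assoc[of \<Gamma>] matrix_inv_right[OF Gamma_invertible] matrix_vector_mul_lid)
  qed
  have "t \<bullet> (matrix_inv R *v (?Gi *v ((1 / sqrt (real n)) *\<^sub>R (\<Sum>i=1..n. u i *\<^sub>R r i))))
      = c \<bullet> ((1 / sqrt (real n)) *\<^sub>R (\<Sum>i=1..n. u i *\<^sub>R r i))"
    unfolding c_def Gi by (simp only: symmetric_matrix_inv[OF Rs Ri])
  also have "\<dots> = (\<Sum>i=1..n. (c \<bullet> r i) / sqrt (real n) * u i)"
    by (simp add: inner_sum_right sum_distrib_left mult_ac sum_divide_distrib)
  finally show "t \<bullet> (matrix_inv R *v (sqrt (real n) *\<^sub>R (matrix_inv Gs *v (\<Sum>i=1..n. y i *\<^sub>R r i) - \<beta>)))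
      = (\<Sum>i=1..n. (c \<bullet> r i) / sqrt (real n) * u i)"
    unfolding least_squares_error .
  let ?b = "matrix_inv R *v t"
  have Rb: "R *v ?b = t" by (simp add: matrix_vector_mul_assoc matrix_inv_right[OF Ri])
  have "c \<bullet> (S *v c) = ?b \<bullet> (?\<Omega> *v ?b)" by (simp only: c_def \<Omega>v Gi)
  also have "\<dots> = (R *v ?b) \<bullet> (R *v ?b)"
    unfolding R(2)[symmetric] by (simp only: matrix_vector_mul_assoc[symmetric] symmetric_dot[OF Rs])
  finally show q: "c \<bullet> (S *v c) = t \<bullet> t" by (simp only: Rb)
  show "c \<bullet> c \<le> (t \<bullet> t) * norm (matrix_inv S)" using pos_def_inverse_bound[OF S, of c] q by simp
qed

end

end

section \<open>The characteristic function of a weighted sum of errors\<close>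

text \<open>Cauchy-Schwarz twice. Each use costs a factor C, and the first one is squared
  afterwards, which gives the cube.\<close>

lemma sum_fourth_power_le:
  fixes f :: "'i \<Rightarrow> real"
  assumes "card I \<le> C"
  shows "(\<Sum>i\<in>I. f i) ^ 4 \<le> real C ^ 3 * (\<Sum>i\<in>I. f i ^ 4)"
proof -
  have c: "real (card I) \<le> real C" using assms by simp
  have nn: "0 \<le> (\<Sum>i\<in>I. (f i)\<^sup>2)" "0 \<le> (\<Sum>i\<in>I. f i ^ 4)" by (auto intro: sum_nonneg)
  have "(\<Sum>i\<in>I. f i)\<^sup>2 \<le> (\<Sum>i\<in>I. (f i)\<^sup>2) * real C"
    using sum_squared_le_sum_of_squares[of f I] mult_left_mono[OF c nn(1)] by linarith
  then have "((\<Sum>i\<in>I. f i)\<^sup>2)\<^sup>2 \<le> ((\<Sum>i\<in>I. (f i)\<^sup>2) * real C)\<^sup>2" by (intro power_mono) auto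
  also have "\<dots> = (\<Sum>i\<in>I. (f i)\<^sup>2)\<^sup>2 * (real C)\<^sup>2" by (simp add: power_mult_distrib)
  also have "\<dots> \<le> ((\<Sum>i\<in>I. f i ^ 4) * real C) * (real C)\<^sup>2"
  proof (intro mult_right_mono)
    have "((f i)\<^sup>2)\<^sup>2 = f i ^ 4" for i by (simp flip: power_mult)
    then have "(\<Sum>i\<in>I. (f i)\<^sup>2)\<^sup>2 \<le> (\<Sum>i\<in>I. f i ^ 4) * real (card I)"
      using sum_squared_le_sum_of_squares[of "\<lambda>i. (f i)\<^sup>2" I] by simp
    then show "(\<Sum>i\<in>I. (f i)\<^sup>2)\<^sup>2 \<le> (\<Sum>i\<in>I. f i ^ 4) * real C"
      using mult_left_mono[OF c nn(2)] by linarith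
  qed simp
  also have "\<dots> = real C ^ 3 * (\<Sum>i\<in>I. f i ^ 4)" by (simp add: power2_eq_square power3_eq_cube)
  finally show ?thesis by (simp flip: power_mult)
qed

text \<open>Expand (|z| - \<alpha>)^2 z^2 >= 0.\<close>

lemma cube_le_interpolation:
  fixes z \<alpha> :: real
  assumes "0 < \<alpha>"
  shows "\<bar>z\<bar> ^ 3 \<le> (\<alpha> * z\<^sup>2 + z ^ 4 / \<alpha>) / 2"
proof -
  have "0 \<le> (\<bar>z\<bar> - \<alpha>)\<^sup>2 * z\<^sup>2" by simp
  also have "(\<bar>z\<bar> - \<alpha>)\<^sup>2 * z\<^sup>2 = z ^ 4 + \<alpha>\<^sup>2 * z\<^sup>2 - 2 * \<alpha> * \<bar>z\<bar> ^ 3"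
  proof -
    have "\<bar>z\<bar> ^ 3 = \<bar>z\<bar> * z\<^sup>2" by (simp add: power3_eq_cube power2_eq_square)
    then show ?thesis by (simp add: power2_diff power2_eq_square power4_eq_xxxx algebra_simps)
  qed
  finally have "2 * \<alpha> * \<bar>z\<bar> ^ 3 \<le> \<alpha> * (\<alpha> * z\<^sup>2 + z ^ 4 / \<alpha>)"
    using assms by (simp add: distrib_left power2_eq_square)
  then have "\<alpha> * (2 * \<bar>z\<bar> ^ 3) \<le> \<alpha> * (\<alpha> * z\<^sup>2 + z ^ 4 / \<alpha>)" by (simp add: mult_ac)
  then have "2 * \<bar>z\<bar> ^ 3 \<le> \<alpha> * z\<^sup>2 + z ^ 4 / \<alpha>" using assms by (simp only: mult_le_cancel_left_pos)
  then show ?thesis by (subst pos_le_divide_eq) (simp_all add: mult.commute)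
qed

context clustered_regression
begin

abbreviation "u4 i \<equiv> nn_cond_exp M F (\<lambda>\<omega>. ennreal ((u i \<omega>) ^ 4))"

text \<open>\<open>C_n\<close> bounds fourth moments from above; the upper bounds on second moments,
  and on covariances below, are derived from them through a^2 <= 1 + a^4.\<close>

lemma second_moment_bound: "i \<in> {1..n} \<Longrightarrow> AE \<omega> in M. u2 i \<omega> \<le> 1 + u4 i \<omega>"
proof -
  assume i: "i \<in> {1..n}"
  note [measurable] = u_meas[OF i]
  have le: "(u i \<omega>)\<^sup>2 \<le> 1 + u i \<omega> ^ 4" for \<omega>
  proof -
    have "2 * (u i \<omega>)\<^sup>2 \<le> 1 + u i \<omega> ^ 4" using sum_squares_bound[of 1 "(u i \<omega>)\<^sup>2"] by (simp flip: power_mult)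
    then show ?thesis using zero_le_power2[of "u i \<omega>"] by linarith
  qed
  have "AE \<omega> in M. u2 i \<omega> \<le> nn_cond_exp M F (\<lambda>\<omega>. 1 + ennreal ((u i \<omega>) ^ 4)) \<omega>"
    by (rule F.nn_cond_exp_mono)
      (auto intro!: AE_I2 ennreal_leI[OF le, THEN order_trans] simp: ennreal_plus simp flip: ennreal_1)
  moreover have "AE \<omega> in M. nn_cond_exp M F (\<lambda>_. 1) \<omega> + u4 i \<omega> = nn_cond_exp M F (\<lambda>\<omega>. 1 + ennreal ((u i \<omega>) ^ 4)) \<omega>"
    by (rule F.nn_cond_exp_sum) simp_all
  moreover have "AE \<omega> in M. 1 = nn_cond_exp M F (\<lambda>_. 1) \<omega>" by (rule F.nn_cond_exp_F_meas) simp
  ultimately show ?thesis by eventually_elim simp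
qed

lemma covariance_bound:
  assumes i: "i \<in> {1..n}" and j: "j \<in> {1..n}"
  shows "AE \<omega> in M. ennreal \<bar>\<rho> i j \<omega>\<bar> \<le> 1 + u4 i \<omega> + u4 j \<omega>"
proof -
  note [measurable] = u_meas[OF i] u_meas[OF j]
  have le: "\<bar>a * b\<bar> \<le> 1 + a ^ 4 + b ^ 4" for a b :: real
  proof -
    have "2 * (\<bar>a\<bar> * \<bar>b\<bar>) \<le> a\<^sup>2 + b\<^sup>2" using sum_squares_bound[of "\<bar>a\<bar>" "\<bar>b\<bar>"] by (simp add: mult.assoc)
    moreover have "2 * a\<^sup>2 \<le> 1 + a ^ 4" using sum_squares_bound[of 1 "a\<^sup>2"] by (simp flip: power_mult)
    moreover have "2 * b\<^sup>2 \<le> 1 + b ^ 4" using sum_squares_bound[of 1 "b\<^sup>2"] by (simp flip: power_mult)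
    moreover have "0 \<le> a ^ 4" "0 \<le> b ^ 4" by simp_all
    ultimately show ?thesis unfolding abs_mult by linarith
  qed
  have "AE \<omega> in M. nn_cond_exp M F (\<lambda>\<omega>. ennreal \<bar>u i \<omega> * u j \<omega>\<bar>) \<omega>
      \<le> nn_cond_exp M F (\<lambda>\<omega>. (1 + ennreal ((u i \<omega>) ^ 4)) + ennreal ((u j \<omega>) ^ 4)) \<omega>"
    by (rule F.nn_cond_exp_mono)
      (auto intro!: AE_I2 ennreal_leI[OF le, THEN order_trans] simp: ennreal_plus simp flip: ennreal_1)
  moreover have "AE \<omega> in M. nn_cond_exp M F (\<lambda>\<omega>. 1 + ennreal ((u i \<omega>) ^ 4)) \<omega> + u4 j \<omega>
      = nn_cond_exp M F (\<lambda>\<omega>. (1 + ennreal ((u i \<omega>) ^ 4)) + ennreal ((u j \<omega>) ^ 4)) \<omega>"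
    by (rule F.nn_cond_exp_sum) simp_all
  moreover have "AE \<omega> in M. nn_cond_exp M F (\<lambda>_. 1) \<omega> + u4 i \<omega> = nn_cond_exp M F (\<lambda>\<omega>. 1 + ennreal ((u i \<omega>) ^ 4)) \<omega>"
    by (rule F.nn_cond_exp_sum) simp_all
  moreover have "AE \<omega> in M. 1 = nn_cond_exp M F (\<lambda>_. 1) \<omega>" by (rule F.nn_cond_exp_F_meas) simp
  moreover have "AE \<omega> in M. ennreal \<bar>\<rho> i j \<omega>\<bar> \<le> nn_cond_exp M F (\<lambda>\<omega>. ennreal \<bar>u i \<omega> * u j \<omega>\<bar>) \<omega>"
    by (rule F.real_cond_exp_abs) simp
  ultimately show ?thesis by eventually_elim simp
qed

text \<open>The weights a_i are cut off outside S, \<kappa> bounds their squares in total, and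
  \<tau> is the conditional variance on S. The first error arises because off S the conditional
  variance is 0 instead of \<tau>. The second comes from the third moments of the cluster sums, by
  interpolation between second and fourth moments. The third comes from the squared cluster
  variances: each is at most (1 + 2 b) (C \<alpha>)^2, and they add up to at most \<tau>.\<close>

lemma char_cluster_close:
  fixes a :: "nat \<Rightarrow> 'a \<Rightarrow> real" and S :: "'a set" and \<alpha> b \<kappa> \<tau> :: real and C :: nat
  assumes S: "S \<in> sets F" and b0: "0 \<le> b" and \<alpha>: "0 < \<alpha>" and \<tau>: "0 \<le> \<tau>"
    and C: "\<And>g. g \<in> {1..G} \<Longrightarrow> card (T g) \<le> C"
    and Su4: "\<And>i \<omega>. i \<in> {1..n} \<Longrightarrow> \<omega> \<in> S \<Longrightarrow> u4 i \<omega> \<le> ennreal b"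
    and Su2: "\<And>i \<omega>. i \<in> {1..n} \<Longrightarrow> \<omega> \<in> S \<Longrightarrow> u2 i \<omega> \<le> ennreal (1 + b)"
    and S\<rho>: "\<And>i j \<omega>. i \<in> {1..n} \<Longrightarrow> j \<in> {1..n} \<Longrightarrow> \<omega> \<in> S \<Longrightarrow> \<bar>\<rho> i j \<omega>\<bar> \<le> 1 + 2 * b"
    and aF: "\<And>i. i \<in> {1..n} \<Longrightarrow> a i \<in> borel_measurable F"
    and a0: "\<And>i \<omega>. i \<in> {1..n} \<Longrightarrow> \<omega> \<notin> S \<Longrightarrow> a i \<omega> = 0"
    and a\<alpha>: "\<And>i \<omega>. i \<in> {1..n} \<Longrightarrow> \<bar>a i \<omega>\<bar> \<le> \<alpha>"
    and a2: "\<And>\<omega>. (\<Sum>i=1..n. (a i \<omega>)\<^sup>2) \<le> \<kappa>"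
    and quad: "AE \<omega> in M. \<omega> \<in> S \<longrightarrow> (\<Sum>g=1..G. \<Sum>i\<in>T g. \<Sum>j\<in>T g. a i \<omega> * a j \<omega> * \<rho> i j \<omega>) = \<tau>"
  shows "cmod ((\<integral>\<omega>. iexp (\<Sum>i=1..n. a i \<omega> * u i \<omega>) \<partial>M) - of_real (exp (- \<tau> / 2)))
    \<le> prob (space M - S) + \<alpha> * (\<tau> + real C ^ 3 * b * \<kappa>) / 12 + \<tau> * (1 + 2 * b) * (real C * \<alpha>)\<^sup>2 / 8"
proof -
  \<comment> \<open>Clusters are numbered from 1, whereas \<open>char_sum_close\<close> counts from
    0; hence \<open>Suc g\<close>.\<close>
  define \<xi> where "\<xi> g \<omega> = (\<Sum>i\<in>T (Suc g). a i \<omega> * u i \<omega>)" for g \<omega>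
  define q where "q g \<omega> = (\<Sum>i\<in>T (Suc g). \<Sum>j\<in>T (Suc g). a i \<omega> * a j \<omega> * \<rho> i j \<omega>)" for g \<omega>
  \<comment> \<open>q is nonnegative almost everywhere, but \<open>char_sum_close\<close> wants a
    pointwise nonnegative variance.\<close>
  define s where "s g \<omega> = max 0 (q g \<omega>)" for g \<omega>
  have gG: "Suc g \<in> {1..G}" if "g < G" for g using that by simp
  have Tn: "i \<in> {1..n}" if "g < G" "i \<in> T (Suc g)" for g i using T_subset[OF gG[OF that(1)]] that(2) by blast
  have SM [measurable]: "S \<in> sets M" by (rule F_sets[OF S])
  have aM: "a i \<in> borel_measurable M" if "i \<in> {1..n}" for i by (rule from_F[OF aF[OF that]])
  have sum_reindex: "(\<Sum>g<G. f (Suc g)) = (\<Sum>g=1..G. f g)" for f :: "nat \<Rightarrow> real"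
    by (simp add: sum.atLeast1_atMost_eq One_nat_def)
  have q_abs: "\<bar>q g \<omega>\<bar> \<le> (1 + 2 * b) * (real C * \<alpha>)\<^sup>2" if g: "g < G" for g \<omega>
  proof -
    have "\<bar>q g \<omega>\<bar> \<le> (\<Sum>i\<in>T (Suc g). \<Sum>j\<in>T (Suc g). \<alpha> * \<alpha> * (1 + 2 * b))"
      unfolding q_def
    proof (rule order_trans[OF sum_abs], rule sum_mono, rule order_trans[OF sum_abs], rule sum_mono)
      fix i j assume ij: "i \<in> T (Suc g)" "j \<in> T (Suc g)"
      note n = Tn[OF g ij(1)] Tn[OF g ij(2)]
      show "\<bar>a i \<omega> * a j \<omega> * \<rho> i j \<omega>\<bar> \<le> \<alpha> * \<alpha> * (1 + 2 * b)"
      proof (cases "\<omega> \<in> S")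
        case True
        show ?thesis unfolding abs_mult
          by (intro mult_mono a\<alpha> S\<rho> n True mult_nonneg_nonneg abs_ge_zero) (use \<alpha> in auto)
      next
        case False
        then show ?thesis using a0[OF n(1)] \<alpha> b0 by simp
      qed
    qed
    also have "\<dots> = real (card (T (Suc g))) ^ 2 * (\<alpha> * \<alpha> * (1 + 2 * b))" by (simp add: power2_eq_square)
    also have "\<dots> \<le> real C ^ 2 * (\<alpha> * \<alpha> * (1 + 2 * b))"
      using C[OF gG[OF g]] b0 by (intro mult_right_mono power_mono) auto
    finally show ?thesis by (simp add: power2_eq_square mult_ac)
  qed
  have qF: "q g \<in> borel_measurable F" if "g < G" for g
    unfolding q_def by (intro borel_measurable_sum borel_measurable_times aF Tn[OF that] borel_measurable_cond_exp)
  have sF: "s g \<in> borel_measurable F" if "g < G" for g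
    unfolding s_def using qF[OF that] by measurable
  have s_le: "s g \<omega> \<le> (1 + 2 * b) * (real C * \<alpha>)\<^sup>2" and s_nonneg: "0 \<le> s g \<omega>" if "g < G" for g \<omega>
    using q_abs[OF that, of \<omega>] b0 by (auto simp: s_def)
  have \<xi>M: "\<xi> g \<in> borel_measurable M" if "g < G" for g
    unfolding \<xi>_def by (intro borel_measurable_sum borel_measurable_times aM u_meas Tn[OF that])
  have sM: "s g \<in> borel_measurable M" if "g < G" for g by (rule from_F[OF sF[OF that]])
  have s_int: "integrable M (s g)" if "g < G" for g
    by (rule integrable_const_bound[of _ "(1 + 2 * b) * (real C * \<alpha>)\<^sup>2"])
      (use s_le[OF that] s_nonneg[OF that] sM[OF that] in auto)
  have s2_int: "integrable M (\<lambda>\<omega>. (s g \<omega>)\<^sup>2)" if "g < G" for g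
    by (rule integrable_const_bound[of _ "((1 + 2 * b) * (real C * \<alpha>)\<^sup>2)\<^sup>2"])
      (use s_le[OF that] s_nonneg[OF that] sM[OF that] in \<open>auto intro!: power_mono\<close>)

  \<comment> \<open>Two of the four factors a_i are bounded by \<alpha>. The other two are kept,
    since the squares of the weights have a bounded sum while their number grows.\<close>
  have a4u4: "(\<integral>\<^sup>+\<omega>. ennreal ((a i \<omega> * u i \<omega>) ^ 4) \<partial>M) \<le> ennreal (b * \<alpha>\<^sup>2 * (\<integral>\<omega>. (a i \<omega>)\<^sup>2 \<partial>M))" if i: "i \<in> {1..n}" for i
  proof -
    note [measurable] = aF[OF i] aM[OF i] u_meas[OF i]
    have a2int: "integrable M (\<lambda>\<omega>. (a i \<omega>)\<^sup>2)"
      by (rule integrable_const_bound[of _ "\<alpha>\<^sup>2"]) (use a\<alpha>[OF i] \<alpha> in \<open>auto simp: abs_le_square_iff[symmetric]\<close>)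
    have "(\<integral>\<^sup>+\<omega>. ennreal ((a i \<omega> * u i \<omega>) ^ 4) \<partial>M) = (\<integral>\<^sup>+\<omega>. ennreal (a i \<omega> ^ 4) * ennreal (u i \<omega> ^ 4) \<partial>M)"
      by (simp add: power_mult_distrib ennreal_mult)
    also have "\<dots> \<le> ennreal b * (\<integral>\<^sup>+\<omega>. ennreal (a i \<omega> ^ 4) \<partial>M)"
    proof (rule F.nn_integral_localized_le)
      fix \<omega> assume "ennreal (a i \<omega> ^ 4) \<noteq> 0"
      then have "\<omega> \<in> S" using a0[OF i, of \<omega>] by auto
      then show "u4 i \<omega> \<le> ennreal b" by (rule Su4[OF i])
    qed measurable
    also have "\<dots> \<le> ennreal b * (\<integral>\<^sup>+\<omega>. ennreal (\<alpha>\<^sup>2 * (a i \<omega>)\<^sup>2) \<partial>M)"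
    proof (intro mult_left_mono nn_integral_mono ennreal_leI)
      fix \<omega>
      have "(a i \<omega>)\<^sup>2 \<le> \<alpha>\<^sup>2" using a\<alpha>[OF i, of \<omega>] \<alpha> by (simp add: abs_le_square_iff[symmetric])
      then have "(a i \<omega>)\<^sup>2 * (a i \<omega>)\<^sup>2 \<le> \<alpha>\<^sup>2 * (a i \<omega>)\<^sup>2" by (intro mult_right_mono) auto
      then show "a i \<omega> ^ 4 \<le> \<alpha>\<^sup>2 * (a i \<omega>)\<^sup>2" by (simp add: power2_eq_square power4_eq_xxxx mult_ac)
    qed simp
    also have "(\<integral>\<^sup>+\<omega>. ennreal (\<alpha>\<^sup>2 * (a i \<omega>)\<^sup>2) \<partial>M) = ennreal (\<integral>\<omega>. \<alpha>\<^sup>2 * (a i \<omega>)\<^sup>2 \<partial>M)"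
      using a2int by (intro nn_integral_eq_integral) auto
    also have "ennreal b * \<dots> = ennreal (b * \<alpha>\<^sup>2 * (\<integral>\<omega>. (a i \<omega>)\<^sup>2 \<partial>M))"
      using b0 by (simp add: ennreal_mult[symmetric] mult.assoc)
    finally show ?thesis .
  qed
  have au4_int: "integrable M (\<lambda>\<omega>. (a i \<omega> * u i \<omega>) ^ 4)" if i: "i \<in> {1..n}" for i
  proof (rule integrableI_nonneg)
    show "(\<lambda>\<omega>. (a i \<omega> * u i \<omega>) ^ 4) \<in> borel_measurable M" using aM[OF i] u_meas[OF i] by measurable
    show "(\<integral>\<^sup>+\<omega>. ennreal ((a i \<omega> * u i \<omega>) ^ 4) \<partial>M) < \<infinity>"
      by (rule order_le_less_trans[OF a4u4[OF i]]) simp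
  qed simp
  have au4_le: "(\<integral>\<omega>. (a i \<omega> * u i \<omega>) ^ 4 \<partial>M) \<le> b * \<alpha>\<^sup>2 * (\<integral>\<omega>. (a i \<omega>)\<^sup>2 \<partial>M)" if i: "i \<in> {1..n}" for i
  proof -
    have "ennreal (\<integral>\<omega>. (a i \<omega> * u i \<omega>) ^ 4 \<partial>M) \<le> ennreal (b * \<alpha>\<^sup>2 * (\<integral>\<omega>. (a i \<omega>)\<^sup>2 \<partial>M))"
      using a4u4[OF i] nn_integral_eq_integral[OF au4_int[OF i]] by simp
    then show ?thesis using b0 by (subst (asm) ennreal_le_iff) auto
  qed

  have \<xi>4_pt: "(\<xi> g \<omega>) ^ 4 \<le> real C ^ 3 * (\<Sum>i\<in>T (Suc g). (a i \<omega> * u i \<omega>) ^ 4)" if "g < G" for g \<omega>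
    unfolding \<xi>_def by (rule sum_fourth_power_le[OF C[OF gG[OF that]]])
  have dom_int: "integrable M (\<lambda>\<omega>. real C ^ 3 * (\<Sum>i\<in>T (Suc g). (a i \<omega> * u i \<omega>) ^ 4))" if "g < G" for g
    by (intro integrable_mult_right Bochner_Integration.integrable_sum au4_int Tn[OF that])
  have \<xi>4_int: "integrable M (\<lambda>\<omega>. (\<xi> g \<omega>) ^ 4)" if g: "g < G" for g
  proof (rule Bochner_Integration.integrable_bound[OF dom_int[OF g]])
    show "(\<lambda>\<omega>. (\<xi> g \<omega>) ^ 4) \<in> borel_measurable M" using \<xi>M[OF g] by measurable
    show "AE \<omega> in M. norm ((\<xi> g \<omega>) ^ 4) \<le> norm (real C ^ 3 * (\<Sum>i\<in>T (Suc g). (a i \<omega> * u i \<omega>) ^ 4))"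
      using order_trans[OF \<xi>4_pt[OF g] abs_ge_self] by (intro AE_I2) simp
  qed
  have \<xi>4_le: "(\<Sum>g<G. \<integral>\<omega>. (\<xi> g \<omega>) ^ 4 \<partial>M) \<le> real C ^ 3 * (b * \<alpha>\<^sup>2 * \<kappa>)"
  proof -
    have "(\<Sum>g<G. \<integral>\<omega>. (\<xi> g \<omega>) ^ 4 \<partial>M) \<le> (\<Sum>g<G. real C ^ 3 * (\<Sum>i\<in>T (Suc g). b * \<alpha>\<^sup>2 * (\<integral>\<omega>. (a i \<omega>)\<^sup>2 \<partial>M)))"
    proof (rule sum_mono)
      fix g assume "g \<in> {..<G}"
      then have g: "g < G" by simp
      have "(\<integral>\<omega>. (\<xi> g \<omega>) ^ 4 \<partial>M) \<le> (\<integral>\<omega>. real C ^ 3 * (\<Sum>i\<in>T (Suc g). (a i \<omega> * u i \<omega>) ^ 4) \<partial>M)"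
        by (intro Bochner_Integration.integral_mono \<xi>4_int dom_int g \<xi>4_pt)
      also have "\<dots> = real C ^ 3 * (\<Sum>i\<in>T (Suc g). \<integral>\<omega>. (a i \<omega> * u i \<omega>) ^ 4 \<partial>M)"
        using au4_int Tn[OF g] by simp
      also have "\<dots> \<le> real C ^ 3 * (\<Sum>i\<in>T (Suc g). b * \<alpha>\<^sup>2 * (\<integral>\<omega>. (a i \<omega>)\<^sup>2 \<partial>M))"
        by (intro mult_left_mono sum_mono au4_le Tn[OF g]) simp_all
      finally show "(\<integral>\<omega>. (\<xi> g \<omega>) ^ 4 \<partial>M) \<le> real C ^ 3 * (\<Sum>i\<in>T (Suc g). b * \<alpha>\<^sup>2 * (\<integral>\<omega>. (a i \<omega>)\<^sup>2 \<partial>M))" .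
    qed
    also have "\<dots> = real C ^ 3 * (\<Sum>i=1..n. b * \<alpha>\<^sup>2 * (\<integral>\<omega>. (a i \<omega>)\<^sup>2 \<partial>M))"
      by (simp only: sum_distrib_left[symmetric] sum_reindex[of "\<lambda>g. \<Sum>i\<in>T g. b * \<alpha>\<^sup>2 * (\<integral>\<omega>. (a i \<omega>)\<^sup>2 \<partial>M)", unfolded sum_clusters])
        (simp only: sum_distrib_left sum_reindex[of "\<lambda>g. \<Sum>i\<in>T g. _ i"] sum_clusters)
    also have "\<dots> = real C ^ 3 * (b * \<alpha>\<^sup>2 * (\<integral>\<omega>. (\<Sum>i=1..n. (a i \<omega>)\<^sup>2) \<partial>M))"
    proof -
      have "integrable M (\<lambda>\<omega>. (a i \<omega>)\<^sup>2)" if i: "i \<in> {1..n}" for i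
        by (rule integrable_const_bound[of _ "\<alpha>\<^sup>2"])
          (use a\<alpha>[OF i] \<alpha> aM[OF i] in \<open>auto simp: abs_le_square_iff[symmetric]\<close>)
      then show ?thesis by (simp add: sum_distrib_left)
    qed
    also have "\<dots> \<le> real C ^ 3 * (b * \<alpha>\<^sup>2 * \<kappa>)"
    proof (intro mult_left_mono)
      have "(\<integral>\<omega>. (\<Sum>i=1..n. (a i \<omega>)\<^sup>2) \<partial>M) \<le> (\<integral>\<omega>. \<kappa> \<partial>M)"
      proof (rule integral_mono_AE')
        have "0 \<le> (\<Sum>i=1..n. (a i undefined)\<^sup>2)" by (intro sum_nonneg) simp
        then show "AE \<omega> in M. 0 \<le> \<kappa>" using a2[of undefined] by auto
      qed (use a2 in auto)
      then show "(\<integral>\<omega>. (\<Sum>i=1..n. (a i \<omega>)\<^sup>2) \<partial>M) \<le> \<kappa>" by (simp add: prob_space)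
    qed (use b0 in auto)
    finally show ?thesis .
  qed

  have pow_le: "\<bar>z\<bar> \<le> 1 + z ^ 4" "z\<^sup>2 \<le> 1 + z ^ 4" "\<bar>z\<bar> ^ 3 \<le> 1 + z ^ 4" for z :: real
  proof -
    have z2: "2 * z\<^sup>2 \<le> 1 + z ^ 4" using sum_squares_bound[of 1 "z\<^sup>2"] by (simp flip: power_mult)
    then show 2: "z\<^sup>2 \<le> 1 + z ^ 4" using zero_le_power2[of z] by linarith
    have "0 \<le> z ^ 4" by simp
    moreover have "2 * \<bar>z\<bar> \<le> 1 + z\<^sup>2" using sum_squares_bound[of 1 "\<bar>z\<bar>"] by simp
    ultimately show "\<bar>z\<bar> \<le> 1 + z ^ 4" using z2 by linarith
    show "\<bar>z\<bar> ^ 3 \<le> 1 + z ^ 4"       using cube_le_interpolation[of 1 z, simplified] 2 by linarith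
  qed
  have \<xi>_dom: "integrable M (\<lambda>\<omega>. 1 + (\<xi> g \<omega>) ^ 4)" if "g < G" for g using \<xi>4_int[OF that] by simp
  have \<xi>_int: "integrable M (\<xi> g)" "integrable M (\<lambda>\<omega>. (\<xi> g \<omega>)\<^sup>2)" "integrable M (\<lambda>\<omega>. \<bar>\<xi> g \<omega>\<bar> ^ 3)" if g: "g < G" for g
  proof -
    note [measurable] = \<xi>M[OF g]
    show "integrable M (\<xi> g)" "integrable M (\<lambda>\<omega>. (\<xi> g \<omega>)\<^sup>2)" "integrable M (\<lambda>\<omega>. \<bar>\<xi> g \<omega>\<bar> ^ 3)"
      by (rule Bochner_Integration.integrable_bound[OF \<xi>_dom[OF g]]; use pow_le order_trans[OF _ abs_ge_self] in force)+
  qed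

  have quad_int: "integrable M (\<lambda>\<omega>. (r \<omega> * (a i \<omega> * a j \<omega>)) * (u i \<omega> * u j \<omega>))"
    if i: "i \<in> {1..n}" and j: "j \<in> {1..n}" and r: "r \<in> borel_measurable M" "\<And>\<omega>. \<bar>r \<omega>\<bar> \<le> 1" for i j r
  proof -
    have "integrable M (\<lambda>\<omega>. (indicator S \<omega> * (r \<omega> * (a i \<omega> * a j \<omega>))) * (u i \<omega> * u j \<omega>))"
    proof (rule product_integrable_on[OF S i j Su2])
      show "(\<lambda>\<omega>. r \<omega> * (a i \<omega> * a j \<omega>)) \<in> borel_measurable M" using r aM[OF i] aM[OF j] by simp
      show "\<bar>r \<omega> * (a i \<omega> * a j \<omega>)\<bar> \<le> 1 * (\<alpha> * \<alpha>)" for \<omega>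
        unfolding abs_mult by (intro mult_mono r a\<alpha> i j) (use \<alpha> in auto)
    qed
    moreover have "indicator S \<omega> * (r \<omega> * (a i \<omega> * a j \<omega>)) = r \<omega> * (a i \<omega> * a j \<omega>)" for \<omega>
      using a0[OF i, of \<omega>] by (auto simp: indicator_def)
    ultimately show ?thesis by simp
  qed
  \<comment> \<open>On S the variance \<open>q g\<close> is the conditional second moment of \<xi>
    g. Setting the weights of the other clusters to 0 makes this an instance of
    \<open>bilinear_cond_exp\<close>.\<close>
  have q_nonneg: "AE \<omega> in M. q g \<omega> = s g \<omega>" if g: "g < G" for g
  proof -
    let ?f = "\<lambda>i \<omega>. if i \<in> T (Suc g) then a i \<omega> else 0"
    have fF: "?f i \<in> borel_measurable F" if "i \<in> {1..n}" for i using aF[OF that] by simp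
    have fb: "\<bar>?f i \<omega>\<bar> \<le> \<alpha>" if "i \<in> {1..n}" for i \<omega> using a\<alpha>[OF that, of \<omega>] \<alpha> by auto
    have q_eq: "(\<Sum>i=1..n. \<Sum>j=1..n. ?f i \<omega> * ?f j \<omega> * \<rho> i j \<omega>) = q g \<omega>" for \<omega>
    proof -
      have sub: "T (Suc g) \<subseteq> {1..n}" using T_subset gG[OF g] by blast
      have "(\<Sum>i=1..n. \<Sum>j=1..n. ?f i \<omega> * ?f j \<omega> * \<rho> i j \<omega>) = (\<Sum>i\<in>T (Suc g). \<Sum>j=1..n. ?f i \<omega> * ?f j \<omega> * \<rho> i j \<omega>)"
        by (rule sum.mono_neutral_right) (use sub in auto)
      also have "\<dots> = (\<Sum>i\<in>T (Suc g). \<Sum>j\<in>T (Suc g). ?f i \<omega> * ?f j \<omega> * \<rho> i j \<omega>)"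
        by (rule sum.cong[OF refl], rule sum.mono_neutral_right) (use sub in auto)
      finally show ?thesis by (simp add: q_def)
    qed
    have "AE \<omega> in M. \<omega> \<in> S \<longrightarrow>
      real_cond_exp M F (\<lambda>\<omega>. (\<Sum>i=1..n. ?f i \<omega> * u i \<omega>) * (\<Sum>j=1..n. ?f j \<omega> * u j \<omega>)) \<omega>
        = (\<Sum>i=1..n. \<Sum>j=1..n. ?f i \<omega> * ?f j \<omega> * \<rho> i j \<omega>)"
      by (rule bilinear_cond_exp[OF S Su2 fF fb fF fb])
    moreover have "AE \<omega> in M. 0 \<le> real_cond_exp M F (\<lambda>\<omega>. (\<Sum>i=1..n. ?f i \<omega> * u i \<omega>) * (\<Sum>j=1..n. ?f j \<omega> * u j \<omega>)) \<omega>"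
      by (rule F.real_cond_exp_pos, simp, intro borel_measurable_times borel_measurable_sum from_F[OF fF] u_meas)
    ultimately show ?thesis
    proof eventually_elim
      case (elim \<omega>)
      have "0 \<le> q g \<omega>"
      proof (cases "\<omega> \<in> S")
        case False
        then have "q g \<omega> = 0" unfolding q_def
          by (intro sum.neutral ballI) (simp add: a0[OF Tn[OF g]])
        then show ?thesis by simp
      qed (use elim q_eq[of \<omega>] in simp)
      then show ?case by (simp add: s_def)
    qed
  qed
  have orth1: "(\<integral>\<omega>. r \<omega> * \<xi> g \<omega> \<partial>M) = 0"
    if g: "g < G" and r: "r \<in> borel_measurable (H (Suc g))" "\<And>\<omega>. \<bar>r \<omega>\<bar> \<le> 1" for g r
  proof -
    have rM: "r \<in> borel_measurable M" by (rule measurable_from_subalg[OF sub_H[OF gG[OF g]] r(1)])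
    have each: "integrable M (\<lambda>\<omega>. (r \<omega> * a i \<omega>) * u i \<omega>) \<and> (\<integral>\<omega>. (r \<omega> * a i \<omega>) * u i \<omega> \<partial>M) = 0" if i: "i \<in> T (Suc g)" for i
    proof
      note iN = Tn[OF g i]
      show int: "integrable M (\<lambda>\<omega>. (r \<omega> * a i \<omega>) * u i \<omega>)"
      proof (rule Bochner_Integration.integrable_bound)
        show "integrable M (\<lambda>\<omega>. \<alpha> * u i \<omega>)" using u_int[OF iN] by simp
        show "(\<lambda>\<omega>. (r \<omega> * a i \<omega>) * u i \<omega>) \<in> borel_measurable M" using rM aM[OF iN] u_meas[OF iN] by simp
        show "AE \<omega> in M. norm ((r \<omega> * a i \<omega>) * u i \<omega>) \<le> norm (\<alpha> * u i \<omega>)"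
        proof (intro AE_I2)
          fix \<omega>
          have "\<bar>r \<omega>\<bar> * \<bar>a i \<omega>\<bar> \<le> 1 * \<alpha>" by (intro mult_mono r a\<alpha> iN) auto
          then show "norm ((r \<omega> * a i \<omega>) * u i \<omega>) \<le> norm (\<alpha> * u i \<omega>)"
            using \<alpha> by (simp add: abs_mult mult_right_mono)
        qed
      qed
      have "(\<integral>\<omega>. (r \<omega> * a i \<omega>) * u i \<omega> \<partial>M) = (\<integral>\<omega>. (r \<omega> * a i \<omega>) * real_cond_exp M F (u i) \<omega> \<partial>M)"
        by (rule cluster_integral(2)[OF gG[OF g] A_measurable(1)[OF gG[OF g] i] _ int])
          (intro borel_measurable_times r measurable_from_subalg[OF sub_H_F[OF gG[OF g]]] aF iN)
      also have "\<dots> = 0" using exog[OF iN] by (intro integral_eq_zero_AE) (elim eventually_mono, simp)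
      finally show "(\<integral>\<omega>. (r \<omega> * a i \<omega>) * u i \<omega> \<partial>M) = 0" .
    qed
    have "(\<integral>\<omega>. r \<omega> * \<xi> g \<omega> \<partial>M) = (\<integral>\<omega>. (\<Sum>i\<in>T (Suc g). (r \<omega> * a i \<omega>) * u i \<omega>) \<partial>M)"
      by (simp add: \<xi>_def sum_distrib_left mult.assoc)
    also have "\<dots> = (\<Sum>i\<in>T (Suc g). \<integral>\<omega>. (r \<omega> * a i \<omega>) * u i \<omega> \<partial>M)"
      by (rule Bochner_Integration.integral_sum) (use each in blast)
    also have "\<dots> = 0" using each by simp
    finally show ?thesis .
  qed
  have orth2: "(\<integral>\<omega>. r \<omega> * ((\<xi> g \<omega>)\<^sup>2 - s g \<omega>) \<partial>M) = 0"
    if g: "g < G" and r: "r \<in> borel_measurable (H (Suc g))" "\<And>\<omega>. \<bar>r \<omega>\<bar> \<le> 1" for g r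
  proof -
    have rM [measurable]: "r \<in> borel_measurable M" by (rule measurable_from_subalg[OF sub_H[OF gG[OF g]] r(1)])
    let ?p = "\<lambda>i j \<omega>. r \<omega> * (a i \<omega> * a j \<omega>)"
    have each: "integrable M (\<lambda>\<omega>. ?p i j \<omega> * (u i \<omega> * u j \<omega>))" "integrable M (\<lambda>\<omega>. ?p i j \<omega> * \<rho> i j \<omega>)"
      "(\<integral>\<omega>. ?p i j \<omega> * (u i \<omega> * u j \<omega>) \<partial>M) = (\<integral>\<omega>. ?p i j \<omega> * \<rho> i j \<omega> \<partial>M)"
      if i: "i \<in> T (Suc g)" and j: "j \<in> T (Suc g)" for i j
    proof -
      note N = Tn[OF g i] Tn[OF g j]
      show int: "integrable M (\<lambda>\<omega>. ?p i j \<omega> * (u i \<omega> * u j \<omega>))" by (rule quad_int[OF N rM r(2)])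
      have m: "(\<lambda>\<omega>. u i \<omega> * u j \<omega>) \<in> borel_measurable (A (Suc g))"
        by (intro borel_measurable_times A_measurable(1)[OF gG[OF g]] i j)
      have p: "?p i j \<in> borel_measurable (H (Suc g))"
        by (intro borel_measurable_times r measurable_from_subalg[OF sub_H_F[OF gG[OF g]]] aF N)
      show "integrable M (\<lambda>\<omega>. ?p i j \<omega> * \<rho> i j \<omega>)"
        "(\<integral>\<omega>. ?p i j \<omega> * (u i \<omega> * u j \<omega>) \<partial>M) = (\<integral>\<omega>. ?p i j \<omega> * \<rho> i j \<omega> \<partial>M)"
        using cluster_integral[OF gG[OF g] m p int] by auto
    qed
    have e1: "r \<omega> * (\<xi> g \<omega>)\<^sup>2 = (\<Sum>i\<in>T (Suc g). \<Sum>j\<in>T (Suc g). ?p i j \<omega> * (u i \<omega> * u j \<omega>))" for \<omega>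
      unfolding \<xi>_def power2_eq_square
      unfolding sum_product
      unfolding sum_distrib_left by (simp add: mult_ac)
    have e2: "r \<omega> * q g \<omega> = (\<Sum>i\<in>T (Suc g). \<Sum>j\<in>T (Suc g). ?p i j \<omega> * \<rho> i j \<omega>)" for \<omega>
      unfolding q_def sum_distrib_left by (simp add: mult_ac)
    have i1: "integrable M (\<lambda>\<omega>. r \<omega> * (\<xi> g \<omega>)\<^sup>2)" unfolding e1
      by (intro Bochner_Integration.integrable_sum each(1))
    have i2: "integrable M (\<lambda>\<omega>. r \<omega> * q g \<omega>)" unfolding e2
      by (intro Bochner_Integration.integrable_sum each(2))
    have eq: "(\<integral>\<omega>. r \<omega> * (\<xi> g \<omega>)\<^sup>2 \<partial>M) = (\<integral>\<omega>. r \<omega> * q g \<omega> \<partial>M)"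
    proof -
      have dbl: "(\<integral>\<omega>. (\<Sum>i\<in>T (Suc g). \<Sum>j\<in>T (Suc g). h i j \<omega>) \<partial>M) = (\<Sum>i\<in>T (Suc g). \<Sum>j\<in>T (Suc g). \<integral>\<omega>. h i j \<omega> \<partial>M)"
        if h: "\<And>i j. i \<in> T (Suc g) \<Longrightarrow> j \<in> T (Suc g) \<Longrightarrow> integrable M (h i j)" for h :: "nat \<Rightarrow> nat \<Rightarrow> 'a \<Rightarrow> real"
      proof -
        have "(\<integral>\<omega>. (\<Sum>i\<in>T (Suc g). \<Sum>j\<in>T (Suc g). h i j \<omega>) \<partial>M) = (\<Sum>i\<in>T (Suc g). \<integral>\<omega>. (\<Sum>j\<in>T (Suc g). h i j \<omega>) \<partial>M)"
          by (rule Bochner_Integration.integral_sum) (intro Bochner_Integration.integrable_sum h)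
        also have "\<dots> = (\<Sum>i\<in>T (Suc g). \<Sum>j\<in>T (Suc g). \<integral>\<omega>. h i j \<omega> \<partial>M)"
          by (rule sum.cong[OF refl], rule Bochner_Integration.integral_sum) (rule h)
        finally show ?thesis .
      qed
      have "(\<integral>\<omega>. r \<omega> * (\<xi> g \<omega>)\<^sup>2 \<partial>M) = (\<Sum>i\<in>T (Suc g). \<Sum>j\<in>T (Suc g). \<integral>\<omega>. ?p i j \<omega> * (u i \<omega> * u j \<omega>) \<partial>M)"
        unfolding e1 by (rule dbl) (rule each(1))
      also have "\<dots> = (\<Sum>i\<in>T (Suc g). \<Sum>j\<in>T (Suc g). \<integral>\<omega>. ?p i j \<omega> * \<rho> i j \<omega> \<partial>M)"
        by (intro sum.cong refl each(3))
      also have "\<dots> = (\<integral>\<omega>. r \<omega> * q g \<omega> \<partial>M)"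
        unfolding e2 by (rule dbl[symmetric]) (rule each(2))
      finally show ?thesis .
    qed
    have "(\<integral>\<omega>. r \<omega> * ((\<xi> g \<omega>)\<^sup>2 - s g \<omega>) \<partial>M) = (\<integral>\<omega>. r \<omega> * (\<xi> g \<omega>)\<^sup>2 - r \<omega> * q g \<omega> \<partial>M)"
    proof (rule integral_cong_AE)
      show "AE \<omega> in M. r \<omega> * ((\<xi> g \<omega>)\<^sup>2 - s g \<omega>) = r \<omega> * (\<xi> g \<omega>)\<^sup>2 - r \<omega> * q g \<omega>"
        using q_nonneg[OF g] by eventually_elim (simp add: right_diff_distrib)
    qed (use i1 i2 \<xi>M[OF g] sM[OF g] in measurable)
    also have "\<dots> = 0" using i1 i2 eq by simp
    finally show ?thesis .
  qed

  have main: "cmod ((\<integral>\<omega>. iexp (\<Sum>g<G. \<xi> g \<omega>) \<partial>M) - (\<integral>\<omega>. of_real (exp (- (\<Sum>g<G. s g \<omega>) / 2)) \<partial>M))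
      \<le> (\<Sum>g<G. \<integral>\<omega>. \<bar>\<xi> g \<omega>\<bar> ^ 3 / 6 + (s g \<omega>)\<^sup>2 / 8 \<partial>M)"
  proof (rule char_sum_close[where H = "\<lambda>g. H (Suc g)"])
    show "subalgebra M (H (Suc g))" if "g < G" for g by (rule sub_H[OF gG[OF that]])
    show "\<xi> h \<in> borel_measurable (H (Suc g))" if "g < G" "h < G" "h \<noteq> g" for g h
      unfolding \<xi>_def
    proof (intro borel_measurable_sum borel_measurable_times)
      fix i assume i: "i \<in> T (Suc h)"
      show "a i \<in> borel_measurable (H (Suc g))"
        by (intro measurable_from_subalg[OF sub_H_F[OF gG[OF that(1)]]] aF Tn[OF that(2) i])
      have "Suc h \<noteq> Suc g" using that(3) by simp
      then show "u i \<in> borel_measurable (H (Suc g))"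
        by (rule measurable_from_subalg[OF sub_H_A[OF gG[OF that(1)] gG[OF that(2)]] A_measurable(1)[OF gG[OF that(2)] i]])
    qed
    show "s h \<in> borel_measurable (H (Suc g))" if "g < G" "h < G" for g h
      by (rule measurable_from_subalg[OF sub_H_F[OF gG[OF that(1)]] sF[OF that(2)]])
  qed (use \<xi>M s_nonneg \<xi>_int s_int s2_int orth1 orth2 in auto)

  have sums: "(\<Sum>g<G. \<xi> g \<omega>) = (\<Sum>i=1..n. a i \<omega> * u i \<omega>)" for \<omega>
    unfolding \<xi>_def sum_reindex[of "\<lambda>g. \<Sum>i\<in>T g. a i \<omega> * u i \<omega>"] by (rule sum_clusters)
  have s_sum: "AE \<omega> in M. (\<Sum>g<G. s g \<omega>) = \<tau> * indicator S \<omega>"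
  proof -
    have "AE \<omega> in M. \<forall>g\<in>{..<G}. q g \<omega> = s g \<omega>" by (intro AE_finite_allI q_nonneg) auto
    then show ?thesis using quad
    proof eventually_elim
      case (elim \<omega>)
      have "(\<Sum>g<G. s g \<omega>) = (\<Sum>g<G. q g \<omega>)" using elim(1) by simp
      also have "\<dots> = (\<Sum>g=1..G. \<Sum>i\<in>T g. \<Sum>j\<in>T g. a i \<omega> * a j \<omega> * \<rho> i j \<omega>)"
        unfolding q_def by (rule sum_reindex)
      also have "\<dots> = \<tau> * indicator S \<omega>"
      proof (cases "\<omega> \<in> S")
        case False
        have "(\<Sum>g=1..G. \<Sum>i\<in>T g. \<Sum>j\<in>T g. a i \<omega> * a j \<omega> * \<rho> i j \<omega>) = 0"
        proof (intro sum.neutral ballI)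
          fix g i j assume "g \<in> {1..G}" "i \<in> T g"
          then have "i \<in> {1..n}" using T_subset by blast
          then show "a i \<omega> * a j \<omega> * \<rho> i j \<omega> = 0" using a0 False by simp
        qed
        then show ?thesis using False by simp
      qed (use elim(2) in simp)
      finally show ?case .
    qed
  qed
  have s_total: "(\<Sum>g<G. \<integral>\<omega>. s g \<omega> \<partial>M) \<le> \<tau>"
  proof -
    have "(\<Sum>g<G. \<integral>\<omega>. s g \<omega> \<partial>M) = (\<integral>\<omega>. (\<Sum>g<G. s g \<omega>) \<partial>M)"
      by (rule Bochner_Integration.integral_sum[symmetric]) (simp add: s_int)
    also have "\<dots> = (\<integral>\<omega>. \<tau> * indicator S \<omega> \<partial>M)"
      by (rule integral_cong_AE[OF _ _ s_sum]) (use sM in simp_all)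
    also have "\<dots> = \<tau> * prob S" by simp
    also have "\<dots> \<le> \<tau> * 1" using \<tau> by (intro mult_left_mono) auto
    finally show ?thesis by simp
  qed
  have \<xi>2_s: "(\<integral>\<omega>. (\<xi> g \<omega>)\<^sup>2 \<partial>M) = (\<integral>\<omega>. s g \<omega> \<partial>M)" if g: "g < G" for g
    using orth2[OF g, of "\<lambda>_. 1"] \<xi>_int(2)[OF g] s_int[OF g] by simp
  have bound: "(\<Sum>g<G. \<integral>\<omega>. \<bar>\<xi> g \<omega>\<bar> ^ 3 / 6 + (s g \<omega>)\<^sup>2 / 8 \<partial>M)
      \<le> \<alpha> * (\<tau> + real C ^ 3 * b * \<kappa>) / 12 + \<tau> * (1 + 2 * b) * (real C * \<alpha>)\<^sup>2 / 8"
  proof -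
    let ?m = "(1 + 2 * b) * (real C * \<alpha>)\<^sup>2"
    have "(\<Sum>g<G. \<integral>\<omega>. \<bar>\<xi> g \<omega>\<bar> ^ 3 / 6 + (s g \<omega>)\<^sup>2 / 8 \<partial>M)
        \<le> (\<Sum>g<G. \<alpha> / 12 * (\<integral>\<omega>. s g \<omega> \<partial>M) + 1 / (12 * \<alpha>) * (\<integral>\<omega>. (\<xi> g \<omega>) ^ 4 \<partial>M) + ?m / 8 * (\<integral>\<omega>. s g \<omega> \<partial>M))"
    proof (rule sum_mono)
      fix g assume "g \<in> {..<G}"
      then have g: "g < G" by simp
      have "(\<integral>\<omega>. \<bar>\<xi> g \<omega>\<bar> ^ 3 / 6 + (s g \<omega>)\<^sup>2 / 8 \<partial>M)
          \<le> (\<integral>\<omega>. \<alpha> / 12 * (\<xi> g \<omega>)\<^sup>2 + 1 / (12 * \<alpha>) * (\<xi> g \<omega>) ^ 4 + ?m / 8 * s g \<omega> \<partial>M)"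
      proof (rule Bochner_Integration.integral_mono)
        fix \<omega>
        have "(s g \<omega>)\<^sup>2 \<le> ?m * s g \<omega>"
          unfolding power2_eq_square by (intro mult_right_mono s_le[OF g, unfolded power2_eq_square] s_nonneg[OF g])
        then show "\<bar>\<xi> g \<omega>\<bar> ^ 3 / 6 + (s g \<omega>)\<^sup>2 / 8
            \<le> \<alpha> / 12 * (\<xi> g \<omega>)\<^sup>2 + 1 / (12 * \<alpha>) * (\<xi> g \<omega>) ^ 4 + ?m / 8 * s g \<omega>"
          using cube_le_interpolation[OF \<alpha>, of "\<xi> g \<omega>"] by (simp add: add_divide_distrib)
      qed (use \<xi>_int[OF g] \<xi>4_int[OF g] s_int[OF g] s2_int[OF g] in auto)
      also have "\<dots> = \<alpha> / 12 * (\<integral>\<omega>. (\<xi> g \<omega>)\<^sup>2 \<partial>M) + 1 / (12 * \<alpha>) * (\<integral>\<omega>. (\<xi> g \<omega>) ^ 4 \<partial>M) + ?m / 8 * (\<integral>\<omega>. s g \<omega> \<partial>M)"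
        using \<xi>_int(2)[OF g] \<xi>4_int[OF g] s_int[OF g] by simp
      finally show "(\<integral>\<omega>. \<bar>\<xi> g \<omega>\<bar> ^ 3 / 6 + (s g \<omega>)\<^sup>2 / 8 \<partial>M)
        \<le> \<alpha> / 12 * (\<integral>\<omega>. s g \<omega> \<partial>M) + 1 / (12 * \<alpha>) * (\<integral>\<omega>. (\<xi> g \<omega>) ^ 4 \<partial>M) + ?m / 8 * (\<integral>\<omega>. s g \<omega> \<partial>M)"
        by (simp only: \<xi>2_s[OF g])
    qed
    also have "\<dots> = \<alpha> / 12 * (\<Sum>g<G. \<integral>\<omega>. s g \<omega> \<partial>M) + 1 / (12 * \<alpha>) * (\<Sum>g<G. \<integral>\<omega>. (\<xi> g \<omega>) ^ 4 \<partial>M)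
        + ?m / 8 * (\<Sum>g<G. \<integral>\<omega>. s g \<omega> \<partial>M)"
      by (simp only: sum.distrib sum_distrib_left)
    also have "\<dots> \<le> \<alpha> / 12 * \<tau> + 1 / (12 * \<alpha>) * (real C ^ 3 * (b * \<alpha>\<^sup>2 * \<kappa>)) + ?m / 8 * \<tau>"
      by (intro add_mono mult_left_mono s_total \<xi>4_le) (use \<alpha> b0 in auto)
    also have "1 / (12 * \<alpha>) * (real C ^ 3 * (b * \<alpha>\<^sup>2 * \<kappa>)) = \<alpha> * (real C ^ 3 * b * \<kappa>) / 12"
      using \<alpha> by (simp add: power2_eq_square)
    finally show ?thesis by (simp add: field_simps)
  qed
  \<comment> \<open>The conditional variances add up to \<tau> on S and to 0 off S, so the
    expectation deviates by (1 - exp (- \<tau> / 2)) times the probability of the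
    complement.\<close>
  have tail: "cmod ((\<integral>\<omega>. of_real (exp (- (\<Sum>g<G. s g \<omega>) / 2)) \<partial>M) - of_real (exp (- \<tau> / 2))) \<le> prob (space M - S)"
  proof -
    have "(\<integral>\<omega>. exp (- (\<Sum>g<G. s g \<omega>) / 2) \<partial>M) = (\<integral>\<omega>. exp (- \<tau> / 2) + (1 - exp (- \<tau> / 2)) * indicator (space M - S) \<omega> \<partial>M)"
    proof (rule integral_cong_AE)
      show "(\<lambda>\<omega>. exp (- (\<Sum>g<G. s g \<omega>) / 2)) \<in> borel_measurable M"
        by (intro measurable_compose[OF _ borel_measurable_exp] borel_measurable_divide borel_measurable_uminus borel_measurable_sum) (simp_all add: sM)
      show "AE \<omega> in M. exp (- (\<Sum>g<G. s g \<omega>) / 2) = exp (- \<tau> / 2) + (1 - exp (- \<tau> / 2)) * indicator (space M - S) \<omega>"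
        using s_sum AE_space by eventually_elim (auto simp: indicator_def)
    qed simp
    also have "\<dots> = exp (- \<tau> / 2) + (1 - exp (- \<tau> / 2)) * prob (space M - S)"
      by (simp add: prob_space emeasure_eq_measure)
    finally have eq: "(\<integral>\<omega>. exp (- (\<Sum>g<G. s g \<omega>) / 2) \<partial>M) - exp (- \<tau> / 2) = (1 - exp (- \<tau> / 2)) * prob (space M - S)" by simp
    have "(1 - exp (- \<tau> / 2)) * prob (space M - S) \<le> 1 * prob (space M - S)"
      by (intro mult_right_mono) auto
    moreover have "0 \<le> (1 - exp (- \<tau> / 2)) * prob (space M - S)" using \<tau> by simp
    ultimately have "\<bar>(\<integral>\<omega>. exp (- (\<Sum>g<G. s g \<omega>) / 2) \<partial>M) - exp (- \<tau> / 2)\<bar> \<le> prob (space M - S)"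
      unfolding eq by simp
    then show ?thesis
      by (simp only: integral_complex_of_real of_real_diff[symmetric] norm_of_real)
  qed
  let ?X = "\<integral>\<omega>. iexp (\<Sum>i=1..n. a i \<omega> * u i \<omega>) \<partial>M" and ?Y = "\<integral>\<omega>. complex_of_real (exp (- (\<Sum>g<G. s g \<omega>) / 2)) \<partial>M"
  have "cmod (?X - of_real (exp (- \<tau> / 2))) \<le> cmod (?X - ?Y) + cmod (?Y - of_real (exp (- \<tau> / 2)))"
    using norm_triangle_ineq[of "?X - ?Y" "?Y - of_real (exp (- \<tau> / 2))"] by simp
  then show ?thesis using main bound tail unfolding sums by linarith
qed

end

section \<open>Reduction to a good event\<close>

lemma borel_measurable_det_real: "(Determinants.det :: real^'n^'n \<Rightarrow> real) \<in> borel_measurable borel"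
  unfolding Determinants.det_def
  by (intro borel_measurable_continuous_onI continuous_intros continuous_on_component continuous_on_id)

lemma borel_measurable_matrix_mult:
  fixes f :: "'a \<Rightarrow> real^'n^'m" and g :: "'a \<Rightarrow> real^'k^'n"
  assumes "f \<in> borel_measurable N" "g \<in> borel_measurable N"
  shows "(\<lambda>\<omega>. f \<omega> ** g \<omega>) \<in> borel_measurable N"
proof (rule borel_measurable_matrixI)
  fix i j
  show "(\<lambda>\<omega>. (f \<omega> ** g \<omega>) $ i $ j) \<in> borel_measurable N"
    unfolding matrix_matrix_mult_def vec_lambda_beta
    by (intro borel_measurable_sum borel_measurable_times measurable_compose[OF assms(1)] measurable_compose[OF assms(2)]
        borel_measurable_continuous_onI continuous_on_component continuous_on_id)
qed

lemma borel_measurable_matrix_vector: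
  fixes f :: "'a \<Rightarrow> real^'n^'m" and g :: "'a \<Rightarrow> real^'n"
  assumes "f \<in> borel_measurable N" "g \<in> borel_measurable N"
  shows "(\<lambda>\<omega>. f \<omega> *v g \<omega>) \<in> borel_measurable N"
proof (rule borel_measurable_vecI)
  fix i
  show "(\<lambda>\<omega>. (f \<omega> *v g \<omega>) $ i) \<in> borel_measurable N"
    unfolding matrix_vector_mult_def vec_lambda_beta
    by (intro borel_measurable_sum borel_measurable_times measurable_compose[OF assms(1)] measurable_compose[OF assms(2)]
        borel_measurable_continuous_onI continuous_on_component continuous_on_id)
qed

lemma borel_measurable_outer:
  fixes f g :: "'a \<Rightarrow> real^'n"
  assumes "f \<in> borel_measurable N" "g \<in> borel_measurable N"
  shows "(\<lambda>\<omega>. outer (f \<omega>) (g \<omega>)) \<in> borel_measurable N"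
  by (rule borel_measurable_matrixI, unfold outer_def vec_lambda_beta)
    (intro borel_measurable_times measurable_compose[OF assms(1)] measurable_compose[OF assms(2)]
      borel_measurable_component)

context clustered_regression
begin

abbreviation "\<Sigma> \<omega> \<equiv> Sigma_n M n K u x w \<omega>"
abbreviation "\<Gamma>h \<omega> \<equiv> Gamma_hat n K x w \<omega>"
abbreviation "gram_det \<omega> \<equiv> Determinant.det (gram n K (\<lambda>i. w i \<omega>))"

lemma Sigma_F: "\<Sigma> \<in> borel_measurable F"
  by (rule borel_measurable_matrixI, unfold Sigma_n_def cond_variance_def mat_cond_exp_def vec_lambda_beta)
    (rule borel_measurable_cond_exp)

lemma Gamma_hat_F: "\<Gamma>h \<in> borel_measurable F"
  unfolding Gamma_hat_def
  by (intro borel_measurable_scaleR borel_measurable_const borel_measurable_sum borel_measurable_outer vhat_F)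

lemma Omega_F: "Omega_n M n K u x w \<in> borel_measurable F"
  unfolding Omega_n_def
  by (intro borel_measurable_matrix_mult measurable_compose[OF Gamma_hat_F borel_measurable_matrix_inv] Sigma_F)

lemma gram_det_F: "gram_det \<in> borel_measurable F"
proof (rule borel_measurable_det[OF gram_carrier])
  fix k l assume kl: "k < K" "l < K"
  have "(\<lambda>\<omega>. \<Sum>i=1..n. w i \<omega> $v k * w i \<omega> $v l) \<in> borel_measurable F"
    by (intro borel_measurable_sum borel_measurable_times measurable_from_subalg[OF sub_F_W w_W] kl)
  then show "(\<lambda>\<omega>. gram n K (\<lambda>i. w i \<omega>) $$ (k, l)) \<in> borel_measurable F" using kl by (simp add: gram_def)
qed

text \<open>The bounds on \<open>u2\<close>, on the covariances and the semidefiniteness follow from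
  the others almost everywhere, see \<open>good_AE\<close>. They are listed because the comparison
  needs them at every point of the event. Invertibility is written with the determinant to make
  F-measurability visible.\<close>

definition good :: "real \<Rightarrow> real \<Rightarrow> real \<Rightarrow> real \<Rightarrow> 'a set" where
  "good b B \<delta> \<kappa> = {\<omega> \<in> space M. gram_det \<omega> \<noteq> 0 \<and> pos_semidef (\<Sigma> \<omega>) \<and>
     (Determinants.det (\<Sigma> \<omega>) \<noteq> 0 \<and> norm (matrix_inv (\<Sigma> \<omega>)) \<le> B) \<and>
     (\<forall>i\<in>{1..n}. u4 i \<omega> \<le> ennreal b \<and> u2 i \<omega> \<le> ennreal (1 + b) \<and> norm (v i \<omega>) \<le> \<delta> * sqrt (real n)) \<and>
     (\<forall>i\<in>{1..n}. \<forall>j\<in>{1..n}. \<bar>\<rho> i j \<omega>\<bar> \<le> 1 + 2 * b) \<and>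
     (\<Sum>i=1..n. (norm (v i \<omega>))\<^sup>2) \<le> \<kappa> * real n}"

lemma good_F: "good b B \<delta> \<kappa> \<in> sets F"
proof -
  have sp: "space F = space M" using sub_F by (simp only: subalgebra_def)
  have 1: "{\<omega> \<in> space F. gram_det \<omega> \<noteq> 0} \<in> sets F"
    using gram_det_F by (intro borel_measurable_neq) simp_all
  have "\<Sigma> -` {A. pos_semidef A} \<inter> space F \<in> sets F"
    by (rule measurable_sets[OF Sigma_F borel_closed[OF closed_pos_semidef]])
  then have 2: "{\<omega> \<in> space F. pos_semidef (\<Sigma> \<omega>)} \<in> sets F" by (simp add: vimage_def Int_def conj_commute)
  have 3: "{\<omega> \<in> space F. Determinants.det (\<Sigma> \<omega>) \<noteq> 0} \<in> sets F"
    using measurable_compose[OF Sigma_F borel_measurable_det_real] by (intro borel_measurable_neq) simp_all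
  have 4: "{\<omega> \<in> space F. norm (matrix_inv (\<Sigma> \<omega>)) \<le> B} \<in> sets F"
    using measurable_compose[OF Sigma_F borel_measurable_matrix_inv]
    by (intro borel_measurable_le measurable_compose[OF _ borel_measurable_norm] borel_measurable_const)
  have 5: "{\<omega> \<in> space F. \<forall>i\<in>{1..n}. u4 i \<omega> \<le> ennreal b \<and> u2 i \<omega> \<le> ennreal (1 + b) \<and> norm (v i \<omega>) \<le> \<delta> * sqrt (real n)} \<in> sets F"
    by (intro sets.sets_Collect_finite_All sets.sets_Collect_conj borel_measurable_le measurable_compose[OF _ borel_measurable_norm]
        borel_measurable_const borel_measurable_nn_cond_exp vhat_F) auto
  have 6: "{\<omega> \<in> space F. \<forall>i\<in>{1..n}. \<forall>j\<in>{1..n}. \<bar>\<rho> i j \<omega>\<bar> \<le> 1 + 2 * b} \<in> sets F"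
    by (intro sets.sets_Collect_finite_All borel_measurable_le borel_measurable_abs
        borel_measurable_const borel_measurable_cond_exp) auto
  have 7: "{\<omega> \<in> space F. (\<Sum>i=1..n. (norm (v i \<omega>))\<^sup>2) \<le> \<kappa> * real n} \<in> sets F"
    by (intro borel_measurable_le borel_measurable_sum borel_measurable_power measurable_compose[OF _ borel_measurable_norm]
        borel_measurable_const vhat_F)
  show ?thesis
    unfolding good_def sp[symmetric] by (intro sets.sets_Collect_conj 1 2 3 4 5 6 7)
qed

text \<open>The constants 1 + b and 1 + 2 b in \<open>good\<close> are what
  \<open>second_moment_bound\<close> and \<open>covariance_bound\<close> yield from a bound b on the
  fourth moments.\<close>

lemma good_AE:
  "AE \<omega> in M. gram_det \<omega> \<noteq> 0 \<longrightarrow> invertible (\<Sigma> \<omega>) \<longrightarrow> norm (matrix_inv (\<Sigma> \<omega>)) \<le> B \<longrightarrow>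
     (\<forall>i\<in>{1..n}. u4 i \<omega> \<le> ennreal b) \<longrightarrow> (\<forall>i\<in>{1..n}. norm (v i \<omega>) \<le> \<delta> * sqrt (real n)) \<longrightarrow>
     (\<Sum>i=1..n. (norm (v i \<omega>))\<^sup>2) \<le> \<kappa> * real n \<longrightarrow> \<omega> \<in> good b B \<delta> \<kappa>"
  if b: "0 \<le> b"
proof -
  have "AE \<omega> in M. \<forall>i\<in>{1..n}. u2 i \<omega> \<le> 1 + u4 i \<omega>" by (intro AE_finite_allI second_moment_bound) simp_all
  moreover have "AE \<omega> in M. \<forall>i\<in>{1..n}. \<forall>j\<in>{1..n}. ennreal \<bar>\<rho> i j \<omega>\<bar> \<le> 1 + u4 i \<omega> + u4 j \<omega>"
    by (intro AE_finite_allI covariance_bound) simp_all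
  moreover note Sigma_pos_semidef AE_space
  ultimately show ?thesis
  proof eventually_elim
    case (elim \<omega>)
    show ?case
    proof (intro impI)
      assume *: "gram_det \<omega> \<noteq> 0" "invertible (\<Sigma> \<omega>)" "norm (matrix_inv (\<Sigma> \<omega>)) \<le> B"
        "\<forall>i\<in>{1..n}. norm (v i \<omega>) \<le> \<delta> * sqrt (real n)" "(\<Sum>i=1..n. (norm (v i \<omega>))\<^sup>2) \<le> \<kappa> * real n"
        and u4: "\<forall>i\<in>{1..n}. u4 i \<omega> \<le> ennreal b"
      have u2: "u2 i \<omega> \<le> ennreal (1 + b)" if i: "i \<in> {1..n}" for i
      proof -
        have "u2 i \<omega> \<le> 1 + u4 i \<omega>" using elim(1) i by blast
        also have "\<dots> \<le> 1 + ennreal b" using u4 i by (intro add_left_mono) blast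
        finally show ?thesis using b by (simp add: ennreal_plus)
      qed
      have r: "\<bar>\<rho> i j \<omega>\<bar> \<le> 1 + 2 * b" if ij: "i \<in> {1..n}" "j \<in> {1..n}" for i j
      proof -
        have "ennreal \<bar>\<rho> i j \<omega>\<bar> \<le> 1 + u4 i \<omega> + u4 j \<omega>" using elim(2) ij by blast
        also have "\<dots> \<le> 1 + ennreal b + ennreal b" using u4 ij by (intro add_mono) auto
        also have "1 + ennreal b = ennreal (1 + b)" using b by (simp add: ennreal_plus)
        also have "ennreal (1 + b) + ennreal b = ennreal (1 + b + b)"
          by (rule ennreal_plus[symmetric]) (use b in simp_all)
        also have "1 + b + b = 1 + 2 * b" by simp
        finally show ?thesis using b by (subst (asm) ennreal_le_iff) auto
      qed
      have "\<forall>i\<in>{1..n}. u2 i \<omega> < \<infinity>" using order_le_less_trans[OF u2] by simp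
      then have "pos_semidef (\<Sigma> \<omega>)" using elim(3) by blast
      moreover have "Determinants.det (\<Sigma> \<omega>) \<noteq> 0" using *(2) invertible_det_nz by blast
      ultimately show "\<omega> \<in> good b B \<delta> \<kappa>" unfolding good_def using * u4 u2 r elim(4) by simp
    qed
  qed
qed

lemma Sigma_quadratic:
  "AE \<omega> in M. (\<forall>i\<in>{1..n}. u2 i \<omega> < \<infinity>) \<longrightarrow> (\<forall>c. c \<bullet> (\<Sigma> \<omega> *v c)
     = (\<Sum>g=1..G. \<Sum>i\<in>T g. \<Sum>j\<in>T g. ((c \<bullet> v i \<omega>) / sqrt (real n)) * ((c \<bullet> v j \<omega>) / sqrt (real n)) * \<rho> i j \<omega>))"
  using Sigma_formula
proof eventually_elim
  case (elim \<omega>)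
  show ?case
  proof (intro impI allI)
    fix c assume "\<forall>i\<in>{1..n}. u2 i \<omega> < \<infinity>"
    then have eq: "\<Sigma> \<omega> = (1 / real n) *\<^sub>R (\<Sum>g=1..G. \<Sum>i\<in>T g. \<Sum>j\<in>T g. \<rho> i j \<omega> *\<^sub>R outer (v i \<omega>) (v j \<omega>))"
      using elim by blast
    have pt: "(a / sqrt (real n)) * (b / sqrt (real n)) * r = (1 / real n) * (r * (b * a))" for a b r
      by (simp add: mult_ac)
    show "c \<bullet> (\<Sigma> \<omega> *v c) = (\<Sum>g=1..G. \<Sum>i\<in>T g. \<Sum>j\<in>T g.
        ((c \<bullet> v i \<omega>) / sqrt (real n)) * ((c \<bullet> v j \<omega>) / sqrt (real n)) * \<rho> i j \<omega>)"
      unfolding eq pt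
      by (simp add: scaleR_matrix_vector_assoc[symmetric] matrix_sum_mult_vec outer_mult_vec inner_sum_right
          sum_distrib_left inner_commute mult.assoc)
  qed
qed

abbreviation "statistic y \<beta> \<omega> \<equiv> matrix_inv (matrix_sqrt (Omega_n M n K u x w \<omega>))
  *v (sqrt (real n) *\<^sub>R (beta_hat n K y x w \<omega> - \<beta>))"

lemma statistic_measurable:
  assumes "\<And>i. i \<in> {1..n} \<Longrightarrow> y i \<in> borel_measurable M"
  shows "statistic y \<beta> \<in> borel_measurable M"
proof (rule borel_measurable_matrix_vector)
  show "(\<lambda>\<omega>. matrix_inv (matrix_sqrt (Omega_n M n K u x w \<omega>))) \<in> borel_measurable M"
    by (rule measurable_compose[OF measurable_compose[OF from_F[OF Omega_F] borel_measurable_matrix_sqrt] borel_measurable_matrix_inv])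
  have G: "(\<lambda>\<omega>. \<Sum>i=1..n. outer (v i \<omega>) (v i \<omega>)) \<in> borel_measurable M"
    by (intro borel_measurable_sum borel_measurable_outer from_F[OF vhat_F])
  show "(\<lambda>\<omega>. sqrt (real n) *\<^sub>R (beta_hat n K y x w \<omega> - \<beta>)) \<in> borel_measurable M"
    unfolding beta_hat_def
    by (intro borel_measurable_scaleR borel_measurable_const borel_measurable_diff borel_measurable_matrix_vector
        measurable_compose[OF G borel_measurable_matrix_inv] borel_measurable_sum assms from_F[OF vhat_F])
qed

text \<open>The factor 3 counts the bad event twice for replacing the statistic by the cut-off sum,
  where two numbers of modulus 1 are compared, and once for \<open>char_cluster_close\<close>. On
  the good event |c| is at most the square root and |vhat_i| / sqrt n at most \<delta>; the added 1
  keeps \<alpha> positive when t or B is 0.\<close>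

lemma char_statistic_close:
  fixes t \<beta> :: "real^'d" and y :: "nat \<Rightarrow> 'a \<Rightarrow> real" and \<gamma> :: "real vec"
  assumes n: "1 \<le> n" and \<gamma>: "\<gamma> \<in> carrier_vec K"
    and y: "\<And>i. i \<in> {1..n} \<Longrightarrow> y i \<in> borel_measurable M"
    and model: "\<And>i. i \<in> {1..n} \<Longrightarrow> AE \<omega> in M. y i \<omega> = \<beta> \<bullet> x i \<omega> + scalar_prod \<gamma> (w i \<omega>) + u i \<omega>"
    and b: "0 \<le> b" and B: "0 \<le> B" and \<delta>: "0 < \<delta>" and \<kappa>: "0 \<le> \<kappa>"
    and C: "\<And>g. g \<in> {1..G} \<Longrightarrow> card (T g) \<le> C"
  defines "\<alpha> \<equiv> (sqrt ((t \<bullet> t) * B) + 1) * \<delta>"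
  shows "cmod ((\<integral>\<omega>. iexp (t \<bullet> statistic y \<beta> \<omega>) \<partial>M) - of_real (exp (- ((norm t)\<^sup>2) / 2)))
    \<le> 3 * prob (space M - good b B \<delta> \<kappa>) + \<alpha> * (t \<bullet> t + real C ^ 3 * b * ((t \<bullet> t) * B * \<kappa>)) / 12
      + (t \<bullet> t) * (1 + 2 * b) * (real C * \<alpha>)\<^sup>2 / 8"
proof -
  let ?S = "good b B \<delta> \<kappa>"
  let ?R = "\<lambda>\<omega>. matrix_sqrt (Omega_n M n K u x w \<omega>)"
  define c where "c \<omega> = matrix_inv (\<Gamma>h \<omega>) *v (matrix_inv (?R \<omega>) *v t)" for \<omega>
  \<comment> \<open>The bound on c holds almost everywhere on the good event. Adding it to the event
    makes the bounds on the weights pointwise and keeps the event in F.\<close>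
  define S where "S = {\<omega> \<in> good b B \<delta> \<kappa>. c \<omega> \<bullet> c \<omega> \<le> (t \<bullet> t) * B}"
  define a where "a i \<omega> = indicator S \<omega> * ((c \<omega> \<bullet> v i \<omega>) / sqrt (real n))" for i \<omega>
  have cF: "c \<in> borel_measurable F"
    unfolding c_def
    by (intro borel_measurable_matrix_vector borel_measurable_const
        measurable_compose[OF Gamma_hat_F borel_measurable_matrix_inv]
        measurable_compose[OF measurable_compose[OF Omega_F borel_measurable_matrix_sqrt] borel_measurable_matrix_inv])
  have SF: "S \<in> sets F"
  proof -
    have "good b B \<delta> \<kappa> \<inter> {\<omega> \<in> space F. c \<omega> \<bullet> c \<omega> \<le> (t \<bullet> t) * B} \<in> sets F"
      by (intro sets.Int good_F borel_measurable_le borel_measurable_inner cF borel_measurable_const)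
    moreover have "good b B \<delta> \<kappa> \<inter> {\<omega> \<in> space F. c \<omega> \<bullet> c \<omega> \<le> (t \<bullet> t) * B} = S"
      using subsetD[OF sets.sets_into_space[OF good_F[of b B \<delta> \<kappa>]]] by (auto simp: S_def)
    ultimately show ?thesis by simp
  qed
  have aF: "a i \<in> borel_measurable F" if "i \<in> {1..n}" for i
    unfolding a_def
    by (intro borel_measurable_times borel_measurable_divide borel_measurable_inner cF vhat_F[OF that]
        borel_measurable_indicator SF borel_measurable_const)
  have SM: "S \<in> sets M" by (rule F_sets[OF SF])
  have Su2: "u2 i \<omega> < \<infinity>" if "i \<in> {1..n}" "\<omega> \<in> ?S" for i \<omega>
    using that order_le_less_trans[of "u2 i \<omega>" "ennreal (1 + b)" \<infinity>] by (simp add: good_def)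
  have AE_model: "AE \<omega> in M. \<forall>i\<in>{1..n}. y i \<omega> = \<beta> \<bullet> x i \<omega> + scalar_prod \<gamma> (w i \<omega>) + u i \<omega>"
    by (intro AE_finite_allI model) simp_all
  have AE_main: "AE \<omega> in M. \<omega> \<in> ?S \<longrightarrow> \<omega> \<in> S \<and> t \<bullet> statistic y \<beta> \<omega> = (\<Sum>i=1..n. a i \<omega> * u i \<omega>)
      \<and> (\<Sum>g=1..G. \<Sum>i\<in>T g. \<Sum>j\<in>T g. a i \<omega> * a j \<omega> * \<rho> i j \<omega>) = t \<bullet> t"
    using Sigma_quadratic AE_model
  proof eventually_elim
    case (elim \<omega>)
    show ?case
    proof
      assume S: "\<omega> \<in> ?S"
      then have sp: "\<omega> \<in> space M" and det: "gram_det \<omega> \<noteq> 0" and psd: "pos_semidef (\<Sigma> \<omega>)" and inv: "invertible (\<Sigma> \<omega>)"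
        by (auto simp: good_def invertible_det_nz)
      interpret D: full_rank_design n K "\<lambda>i. w i \<omega>"
        by standard (use w_carrier[OF _ sp] det in auto)
      have quad: "d \<bullet> (\<Sigma> \<omega> *v d)
        = (\<Sum>g=1..G. \<Sum>i\<in>T g. \<Sum>j\<in>T g. ((d \<bullet> v i \<omega>) / sqrt (real n)) * ((d \<bullet> v j \<omega>) / sqrt (real n)) * \<rho> i j \<omega>)" for d
        using elim(1) Su2[OF _ S] by blast
      have ker: "d \<bullet> (\<Sigma> \<omega> *v d) = 0" if "\<And>i. i \<in> {1..n} \<Longrightarrow> d \<bullet> residual n K (\<lambda>i. w i \<omega>) (\<lambda>i. x i \<omega>) i = 0" for d
        unfolding quad
      proof (intro sum.neutral ballI)
        fix g i j assume "g \<in> {1..G}" "i \<in> T g"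
        then have "i \<in> {1..n}" using T_subset by blast
        from that[OF this] show "((d \<bullet> v i \<omega>) / sqrt (real n)) * ((d \<bullet> v j \<omega>) / sqrt (real n)) * \<rho> i j \<omega> = 0"
          by (simp add: vhat_def)
      qed
      have mod: "y i \<omega> = \<beta> \<bullet> x i \<omega> + scalar_prod \<gamma> (w i \<omega>) + u i \<omega>" if "i \<in> {1..n}" for i
        using elim(2) that by blast
      note st = D.standardized_statistic[OF n \<gamma> mod psd inv ker, of t]
      have "c \<omega> \<bullet> c \<omega> \<le> (t \<bullet> t) * norm (matrix_inv (\<Sigma> \<omega>))"
        using st(3) by (simp add: c_def Omega_n_def Gamma_hat_def vhat_def)
      also have "\<dots> \<le> (t \<bullet> t) * B" using S by (intro mult_left_mono) (simp_all add: good_def)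
      finally have SS: "\<omega> \<in> S" using S by (simp add: S_def)
      have a_eq: "a i \<omega> = (c \<omega> \<bullet> v i \<omega>) / sqrt (real n)" for i using SS by (simp add: a_def)
      have "t \<bullet> statistic y \<beta> \<omega> = (\<Sum>i=1..n. a i \<omega> * u i \<omega>)"
        using st(1) by (simp add: a_eq c_def beta_hat_def Omega_n_def Gamma_hat_def vhat_def)
      moreover have "c \<omega> \<bullet> (\<Sigma> \<omega> *v c \<omega>) = t \<bullet> t"
        using st(2) by (simp add: c_def Omega_n_def Gamma_hat_def vhat_def)
      ultimately show "\<omega> \<in> S \<and> t \<bullet> statistic y \<beta> \<omega> = (\<Sum>i=1..n. a i \<omega> * u i \<omega>)
          \<and> (\<Sum>g=1..G. \<Sum>i\<in>T g. \<Sum>j\<in>T g. a i \<omega> * a j \<omega> * \<rho> i j \<omega>) = t \<bullet> t"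
        using SS by (simp add: a_eq quad)
    qed
  qed
  have \<alpha>: "0 < \<alpha>" using \<delta> B by (simp add: \<alpha>_def add_nonneg_pos)
  have c_norm: "norm (c \<omega>) \<le> sqrt ((t \<bullet> t) * B)" if "\<omega> \<in> S" for \<omega>
    using that unfolding norm_eq_sqrt_inner by (simp add: S_def)
  have a_sq: "(a i \<omega>)\<^sup>2 \<le> indicator S \<omega> * ((t \<bullet> t) * B * ((norm (v i \<omega>))\<^sup>2 / real n))" for i \<omega>
  proof (cases "\<omega> \<in> S")
    case True
    have "(c \<omega> \<bullet> v i \<omega>)\<^sup>2 \<le> (c \<omega> \<bullet> c \<omega>) * (norm (v i \<omega>))\<^sup>2"
      using Cauchy_Schwarz_ineq[of "c \<omega>" "v i \<omega>"] by (simp add: power2_norm_eq_inner)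
    also have "\<dots> \<le> ((t \<bullet> t) * B) * (norm (v i \<omega>))\<^sup>2" using True by (intro mult_right_mono) (simp_all add: S_def)
    finally have "(c \<omega> \<bullet> v i \<omega>)\<^sup>2 / real n \<le> ((t \<bullet> t) * B) * (norm (v i \<omega>))\<^sup>2 / real n"
      by (intro divide_right_mono) simp_all
    then show ?thesis using True by (simp add: a_def power_divide)
  qed (simp add: a_def)
  have "cmod ((\<integral>\<omega>. iexp (\<Sum>i=1..n. a i \<omega> * u i \<omega>) \<partial>M) - of_real (exp (- (t \<bullet> t) / 2)))
    \<le> prob (space M - S) + \<alpha> * ((t \<bullet> t) + real C ^ 3 * b * ((t \<bullet> t) * B * \<kappa>)) / 12
      + (t \<bullet> t) * (1 + 2 * b) * (real C * \<alpha>)\<^sup>2 / 8"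
  proof (rule char_cluster_close[OF SF b \<alpha> _ C])
    show "u4 i \<omega> \<le> ennreal b" "u2 i \<omega> \<le> ennreal (1 + b)" if "i \<in> {1..n}" "\<omega> \<in> S" for i \<omega>
      using that by (simp_all add: S_def good_def)
    show "\<bar>\<rho> i j \<omega>\<bar> \<le> 1 + 2 * b" if "i \<in> {1..n}" "j \<in> {1..n}" "\<omega> \<in> S" for i j \<omega>
      using that by (simp add: S_def good_def)
    show "\<bar>a i \<omega>\<bar> \<le> \<alpha>" if i: "i \<in> {1..n}" for i \<omega>
    proof (cases "\<omega> \<in> S")
      case True
      have rn: "0 < sqrt (real n)" using n by simp
      have "\<bar>c \<omega> \<bullet> v i \<omega>\<bar> \<le> norm (c \<omega>) * norm (v i \<omega>)" by (rule Cauchy_Schwarz_ineq2)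
      also have "\<dots> \<le> sqrt ((t \<bullet> t) * B) * (\<delta> * sqrt (real n))"
        using True i B by (intro mult_mono c_norm) (simp_all add: S_def good_def)
      also have "\<dots> \<le> \<alpha> * sqrt (real n)"
        unfolding \<alpha>_def using \<delta> by (simp add: distrib_right mult.assoc)
      finally have "\<bar>c \<omega> \<bullet> v i \<omega>\<bar> / sqrt (real n) \<le> \<alpha>" using rn by (simp add: pos_divide_le_eq)
      then show ?thesis using True by (simp add: a_def abs_divide)
    qed (use \<alpha> in \<open>simp add: a_def\<close>)
    show "(\<Sum>i=1..n. (a i \<omega>)\<^sup>2) \<le> (t \<bullet> t) * B * \<kappa>" for \<omega>
    proof -
      have "(\<Sum>i=1..n. (a i \<omega>)\<^sup>2) \<le> (\<Sum>i=1..n. indicator S \<omega> * ((t \<bullet> t) * B * ((norm (v i \<omega>))\<^sup>2 / real n)))"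
        by (intro sum_mono a_sq)
      also have "\<dots> = indicator S \<omega> * ((t \<bullet> t) * B * ((\<Sum>i=1..n. (norm (v i \<omega>))\<^sup>2) / real n))"
        by (simp only: sum_distrib_left sum_divide_distrib)
      also have "\<dots> \<le> (t \<bullet> t) * B * \<kappa>"
      proof (cases "\<omega> \<in> S")
        case True
        then have "(\<Sum>i=1..n. (norm (v i \<omega>))\<^sup>2) / real n \<le> \<kappa>"
          using n by (simp add: S_def good_def pos_divide_le_eq)
        then have "(t \<bullet> t) * B * ((\<Sum>i=1..n. (norm (v i \<omega>))\<^sup>2) / real n) \<le> (t \<bullet> t) * B * \<kappa>"
          using B by (intro mult_left_mono) simp_all
        then show ?thesis using True by simp
      qed (use B \<kappa> in simp)
      finally show ?thesis .
    qed
    show "AE \<omega> in M. \<omega> \<in> S \<longrightarrow> (\<Sum>g=1..G. \<Sum>i\<in>T g. \<Sum>j\<in>T g. a i \<omega> * a j \<omega> * \<rho> i j \<omega>) = t \<bullet> t"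
      using AE_main by eventually_elim (simp add: S_def)
  qed (simp_all add: aF, simp add: a_def)
  moreover have "cmod ((\<integral>\<omega>. iexp (t \<bullet> statistic y \<beta> \<omega>) \<partial>M) - (\<integral>\<omega>. iexp (\<Sum>i=1..n. a i \<omega> * u i \<omega>) \<partial>M))
      \<le> 2 * prob (space M - S)"
  proof -
    note [measurable] = statistic_measurable[where y = y and \<beta> = \<beta>, OF y] SM
    have sum_m [measurable]: "(\<lambda>\<omega>. \<Sum>i=1..n. a i \<omega> * u i \<omega>) \<in> borel_measurable M"
      by (intro borel_measurable_sum borel_measurable_times from_F[OF aF] u_meas)
    have ts [measurable]: "(\<lambda>\<omega>. t \<bullet> statistic y \<beta> \<omega>) \<in> borel_measurable M"
      by (intro borel_measurable_inner borel_measurable_const statistic_measurable y)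
    have i1: "integrable M (\<lambda>\<omega>. iexp (t \<bullet> statistic y \<beta> \<omega>))" "integrable M (\<lambda>\<omega>. iexp (\<Sum>i=1..n. a i \<omega> * u i \<omega>))"
      by (rule integrable_const_bound[of _ 1], simp, rule measurable_compose[OF ts], simp)
        (rule integrable_const_bound[of _ 1], simp, rule measurable_compose[OF sum_m], simp)
    have "cmod (\<integral>\<omega>. iexp (t \<bullet> statistic y \<beta> \<omega>) - iexp (\<Sum>i=1..n. a i \<omega> * u i \<omega>) \<partial>M)
        \<le> (\<integral>\<omega>. cmod (iexp (t \<bullet> statistic y \<beta> \<omega>) - iexp (\<Sum>i=1..n. a i \<omega> * u i \<omega>)) \<partial>M)"
      by (rule integral_norm_bound)
    also have "\<dots> \<le> (\<integral>\<omega>. 2 * indicator (space M - S) \<omega> \<partial>M)"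
    proof (rule integral_mono_AE)
      show "AE \<omega> in M. cmod (iexp (t \<bullet> statistic y \<beta> \<omega>) - iexp (\<Sum>i=1..n. a i \<omega> * u i \<omega>))
          \<le> 2 * indicator (space M - S) \<omega>"
        using AE_main AE_space
      proof eventually_elim
        case (elim \<omega>)
        show ?case
        proof (cases "\<omega> \<in> S")
          case True
          then have "t \<bullet> statistic y \<beta> \<omega> = (\<Sum>i=1..n. a i \<omega> * u i \<omega>)" using elim(1) by (simp add: S_def)
          then show ?thesis by simp
        next
          case False
          have "cmod (iexp (t \<bullet> statistic y \<beta> \<omega>) - iexp (\<Sum>i=1..n. a i \<omega> * u i \<omega>)) \<le> 1 + 1"
            by (rule order_trans[OF norm_triangle_ineq4]) simp
          then show ?thesis using False elim(2) by simp
        qed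
      qed
    qed (use i1 SM in \<open>simp_all add: emeasure_eq_measure\<close>)
    also have "\<dots> = 2 * prob (space M - S)" using SM by (simp add: emeasure_eq_measure)
    finally show ?thesis using i1 by simp
  qed
  moreover have "prob (space M - S) = prob (space M - good b B \<delta> \<kappa>)"
  proof (rule finite_measure_eq_AE)
    show "AE \<omega> in M. (\<omega> \<in> space M - S) = (\<omega> \<in> space M - good b B \<delta> \<kappa>)"
      using AE_main by eventually_elim (auto simp: S_def)
  qed (use SM F_sets[OF good_F] in auto)
  moreover have "cmod (X - Z) \<le> cmod (X - Y) + cmod (Y - Z)" for X Y Z :: complex
    using norm_triangle_ineq[of "X - Y" "Y - Z"] by simp
  ultimately show ?thesis unfolding power2_norm_eq_inner by (smt (verit))
qed

end

section \<open>The probability of the good event\<close>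

locale clustered_regression_moments = clustered_regression M n K G u x w T
  for M :: "'a measure" and n K G :: nat and u :: "nat \<Rightarrow> 'a \<Rightarrow> real" and x :: "nat \<Rightarrow> 'a \<Rightarrow> real^'d"
    and w :: "nat \<Rightarrow> 'a \<Rightarrow> real vec" and T :: "nat \<Rightarrow> nat set" +
  assumes x_int: "i \<in> {1..n} \<Longrightarrow> integrable M (x i)"
    and ww_int: "i \<in> {1..n} \<Longrightarrow> l < K \<Longrightarrow> integrable M (\<lambda>\<omega>. w i \<omega> $v l * w i \<omega> $v l)"
begin

abbreviation "V i \<omega> \<equiv> V_n M n K x w i \<omega>"
abbreviation "Q i \<omega> \<equiv> Q_n M n K x w i \<omega>"
abbreviation "V4 i \<equiv> nn_cond_exp M W (\<lambda>\<omega>. ennreal ((norm (V i \<omega>)) ^ 4))"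

sublocale W: sigma_finite_subalgebra M W by (rule sigma_finite_subalgebraI[OF sub_W])

text \<open>Row p of the coefficient matrix of the population projection of x on w inside
  \<open>v_pop\<close>.\<close>

definition L :: "'d \<Rightarrow> nat \<Rightarrow> real" where
  "L p l = (\<Sum>k<K. Matrix.vec K (\<lambda>l. \<Sum>j=1..n. \<integral>\<omega>'. x j \<omega>' $ p * w j \<omega>' $v l \<partial>M) $v k *
     mat_inv (Matrix.mat K K (\<lambda>(k, l). \<Sum>j=1..n. \<integral>\<omega>'. w j \<omega>' $v k * w j \<omega>' $v l \<partial>M)) $$ (k, l))"

lemma v_pop_component:
  assumes "i \<in> {1..n}" "\<omega> \<in> space M"
  shows "v_pop M n K x w i \<omega> $ p = x i \<omega> $ p - (\<Sum>l<K. L p l * w i \<omega> $v l)"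
proof -
  let ?E = "Matrix.mat K K (\<lambda>(k, l). \<Sum>j=1..n. \<integral>\<omega>'. w j \<omega>' $v k * w j \<omega>' $v l \<partial>M)"
  let ?X = "Matrix.vec K (\<lambda>l. \<Sum>j=1..n. \<integral>\<omega>'. x j \<omega>' $ p * w j \<omega>' $v l \<partial>M)"
  have "scalar_prod ?X (mat_inv ?E *\<^sub>v w i \<omega>) = (\<Sum>k<K. \<Sum>l<K. ?X $v k * mat_inv ?E $$ (k, l) * w i \<omega> $v l)"
    by (rule quadratic_form_mat_inv) (use w_carrier[OF assms] in simp_all)
  also have "\<dots> = (\<Sum>l<K. \<Sum>k<K. ?X $v k * mat_inv ?E $$ (k, l) * w i \<omega> $v l)" by (rule sum.swap)
  also have "\<dots> = (\<Sum>l<K. L p l * w i \<omega> $v l)" unfolding L_def sum_distrib_right ..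
  finally show ?thesis by (simp add: v_pop_def)
qed

lemma w_integrable: "i \<in> {1..n} \<Longrightarrow> l < K \<Longrightarrow> integrable M (\<lambda>\<omega>. w i \<omega> $v l)"
proof (rule Bochner_Integration.integrable_bound)
  assume i: "i \<in> {1..n}" "l < K"
  show "integrable M (\<lambda>\<omega>. 1 + w i \<omega> $v l * w i \<omega> $v l)" using ww_int[OF i] by simp
  show "(\<lambda>\<omega>. w i \<omega> $v l) \<in> borel_measurable M" by (rule w_meas[OF i])
  have "\<bar>z\<bar> \<le> 1 + z * z" for z :: real
  proof -
    have "2 * \<bar>z\<bar> \<le> 1 + z * z" using sum_squares_bound[of 1 "\<bar>z\<bar>"] by (simp add: power2_eq_square)
    then show ?thesis using abs_ge_zero[of z] by linarith
  qed
  then show "AE \<omega> in M. norm (w i \<omega> $v l) \<le> norm (1 + w i \<omega> $v l * w i \<omega> $v l)"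
    by (intro AE_I2) (auto intro: order_trans[OF _ abs_ge_self])
qed

lemma x_component_integrable: "i \<in> {1..n} \<Longrightarrow> integrable M (\<lambda>\<omega>. x i \<omega> $ p)"
proof -
  assume "i \<in> {1..n}"
  then have "integrable M (\<lambda>\<omega>. x i \<omega> \<bullet> axis p 1)" by (intro integrable_inner_left) (rule x_int)
  then show ?thesis by (simp add: inner_axis)
qed

text \<open>The projection of x is linear in w, hence W-measurable. Conditioning on W therefore acts
  on x alone, and Q_i is the conditional mean of x_i minus its projection.\<close>

lemma v_pop_decomposition:
  assumes i: "i \<in> {1..n}"
  shows "AE \<omega> in M. v_pop M n K x w i \<omega> = V i \<omega> + Q i \<omega>"
proof -
  have each: "AE \<omega> in M. \<forall>p\<in>UNIV. Q i \<omega> $ p = real_cond_exp M W (\<lambda>\<omega>. x i \<omega> $ p) \<omega> - (\<Sum>l<K. L p l * w i \<omega> $v l)"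
  proof (rule AE_finite_allI)
    fix p
    have lin: "integrable M (\<lambda>\<omega>. \<Sum>l<K. L p l * w i \<omega> $v l)"
      by (intro Bochner_Integration.integrable_sum integrable_mult_right w_integrable[OF i]) simp
    have linW: "(\<lambda>\<omega>. \<Sum>l<K. L p l * w i \<omega> $v l) \<in> borel_measurable W"
      by (intro borel_measurable_sum borel_measurable_times borel_measurable_const w_W[OF i]) simp
    have "AE \<omega> in M. real_cond_exp M W (\<lambda>\<omega>. v_pop M n K x w i \<omega> $ p) \<omega>
        = real_cond_exp M W (\<lambda>\<omega>. x i \<omega> $ p - (\<Sum>l<K. L p l * w i \<omega> $v l)) \<omega>"
    proof (rule W.real_cond_exp_cong)
      show eq: "AE \<omega> in M. v_pop M n K x w i \<omega> $ p = x i \<omega> $ p - (\<Sum>l<K. L p l * w i \<omega> $v l)"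
        by (intro AE_I2 v_pop_component i)
      show m: "(\<lambda>\<omega>. x i \<omega> $ p - (\<Sum>l<K. L p l * w i \<omega> $v l)) \<in> borel_measurable M"
        using x_component_integrable[OF i, of p] lin by auto
      show "(\<lambda>\<omega>. v_pop M n K x w i \<omega> $ p) \<in> borel_measurable M"
        by (rule measurable_cong[THEN iffD2, OF v_pop_component[OF i] m])
    qed
    moreover have "AE \<omega> in M. real_cond_exp M W (\<lambda>\<omega>. x i \<omega> $ p - (\<Sum>l<K. L p l * w i \<omega> $v l)) \<omega>
        = real_cond_exp M W (\<lambda>\<omega>. x i \<omega> $ p) \<omega> - real_cond_exp M W (\<lambda>\<omega>. \<Sum>l<K. L p l * w i \<omega> $v l) \<omega>"
      by (rule W.real_cond_exp_diff[OF x_component_integrable[OF i] lin])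
    moreover have "AE \<omega> in M. real_cond_exp M W (\<lambda>\<omega>. \<Sum>l<K. L p l * w i \<omega> $v l) \<omega> = (\<Sum>l<K. L p l * w i \<omega> $v l)"
      by (rule W.real_cond_exp_F_meas[OF lin linW])
    ultimately show "AE \<omega> in M. Q i \<omega> $ p = real_cond_exp M W (\<lambda>\<omega>. x i \<omega> $ p) \<omega> - (\<Sum>l<K. L p l * w i \<omega> $v l)"
      unfolding Q_n_def vec_cond_exp_def vec_lambda_beta by eventually_elim simp
  qed simp
  from each AE_space show ?thesis
  proof eventually_elim
    case (elim \<omega>)
    then show ?case
      by (simp add: Finite_Cartesian_Product.vec_eq_iff v_pop_component[OF i] V_n_def vec_cond_exp_def)
  qed
qed

lemma V_measurable: "i \<in> {1..n} \<Longrightarrow> (\<lambda>\<omega>. V i \<omega>) \<in> borel_measurable M"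
  unfolding V_n_def
  by (intro borel_measurable_diff x_meas borel_measurable_vecI)
    (simp_all add: vec_cond_exp_def)

lemma Q_measurable: "(\<lambda>\<omega>. Q i \<omega>) \<in> borel_measurable M"
  by (rule borel_measurable_vecI) (simp add: Q_n_def vec_cond_exp_def)

text \<open>By \<open>residual_design_combination\<close> the residuals of x are those of
  \<open>v_pop\<close>, and taking residuals does not increase the sum of squares.\<close>

lemma sum_vhat_le:
  "AE \<omega> in M. Determinant.det (gram n K (\<lambda>i. w i \<omega>)) \<noteq> 0 \<longrightarrow>
     (\<Sum>i=1..n. (norm (v i \<omega>))\<^sup>2) \<le> (\<Sum>i=1..n. 2 * (norm (V i \<omega>))\<^sup>2 + 2 * (norm (Q i \<omega>))\<^sup>2)"
proof -
  have "AE \<omega> in M. \<forall>i\<in>{1..n}. v_pop M n K x w i \<omega> = V i \<omega> + Q i \<omega>"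
    by (intro AE_finite_allI v_pop_decomposition) simp_all
  with AE_space show ?thesis
  proof eventually_elim
    case (elim \<omega>)
    show ?case
    proof
      assume det: "Determinant.det (gram n K (\<lambda>i. w i \<omega>)) \<noteq> 0"
      interpret D: full_rank_design n K "\<lambda>i. w i \<omega>" by standard (use w_carrier[OF _ elim(1)] det in auto)
      have eq: "v i \<omega> = residual n K (\<lambda>j. w j \<omega>) (\<lambda>j. v_pop M n K x w j \<omega>) i" if "i \<in> {1..n}" for i
        unfolding vhat_def
        by (rule D.residual_design_combination[OF _ that, where L = L]) (simp add: v_pop_component elim(1))
      have "(\<Sum>i=1..n. (norm (v i \<omega>))\<^sup>2) = (\<Sum>i=1..n. (norm (residual n K (\<lambda>j. w j \<omega>) (\<lambda>j. v_pop M n K x w j \<omega>) i))\<^sup>2)"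
        by (rule sum.cong[OF refl]) (simp only: eq)
      also have "\<dots> \<le> (\<Sum>i=1..n. (norm (v_pop M n K x w i \<omega>))\<^sup>2)" by (rule D.sum_norm_residual_le)
      also have "\<dots> \<le> (\<Sum>i=1..n. 2 * (norm (V i \<omega>))\<^sup>2 + 2 * (norm (Q i \<omega>))\<^sup>2)"
      proof (rule sum_mono)
        fix i assume "i \<in> {1..n}"
        then have "v_pop M n K x w i \<omega> = V i \<omega> + Q i \<omega>" using elim(2) by blast
        then have "(norm (v_pop M n K x w i \<omega>))\<^sup>2 \<le> (norm (V i \<omega>) + norm (Q i \<omega>))\<^sup>2"
          by (intro power_mono) (simp_all add: norm_triangle_ineq)
        also have "\<dots> \<le> 2 * (norm (V i \<omega>))\<^sup>2 + 2 * (norm (Q i \<omega>))\<^sup>2"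
          using sum_squares_bound[of "norm (V i \<omega>)" "norm (Q i \<omega>)"] by (simp add: power2_sum)
        finally show "(norm (v_pop M n K x w i \<omega>))\<^sup>2 \<le> 2 * (norm (V i \<omega>))\<^sup>2 + 2 * (norm (Q i \<omega>))\<^sup>2" .
      qed
      finally show "(\<Sum>i=1..n. (norm (v i \<omega>))\<^sup>2) \<le> (\<Sum>i=1..n. 2 * (norm (V i \<omega>))\<^sup>2 + 2 * (norm (Q i \<omega>))\<^sup>2)" .
    qed
  qed
qed

text \<open>Markov's inequality, restricted to D because the moments of V_i are controlled there. D
  is W-measurable, so the conditional bound integrates over D, and |V|^2 <= 1 + |V|^4 gives 1 + b
  per observation; chi_n gives n X for all Q_i together.\<close>

lemma mean_vhat_tail:
  assumes n: "1 \<le> n" and b: "0 \<le> b" and X: "0 \<le> X" "chi_n M n K x w \<le> ennreal X" and \<kappa>: "0 < \<kappa>"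
  defines "D \<equiv> {\<omega> \<in> space M. \<forall>i\<in>{1..n}. V4 i \<omega> \<le> ennreal b}"
  defines "Y \<equiv> \<lambda>\<omega>. \<Sum>i=1..n. 2 * (norm (V i \<omega>))\<^sup>2 + 2 * (norm (Q i \<omega>))\<^sup>2"
  shows "D \<in> sets M" "{\<omega> \<in> D. \<kappa> * real n < Y \<omega>} \<in> sets M"
    "prob {\<omega> \<in> D. \<kappa> * real n < Y \<omega>} \<le> (2 * (1 + b) + 2 * X) / \<kappa>"
proof -
  have sp: "space W = space M" using sub_W by (simp only: subalgebra_def)
  have DW: "D \<in> sets W"
    unfolding D_def sp[symmetric]
    by (intro sets.sets_Collect_finite_All borel_measurable_le borel_measurable_const borel_measurable_nn_cond_exp) auto
  show DM: "D \<in> sets M" using DW sub_W by (auto simp: subalgebra_def)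
  note [measurable] = DM DW
  have Vm: "(\<lambda>\<omega>. norm (V i \<omega>)) \<in> borel_measurable M" if "i \<in> {1..n}" for i
    by (rule measurable_compose[OF V_measurable[OF that] borel_measurable_norm])
  have Qm: "(\<lambda>\<omega>. norm (Q i \<omega>)) \<in> borel_measurable M" for i
    by (rule measurable_compose[OF Q_measurable borel_measurable_norm])
  have YM: "Y \<in> borel_measurable M"
    unfolding Y_def
    by (intro borel_measurable_sum borel_measurable_add borel_measurable_times borel_measurable_power borel_measurable_const Vm Qm)
  have set_eq: "{\<omega> \<in> D. \<kappa> * real n < Y \<omega>} = D \<inter> {\<omega> \<in> space M. \<kappa> * real n < Y \<omega>}"
    using sets.sets_into_space[OF DM] by blast
  show SM: "{\<omega> \<in> D. \<kappa> * real n < Y \<omega>} \<in> sets M"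
    unfolding set_eq by (intro sets.Int DM borel_measurable_less borel_measurable_const YM)
  have V_le: "(\<integral>\<^sup>+\<omega>. indicator D \<omega> * ennreal ((norm (V i \<omega>))\<^sup>2) \<partial>M) \<le> ennreal (1 + b)" if i: "i \<in> {1..n}" for i
  proof -
    have "(\<integral>\<^sup>+\<omega>. indicator D \<omega> * ennreal ((norm (V i \<omega>))\<^sup>2) \<partial>M)
        \<le> (\<integral>\<^sup>+\<omega>. 1 + indicator D \<omega> * ennreal ((norm (V i \<omega>)) ^ 4) \<partial>M)"
    proof (rule nn_integral_mono)
      fix \<omega>
      have "2 * (norm (V i \<omega>))\<^sup>2 \<le> 1 + norm (V i \<omega>) ^ 4"
        using sum_squares_bound[of 1 "(norm (V i \<omega>))\<^sup>2"] by (simp flip: power_mult)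
      then have "(norm (V i \<omega>))\<^sup>2 \<le> 1 + norm (V i \<omega>) ^ 4" using zero_le_power2[of "norm (V i \<omega>)"] by linarith
      then have "ennreal ((norm (V i \<omega>))\<^sup>2) \<le> ennreal (1 + norm (V i \<omega>) ^ 4)" by (rule ennreal_leI)
      also have "\<dots> = 1 + ennreal (norm (V i \<omega>) ^ 4)" by (simp add: ennreal_plus)
      finally show "indicator D \<omega> * ennreal ((norm (V i \<omega>))\<^sup>2) \<le> 1 + indicator D \<omega> * ennreal ((norm (V i \<omega>)) ^ 4)"
        by (simp add: indicator_def)
    qed
    also have "\<dots> = 1 + (\<integral>\<^sup>+\<omega>. indicator D \<omega> * ennreal ((norm (V i \<omega>)) ^ 4) \<partial>M)"
      using Vm[OF i] by (subst nn_integral_add) (simp_all add: emeasure_space_1)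
    also have "\<dots> \<le> 1 + ennreal b * (\<integral>\<^sup>+\<omega>. indicator D \<omega> \<partial>M)"
    proof (intro add_left_mono W.nn_integral_localized_le)
      show "(\<lambda>\<omega>. ennreal (norm (V i \<omega>) ^ 4)) \<in> borel_measurable M" using Vm[OF i] by simp
      fix \<omega> assume "\<omega> \<in> space M" "(indicator D \<omega> :: ennreal) \<noteq> 0"
      then have "\<omega> \<in> D" by (simp add: indicator_def split: if_splits)
      then show "V4 i \<omega> \<le> ennreal b" using i by (simp add: D_def)
    qed simp
    also have "\<dots> \<le> 1 + ennreal b * 1"
      by (intro add_left_mono mult_left_mono) (simp_all add: emeasure_le_1)
    finally show ?thesis using b by (simp add: ennreal_plus)
  qed
  have Q_le: "(\<Sum>i=1..n. \<integral>\<^sup>+\<omega>. ennreal ((norm (Q i \<omega>))\<^sup>2) \<partial>M) \<le> ennreal (real n * X)"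
  proof -
    let ?s = "\<Sum>i=1..n. \<integral>\<^sup>+\<omega>. ennreal ((norm (Q i \<omega>))\<^sup>2) \<partial>M"
    have nn: "(of_nat n :: ennreal) \<noteq> 0" "(of_nat n :: ennreal) \<noteq> \<top>" using n by simp_all
    have "?s = of_nat n * chi_n M n K x w"
      unfolding chi_n_def ennreal_times_divide
      by (subst mult.commute, rule ennreal_mult_divide_eq[symmetric]) (use nn in auto)
    also have "\<dots> \<le> of_nat n * ennreal X" using X(2) by (rule mult_left_mono) simp
    also have "\<dots> = ennreal (real n * X)" using X(1) by (simp add: ennreal_mult ennreal_of_nat_eq_real_of_nat)
    finally show ?thesis .
  qed
  have "(\<integral>\<^sup>+\<omega>. indicator D \<omega> * ennreal (Y \<omega>) \<partial>M)
      \<le> (\<integral>\<^sup>+\<omega>. (\<Sum>i=1..n. 2 * (indicator D \<omega> * ennreal ((norm (V i \<omega>))\<^sup>2)) + 2 * ennreal ((norm (Q i \<omega>))\<^sup>2)) \<partial>M)"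
  proof (rule nn_integral_mono)
    fix \<omega>
    have "ennreal (Y \<omega>) = (\<Sum>i=1..n. 2 * ennreal ((norm (V i \<omega>))\<^sup>2) + 2 * ennreal ((norm (Q i \<omega>))\<^sup>2))"
      unfolding Y_def
      by (subst sum_ennreal[symmetric]) (simp_all add: ennreal_plus ennreal_mult)
    then show "indicator D \<omega> * ennreal (Y \<omega>)
        \<le> (\<Sum>i=1..n. 2 * (indicator D \<omega> * ennreal ((norm (V i \<omega>))\<^sup>2)) + 2 * ennreal ((norm (Q i \<omega>))\<^sup>2))"
      by (simp add: indicator_def)
  qed
  also have "\<dots> = (\<Sum>i=1..n. 2 * (\<integral>\<^sup>+\<omega>. indicator D \<omega> * ennreal ((norm (V i \<omega>))\<^sup>2) \<partial>M) + 2 * (\<integral>\<^sup>+\<omega>. ennreal ((norm (Q i \<omega>))\<^sup>2) \<partial>M))"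
  proof (subst nn_integral_sum)
    show "(\<lambda>\<omega>. 2 * (indicator D \<omega> * ennreal ((norm (V i \<omega>))\<^sup>2)) + 2 * ennreal ((norm (Q i \<omega>))\<^sup>2)) \<in> borel_measurable M"
      if "i \<in> {1..n}" for i using Vm[OF that] Qm[of i] by simp
    show "(\<Sum>i=1..n. \<integral>\<^sup>+\<omega>. 2 * (indicator D \<omega> * ennreal ((norm (V i \<omega>))\<^sup>2)) + 2 * ennreal ((norm (Q i \<omega>))\<^sup>2) \<partial>M)
        = (\<Sum>i=1..n. 2 * (\<integral>\<^sup>+\<omega>. indicator D \<omega> * ennreal ((norm (V i \<omega>))\<^sup>2) \<partial>M) + 2 * (\<integral>\<^sup>+\<omega>. ennreal ((norm (Q i \<omega>))\<^sup>2) \<partial>M))"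
    proof (rule sum.cong[OF refl])
      fix i assume i: "i \<in> {1..n}"
      show "(\<integral>\<^sup>+\<omega>. 2 * (indicator D \<omega> * ennreal ((norm (V i \<omega>))\<^sup>2)) + 2 * ennreal ((norm (Q i \<omega>))\<^sup>2) \<partial>M)
          = 2 * (\<integral>\<^sup>+\<omega>. indicator D \<omega> * ennreal ((norm (V i \<omega>))\<^sup>2) \<partial>M) + 2 * (\<integral>\<^sup>+\<omega>. ennreal ((norm (Q i \<omega>))\<^sup>2) \<partial>M)"
        using Vm[OF i] Qm[of i] by (simp add: nn_integral_add nn_integral_cmult)
    qed
  qed
  also have "\<dots> = 2 * (\<Sum>i=1..n. \<integral>\<^sup>+\<omega>. indicator D \<omega> * ennreal ((norm (V i \<omega>))\<^sup>2) \<partial>M)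
      + 2 * (\<Sum>i=1..n. \<integral>\<^sup>+\<omega>. ennreal ((norm (Q i \<omega>))\<^sup>2) \<partial>M)"
    by (simp only: sum.distrib sum_distrib_left)
  also have "\<dots> \<le> 2 * (\<Sum>i=1..n. ennreal (1 + b)) + 2 * ennreal (real n * X)"
    by (intro add_mono mult_left_mono sum_mono V_le Q_le) simp_all
  also have "\<dots> = ennreal (real n * (2 * (1 + b) + 2 * X))"
  proof -
    have "(\<Sum>i=1..n. ennreal (1 + b)) = ennreal (real n * (1 + b))"
      using b by (simp add: ennreal_mult ennreal_of_nat_eq_real_of_nat)
    then have "2 * (\<Sum>i=1..n. ennreal (1 + b)) + 2 * ennreal (real n * X)
        = ennreal (2 * (real n * (1 + b))) + ennreal (2 * (real n * X))"
      using b X(1) by (simp add: ennreal_mult)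
    also have "\<dots> = ennreal (2 * (real n * (1 + b)) + 2 * (real n * X))"
      using b X(1) by (intro ennreal_plus[symmetric]) simp_all
    also have "2 * (real n * (1 + b)) + 2 * (real n * X) = real n * (2 * (1 + b) + 2 * X)"
      by (simp add: algebra_simps)
    finally show ?thesis .
  qed
  finally have EY: "(\<integral>\<^sup>+\<omega>. indicator D \<omega> * ennreal (Y \<omega>) \<partial>M) \<le> ennreal (real n * (2 * (1 + b) + 2 * X))" .
  have kn: "0 < \<kappa> * real n" using \<kappa> n by simp
  have "ennreal (\<kappa> * real n) * emeasure M {\<omega> \<in> D. \<kappa> * real n < Y \<omega>}
      = (\<integral>\<^sup>+\<omega>. ennreal (\<kappa> * real n) * indicator {\<omega> \<in> D. \<kappa> * real n < Y \<omega>} \<omega> \<partial>M)"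
    using SM by (simp add: nn_integral_cmult)
  also have "\<dots> \<le> (\<integral>\<^sup>+\<omega>. indicator D \<omega> * ennreal (Y \<omega>) \<partial>M)"
    by (intro nn_integral_mono) (auto simp: indicator_def intro!: ennreal_leI)
  finally have "ennreal (\<kappa> * real n * prob {\<omega> \<in> D. \<kappa> * real n < Y \<omega>}) \<le> ennreal (real n * (2 * (1 + b) + 2 * X))"
    using EY kn by (simp add: emeasure_eq_measure ennreal_mult)
  then have "\<kappa> * real n * prob {\<omega> \<in> D. \<kappa> * real n < Y \<omega>} \<le> real n * (2 * (1 + b) + 2 * X)"
    using b X(1) by (subst (asm) ennreal_le_iff) simp_all
  then have "real n * (\<kappa> * prob {\<omega> \<in> D. \<kappa> * real n < Y \<omega>}) \<le> real n * (2 * (1 + b) + 2 * X)"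
    by (simp add: mult_ac)
  then have "\<kappa> * prob {\<omega> \<in> D. \<kappa> * real n < Y \<omega>} \<le> 2 * (1 + b) + 2 * X" using n by simp
  then show "prob {\<omega> \<in> D. \<kappa> * real n < Y \<omega>} \<le> (2 * (1 + b) + 2 * X) / \<kappa>"
    using \<kappa> by (simp add: pos_le_divide_eq mult.commute)
qed

end

lemma borel_measurable_inv_norm: "(inv_norm :: real^'n^'n \<Rightarrow> ennreal) \<in> borel_measurable borel"
proof -
  have "(\<lambda>A :: real^'n^'n. if Determinants.det A \<noteq> 0 then ennreal (norm (matrix_inv A)) else \<infinity>) \<in> borel_measurable borel"
    using borel_measurable_det_real measurable_compose[OF borel_measurable_matrix_inv borel_measurable_norm] by measurable
  then show ?thesis by (simp add: inv_norm_def[abs_def] invertible_det_nz)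
qed

context clustered_regression_moments
begin

text \<open>The tail condition on \<open>C_n\<close> carries information only because \<open>C_n\<close> is measurable: \<open>prob\<close> of a
  nonmeasurable set is \<open>0\<close>.\<close>

lemma C_n_measurable: "C_n M n K u x w \<in> borel_measurable M"
proof -
  let ?E = "mat_cond_exp M W (Gamma_tilde M n K x w)"
  have E: "?E \<in> borel_measurable M"
    by (rule borel_measurable_matrixI) (simp add: mat_cond_exp_def)
  have "Gamma_tilde M n K x w \<omega> $ p $ q = Gamma_tilde M n K x w \<omega> $ q $ p" for \<omega> p q
    by (simp add: Gamma_tilde_def outer_def mult.commute)
  then have sym: "is_symmetric (?E \<omega>)" for \<omega>
    unfolding Finite_Cartesian_Product.transpose_def Finite_Cartesian_Product.vec_eq_iff mat_cond_exp_def by simp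
  have l: "(\<lambda>\<omega>. lambda_min (?E \<omega>)) \<in> borel_measurable M"
    by (rule borel_measurable_lambda_min[OF E sym])
  show ?thesis
    unfolding C_n_def[abs_def]
    by (intro borel_measurable_add borel_measurable_Max borel_measurable_inverse_ennreal
        borel_measurable_nn_cond_exp2 measurable_compose[OF l measurable_ennreal]) simp_all
qed

text \<open>A union bound: up to a null set, an outcome outside \<open>good\<close> violates one of
  five conditions. The fifth, on the mean of |vhat_i|^2, is tested where the conditional fourth
  moments of V_i are at most b, because Markov's inequality is available there; elsewhere the
  condition on \<open>C_n\<close> already fails.\<close>

lemma good_tail:
  assumes n: "1 \<le> n" and b: "0 \<le> b" and B: "0 \<le> B" and X: "0 \<le> X" "chi_n M n K x w \<le> ennreal X" and \<kappa>: "0 < \<kappa>"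
    and E0: "{\<omega> \<in> space M. mat_lambda_min (gram n K (\<lambda>i. w i \<omega>)) > 0} \<in> sets M"
  shows "prob (space M - good b B \<delta> \<kappa>)
    \<le> (1 - prob {\<omega> \<in> space M. mat_lambda_min (gram n K (\<lambda>i. w i \<omega>)) > 0})
      + prob {\<omega> \<in> space M. C_n M n K u x w \<omega> > ennreal b}
      + prob {\<omega> \<in> space M. inv_norm (\<Sigma> \<omega>) > ennreal B}
      + prob {\<omega> \<in> space M. \<bar>(MAX i\<in>{1..n}. norm (v i \<omega>)) / sqrt (real n)\<bar> > \<delta>}
      + (2 * (1 + b) + 2 * X) / \<kappa>"
proof -
  let ?E0 = "{\<omega> \<in> space M. mat_lambda_min (gram n K (\<lambda>i. w i \<omega>)) > 0}"
  let ?A1 = "space M - ?E0"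
  let ?A2 = "{\<omega> \<in> space M. C_n M n K u x w \<omega> > ennreal b}"
  let ?A3 = "{\<omega> \<in> space M. inv_norm (\<Sigma> \<omega>) > ennreal B}"
  let ?A4 = "{\<omega> \<in> space M. \<bar>(MAX i\<in>{1..n}. norm (v i \<omega>)) / sqrt (real n)\<bar> > \<delta>}"
  let ?D = "{\<omega> \<in> space M. \<forall>i\<in>{1..n}. V4 i \<omega> \<le> ennreal b}"
  let ?Y = "\<lambda>\<omega>. \<Sum>i=1..n. 2 * (norm (V i \<omega>))\<^sup>2 + 2 * (norm (Q i \<omega>))\<^sup>2"
  let ?A5 = "{\<omega> \<in> ?D. \<kappa> * real n < ?Y \<omega>}"
  have m1: "?A1 \<in> sets M" using E0 by (rule sets.compl_sets)
  have m2: "?A2 \<in> sets M" by (intro borel_measurable_less borel_measurable_const C_n_measurable)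
  have m3: "?A3 \<in> sets M"
    by (intro borel_measurable_less borel_measurable_const measurable_compose[OF from_F[OF Sigma_F] borel_measurable_inv_norm])
  have m4: "?A4 \<in> sets M"
    by (intro borel_measurable_less borel_measurable_const borel_measurable_abs borel_measurable_divide borel_measurable_Max
        measurable_compose[OF from_F[OF vhat_F] borel_measurable_norm]) simp_all
  have m5: "?A5 \<in> sets M" and p5: "prob ?A5 \<le> (2 * (1 + b) + 2 * X) / \<kappa>"
    by (rule mean_vhat_tail(2)[OF n b X \<kappa>], rule mean_vhat_tail(3)[OF n b X \<kappa>])
  have "prob (space M - good b B \<delta> \<kappa>) \<le> prob ((((?A1 \<union> ?A2) \<union> ?A3) \<union> ?A4) \<union> ?A5)"
  proof (rule finite_measure_mono_AE)
    show "AE \<omega> in M. \<omega> \<in> space M - good b B \<delta> \<kappa> \<longrightarrow> \<omega> \<in> (((?A1 \<union> ?A2) \<union> ?A3) \<union> ?A4) \<union> ?A5"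
      using good_AE[OF b, of B \<delta> \<kappa>] sum_vhat_le
    proof eventually_elim
      case (elim \<omega>)
      show ?case
      proof (intro impI, rule ccontr)
        assume bad: "\<omega> \<in> space M - good b B \<delta> \<kappa>" and "\<omega> \<notin> (((?A1 \<union> ?A2) \<union> ?A3) \<union> ?A4) \<union> ?A5"
        then have sp: "\<omega> \<in> space M" and n1: "mat_lambda_min (gram n K (\<lambda>i. w i \<omega>)) > 0"
          and n2: "C_n M n K u x w \<omega> \<le> ennreal b" and n3: "inv_norm (\<Sigma> \<omega>) \<le> ennreal B"
          and n4: "\<bar>(MAX i\<in>{1..n}. norm (v i \<omega>)) / sqrt (real n)\<bar> \<le> \<delta>" and n5: "\<omega> \<notin> ?A5"
          by (simp_all add: not_less)
        have det: "gram_det \<omega> \<noteq> 0" by (rule mat_lambda_min_pos_det[OF gram_carrier n1])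
        \<comment> \<open>\<open>inv_norm\<close> is infinite at singular matrices, so a finite
          bound implies invertibility.\<close>
        have inv: "invertible (\<Sigma> \<omega>)" using n3 unfolding inv_norm_def by (auto simp: top_unique split: if_splits)
        then have nrm: "norm (matrix_inv (\<Sigma> \<omega>)) \<le> B" using n3 B by (simp add: inv_norm_def)
        have each: "u4 i \<omega> + V4 i \<omega> \<le> ennreal b" if i: "i \<in> {1..n}" for i
        proof -
          let ?f = "\<lambda>i. u4 i \<omega> + V4 i \<omega> + inverse (u2 i \<omega>)"
          have "u4 i \<omega> + V4 i \<omega> \<le> ?f i" by simp
          also have "\<dots> \<le> (MAX i\<in>{1..n}. ?f i)" using i by (intro Max_ge) auto
          also have "\<dots> \<le> C_n M n K u x w \<omega>" unfolding C_n_def by simp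
          also note n2
          finally show ?thesis .
        qed
        have u4: "\<forall>i\<in>{1..n}. u4 i \<omega> \<le> ennreal b"
        proof
          fix i assume "i \<in> {1..n}"
          then show "u4 i \<omega> \<le> ennreal b" by (intro order_trans[OF _ each]) simp_all
        qed
        have "V4 i \<omega> \<le> ennreal b" if "i \<in> {1..n}" for i
          using each[OF that] by (rule order_trans[rotated]) simp
        then have "\<omega> \<in> ?D" using sp by simp
        then have Y: "?Y \<omega> \<le> \<kappa> * real n" using n5 by (simp add: not_less)
        have "(\<Sum>i=1..n. (norm (v i \<omega>))\<^sup>2) \<le> \<kappa> * real n" using elim(2) det Y by (meson order_trans)
        moreover have "norm (v i \<omega>) \<le> \<delta> * sqrt (real n)" if i: "i \<in> {1..n}" for i
        proof -
          have rn: "0 < sqrt (real n)" using n by simp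
          have "norm (v i \<omega>) \<le> (MAX i\<in>{1..n}. norm (v i \<omega>))" using i by (intro Max_ge) auto
          also have "\<dots> \<le> \<delta> * sqrt (real n)" using n4 rn by (simp add: abs_le_iff pos_divide_le_eq)
          finally show ?thesis .
        qed
        ultimately have "\<omega> \<in> good b B \<delta> \<kappa>" using elim(1) det inv nrm u4 by blast
        then show False using bad by simp
      qed
    qed
  qed (intro sets.Un m1 m2 m3 m4 m5)
  also have "\<dots> \<le> prob ?A1 + prob ?A2 + prob ?A3 + prob ?A4 + prob ?A5"
    using measure_Un_le[OF sets.Un[OF sets.Un[OF sets.Un[OF m1 m2] m3] m4] m5]
      measure_Un_le[OF sets.Un[OF sets.Un[OF m1 m2] m3] m4]
      measure_Un_le[OF sets.Un[OF m1 m2] m3] measure_Un_le[OF m1 m2] by linarith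
  finally show ?thesis using p5 prob_compl[OF E0] by linarith
qed

end

section \<open>The limit theorem\<close>

text \<open>The bound in the definition may be negative. \<open>ennreal\<close> then sends it to 0,
  so 0 serves as well.\<close>

lemma bounded_in_probE:
  assumes "bounded_in_prob M X" "0 < \<epsilon>"
  obtains b :: real where "0 \<le> b"
    "\<forall>\<^sub>F n in sequentially. measure (M n) {\<omega> \<in> space (M n). X n \<omega> > ennreal b} \<le> \<epsilon>"
proof -
  obtain b where b: "\<forall>\<^sub>F n in sequentially. measure (M n) {\<omega> \<in> space (M n). X n \<omega> > ennreal b} \<le> \<epsilon>"
    using assms unfolding bounded_in_prob_def by blast
  show thesis
  proof (cases "0 \<le> b")
    case True
    then show thesis using b by (rule that)
  next
    case False
    then have "ennreal b = ennreal 0" by (simp add: ennreal_neg)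
    then show thesis using b by (intro that[of 0]) simp_all
  qed
qed

lemma limsup_finiteE:
  fixes f :: "nat \<Rightarrow> ennreal"
  assumes "limsup f < \<infinity>"
  obtains X :: real where "0 \<le> X" "\<forall>\<^sub>F n in sequentially. f n \<le> ennreal X"
proof -
  obtain y where y: "limsup f < y" "y < \<infinity>" using dense[OF assms] by blast
  have "\<forall>\<^sub>F n in sequentially. f n < y" by (rule Limsup_lessD[OF y(1)])
  moreover have "y = ennreal (enn2real y)" using y(2) by simp
  ultimately have "\<forall>\<^sub>F n in sequentially. f n \<le> ennreal (enn2real y)" by (auto elim: eventually_mono)
  then show thesis using that[of "enn2real y"] by simp
qed

theorem theorem1:
  fixes M :: "nat \<Rightarrow> 'a measure"
    and K G :: "nat \<Rightarrow> nat"
    and y u :: "nat \<Rightarrow> nat \<Rightarrow> 'a \<Rightarrow> real"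
    and x :: "nat \<Rightarrow> nat \<Rightarrow> 'a \<Rightarrow> real ^ 'd"
    and w :: "nat \<Rightarrow> nat \<Rightarrow> 'a \<Rightarrow> real vec"
    and \<beta> :: "real ^ 'd"
    and \<gamma> :: "nat \<Rightarrow> real vec"
    and T :: "nat \<Rightarrow> nat \<Rightarrow> nat set"
  assumes "\<And>n. prob_space (M n)"
    and "\<And>n. 1 \<le> K n"
    and "\<And>n. \<gamma> n \<in> carrier_vec (K n)"
    and "\<And>n i. i \<in> {1..n} \<Longrightarrow> y n i \<in> borel_measurable (M n)"
    and "\<And>n i. i \<in> {1..n} \<Longrightarrow> x n i \<in> borel_measurable (M n)"
    and "\<And>n i. i \<in> {1..n} \<Longrightarrow> u n i \<in> borel_measurable (M n)"
    and "\<And>n i \<omega>. i \<in> {1..n} \<Longrightarrow> \<omega> \<in> space (M n) \<Longrightarrow> w n i \<omega> \<in> carrier_vec (K n)"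
    and "\<And>n i l. i \<in> {1..n} \<Longrightarrow> l < K n \<Longrightarrow> (\<lambda>\<omega>. w n i \<omega> $v l) \<in> borel_measurable (M n)"
    and "\<And>n i. i \<in> {1..n} \<Longrightarrow>
           AE \<omega> in M n. y n i \<omega> = \<beta> \<bullet> x n i \<omega> + scalar_prod (\<gamma> n) (w n i \<omega>) + u n i \<omega>"
  \<comment> \<open>existence of the expectations entering the definitions\<close>
    and "\<And>n i. i \<in> {1..n} \<Longrightarrow> integrable (M n) (x n i)"
    and "\<And>n i. i \<in> {1..n} \<Longrightarrow> integrable (M n) (u n i)"
    and "\<And>n i a l. i \<in> {1..n} \<Longrightarrow> l < K n \<Longrightarrow> integrable (M n) (\<lambda>\<omega>. x n i \<omega> $ a * w n i \<omega> $v l)"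
    and "\<And>n i k l. i \<in> {1..n} \<Longrightarrow> k < K n \<Longrightarrow> l < K n \<Longrightarrow>
           integrable (M n) (\<lambda>\<omega>. w n i \<omega> $v k * w n i \<omega> $v l)"
    and "\<And>n. partition_on {1..n} (T n ` {1..G n})"
    and "\<And>n. inj_on (T n) {1..G n}"
    and "\<And>n. cond_indep (M n) (sigma_W (M n) n (K n) (w n))
               (\<lambda>g. sigma_cluster (M n) (T n g) (u n) (x n)) {1..G n}"
    and "(\<lambda>n. real (MAX g\<in>{1..G n}. card (T n g))) \<in> O(\<lambda>n. 1)"
    and "(\<lambda>n. measure (M n) {\<omega> \<in> space (M n). mat_lambda_min (gram n (K n) (\<lambda>i. w n i \<omega>)) > 0})
           \<longlonglongrightarrow> 1"
    and "limsup (\<lambda>n. ereal (real (K n) / real n)) < 1"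
    and "bounded_in_prob M (\<lambda>n. C_n (M n) n (K n) (u n) (x n) (w n))"
    and "bounded_in_prob M (\<lambda>n \<omega>. inv_norm (Sigma_n (M n) n (K n) (u n) (x n) (w n) \<omega>))"
    and "\<And>n i. i \<in> {1..n} \<Longrightarrow>
           AE \<omega> in M n. real_cond_exp (M n) (sigma_XW (M n) n (K n) (x n) (w n)) (u n i) \<omega> = 0"
    and "limsup (\<lambda>n. chi_n (M n) n (K n) (x n) (w n)) < \<infinity>"
    and "tendsto_zero_in_prob M
           (\<lambda>n \<omega>. (MAX i\<in>{1..n}. norm (vhat n (K n) (x n) (w n) i \<omega>)) / sqrt (real n))"
  shows "conv_in_dist M
           (\<lambda>n \<omega>. matrix_inv (matrix_sqrt (Omega_n (M n) n (K n) (u n) (x n) (w n) \<omega>))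
                    *v (sqrt (real n) *\<^sub>R (beta_hat n (K n) (y n) (x n) (w n) \<omega> - \<beta>)))
           std_normal
         \<and>
         (\<forall>n. AE \<omega> in M n.
           (\<forall>i\<in>{1..n}. nn_cond_exp (M n) (sigma_XW (M n) n (K n) (x n) (w n))
                          (\<lambda>\<omega>'. ennreal ((u n i \<omega>')\<^sup>2)) \<omega> < \<infinity>) \<longrightarrow>
           Sigma_n (M n) n (K n) (u n) (x n) (w n) \<omega>
             = (1 / real n) *\<^sub>R (\<Sum>g=1..G n. \<Sum>i\<in>T n g. \<Sum>j\<in>T n g.
                 real_cond_exp (M n) (sigma_XW (M n) n (K n) (x n) (w n))
                   (\<lambda>\<omega>'. u n i \<omega>' * u n j \<omega>') \<omega>
                 *\<^sub>R outer (vhat n (K n) (x n) (w n) i \<omega>) (vhat n (K n) (x n) (w n) j \<omega>)))"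
proof -
  note prob = assms(1) and K = assms(2) and \<gamma> = assms(3) and y_meas = assms(4) and x_meas = assms(5)
    and u_meas = assms(6) and w_carrier = assms(7) and w_meas = assms(8) and model = assms(9)
    and x_int = assms(10) and u_int = assms(11) and ww_int = assms(13) and part = assms(14) and inj = assms(15)
    and indep = assms(16) and sizes = assms(17) and gram = assms(18) and Cn = assms(20) and Sn = assms(21)
    and exog = assms(22) and chi = assms(23) and vmax = assms(24)
  have R: "clustered_regression_moments (M n) n (K n) (G n) (u n) (x n) (w n) (T n)" for n
    by (intro clustered_regression_moments.intro clustered_regression.intro clustered_regression_axioms.intro
        clustered_regression_moments_axioms.intro)
      (fact prob x_meas u_meas w_carrier w_meas u_int part inj indep exog x_int | rule ww_int)+
  let ?Z = "\<lambda>n \<omega>. matrix_inv (matrix_sqrt (Omega_n (M n) n (K n) (u n) (x n) (w n) \<omega>))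
     *v (sqrt (real n) *\<^sub>R (beta_hat n (K n) (y n) (x n) (w n) \<omega> - \<beta>))"
  have Z_meas: "?Z n \<in> borel_measurable (M n)" for n
  proof -
    interpret clustered_regression_moments "M n" n "K n" "G n" "u n" "x n" "w n" "T n" by (rule R)
    show ?thesis by (rule statistic_measurable) (rule y_meas)
  qed
  obtain c where "\<forall>\<^sub>F n in sequentially. norm (real (MAX g\<in>{1..G n}. card (T n g))) \<le> c * norm (1::real)"
    using landau_o.bigE[OF sizes] by blast
  then have sizes': "\<forall>\<^sub>F n in sequentially. \<forall>g\<in>{1..G n}. card (T n g) \<le> nat \<lceil>c\<rceil>"
  proof eventually_elim
    case (elim n)
    show ?case
    proof
      fix g assume "g \<in> {1..G n}"
      then have "card (T n g) \<le> (MAX g\<in>{1..G n}. card (T n g))" by (intro Max_ge) auto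
      then have "real (card (T n g)) \<le> c" using elim by simp
      then show "card (T n g) \<le> nat \<lceil>c\<rceil>" by linarith
    qed
  qed
  obtain X where X: "0 \<le> X" "\<forall>\<^sub>F n in sequentially. chi_n (M n) n (K n) (x n) (w n) \<le> ennreal X"
    using limsup_finiteE[OF chi] by blast
  have char_conv: "(\<lambda>n. \<integral>\<omega>. iexp (t \<bullet> ?Z n \<omega>) \<partial>M n) \<longlonglongrightarrow> complex_of_real (exp (- ((norm t)\<^sup>2) / 2))" for t
  proof (rule tendstoI)
    fix \<epsilon> :: real assume \<epsilon>: "0 < \<epsilon>"
    \<comment> \<open>Five tail events of size e, counted three times in
      \<open>char_statistic_close\<close>, cost 15 e = \<epsilon> / 2; the remaining error stays
      below \<epsilon> / 4.\<close>
    define e where "e = \<epsilon> / 30"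
    have e: "0 < e" using \<epsilon> by (simp add: e_def)
    obtain b where b: "0 \<le> b"
      "\<forall>\<^sub>F n in sequentially. measure (M n) {\<omega> \<in> space (M n). C_n (M n) n (K n) (u n) (x n) (w n) \<omega> > ennreal b} \<le> e"
      using bounded_in_probE[OF Cn e] by blast
    obtain B where B: "0 \<le> B"
      "\<forall>\<^sub>F n in sequentially. measure (M n)
        {\<omega> \<in> space (M n). inv_norm (Sigma_n (M n) n (K n) (u n) (x n) (w n) \<omega>) > ennreal B} \<le> e"
      using bounded_in_probE[OF Sn e] by blast
    \<comment> \<open>Large enough for the Markov bound in \<open>good_tail\<close> to be at most
      e.\<close>
    define \<kappa> where "\<kappa> = (2 * (1 + b) + 2 * X) / e + 1"
    have \<kappa>: "0 < \<kappa>" using b(1) X(1) e by (simp add: \<kappa>_def add_nonneg_pos)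
    have "e * (N / e + 1) = N + e" for N using e by (simp add: field_simps)
    then have "2 * (1 + b) + 2 * X \<le> e * \<kappa>" using e unfolding \<kappa>_def by simp
    then have \<kappa>_le: "(2 * (1 + b) + 2 * X) / \<kappa> \<le> e" using \<kappa> by (simp add: pos_divide_le_eq)
    let ?C = "nat \<lceil>c\<rceil>"
    \<comment> \<open>The error of \<open>char_statistic_close\<close> apart from the bad event, as
      a function of \<delta>. It is a polynomial in \<delta> that vanishes at 0, and b, B and
      \<kappa> are already fixed, so a positive \<delta> makes it small.\<close>
    define h where "h \<delta> = ((sqrt ((t \<bullet> t) * B) + 1) * \<delta>) * (t \<bullet> t + real ?C ^ 3 * b * ((t \<bullet> t) * B * \<kappa>)) / 12
      + (t \<bullet> t) * (1 + 2 * b) * (real ?C * ((sqrt ((t \<bullet> t) * B) + 1) * \<delta>))\<^sup>2 / 8" for \<delta>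
    have "(h \<longlongrightarrow> h 0) (at_right 0)" unfolding h_def by (intro tendsto_intros) simp_all
    then have "\<forall>\<^sub>F \<delta> in at_right 0. h \<delta> < \<epsilon> / 4"       by (rule order_tendstoD(2)) (use \<epsilon> in \<open>simp add: h_def\<close>)
    then have "\<forall>\<^sub>F \<delta> in at_right 0. h \<delta> < \<epsilon> / 4 \<and> 0 < \<delta>"
      using eventually_at_right_less by (rule eventually_conj)
    then obtain \<delta> where \<delta>: "h \<delta> < \<epsilon> / 4" "0 < \<delta>"
      using eventually_happens'[of "at_right (0::real)"] by (auto simp: trivial_limit_at_right_real)
    have v_small: "\<forall>\<^sub>F n in sequentially. measure (M n) {\<omega> \<in> space (M n).
        \<bar>(MAX i\<in>{1..n}. norm (vhat n (K n) (x n) (w n) i \<omega>)) / sqrt (real n)\<bar> > \<delta>} < e"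
      using vmax \<delta>(2) e unfolding tendsto_zero_in_prob_def by (intro order_tendstoD(2)) blast+
    have gram1: "\<forall>\<^sub>F n in sequentially. 1 - e
        < measure (M n) {\<omega> \<in> space (M n). mat_lambda_min (gram n (K n) (\<lambda>i. w n i \<omega>)) > 0}"
      by (rule order_tendstoD(1)[OF gram]) (use e in simp)
    have gram0: "\<forall>\<^sub>F n in sequentially.
        0 < measure (M n) {\<omega> \<in> space (M n). mat_lambda_min (gram n (K n) (\<lambda>i. w n i \<omega>)) > 0}"
      by (rule order_tendstoD(1)[OF gram]) simp
    show "\<forall>\<^sub>F n in sequentially. dist (\<integral>\<omega>. iexp (t \<bullet> ?Z n \<omega>) \<partial>M n) (of_real (exp (- ((norm t)\<^sup>2) / 2))) < \<epsilon>"
      using sizes' X(2) b(2) B(2) v_small gram1 gram0 eventually_ge_at_top[of 1]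
    proof eventually_elim
      case (elim n)
      interpret clustered_regression_moments "M n" n "K n" "G n" "u n" "x n" "w n" "T n" by (rule R)
      \<comment> \<open>A set of positive \<open>measure\<close> is measurable, because a
        nonmeasurable one would get the value 0.\<close>
      have E0: "{\<omega> \<in> space (M n). mat_lambda_min (gram n (K n) (\<lambda>i. w n i \<omega>)) > 0} \<in> sets (M n)"
        using elim(7) measure_notin_sets by fastforce
      have tail: "prob (space (M n) - good b B \<delta> \<kappa>) \<le> 5 * e"
        using good_tail[OF elim(8) b(1) B(1) X(1) elim(2) \<kappa> E0, of \<delta>] elim(3-6) \<kappa>_le by linarith
      have "cmod ((\<integral>\<omega>. iexp (t \<bullet> ?Z n \<omega>) \<partial>M n) - of_real (exp (- ((norm t)\<^sup>2) / 2)))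
          \<le> 3 * prob (space (M n) - good b B \<delta> \<kappa>) + h \<delta>"
        using char_statistic_close[OF elim(8) \<gamma> y_meas model b(1) B(1) \<delta>(2) less_imp_le[OF \<kappa>] elim(1)[rule_format], of t]
        unfolding h_def by (simp only: add.assoc)
      also have "\<dots> < \<epsilon>" using tail \<delta>(1) e by (simp add: e_def)
      finally show ?case by (simp only: dist_norm)
    qed
  qed
  interpret char_convergence M ?Z by (rule char_convergence.intro) (fact prob Z_meas char_conv)+
  show ?thesis
  proof (intro conjI allI)
    show "conv_in_dist M ?Z std_normal" by (rule Levy_std_normal)
    fix n
    interpret clustered_regression_moments "M n" n "K n" "G n" "u n" "x n" "w n" "T n" by (rule R)
    show "AE \<omega> in M n.
       (\<forall>i\<in>{1..n}. nn_cond_exp (M n) (sigma_XW (M n) n (K n) (x n) (w n)) (\<lambda>\<omega>'. ennreal ((u n i \<omega>')\<^sup>2)) \<omega> < \<infinity>) \<longrightarrow>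
       Sigma_n (M n) n (K n) (u n) (x n) (w n) \<omega>
         = (1 / real n) *\<^sub>R (\<Sum>g=1..G n. \<Sum>i\<in>T n g. \<Sum>j\<in>T n g.
             real_cond_exp (M n) (sigma_XW (M n) n (K n) (x n) (w n)) (\<lambda>\<omega>'. u n i \<omega>' * u n j \<omega>') \<omega>
             *\<^sub>R outer (vhat n (K n) (x n) (w n) i \<omega>) (vhat n (K n) (x n) (w n) j \<omega>))"
      by (rule Sigma_formula)
  qed
qed

end
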